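(* Let $g$ be monotone increasing and satisfy hypothesis (H), let $h\ge0$, and assume $u=\phi(x+c_*t)$, $c_*>c_\#$, is a pushed traveling front of $u_t=u_{xx}-u+g(u(t-h,x))$; write $c=c_*$. Let $w_0$ satisfy all conditions (IC) with constants $A,B>0$, $\sigma\in(0,\kappa)$, $\mu>\lambda_1(c)$, and fix $\lambda\in(\lambda_1(c),\lambda_2(c))$ with $\lambda<\mu$. Then for some $z_0\in\mathbb{R}$ the classical solution $w$ of $$w_t(t,z)=w_{zz}(t,z)-cw_z(t,z)-w(t,z)+g(w(t-h,z-ch)),\ t>0;\qquad w(s,z)=w_0(s,z-cs),\ s\in[-h,0],\ z\in\mathbb{R},$$ satisfies $\lim_{t\to\infty}|w(t,\cdot)-\phi(\cdot+z_0)|_\lambda=0$.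
   Context: Hypothesis (H) on $g:\mathbb{R}_+\to\mathbb{R}_+$: $g(x)=x$ has exactly two nonnegative solutions $0$ and $\kappa>0$; $g$ is $C^1$ in a $\delta_0$-neighbourhood of $0$ and of $\kappa$, with $g'(0)>1$, $g'(\kappa)<1$; $|g(u)-g(v)|\le L_g|u-v|$ for $u,v\in[0,\kappa]$; there are $C>0,\theta\in(0,1]$ with $|g'(u)-g'(0)|+|g'(\kappa)-g'(\kappa-u)|\le Cu^\theta$ for $u\in(0,\delta_0]$; $g$ is extended linearly and $C^1$-smoothly to $(-\infty,0]$ and $[\kappa,\infty)$. Characteristic function $\chi(z,c)=z^2-cz-1+g'(0)e^{-zch}$; $c_\#$ is the unique real $c$ for which $\chi(\cdot,c)$ has a positive double zero; for $c>c_\#$ its two positive simple zeros are $\lambda_1(c)<\lambda_2(c)$. A wavefront is a solution $u=\phi(x+ct)$ with $\phi>0$, $\phi(-\infty)=0$, $\phi(+\infty)=\kappa$; $c_*$ is the minimal wavefront speed; the minimal wavefront is pushed if $c_*>c_\#$. $w_0:[-h,0]\times\mathbb{R}\to\mathbb{R}$ is continuous, locally Hölder in $x$ uniformly in $s$, and satisfies (IC): (IC1) $0\le w_0(s,x)\le\kappa$; (IC2) $w_0(s,x)\le Ae^{\mu x}$; (IC3) $w_0(s,x)>\kappa-\sigma$ for $x\ge B$ (all for $s\in[-h,0]$). $\eta(z)=\min\{e^{\lambda z},1\}$, $|y|_\lambda=\sup_{z}|y(z)|/\eta(z)$. *)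

theory Defs
  imports "HOL-Analysis.Analysis"
begin

text \<open>Hypothesis (H) on g (already extended linearly and C1-smoothly outside [0,kappa]).\<close>
definition hypH :: "(real \<Rightarrow> real) \<Rightarrow> real \<Rightarrow> bool" where
  "hypH g \<kappa> \<longleftrightarrow>
     \<kappa> > 0 \<and>
     (\<forall>x\<in>{0..\<kappa>}. g x \<ge> 0) \<and>
     {x. x \<ge> 0 \<and> g x = x} = {0, \<kappa>} \<and>
     (\<exists>\<delta>0>0.
        (\<forall>x\<in>{-\<delta>0<..<\<delta>0} \<union> {\<kappa>-\<delta>0<..<\<kappa>+\<delta>0}.
            (g has_real_derivative deriv g x) (at x)) \<and>
        continuous_on ({-\<delta>0<..<\<delta>0} \<union> {\<kappa>-\<delta>0<..<\<kappa>+\<delta>0}) (deriv g) \<and>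
        (\<exists>C>0. \<exists>\<theta>. 0 < \<theta> \<and> \<theta> \<le> 1 \<and>
           (\<forall>u\<in>{0<..\<delta>0}. \<bar>deriv g u - deriv g 0\<bar> + \<bar>deriv g \<kappa> - deriv g (\<kappa> - u)\<bar>
                                 \<le> C * u powr \<theta>))) \<and>
     deriv g 0 > 1 \<and> deriv g \<kappa> < 1 \<and>
     (\<exists>Lg. \<forall>u\<in>{0..\<kappa>}. \<forall>v\<in>{0..\<kappa>}. \<bar>g u - g v\<bar> \<le> Lg * \<bar>u - v\<bar>) \<and>
     (\<forall>x\<le>0. g x = deriv g 0 * x) \<and>
     (\<forall>x\<ge>\<kappa>. g x = \<kappa> + deriv g \<kappa> * (x - \<kappa>))"

definition chi :: "(real \<Rightarrow> real) \<Rightarrow> real \<Rightarrow> real \<Rightarrow> real \<Rightarrow> real" where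
  "chi g h z c = z^2 - c * z - 1 + deriv g 0 * exp (- z * c * h)"

definition c_sharp :: "(real \<Rightarrow> real) \<Rightarrow> real \<Rightarrow> real" where
  "c_sharp g h = (THE c. \<exists>z>0. chi g h z c = 0 \<and> deriv (\<lambda>y. chi g h y c) z = 0)"

text \<open>lambda_1(c) < lambda_2(c): the two positive zeros of chi(.,c) for c > c_#.\<close>
definition lambda1 :: "(real \<Rightarrow> real) \<Rightarrow> real \<Rightarrow> real \<Rightarrow> real" where
  "lambda1 g h c = Min {z. z > 0 \<and> chi g h z c = 0}"

definition lambda2 :: "(real \<Rightarrow> real) \<Rightarrow> real \<Rightarrow> real \<Rightarrow> real" where
  "lambda2 g h c = Max {z. z > 0 \<and> chi g h z c = 0}"

text \<open>phi is a wavefront profile of speed c: u(t,x) = phi(x + c t) solves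
  u_t = u_xx - u + g(u(t-h,x)), i.e. phi'' - c phi' - phi + g(phi(. - c h)) = 0,
  phi > 0, phi(-inf) = 0, phi(+inf) = kappa.\<close>
definition wavefront :: "(real \<Rightarrow> real) \<Rightarrow> real \<Rightarrow> real \<Rightarrow> real \<Rightarrow> (real \<Rightarrow> real) \<Rightarrow> bool" where
  "wavefront g h \<kappa> c \<phi> \<longleftrightarrow>
     (\<exists>\<phi>' \<phi>''. \<forall>s. (\<phi> has_real_derivative \<phi>' s) (at s) \<and>
                   (\<phi>' has_real_derivative \<phi>'' s) (at s) \<and>
                   c * \<phi>' s = \<phi>'' s - \<phi> s + g (\<phi> (s - c * h))) \<and>
     (\<forall>s. \<phi> s > 0) \<and>
     (\<phi> \<longlongrightarrow> 0) at_bot \<and> (\<phi> \<longlongrightarrow> \<kappa>) at_top"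

definition c_star :: "(real \<Rightarrow> real) \<Rightarrow> real \<Rightarrow> real \<Rightarrow> real" where
  "c_star g h \<kappa> = Inf {c. \<exists>\<phi>. wavefront g h \<kappa> c \<phi>}"

definition eta :: "real \<Rightarrow> real \<Rightarrow> real" where
  "eta lam z = min (exp (lam * z)) 1"

definition wnorm :: "real \<Rightarrow> (real \<Rightarrow> real) \<Rightarrow> ereal" where
  "wnorm lam y = (SUP z. ereal (\<bar>y z\<bar> / eta lam z))"

definition admissible_init :: "real \<Rightarrow> (real \<Rightarrow> real \<Rightarrow> real) \<Rightarrow> bool" where
  "admissible_init h w0 \<longleftrightarrow>
     continuous_on ({-h..0} \<times> UNIV) (\<lambda>(s, x). w0 s x) \<and>
     (\<forall>R. \<exists>C \<alpha>. 0 < \<alpha> \<and> \<alpha> \<le> 1 \<and>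
        (\<forall>s\<in>{-h..0}. \<forall>x y. \<bar>x\<bar> \<le> R \<longrightarrow> \<bar>y\<bar> \<le> R \<longrightarrow>
            \<bar>w0 s x - w0 s y\<bar> \<le> C * \<bar>x - y\<bar> powr \<alpha>))"

definition IC :: "real \<Rightarrow> real \<Rightarrow> real \<Rightarrow> real \<Rightarrow> real \<Rightarrow> real \<Rightarrow> (real \<Rightarrow> real \<Rightarrow> real) \<Rightarrow> bool" where
  "IC h \<kappa> A B \<sigma> \<mu> w0 \<longleftrightarrow>
     (\<forall>s\<in>{-h..0}. \<forall>x. 0 \<le> w0 s x \<and> w0 s x \<le> \<kappa>) \<and>
     (\<forall>s\<in>{-h..0}. \<forall>x. w0 s x \<le> A * exp (\<mu> * x)) \<and>
     (\<forall>s\<in>{-h..0}. \<forall>x\<ge>B. w0 s x > \<kappa> - \<sigma>)"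

definition classical_solution ::
  "(real \<Rightarrow> real) \<Rightarrow> real \<Rightarrow> real \<Rightarrow> (real \<Rightarrow> real \<Rightarrow> real) \<Rightarrow> (real \<Rightarrow> real \<Rightarrow> real) \<Rightarrow> bool" where
  "classical_solution g h c w0 w \<longleftrightarrow>
     continuous_on ({-h..} \<times> UNIV) (\<lambda>(t, z). w t z) \<and>
     (\<forall>T. bounded ((\<lambda>(t, z). w t z) ` ({-h..T} \<times> UNIV))) \<and>
     (\<forall>s\<in>{-h..0}. \<forall>z. w s z = w0 s (z - c * s)) \<and>
     (\<exists>wt wz wzz. \<forall>t>0. \<forall>z.
        ((\<lambda>\<tau>. w \<tau> z) has_real_derivative wt t z) (at t) \<and>
        ((\<lambda>y. w t y) has_real_derivative wz t z) (at z) \<and>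
        ((\<lambda>y. wz t y) has_real_derivative wzz t z) (at z) \<and>
        wt t z = wzz t z - c * wz t z - w t z + g (w (t - h) (z - c * h)))"

end

theory Submission
  imports Defs
begin

text \<open>
  Minimality of the speed \<open>c\<close> together with \<open>c > c_sharp\<close> forces \<open>\<phi> = O(exp (l z))\<close> at \<open>- \<infinity>\<close> for every
  \<open>l < lambda2\<close>: otherwise an exponential ahead of the front could be glued to a supersolution behind it
  and monotone iteration would yield a front of smaller speed. Consequently \<open>\<phi>\<close> and its derivative are
  \<open>o(exp (lam z))\<close>, while \<open>exp (lam z)\<close> is a strict supersolution of the linearisation at \<open>0\<close> since
  \<open>chi lam c < 0\<close>. This gives Fife--McLeod barriers \<open>\<phi> (z \<plusminus> S t) \<plusminus> Q t e z\<close> with \<open>Q\<close> exponentially decaying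
  and \<open>S\<close> bounded, which trap the solution between translates of the front. If the optimal upper and lower
  shifts in the limit differed, the solution would infinitely often stay away from one of the two translates
  at the origin; a quantitative strong maximum principle then improves that shift, a contradiction.
\<close>

section \<open>Parabolic comparison\<close>

text \<open>Solutions and fronts are known only pointwise, so every estimate is a first-touching
  argument against an explicit comparison function; no compactness of orbits enters. A front is
  assumed neither monotone nor of positive speed. Positivity of the speed follows from a concavity
  argument. Monotonicity comes only after the decay, since sliding one copy of the front over
  another needs control at - \<infinity>. Hence the decay proof works with a substitute: the profile
  operator, applied twice to the largest nondecreasing minorant of \<phi>, gives a smooth monotone
  supersolution bounded below by a multiple of \<phi>. The Hoelder exponent \<theta> restricts the
  gluing to exponents up to (1 + \<theta>) lambda1; a maximum principle then carries the bound to
  every l < lambda2. In the last step a shift of the front by \<delta> costs, far out, only a small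
  multiple of \<delta> in the weight, because the derivative of \<phi> is o of the weight at both
  ends. For a front decaying like exp (lambda1 z) this fails. The delay asks for bounds on whole
  windows of length h, which is the origin of the factors exp (\<gamma> h) and r.\<close>

lemma local_min_derivatives:
  fixes f :: "real \<Rightarrow> real"
  assumes d1: "\<forall>\<^sub>F y in nhds x. (f has_real_derivative f' y) (at y)"
    and d2: "(f' has_real_derivative f2) (at x)"
    and mn: "\<forall>\<^sub>F y in nhds x. f x \<le> f y"
  shows "f' x = 0" "f2 \<ge> 0"
proof -
  obtain e1 where e1: "e1 > 0" "\<And>y. dist y x < e1 \<Longrightarrow> (f has_real_derivative f' y) (at y)"
    using d1 unfolding eventually_nhds_metric by blast
  obtain e2 where e2: "e2 > 0" "\<And>y. dist y x < e2 \<Longrightarrow> f x \<le> f y"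
    using mn unfolding eventually_nhds_metric by blast
  have dx: "(f has_real_derivative f' x) (at x)" using e1 by simp
  show z: "f' x = 0"
    by (rule DERIV_local_min[OF dx e2(1)]) (use e2 in \<open>auto simp: dist_real_def abs_minus_commute\<close>)
  show "f2 \<ge> 0"
  proof (rule ccontr)
    assume "\<not> f2 \<ge> 0"
    then obtain d where d: "d > 0" "\<And>k. k > 0 \<Longrightarrow> k < d \<Longrightarrow> f' (x + k) < f' x"
      using DERIV_neg_dec_right[OF d2] by force
    define k where "k = min d (min e1 e2) / 2"
    have k: "k > 0" "k < d" "k < e1" "k < e2" using d e1 e2 by (auto simp: k_def)
    have "\<exists>u. u > x \<and> u < x + k \<and> f (x + k) - f x = (x + k - x) * f' u"
      by (rule MVT2) (use k e1 in \<open>auto simp: dist_real_def\<close>)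
    then obtain u where u: "x < u" "u < x + k" "f (x + k) - f x = k * f' u" by auto
    have "f' u < 0" using d(2)[of "u - x"] u k z by auto
    with u k have "f (x + k) < f x" by (simp add: mult_pos_neg algebra_simps less_diff_eq)
    moreover have "f x \<le> f (x + k)" using e2 k by (simp add: dist_real_def)
    ultimately show False by simp
  qed
qed

lemma local_max_derivatives:
  fixes f :: "real \<Rightarrow> real"
  assumes d1: "\<forall>\<^sub>F y in nhds x. (f has_real_derivative f' y) (at y)"
    and d2: "(f' has_real_derivative f2) (at x)"
    and mn: "\<forall>\<^sub>F y in nhds x. f y \<le> f x"
  shows "f' x = 0" "f2 \<le> 0"
proof -
  have 1: "\<forall>\<^sub>F y in nhds x. ((\<lambda>y. - f y) has_real_derivative - f' y) (at y)"
    using d1 by (auto elim!: eventually_mono intro: DERIV_minus)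
  have 2: "((\<lambda>y. - f' y) has_real_derivative - f2) (at x)" using d2 by (rule DERIV_minus)
  have 3: "\<forall>\<^sub>F y in nhds x. - f x \<le> - f y" using mn by simp
  from local_min_derivatives[OF 1 2 3] show "f' x = 0" "f2 \<le> 0" by auto
qed

text \<open>The function exp (k (t - t0)) (1 + z^2) grows in space, so adding a small multiple of it
  to a function bounded below moves all nonpositive values into a compact set; at the earliest such
  point the differential inequality fails. The inequality is demanded only where D < 0, which lets
  later applications drop zero-order terms by sign and use barriers with kinks.\<close>

lemma delayed_parabolic_min_principle:
  fixes D :: "real \<Rightarrow> real \<Rightarrow> real"
  assumes h: "h \<ge> 0" and L: "L \<ge> 0"
    and cont: "continuous_on ({t0..T} \<times> UNIV) (\<lambda>(t, z). D t z)"
    and bd: "\<And>t z. t0 \<le> t \<Longrightarrow> t \<le> T \<Longrightarrow> D t z \<ge> - C"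
    and init: "\<And>t z. t0 - h \<le> t \<Longrightarrow> t \<le> t0 \<Longrightarrow> D t z \<ge> 0"
    and pde: "\<And>t z. t0 < t \<Longrightarrow> t \<le> T \<Longrightarrow> D t z < 0 \<Longrightarrow>
       \<exists>Dt Dz Dzz. ((\<lambda>\<tau>. D \<tau> z) has_real_derivative Dt) (at t) \<and>
         (\<forall>\<^sub>F y in nhds z. ((\<lambda>x. D t x) has_real_derivative Dz y) (at y)) \<and>
         (Dz has_real_derivative Dzz) (at z) \<and>
         Dt \<ge> Dzz - c * Dz z - L * max 0 (- D (t - h) (z - c * h))"
    and t: "t0 \<le> t" "t \<le> T"
  shows "D t z \<ge> 0"
proof (rule ccontr)
  assume neg: "\<not> D t z \<ge> 0"
  \<comment> \<open>One summand per term at the touching point: 3 beats the 2 from the second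
    derivative of 1 + z^2, |c| the drift via 2 |z| \<le> 1 + z^2, and the last one the delayed term
    via (z - c h)^2 \<le> 2 z^2 + 2 (c h)^2.\<close>
  define k where "k = 3 + \<bar>c\<bar> + L * (2 + 2 * (c*h)^2)"
  define \<psi> where "\<psi> = (\<lambda>t z::real. exp (k * (t - t0)) * (1 + z^2))"
  have k0: "k > 0" using L unfolding k_def by (simp add: add_nonneg_pos add_pos_nonneg)
  have psi0: "\<psi> s y > 0" for s y unfolding \<psi>_def by (simp add: add_pos_nonneg)
  have psi1: "\<psi> s y \<ge> 1 + y^2" if "s \<ge> t0" for s y
  proof -
    have "exp (k * (s - t0)) \<ge> 1" using that k0 by simp
    then have "exp (k * (s - t0)) * (1 + y^2) \<ge> 1 * (1 + y^2)" by (intro mult_right_mono) auto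
    then show ?thesis by (simp add: \<psi>_def)
  qed
  \<comment> \<open>Half of the deficit at (t, z), so that F is still negative there.\<close>
  define \<epsilon> where "\<epsilon> = - D t z / (2 * \<psi> t z)"
  have e0: "\<epsilon> > 0" using neg psi0[of t z] unfolding \<epsilon>_def by (auto simp: field_simps)
  define F where "F = (\<lambda>t z. D t z + \<epsilon> * \<psi> t z)"
  have Fneg: "F t z < 0" using neg psi0[of t z] by (simp add: F_def \<epsilon>_def field_simps)
  define R where "R = \<bar>C\<bar> / \<epsilon>"
  have R: "F s y > 0" if "t0 \<le> s" "s \<le> T" "\<bar>y\<bar> \<ge> R" for s y
  proof -
    have "\<bar>y\<bar> < 1 + y^2"
    proof -
      have "(\<bar>y\<bar> - 1/2)^2 \<ge> 0" by simp
      then show ?thesis by (simp add: power2_eq_square algebra_simps flip: abs_mult)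
    qed
    then have "R < \<psi> s y" using psi1[OF that(1), of y] that(3) by simp
    then have "\<bar>C\<bar> < \<epsilon> * \<psi> s y" using e0 by (simp add: R_def field_simps)
    then show ?thesis using bd[OF that(1,2), of y] by (simp add: F_def)
  qed
  have contF: "continuous_on ({t0..T} \<times> UNIV) (\<lambda>p. F (fst p) (snd p))"
    unfolding F_def \<psi>_def using cont[unfolded case_prod_beta]
    by (intro continuous_intros) auto
  define S where "S = ({t0..T} \<times> {-R..R}) \<inter> (\<lambda>p. F (fst p) (snd p)) -` {..0}"
  have "closed S" unfolding S_def
    by (rule continuous_closed_preimage[OF continuous_on_subset[OF contF]]) (auto intro: closed_Times)
  moreover have "bounded S" unfolding S_def
    by (intro bounded_Int disjI1 compact_imp_bounded compact_Times compact_Icc)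
  ultimately have "compact S" using compact_eq_bounded_closed by blast
  moreover have "(t, z) \<in> S" unfolding S_def using t Fneg R[OF t, of z] by (force)
  \<comment> \<open>Minimising the time coordinate over the compact set S gives the first time at
    which F is nonpositive.\<close>
  ultimately obtain p where p: "p \<in> S" "\<And>q. q \<in> S \<Longrightarrow> fst p \<le> fst q"
    using continuous_attains_inf[of S fst] continuous_on_fst[OF continuous_on_id, of S] by fastforce
  obtain t1 z1 where pp: "p = (t1, z1)" by force
  have t1: "t0 \<le> t1" "t1 \<le> T" "F t1 z1 \<le> 0" using p(1) unfolding S_def pp by auto
  have Ft0: "F t0 y > 0" for y using init[of t0 y] h psi0 e0 by (simp add: F_def add_nonneg_pos)
  have t1': "t0 < t1" using Ft0 t1 by (metis order_less_le not_le)
  have before: "F s y > 0" if "t0 \<le> s" "s < t1" for s y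
  proof (rule ccontr)
    assume a: "\<not> F s y > 0"
    have "\<bar>y\<bar> < R" using R[of s y] that t1 a by (meson not_le le_less_trans less_imp_le)
    then have "(s, y) \<in> S" unfolding S_def using that t1 a by auto
    then show False using p(2) that pp by fastforce
  qed
  have at1: "F t1 y \<ge> 0" for y
  proof (rule ccontr)
    assume a: "\<not> F t1 y \<ge> 0"
    have "continuous_on {t0..t1} (\<lambda>s. F s y)"
      by (rule continuous_on_compose2[OF contF, of _ "\<lambda>s. (s, y)", simplified])
         (use t1 in \<open>auto intro!: continuous_intros\<close>)
    then obtain s where "t0 \<le> s" "s \<le> t1" "F s y = 0"
      using IVT2'[of "\<lambda>s. F s y" t1 0 t0] a Ft0[of y] t1 by force
    then show False using before[of s y] a by (cases "s = t1") auto
  qed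
  have F0: "F t1 z1 = 0" using at1[of z1] t1 by simp
  have "D t1 z1 = - \<epsilon> * \<psi> t1 z1" using F0 by (simp add: F_def)
  then have "D t1 z1 < 0" using e0 psi0[of t1 z1] by simp
  from pde[OF t1' t1(2) this] obtain Dt Dz Dzz where
     dt: "((\<lambda>\<tau>. D \<tau> z1) has_real_derivative Dt) (at t1)"
     and dz: "\<forall>\<^sub>F y in nhds z1. ((\<lambda>x. D t1 x) has_real_derivative Dz y) (at y)"
     and dzz: "(Dz has_real_derivative Dzz) (at z1)"
     and ineq: "Dt \<ge> Dzz - c * Dz z1 - L * max 0 (- D (t1 - h) (z1 - c * h))" by blast
  define E where "E = \<epsilon> * exp (k * (t1 - t0))"
  have E0: "E > 0" using e0 by (simp add: E_def)
  have Ft: "((\<lambda>\<tau>. F \<tau> z1) has_real_derivative Dt + k * E * (1 + z1^2)) (at t1)"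
    unfolding F_def \<psi>_def E_def by (auto intro!: derivative_eq_intros dt)
  \<comment> \<open>F is positive before t1 and zero at t1, so its time derivative is not positive;
    only earlier times are compared, as t1 may be the final time T.\<close>
  have "Dt + k * E * (1 + z1^2) \<le> 0"
  proof (rule ccontr)
    assume "\<not> ?thesis"
    then obtain d where d: "d > 0" "\<And>k. k > 0 \<Longrightarrow> k < d \<Longrightarrow> F (t1 - k) z1 < F t1 z1"
      using DERIV_pos_inc_left[OF Ft] by force
    define s where "s = min d (t1 - t0) / 2"
    have "s > 0" "s < d" "s < t1 - t0" using d t1' by (auto simp: s_def)
    then show False using d(2)[of s] before[of "t1 - s" z1] F0 by auto
  qed
  moreover have 1: "\<forall>\<^sub>F y in nhds z1. ((\<lambda>x. F t1 x) has_real_derivative Dz y + E * (2 * y)) (at y)"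
    using dz unfolding F_def \<psi>_def E_def by (auto elim!: eventually_mono intro!: derivative_eq_intros)
  moreover have 2: "((\<lambda>y. Dz y + E * (2 * y)) has_real_derivative Dzz + E * 2) (at z1)"
    by (auto intro!: derivative_eq_intros dzz)
  moreover have 3: "\<forall>\<^sub>F y in nhds z1. F t1 z1 \<le> F t1 y" using at1 F0 by simp
  ultimately have D2: "Dz z1 = - E * (2 * z1)" "Dzz \<ge> - 2 * E" "Dt \<le> - k * E * (1 + z1^2)"
    using local_min_derivatives[OF 1 2 3] by auto
  \<comment> \<open>The delayed time is either not before t0, where F \<ge> 0 is known (for h = 0 it
    is t1 itself), or in the initial window, where D \<ge> 0.\<close>
  have dl: "max 0 (- D (t1 - h) (z1 - c * h)) \<le> E * (1 + (z1 - c*h)^2)"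
  proof (cases "t1 - h \<ge> t0")
    case True
    have "F (t1 - h) (z1 - c*h) \<ge> 0" using before[of "t1 - h" "z1 - c*h"] at1 True h
      by (cases "h = 0") auto
    then have "- D (t1 - h) (z1 - c*h) \<le> \<epsilon> * \<psi> (t1 - h) (z1 - c*h)" by (simp add: F_def)
    also have "\<dots> \<le> \<epsilon> * (exp (k * (t1 - t0)) * (1 + (z1 - c*h)^2))"
      unfolding \<psi>_def using e0 h k0 by (intro mult_left_mono mult_right_mono) auto
    also have "\<dots> = E * (1 + (z1 - c*h)^2)" by (simp add: E_def)
    finally show ?thesis using E0 by simp
  next
    case False
    have "D (t1 - h) (z1 - c*h) \<ge> 0" using init[of "t1 - h"] False t1' by simp
    then show ?thesis using E0 by simp
  qed
  have "(z1 - c*h)^2 \<le> 2 * z1^2 + 2 * (c*h)^2"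
    using zero_le_power2[of "z1 + c*h"] by (simp add: power2_eq_square algebra_simps)
  then have "1 + (z1 - c*h)^2 \<le> (2 + 2 * (c*h)^2) * (1 + z1^2)"
  proof -
    assume a: "(z1 - c*h)^2 \<le> 2 * z1^2 + 2 * (c*h)^2"
    have "0 \<le> 2 * (c*h)^2 * z1^2" by simp
    moreover have "(2 + 2 * (c*h)^2) * (1 + z1^2) = 2 + 2 * (c*h)^2 + 2 * z1^2 + 2 * (c*h)^2 * z1^2"
      by (simp only: distrib_left distrib_right mult_1 mult_1_right)
    ultimately show ?thesis using a by linarith
  qed
  then have "E * (1 + (z1 - c*h)^2) \<le> E * ((2 + 2 * (c*h)^2) * (1 + z1^2))" using E0 by simp
  with dl have "max 0 (- D (t1 - h) (z1 - c * h)) \<le> E * ((2 + 2 * (c*h)^2) * (1 + z1^2))" by linarith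
  then have dl2: "L * max 0 (- D (t1 - h) (z1 - c * h)) \<le> L * (E * ((2 + 2 * (c*h)^2) * (1 + z1^2)))"
    using L by (rule mult_left_mono)
  have "2 * \<bar>z1\<bar> \<le> 1 + z1^2"
    using zero_le_power2[of "\<bar>z1\<bar> - 1"] by (simp add: power2_eq_square algebra_simps flip: abs_mult)
  then have "\<bar>c\<bar> * E * (2 * \<bar>z1\<bar>) \<le> \<bar>c\<bar> * E * (1 + z1^2)" using E0 by (intro mult_left_mono) auto
  moreover have "- c * Dz z1 \<ge> - (\<bar>c\<bar> * E * (2 * \<bar>z1\<bar>))"
  proof -
    have "\<bar>c * Dz z1\<bar> = \<bar>c\<bar> * E * (2 * \<bar>z1\<bar>)" using E0 unfolding D2(1) by (simp add: abs_mult)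
    then show ?thesis by linarith
  qed
  ultimately have "- k * E * (1 + z1^2) \<ge> - 2 * E - \<bar>c\<bar> * E * (1 + z1^2)
       - L * (E * ((2 + 2 * (c*h)^2) * (1 + z1^2)))"
    using D2 ineq dl2 by linarith
  moreover have "k * E * (1 + z1^2) = 3 * E * (1 + z1^2) + \<bar>c\<bar> * E * (1 + z1^2)
       + L * (E * ((2 + 2 * (c*h)^2) * (1 + z1^2)))" by (simp add: k_def algebra_simps)
  moreover have "3 * E * (1 + z1^2) > 2 * E"
  proof -
    have "3 * E * (1 + z1^2) = 3 * E + 3 * (E * z1^2)" by (simp add: algebra_simps)
    moreover have "E * z1^2 \<ge> 0" using E0 by simp
    ultimately show ?thesis using E0 by linarith
  qed
  ultimately show False by linarith
qed

text \<open>A quantitative strong maximum principle: a decaying multiple of the squared positive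
  part of R^2 - z^2, with radius R growing at speed 2 M, is a subsolution and reaches the ball of
  radius M within time 1. Since \<epsilon> is chosen before d and t0, the bound is uniform along a
  solution; this uniformity replaces a passage to limit solutions.\<close>

lemma spreading_lower_bound:
  fixes c h m \<rho> M :: real
  assumes h: "h \<ge> 0" and m: "m > 0" and \<rho>: "\<rho> > 0" and M: "M > 0"
  shows "\<exists>\<epsilon>>0. \<forall>d t0. continuous_on ({t0..t0+1+h} \<times> UNIV) (\<lambda>(t, z). d t z) \<longrightarrow>
     (\<forall>t z. t0 \<le> t \<longrightarrow> t \<le> t0+1+h \<longrightarrow> 0 \<le> d t z) \<longrightarrow> (\<forall>z. \<bar>z\<bar> \<le> \<rho> \<longrightarrow> m \<le> d t0 z) \<longrightarrow>
     (\<forall>t z. t0 < t \<longrightarrow> t \<le> t0+1+h \<longrightarrow> (\<exists>dt dz dzz. ((\<lambda>\<tau>. d \<tau> z) has_real_derivative dt) (at t) \<and>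
        (\<forall>y. ((\<lambda>x. d t x) has_real_derivative dz y) (at y)) \<and> (dz has_real_derivative dzz) (at z) \<and>
        dt \<ge> dzz - c * dz z - d t z)) \<longrightarrow>
     (\<forall>t z. t0+1 \<le> t \<longrightarrow> t \<le> t0+1+h \<longrightarrow> \<bar>z\<bar> \<le> M \<longrightarrow> \<epsilon> \<le> d t z)"
proof -
  \<comment> \<open>Rm is the largest radius on the time window. E bounds the coefficient of P in
    the subsolution inequality; k comes from completing the square in E P \<le> (k - 1) P^2 + 8
    \<rho>^2, with one more unit for the zero-order term. e2 puts the bump below m at time t0, and
    \<epsilon> is its size where P \<ge> 3 M^2.\<close>
  define Rm where "Rm = \<rho> + 2 * M * (1 + h)"
  define E where "E = 8 * Rm * M + 12 + 4 * \<bar>c\<bar> * Rm"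
  define k where "k = 1 + E^2 / (32 * \<rho>^2)"
  define e2 where "e2 = m / \<rho>^4"
  define \<epsilon> where "\<epsilon> = e2 * exp (- k * (1 + h)) * (3 * M^2)^2"
  have e2: "e2 > 0" using m \<rho> by (simp add: e2_def)
  have k: "k > 0" unfolding k_def by (simp add: add_pos_nonneg)
  have Rm: "Rm > 0" using \<rho> M h unfolding Rm_def by (simp add: add_pos_nonneg)
  have eps: "\<epsilon> > 0" using e2 M by (simp add: \<epsilon>_def)
  have main: "\<epsilon> \<le> d t z"
    if cont: "continuous_on ({t0..t0+1+h} \<times> UNIV) (\<lambda>(t, z). d t z)"
      and nn: "\<And>t z. t0 \<le> t \<Longrightarrow> t \<le> t0+1+h \<Longrightarrow> 0 \<le> d t z"
      and ini: "\<And>z. \<bar>z\<bar> \<le> \<rho> \<Longrightarrow> m \<le> d t0 z"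
      and pde: "\<And>t z. t0 < t \<Longrightarrow> t \<le> t0+1+h \<Longrightarrow> (\<exists>dt dz dzz. ((\<lambda>\<tau>. d \<tau> z) has_real_derivative dt) (at t) \<and>
        (\<forall>y. ((\<lambda>x. d t x) has_real_derivative dz y) (at y)) \<and> (dz has_real_derivative dzz) (at z) \<and>
        dt \<ge> dzz - c * dz z - d t z)"
      and t: "t0+1 \<le> t" "t \<le> t0+1+h" "\<bar>z\<bar> \<le> M" for d t0 t z
  proof -
    define R where "R = (\<lambda>t. \<rho> + 2 * M * (t - t0))"
    define P where "P = (\<lambda>t z. (R t)^2 - z^2)"
    define v where "v = (\<lambda>t z. e2 * exp (- k * (t - t0)) * (max 0 (P t z))^2)"
    have R: "\<rho> \<le> R s" "R s \<le> Rm" if "t0 \<le> s" "s \<le> t0+1+h" for s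
      using that M unfolding R_def Rm_def by (auto intro!: mult_left_mono)
    have vle: "v s y \<le> e2 * Rm^4" if "t0 \<le> s" "s \<le> t0+1+h" for s y
    proof -
      have "P s y \<le> Rm^2" using R[OF that] \<rho> unfolding P_def
        by (smt (verit) power_mono zero_le_power2)
      then have "(max 0 (P s y))^2 \<le> (Rm^2)^2" by (intro power_mono) auto
      moreover have "exp (- k * (s - t0)) \<le> 1" using that k by (simp add: mult_nonneg_nonneg)
      ultimately have "exp (- k * (s - t0)) * (max 0 (P s y))^2 \<le> 1 * (Rm^2)^2"
        by (intro mult_mono) auto
      then show ?thesis unfolding v_def using e2 by (simp add: mult.assoc flip: power_mult)
    qed
    have contv: "continuous_on ({t0..t0+1+h} \<times> UNIV) (\<lambda>(t, z). v t z)"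
      unfolding v_def P_def R_def case_prod_beta by (intro continuous_intros)
    have "d t z - v t z \<ge> 0"
    \<comment> \<open>Used with h = 0 and L = 0: there is no delayed term, and the initial window is
      the single time t0.\<close>
    proof (rule delayed_parabolic_min_principle[where D="\<lambda>t z. d t z - v t z" and h=0 and L=0 and c=c
          and T="t0+1+h" and ?t0.0=t0 and C="e2 * Rm^4"])
      show "continuous_on ({t0..t0 + 1 + h} \<times> UNIV) (\<lambda>(t, z). d t z - v t z)"
        using continuous_on_diff[OF cont contv] by (simp add: case_prod_beta)
      show "- (e2 * Rm^4) \<le> d s y - v s y" if "t0 \<le> s" "s \<le> t0+1+h" for s y
        using vle[OF that, of y] nn[OF that, of y] by linarith
      show "0 \<le> d s y - v s y" if "t0 - 0 \<le> s" "s \<le> t0" for s y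
      proof -
        have s: "s = t0" using that by simp
        show ?thesis
        proof (cases "\<bar>y\<bar> \<le> \<rho>")
          case True
          have "max 0 (P t0 y) \<le> \<rho>^2" by (simp add: P_def R_def)
          then have "(max 0 (P t0 y))^2 \<le> (\<rho>^2)^2" by (intro power_mono) auto
          then have "v t0 y \<le> e2 * (\<rho>^2)^2" unfolding v_def using e2 by simp
          also have "\<dots> = m" using \<rho> by (simp add: e2_def flip: power_mult)
          finally show ?thesis using ini[OF True] s by simp
        next
          case False
          have "\<rho>^2 \<le> \<bar>y\<bar>^2" using False \<rho> by (intro power_mono) auto
          then have "v t0 y = 0" by (simp add: v_def P_def R_def)
          then show ?thesis using nn[of t0 y] s h by simp
        qed
      qed
      show "\<exists>Dt Dz Dzz. ((\<lambda>\<tau>. d \<tau> y - v \<tau> y) has_real_derivative Dt) (at s) \<and>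
           (\<forall>\<^sub>F y in nhds y. ((\<lambda>x. d s x - v s x) has_real_derivative Dz y) (at y)) \<and>
           (Dz has_real_derivative Dzz) (at y) \<and>
           Dzz - c * Dz y - 0 * max 0 (- (d (s - 0) (y - c * 0) - v (s - 0) (y - c * 0))) \<le> Dt"
        if s: "t0 < s" "s \<le> t0+1+h" and neg: "d s y - v s y < 0" for s y
      proof -
        \<comment> \<open>Where d < v the bump is positive, so the kink of max at the edge of its
          support is never met.\<close>
        have vpos: "v s y > 0" using neg nn[of s y] s by simp
        have Ppos: "P s y > 0"
        proof (rule ccontr)
          assume "\<not> ?thesis" then have "v s y = 0" by (simp add: v_def)
          with vpos show False by simp
        qed
        from pde[OF s] obtain dt dz dzz where d: "((\<lambda>\<tau>. d \<tau> y) has_real_derivative dt) (at s)"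
          "\<And>y. ((\<lambda>x. d s x) has_real_derivative dz y) (at y)" "(dz has_real_derivative dzz) (at y)"
          "dt \<ge> dzz - c * dz y - d s y" by blast
        define X where "X = e2 * exp (- k * (s - t0))"
        have X: "X > 0" using e2 by (simp add: X_def)
        define vt where "vt = X * (- k * (P s y)^2 + 2 * P s y * (2 * R s * (2 * M)))"
        define vz where "vz = (\<lambda>y. X * (2 * P s y * (- 2 * y)))"
        define vzz where "vzz = X * (8 * y^2 - 4 * P s y)"
        have 1: "((\<lambda>\<tau>. v \<tau> y) has_real_derivative vt) (at s)"
        proof -
          have op: "open {\<tau>. P \<tau> y > 0}" unfolding P_def R_def
            by (intro open_Collect_less continuous_intros)
          have "((\<lambda>\<tau>. e2 * exp (- k * (\<tau> - t0)) * (P \<tau> y)^2) has_real_derivative vt) (at s)"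
            unfolding vt_def X_def P_def R_def
            by (auto intro!: derivative_eq_intros simp: algebra_simps)
          then show ?thesis
            by (rule has_field_derivative_transform_within_open[OF _ op])
               (use Ppos in \<open>auto simp: v_def\<close>)
        qed
        have op: "open {y. P s y > 0}" unfolding P_def R_def
            by (intro open_Collect_less continuous_intros)
        have 2: "((\<lambda>x. v s x) has_real_derivative vz y') (at y')" if "P s y' > 0" for y'
        proof -
          have "((\<lambda>x. e2 * exp (- k * (s - t0)) * (P s x)^2) has_real_derivative vz y') (at y')"
            unfolding vz_def X_def P_def R_def
            by (auto intro!: derivative_eq_intros simp: algebra_simps)
          then show ?thesis
            by (rule has_field_derivative_transform_within_open[OF _ op])
               (use that in \<open>auto simp: v_def\<close>)
        qed
        have ev: "\<forall>\<^sub>F y in nhds y. ((\<lambda>x. d s x - v s x) has_real_derivative dz y - vz y) (at y)"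
          using eventually_nhds_in_open[OF op, of y] Ppos
          by (auto elim!: eventually_mono intro!: DERIV_diff d(2) 2)
        have 3: "(vz has_real_derivative vzz) (at y)"
          unfolding vz_def vzz_def P_def
          by (auto intro!: derivative_eq_intros simp: algebra_simps power2_eq_square)
        have ineq: "vt \<le> vzz - c * vz y - v s y"
        proof -
          let ?p = "P s y"
          have Rs: "\<rho> \<le> R s" "R s \<le> Rm" using R s by auto
          have zz: "y^2 = (R s)^2 - ?p" by (simp add: P_def)
          have "y^2 \<le> (R s)^2" using Ppos by (simp add: P_def)
          then have "\<bar>y\<bar> \<le> R s" using power2_le_imp_le[of "\<bar>y\<bar>" "R s"] Rs \<rho> by simp
          then have y: "\<bar>y\<bar> \<le> Rm" using Rs by simp
          then have "\<bar>c * y\<bar> \<le> \<bar>c\<bar> * Rm" unfolding abs_mult by (intro mult_left_mono) auto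
          then have "- (c * y) \<le> \<bar>c\<bar> * Rm" by linarith
          moreover have "8 * R s * M \<le> 8 * Rm * M" using Rs(2) M by simp
          ultimately have E1: "8 * R s * M + 12 - 4 * (c * y) \<le> E" unfolding E_def by linarith
          have "(E * ?p / \<rho> - 16 * \<rho>)^2 \<ge> 0" by simp
          then have "32 * (E * ?p) \<le> E^2 * ?p^2 / \<rho>^2 + 256 * \<rho>^2"
            using \<rho> by (simp add: power2_diff power_divide power_mult_distrib)
          then have "E * ?p \<le> (k - 1) * ?p^2 + 8 * \<rho>^2" using \<rho> by (simp add: k_def field_simps)
          moreover have "\<rho>^2 \<le> (R s)^2" using Rs \<rho> by (intro power_mono) auto
          moreover have "?p * (8 * R s * M + 12 - 4 * (c * y)) \<le> ?p * E"
            using E1 Ppos by (intro mult_left_mono) auto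
          ultimately have "?p * (8 * R s * M + 12 - 4 * (c * y)) \<le> (k - 1) * ?p^2 + 8 * (R s)^2"
            by (simp add: mult.commute)
          then have "0 \<le> (8 * y^2 - 4 * ?p) - c * (2 * ?p * (- 2 * y)) - ?p^2
              - (- k * ?p^2 + 2 * ?p * (2 * R s * (2 * M)))"
            unfolding zz by (simp add: algebra_simps)
          then have "0 \<le> X * ((8 * y^2 - 4 * ?p) - c * (2 * ?p * (- 2 * y)) - ?p^2
              - (- k * ?p^2 + 2 * ?p * (2 * R s * (2 * M))))" using X by simp
          moreover have "v s y = X * ?p^2" using Ppos by (simp add: v_def X_def)
          ultimately show ?thesis unfolding vt_def vz_def vzz_def by (simp add: algebra_simps)
        qed
        show ?thesis
          using DERIV_diff[OF d(1) 1] ev DERIV_diff[OF d(3) 3] ineq d(4) neg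
          by (intro exI[of _ "dt - vt"] exI[of _ "\<lambda>y. dz y - vz y"] exI[of _ "dzz - vzz"])
             (auto simp: algebra_simps)
      qed
    qed (use t h in auto)
    moreover have "\<epsilon> \<le> v t z"
    proof -
      have "2 * M * 1 \<le> 2 * M * (t - t0)" using t M by (intro mult_left_mono) auto
      then have "2 * M \<le> R t" using \<rho> unfolding R_def by linarith
      then have "(2 * M)^2 \<le> (R t)^2" using M by (intro power_mono) auto
      moreover have "z^2 \<le> M^2" using power_mono[OF t(3), of 2] by simp
      ultimately have "3 * M^2 \<le> P t z" by (simp add: P_def power_mult_distrib)
      then have "(3 * M^2)^2 \<le> (max 0 (P t z))^2" by (intro power_mono) auto
      moreover have "exp (- k * (1 + h)) \<le> exp (- k * (t - t0))" using t k by simp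
      ultimately have "exp (- k * (1 + h)) * (3 * M^2)^2 \<le> exp (- k * (t - t0)) * (max 0 (P t z))^2"
        by (intro mult_mono) auto
      then show ?thesis unfolding \<epsilon>_def v_def using e2 by (simp add: mult.assoc)
    qed
    ultimately show ?thesis by simp
  qed
  show ?thesis
    by (rule exI[of _ \<epsilon>]) (use eps main in blast)
qed

text \<open>Doubling of variables: u at p + r/2 minus u at p - r/2 is compared with \<kappa> (2 r -
  r^2). Concavity in r contributes - 8 \<kappa> at a maximum, more than the bounded terms can
  return. The factor t - t0 removes the values at t0, so the constant depends on the bounds for u
  and f alone.\<close>

lemma parabolic_one_sided_gradient_bound:
  fixes u f ut ux uxx :: "real \<Rightarrow> real \<Rightarrow> real"
  assumes \<kappa>: "\<kappa> > 0"
    and cont: "continuous_on ({t0..t0+1} \<times> UNIV) (\<lambda>(t, z). u t z)"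
    and bd: "\<And>t z. t0 \<le> t \<Longrightarrow> t \<le> t0+1 \<Longrightarrow> 0 \<le> u t z \<and> u t z \<le> \<kappa>"
    and fbd: "\<And>t z. t0 < t \<Longrightarrow> t \<le> t0+1 \<Longrightarrow> 0 \<le> f t z \<and> f t z \<le> \<kappa>"
    and dt: "\<And>t z. t0 < t \<Longrightarrow> t \<le> t0+1 \<Longrightarrow> ((\<lambda>\<tau>. u \<tau> z) has_real_derivative ut t z) (at t)"
    and dx: "\<And>t z. t0 < t \<Longrightarrow> t \<le> t0+1 \<Longrightarrow> ((\<lambda>y. u t y) has_real_derivative ux t z) (at z)"
    and dxx: "\<And>t z. t0 < t \<Longrightarrow> t \<le> t0+1 \<Longrightarrow> ((\<lambda>y. ux t y) has_real_derivative uxx t z) (at z)"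
    and pde: "\<And>t z. t0 < t \<Longrightarrow> t \<le> t0+1 \<Longrightarrow> ut t z = uxx t z - c * ux t z - u t z + f t z"
    and yx: "y \<le> x"
  shows "u (t0+1) x - u (t0+1) y \<le> 2 * \<kappa> * (x - y)"
proof -
  \<comment> \<open>For distances up to 1 only: there 2 r - r^2 is increasing, and \<kappa> (2 r -
    r^2) reaches \<kappa>, the full oscillation of u, at r = 1.\<close>
  have key: "u (t0+1) x - u (t0+1) y \<le> \<kappa> * (2 * (x - y) - (x - y)^2)" if xy: "y \<le> x" "x \<le> y + 1" for x y
  proof (rule ccontr)
    assume ng: "\<not> ?thesis"
    define gap where "gap = u (t0+1) x - u (t0+1) y - \<kappa> * (2 * (x - y) - (x - y)^2)"
    define p0 where "p0 = (x + y) / 2"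
    \<comment> \<open>The first bound keeps F positive at the offending pair, the second keeps the
      drift term below \<kappa>. The penalty sqrt (1 + p^2) confines the maximum in p and has slope
      at most 1.\<close>
    define \<epsilon> where "\<epsilon> = min (gap / (2 * sqrt (1 + p0^2))) (\<kappa> / (1 + 2 * \<bar>c\<bar>))"
    have sq: "sqrt (1 + p^2) > 0" for p :: real by (simp add: add_pos_nonneg)
    have gap: "gap > 0" using ng by (simp add: gap_def)
    have \<epsilon>: "\<epsilon> > 0" unfolding \<epsilon>_def using gap sq[of p0] \<kappa> by simp
    have e1: "\<epsilon> * sqrt (1 + p0^2) < gap"
    proof -
      have "\<epsilon> * sqrt (1 + p0^2) \<le> gap / (2 * sqrt (1 + p0^2)) * sqrt (1 + p0^2)"
        using sq[of p0] by (intro mult_right_mono) (auto simp: \<epsilon>_def)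
      also have "\<dots> = gap / 2" using sq[of p0] by simp
      finally show ?thesis using gap by simp
    qed
    have e2: "2 * \<bar>c\<bar> * \<epsilon> \<le> \<kappa>"
    proof -
      have "\<epsilon> \<le> \<kappa> / (1 + 2 * \<bar>c\<bar>)" by (simp add: \<epsilon>_def)
      then have "\<epsilon> * (1 + 2 * \<bar>c\<bar>) \<le> \<kappa>" by (simp add: pos_le_divide_eq add_pos_nonneg)
      then show ?thesis using \<epsilon> by (simp add: algebra_simps)
    qed
    define F where "F = (\<lambda>t p r. (t - t0) * (u t (p + r/2) - u t (p - r/2)) - \<kappa> * (2 * r - r^2) - \<epsilon> * sqrt (1 + p^2))"
    define K where "K = \<kappa> / \<epsilon>"
    let ?S = "{t0..t0+1} \<times> ({-K..K} \<times> {0..1::real})"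
    have cF: "continuous_on ?S (\<lambda>q. F (fst q) (fst (snd q)) (snd (snd q)))"
    proof -
      have a: "continuous_on ?S (\<lambda>q. u (fst q) (fst (snd q) + snd (snd q)/2))"
        by (rule continuous_on_compose2[OF cont, where f="\<lambda>q. (fst q, fst (snd q) + snd (snd q)/2)", simplified])
           (auto intro!: continuous_intros)
      have b: "continuous_on ?S (\<lambda>q. u (fst q) (fst (snd q) - snd (snd q)/2))"
        by (rule continuous_on_compose2[OF cont, where f="\<lambda>q. (fst q, fst (snd q) - snd (snd q)/2)", simplified])
           (auto intro!: continuous_intros)
      show ?thesis unfolding F_def by (intro continuous_intros a b)
    qed
    \<comment> \<open>Positivity of F excludes t = t0, r = 0, r = 1 and |p| = K, so a positive
      maximum is interior except possibly for the final time.\<close>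
    have Fp: "\<bar>p\<bar> < K \<and> t > t0 \<and> r > 0 \<and> r < 1" if "F t p r > 0" "t0 \<le> t" "t \<le> t0+1" "0 \<le> r" "r \<le> 1" for t p r
    proof -
      have up: "u t (p + r/2) - u t (p - r/2) \<le> \<kappa>" using bd[OF that(2,3)] by (smt (verit))
      have r2: "r^2 \<le> r" using that by (simp add: power2_eq_square mult_left_le)
      have rr: "\<kappa> * (2 * r - r^2) \<ge> 0" using \<kappa> r2 that by simp
      have tle: "(t - t0) * (u t (p + r/2) - u t (p - r/2)) \<le> 1 * \<kappa>"
        by (smt (verit) up that \<kappa> mult_mono mult_nonneg_nonneg mult_left_le_one_le mult_nonneg_nonpos)
      have ps: "\<bar>p\<bar> < sqrt (1 + p^2)" by (rule real_less_rsqrt) simp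
      have es: "\<epsilon> * sqrt (1 + p^2) > 0" using \<epsilon> sq by simp
      have "\<epsilon> * sqrt (1 + p^2) < \<kappa>" using that(1) tle rr unfolding F_def by linarith
      then have "sqrt (1 + p^2) < K" using \<epsilon> by (simp add: K_def field_simps)
      moreover have "t \<noteq> t0" using that(1) rr es unfolding F_def by (auto)
      moreover have "r \<noteq> 0" using that(1) es unfolding F_def by auto
      moreover have "r \<noteq> 1" using that(1) es tle unfolding F_def by auto
      ultimately show ?thesis using ps that by auto
    qed
    have F1: "F (t0+1) p0 (x - y) > 0"
    proof -
      have "p0 + (x - y)/2 = x" "p0 - (x - y)/2 = y" by (auto simp: p0_def field_simps)
      then show ?thesis using e1 by (simp add: F_def gap_def)
    qed
    then have mem: "(t0+1, p0, x - y) \<in> ?S" using Fp[OF F1] xy by auto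
    have "compact ?S" by (intro compact_Times compact_Icc)
    then obtain q where q: "q \<in> ?S" "\<And>q'. q' \<in> ?S \<Longrightarrow>
        F (fst q') (fst (snd q')) (snd (snd q')) \<le> F (fst q) (fst (snd q)) (snd (snd q))"
      using continuous_attains_sup[OF _ _ cF] mem by blast
    obtain t p r where qq: "q = (t, p, r)" by (metis prod.exhaust)
    have mx: "F t' p' r' \<le> F t p r" if "t0 \<le> t'" "t' \<le> t0+1" "\<bar>p'\<bar> \<le> K" "0 \<le> r'" "r' \<le> 1" for t' p' r'
    proof -
      have "(t', p', r') \<in> ?S" using that by auto
      from q(2)[OF this] show ?thesis by (simp add: qq)
    qed
    have pos: "F t p r > 0" using q(2)[OF mem] F1 qq by simp
    have rng: "t0 \<le> t" "t \<le> t0+1" "0 \<le> r" "r \<le> 1" using q(1) qq by auto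
    have in1: "\<bar>p\<bar> < K" "t > t0" "r > 0" "r < 1" using Fp[OF pos rng] by auto
    define s where "s = t - t0"
    have s: "s > 0" "s \<le> 1" using in1 rng by (auto simp: s_def)
    let ?X = "p + r/2" and ?Y = "p - r/2"
    have dX: "((\<lambda>y. u t y) has_real_derivative ux t z) (at z)"
        "((\<lambda>y. ux t y) has_real_derivative uxx t z) (at z)" for z
      using dx dxx in1 rng by auto
    have p1: "1 + p^2 > 0" by (simp add: add_pos_nonneg)
    have "((\<lambda>p. F t p r) has_real_derivative s * (ux t ?X - ux t ?Y) - \<epsilon> * (p / sqrt (1 + p^2))) (at p)"
      unfolding F_def s_def using sq[of p] p1
      by (auto intro!: derivative_eq_intros DERIV_chain2[OF dX(1)] simp: field_simps)
    \<comment> \<open>Criticality in p says that the two gradients nearly agree, which makes the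
      drift harmless whatever the size of ux.\<close>
    then have "s * (ux t ?X - ux t ?Y) - \<epsilon> * (p / sqrt (1 + p^2)) = 0"
      by (rule DERIV_local_max[where d="K - \<bar>p\<bar>"])
         (use in1 rng in \<open>auto intro!: mx\<close>)
    moreover have "\<bar>p / sqrt (1 + p^2)\<bar> \<le> 1"
    proof -
      have "\<bar>p\<bar> \<le> sqrt (1 + p^2)" by (rule real_le_rsqrt) simp
      then show ?thesis using sq[of p] by (simp add: abs_divide)
    qed
    moreover from this have "\<epsilon> * \<bar>p / sqrt (1 + p^2)\<bar> \<le> \<epsilon>" using \<epsilon> by (intro mult_left_le) auto
    ultimately have gx: "\<bar>s * (ux t ?X - ux t ?Y)\<bar> \<le> \<epsilon>"
      using \<epsilon> by (simp add: abs_mult)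
    have r1: "\<forall>\<^sub>F r in nhds r. ((\<lambda>r. F t p r) has_real_derivative
           s * (ux t (p + r/2) / 2 + ux t (p - r/2) / 2) - \<kappa> * (2 - 2 * r)) (at r)"
      unfolding F_def s_def
      by (intro always_eventually allI) (auto intro!: derivative_eq_intros DERIV_chain2[OF dX(1)])
    have r2: "((\<lambda>r. s * (ux t (p + r/2) / 2 + ux t (p - r/2) / 2) - \<kappa> * (2 - 2 * r)) has_real_derivative
           s * (uxx t ?X / 4 - uxx t ?Y / 4) + 2 * \<kappa>) (at r)"
      by (auto intro!: derivative_eq_intros DERIV_chain2[OF dX(2)])
    have r3: "\<forall>\<^sub>F r' in nhds r. F t p r' \<le> F t p r"
      unfolding eventually_nhds_metric
      by (rule exI[of _ "min r (1 - r)"]) (use in1 rng in \<open>auto intro!: mx simp: dist_real_def\<close>)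
    have xx: "s * (uxx t ?X - uxx t ?Y) \<le> - 8 * \<kappa>"
      using local_max_derivatives(2)[OF r1 r2 r3] by (simp add: algebra_simps)
    have Ft: "((\<lambda>t. F t p r) has_real_derivative (u t ?X - u t ?Y) + s * (ut t ?X - ut t ?Y)) (at t)"
      unfolding F_def s_def using dt in1 rng by (auto intro!: derivative_eq_intros)
    have Ft0: "(u t ?X - u t ?Y) + s * (ut t ?X - ut t ?Y) \<ge> 0"
    proof (rule ccontr)
      assume "\<not> ?thesis"
      then obtain d where d: "d > 0" "\<And>k. k > 0 \<Longrightarrow> k < d \<Longrightarrow> F t p r < F (t - k) p r"
        using DERIV_neg_dec_left[OF Ft] by force
      define k where "k = min d s / 2"
      have k: "k > 0" "k < d" "k < s" using d s by (auto simp: k_def)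
      show False using d(2)[OF k(1,2)] mx[of "t - k" p r] k rng in1 by (auto simp: s_def)
    qed
    have ud: "\<bar>u t ?X - u t ?Y\<bar> \<le> \<kappa>" using bd[OF rng(1,2)] by (smt (verit))
    have fd: "\<bar>f t ?X - f t ?Y\<bar> \<le> \<kappa>" using fbd[OF in1(2) rng(2)] by (smt (verit))
    have "s * (ut t ?X - ut t ?Y) = s * (uxx t ?X - uxx t ?Y) - c * (s * (ux t ?X - ux t ?Y))
         - s * (u t ?X - u t ?Y) + s * (f t ?X - f t ?Y)"
      unfolding pde[OF in1(2) rng(2), of ?X] pde[OF in1(2) rng(2), of ?Y] by (simp add: algebra_simps)
    moreover have "\<bar>s * (u t ?X - u t ?Y)\<bar> \<le> \<kappa>"
      using mult_mono[of "\<bar>s\<bar>" 1, OF _ ud] s by (simp add: abs_mult)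
    moreover have "\<bar>s * (f t ?X - f t ?Y)\<bar> \<le> \<kappa>"
      using mult_mono[of "\<bar>s\<bar>" 1, OF _ fd] s by (simp add: abs_mult)
    moreover have "\<bar>c * (s * (ux t ?X - ux t ?Y))\<bar> \<le> \<bar>c\<bar> * \<epsilon>"
      unfolding abs_mult[of c] using gx by (intro mult_left_mono) auto
    ultimately show False using Ft0 ud xx e2 \<kappa> by linarith
  qed
  show ?thesis
  proof (cases "x \<le> y + 1")
    case True
    have "\<kappa> * (2 * (x - y) - (x - y)^2) \<le> \<kappa> * (2 * (x - y))" using \<kappa> by (intro mult_left_mono) auto
    moreover have "2 * \<kappa> * (x - y) = \<kappa> * (2 * (x - y))" by simp
    ultimately show ?thesis using key[OF yx True] by linarith
  next
    case False
    have "\<kappa> * 1 \<le> \<kappa> * (2 * (x - y))" using \<kappa> False by (intro mult_left_mono) auto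
    moreover have "u (t0+1) x - u (t0+1) y \<le> \<kappa>" using bd[of "t0+1" x] bd[of "t0+1" y] by simp
    moreover have "2 * \<kappa> * (x - y) = \<kappa> * (2 * (x - y))" by simp
    ultimately show ?thesis by linarith
  qed
qed

text \<open>The reflection of z turns c into - c and supplies the missing direction.\<close>

lemma parabolic_gradient_bound:
  fixes u f ut ux uxx :: "real \<Rightarrow> real \<Rightarrow> real"
  assumes \<kappa>: "\<kappa> > 0"
    and cont: "continuous_on ({t0..t0+1} \<times> UNIV) (\<lambda>(t, z). u t z)"
    and bd: "\<And>t z. t0 \<le> t \<Longrightarrow> t \<le> t0+1 \<Longrightarrow> 0 \<le> u t z \<and> u t z \<le> \<kappa>"
    and fbd: "\<And>t z. t0 < t \<Longrightarrow> t \<le> t0+1 \<Longrightarrow> 0 \<le> f t z \<and> f t z \<le> \<kappa>"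
    and dt: "\<And>t z. t0 < t \<Longrightarrow> t \<le> t0+1 \<Longrightarrow> ((\<lambda>\<tau>. u \<tau> z) has_real_derivative ut t z) (at t)"
    and dx: "\<And>t z. t0 < t \<Longrightarrow> t \<le> t0+1 \<Longrightarrow> ((\<lambda>y. u t y) has_real_derivative ux t z) (at z)"
    and dxx: "\<And>t z. t0 < t \<Longrightarrow> t \<le> t0+1 \<Longrightarrow> ((\<lambda>y. ux t y) has_real_derivative uxx t z) (at z)"
    and pde: "\<And>t z. t0 < t \<Longrightarrow> t \<le> t0+1 \<Longrightarrow> ut t z = uxx t z - c * ux t z - u t z + f t z"
  shows "\<bar>u (t0+1) x - u (t0+1) y\<bar> \<le> 2 * \<kappa> * \<bar>x - y\<bar>"
proof -
  have 1: "u (t0+1) x - u (t0+1) y \<le> 2 * \<kappa> * (x - y)" if "y \<le> x" for x y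
    by (rule parabolic_one_sided_gradient_bound[OF assms that])
  have 2: "u (t0+1) (- x) - u (t0+1) (- y) \<le> 2 * \<kappa> * (x - y)" if yx: "y \<le> x" for x y
  proof (rule parabolic_one_sided_gradient_bound[where u="\<lambda>t z. u t (- z)" and f="\<lambda>t z. f t (- z)"
        and ut="\<lambda>t z. ut t (- z)" and ux="\<lambda>t z. - ux t (- z)" and uxx="\<lambda>t z. uxx t (- z)"
        and c="- c", OF \<kappa> _ _ _ _ _ _ _ yx])
    show "continuous_on ({t0..t0+1} \<times> UNIV) (\<lambda>(t, z). u t (- z))"
    proof -
      have "continuous_on ({t0..t0+1} \<times> UNIV) (\<lambda>q::real \<times> real. (fst q, - snd q))"
        by (intro continuous_intros)
      from continuous_on_compose2[OF cont this] show ?thesis by (force simp: case_prod_beta)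
    qed
    fix t z assume t: "t0 < t" "t \<le> t0+1"
    show "((\<lambda>y. u t (- y)) has_real_derivative - ux t (- z)) (at z)"
      using DERIV_chain2[OF dx[OF t] DERIV_minus[OF DERIV_ident]] by simp
    have "((\<lambda>y. ux t (- y)) has_real_derivative - uxx t (- z)) (at z)"
      using DERIV_chain2[OF dxx[OF t] DERIV_minus[OF DERIV_ident]] by simp
    then show "((\<lambda>y. - ux t (- y)) has_real_derivative uxx t (- z)) (at z)"
      using DERIV_minus by fastforce
    show "((\<lambda>\<tau>. u \<tau> (- z)) has_real_derivative ut t (- z)) (at t)" by (rule dt[OF t])
    show "ut t (- z) = uxx t (- z) - - c * - ux t (- z) - u t (- z) + f t (- z)"
      using pde[OF t, of "- z"] by simp
  qed (use bd fbd in auto)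
  have 3: "\<bar>u (t0+1) x - u (t0+1) y\<bar> \<le> 2 * \<kappa> * (x - y)" if "y \<le> x" for x y
    using 1[OF that] 2[of "- x" "- y"] that by simp
  show ?thesis
  proof (cases "y \<le> x")
    case True then show ?thesis using 3[of y x] by simp
  next
    case False then show ?thesis using 3[of x y] by (simp add: abs_minus_commute)
  qed
qed

section \<open>The nonlinearity and the characteristic function\<close>

locale monostable =
  fixes g :: "real \<Rightarrow> real" and \<kappa> h :: real
  assumes mono_g: "mono g" and hyp: "hypH g \<kappa>" and h: "h \<ge> 0"
begin

section \<open>Elementary bounds for g\<close>

abbreviation "g0 \<equiv> deriv g 0"
abbreviation "gk \<equiv> deriv g \<kappa>"

lemma kap: "\<kappa> > 0"
  by (rule hyp[unfolded hypH_def, THEN conjunct1])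

lemma g0: "g0 > 1"
  by (rule hyp[unfolded hypH_def, THEN conjunct2, THEN conjunct2, THEN conjunct2, THEN conjunct2, THEN conjunct1])

lemma gk1: "gk < 1"
  by (rule hyp[unfolded hypH_def, THEN conjunct2, THEN conjunct2, THEN conjunct2, THEN conjunct2, THEN conjunct2, THEN conjunct1])

lemma g_left: "x \<le> 0 \<Longrightarrow> g x = g0 * x"
  by (rule hyp[unfolded hypH_def, THEN conjunct2, THEN conjunct2, THEN conjunct2, THEN conjunct2, THEN conjunct2, THEN conjunct2, THEN conjunct2, THEN conjunct1, rule_format])

lemma g_right: "x \<ge> \<kappa> \<Longrightarrow> g x = \<kappa> + gk * (x - \<kappa>)"
  by (rule hyp[unfolded hypH_def, THEN conjunct2, THEN conjunct2, THEN conjunct2, THEN conjunct2, THEN conjunct2, THEN conjunct2, THEN conjunct2, THEN conjunct2, rule_format])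

lemma g_zero [simp]: "g 0 = 0" and g_kap [simp]: "g \<kappa> = \<kappa>"
  using g_left[of 0] g_right[of \<kappa>] by simp_all

lemma g_fixed: "x \<ge> 0 \<Longrightarrow> g x = x \<Longrightarrow> x = 0 \<or> x = \<kappa>"
proof -
  have "{x. x \<ge> 0 \<and> g x = x} = {0, \<kappa>}"
    by (rule hyp[unfolded hypH_def, THEN conjunct2, THEN conjunct2, THEN conjunct1])
  then show "x \<ge> 0 \<Longrightarrow> g x = x \<Longrightarrow> x = 0 \<or> x = \<kappa>" by blast
qed

lemma gmono: "x \<le> y \<Longrightarrow> g x \<le> g y" using mono_g by (rule monoD)

lemma gk0: "gk \<ge> 0"
  using gmono[of \<kappa> "\<kappa> + 1"] g_right[of "\<kappa> + 1"] by simp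

lemma g_derivs:
  "\<exists>\<delta>>0. \<delta> < \<kappa> \<and> (\<forall>x. \<bar>x\<bar> < \<delta> \<longrightarrow> (g has_real_derivative deriv g x) (at x)) \<and>
    (\<forall>x. \<bar>x - \<kappa>\<bar> < \<delta> \<longrightarrow> (g has_real_derivative deriv g x) (at x)) \<and>
    isCont (deriv g) 0 \<and> isCont (deriv g) \<kappa> \<and>
    (\<exists>C \<theta>. C > 0 \<and> 0 < \<theta> \<and> \<theta> \<le> 1 \<and> (\<forall>u. 0 < u \<longrightarrow> u < \<delta> \<longrightarrow> \<bar>deriv g u - g0\<bar> \<le> C * u powr \<theta>))"
proof -
  obtain \<delta>0 where d0: "\<delta>0 > 0"
    "(\<forall>x\<in>{-\<delta>0<..<\<delta>0} \<union> {\<kappa>-\<delta>0<..<\<kappa>+\<delta>0}. (g has_real_derivative deriv g x) (at x)) \<and>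
     continuous_on ({-\<delta>0<..<\<delta>0} \<union> {\<kappa>-\<delta>0<..<\<kappa>+\<delta>0}) (deriv g) \<and>
     (\<exists>C>0. \<exists>\<theta>. 0 < \<theta> \<and> \<theta> \<le> 1 \<and>
        (\<forall>u\<in>{0<..\<delta>0}. \<bar>deriv g u - deriv g 0\<bar> + \<bar>deriv g \<kappa> - deriv g (\<kappa> - u)\<bar> \<le> C * u powr \<theta>))"
    using hyp[unfolded hypH_def, THEN conjunct2, THEN conjunct2, THEN conjunct2, THEN conjunct1] by (elim bexE exE) (erule conjE, rule that, assumption+)
  obtain C \<theta> where d1: "C > 0" "0 < \<theta>" "\<theta> \<le> 1"
    "\<forall>u\<in>{0<..\<delta>0}. \<bar>deriv g u - deriv g 0\<bar> + \<bar>deriv g \<kappa> - deriv g (\<kappa> - u)\<bar> \<le> C * u powr \<theta>"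
    using d0(2) by (elim exE conjE) (rule that)
  note d = d0(1) conjunct1[OF d0(2)] conjunct1[OF conjunct2[OF d0(2)]] d1
  define \<delta> where "\<delta> = min \<delta>0 (\<kappa>/2)"
  have \<delta>: "\<delta> > 0" "\<delta> < \<kappa>" "\<delta> \<le> \<delta>0" using d(1) kap by (auto simp: \<delta>_def)
  have 1: "(g has_real_derivative deriv g x) (at x)" if "\<bar>x\<bar> < \<delta>" for x
    by (rule d(2)[rule_format]) (use that \<delta> in auto)
  have 2: "(g has_real_derivative deriv g x) (at x)" if "\<bar>x - \<kappa>\<bar> < \<delta>" for x
    by (rule d(2)[rule_format]) (use that \<delta> in auto)
  have op: "open ({-\<delta>0<..<\<delta>0} \<union> {\<kappa>-\<delta>0<..<\<kappa>+\<delta>0})" by (intro open_Un open_greaterThanLessThan)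
  have 3: "isCont (deriv g) x" if "x \<in> {-\<delta>0<..<\<delta>0} \<union> {\<kappa>-\<delta>0<..<\<kappa>+\<delta>0}" for x
    using d(3) that unfolding continuous_on_eq_continuous_at[OF op] by (rule bspec)
  have 4: "\<bar>deriv g u - g0\<bar> \<le> C * u powr \<theta>" if "0 < u" "u < \<delta>" for u
  proof -
    have "u \<in> {0<..\<delta>0}" using that \<delta> by simp
    from d(7)[rule_format, OF this] show ?thesis by linarith
  qed
  show ?thesis
    by (intro exI[of _ \<delta>] conjI exI[of _ C] exI[of _ \<theta>] allI impI 1 2 3 4 \<delta> d) (use d(1) in auto)
qed

text \<open>Barriers leave [0, \<kappa>], so the constant has to be global. Clamping to
  [0, \<kappa>] splits g into its two linear tails and the part covered by the hypothesis.\<close>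

lemma g_lipschitz: "\<exists>L>0. \<forall>u v. \<bar>g u - g v\<bar> \<le> L * \<bar>u - v\<bar>"
proof -
  obtain Lg where "\<forall>u\<in>{0..\<kappa>}. \<forall>v\<in>{0..\<kappa>}. \<bar>g u - g v\<bar> \<le> Lg * \<bar>u - v\<bar>"
    using hyp[unfolded hypH_def, THEN conjunct2, THEN conjunct2, THEN conjunct2, THEN conjunct2, THEN conjunct2, THEN conjunct2, THEN conjunct1] by (rule exE)
  then have Lg: "\<And>u v. u \<in> {0..\<kappa>} \<Longrightarrow> v \<in> {0..\<kappa>} \<Longrightarrow> \<bar>g u - g v\<bar> \<le> Lg * \<bar>u - v\<bar>" by simp
  define cl where "cl = (\<lambda>x. max 0 (min x \<kappa>))"
  have dec: "g x = g0 * min x 0 + g (cl x) + gk * max (x - \<kappa>) 0" for x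
  proof -
    consider "x \<le> 0" | "0 < x" "x < \<kappa>" | "x \<ge> \<kappa>" by linarith
    then show ?thesis
    proof cases
      case 1
      then have "cl x = 0" "min x 0 = x" "max (x - \<kappa>) 0 = 0" using kap unfolding cl_def by linarith+
      then show ?thesis using g_left[OF 1] by (simp only: g_zero)
    next
      case 2
      then have "cl x = x" "min x 0 = 0" "max (x - \<kappa>) 0 = 0" unfolding cl_def by linarith+
      then show ?thesis by (simp only:)
    next
      case 3
      then have "cl x = \<kappa>" "min x 0 = 0" "max (x - \<kappa>) 0 = x - \<kappa>" using kap unfolding cl_def by linarith+
      then show ?thesis using g_right[OF 3] by (simp only: g_kap)
    qed
  qed
  show ?thesis
  proof (intro exI[of _ "g0 + \<bar>Lg\<bar> + gk"] conjI allI)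
    fix u v
    have cl: "cl x \<in> {0..\<kappa>}" for x using kap by (auto simp: cl_def)
    have sc: "\<bar>r * x - r * y\<bar> \<le> r * \<bar>u - v\<bar>" if "r \<ge> 0" "\<bar>x - y\<bar> \<le> \<bar>u - v\<bar>" for r x y :: real
    proof -
      have "\<bar>r * x - r * y\<bar> = r * \<bar>x - y\<bar>" using that(1) by (metis abs_mult abs_of_nonneg right_diff_distrib)
      then show ?thesis using mult_left_mono[OF that(2,1)] by simp
    qed
    have "\<bar>min u 0 - min v 0\<bar> \<le> \<bar>u - v\<bar>" by linarith
    then have 1: "\<bar>g0 * min u 0 - g0 * min v 0\<bar> \<le> g0 * \<bar>u - v\<bar>" using g0 by (intro sc) simp_all
    have "\<bar>cl u - cl v\<bar> \<le> \<bar>u - v\<bar>" using kap unfolding cl_def by linarith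
    then have "\<bar>Lg\<bar> * \<bar>cl u - cl v\<bar> \<le> \<bar>Lg\<bar> * \<bar>u - v\<bar>" by (rule mult_left_mono) simp
    moreover have "Lg * \<bar>cl u - cl v\<bar> \<le> \<bar>Lg\<bar> * \<bar>cl u - cl v\<bar>" by (rule mult_right_mono) auto
    ultimately have 2: "\<bar>g (cl u) - g (cl v)\<bar> \<le> \<bar>Lg\<bar> * \<bar>u - v\<bar>" using Lg[OF cl cl, of u v] by linarith
    have "\<bar>max (u - \<kappa>) 0 - max (v - \<kappa>) 0\<bar> \<le> \<bar>u - v\<bar>" by linarith
    then have 3: "\<bar>gk * max (u - \<kappa>) 0 - gk * max (v - \<kappa>) 0\<bar> \<le> gk * \<bar>u - v\<bar>" by (rule sc[OF gk0])
    show "\<bar>g u - g v\<bar> \<le> (g0 + \<bar>Lg\<bar> + gk) * \<bar>u - v\<bar>"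
    proof -
      have tri: "\<bar>(p1 + p2 + p3) - (q1 + q2 + q3)\<bar> \<le> a + b + d"
        if "\<bar>p1 - q1\<bar> \<le> a" "\<bar>p2 - q2\<bar> \<le> b" "\<bar>p3 - q3\<bar> \<le> d" for p1 p2 p3 q1 q2 q3 a b d :: real
        using that by linarith
      show ?thesis using tri[OF 1 2 3] by (simp only: dec[of u, symmetric] dec[of v, symmetric] distrib_right)
    qed
  qed (use g0 gk0 in auto)
qed

lemma g_cont: "continuous_on S g"
proof -
  obtain L where L: "L > 0" "\<And>u v. \<bar>g u - g v\<bar> \<le> L * \<bar>u - v\<bar>" using g_lipschitz by blast
  show ?thesis
  proof (rule continuous_on_subset[of UNIV])
    show "continuous_on UNIV g"
      by (rule lipschitz_on_continuous_on[of L])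
         (use L in \<open>auto simp: lipschitz_on_def dist_real_def\<close>)
  qed simp
qed

text \<open>A slope above 1 at 0 puts g above the diagonal near 0; a point below it would force a
  further fixed point in between.\<close>

lemma g_gt:
  assumes "0 < x" "x < \<kappa>" shows "g x > x"
proof (rule ccontr)
  assume "\<not> ?thesis"
  then have gx: "g x < x" using g_fixed[of x] assms by fastforce
  obtain \<delta> where "\<delta> > 0" "\<And>x. \<bar>x\<bar> < \<delta> \<Longrightarrow> (g has_real_derivative deriv g x) (at x)"
    using g_derivs by blast
  then have "(g has_real_derivative g0) (at 0)" by simp
  then have "((\<lambda>y. g y - y) has_real_derivative g0 - 1) (at 0)" by (auto intro!: derivative_eq_intros)
  from DERIV_pos_inc_right[OF this] g0 obtain d where d: "d > 0" "\<And>k. k > 0 \<Longrightarrow> k < d \<Longrightarrow> g k - k > 0"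
    by force
  define y where "y = min d x / 2"
  have y: "y > 0" "y < d" "y < x" using d assms by (auto simp: y_def)
  have "\<exists>t. y \<le> t \<and> t \<le> x \<and> g t - t = 0"
    by (rule IVT2') (use y d(2)[OF y(1,2)] gx in \<open>auto intro!: continuous_intros g_cont\<close>)
  then obtain t where "y \<le> t" "t \<le> x" "g t = t" by auto
  then show False using g_fixed[of t] y assms by auto
qed

lemma g_ge: "0 \<le> x \<Longrightarrow> x \<le> \<kappa> \<Longrightarrow> g x \<ge> x"
  using g_gt[of x] by (cases "x = 0"; cases "x = \<kappa>") auto

lemma g_less: "x > \<kappa> \<Longrightarrow> g x < x"
proof -
  assume x: "x > \<kappa>"
  have "gk * (x - \<kappa>) < 1 * (x - \<kappa>)" using x gk1 by (intro mult_strict_right_mono) auto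
  have "g x = \<kappa> + gk * (x - \<kappa>)" using g_right x by simp
  also have "\<dots> < \<kappa> + 1 * (x - \<kappa>)" using \<open>gk * (x - \<kappa>) < 1 * (x - \<kappa>)\<close> by (rule add_strict_left_mono)
  finally show ?thesis by simp
qed

lemma g_nonneg: "x \<ge> 0 \<Longrightarrow> g x \<ge> 0" using gmono[of 0 x] by simp
lemma g_le_kap: "x \<le> \<kappa> \<Longrightarrow> g x \<le> \<kappa>" using gmono[of x \<kappa>] by simp
text \<open>Since g is nondecreasing, an upper bound for its derivative near p already bounds |g x -
  g y|.\<close>

lemma local_slope:
  assumes "p \<in> {0, \<kappa>}" "\<epsilon> > 0"
  obtains d where "d > 0" "\<And>x y. \<bar>x - p\<bar> \<le> d \<Longrightarrow> \<bar>y - p\<bar> \<le> d \<Longrightarrow> \<bar>g x - g y\<bar> \<le> (deriv g p + \<epsilon>) * \<bar>x - y\<bar>"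
proof -
  obtain \<delta> where \<delta>: "\<delta> > 0" "\<And>x. \<bar>x\<bar> < \<delta> \<Longrightarrow> (g has_real_derivative deriv g x) (at x)"
    "\<And>x. \<bar>x - \<kappa>\<bar> < \<delta> \<Longrightarrow> (g has_real_derivative deriv g x) (at x)"
    "isCont (deriv g) 0" "isCont (deriv g) \<kappa>" using g_derivs by blast
  have dg: "(g has_real_derivative deriv g x) (at x)" if "\<bar>x - p\<bar> < \<delta>" for x
    using \<delta>(2,3) that assms(1) by auto
  have "isCont (deriv g) p" using \<delta> assms by auto
  then obtain d where d: "d > 0" "\<And>x. \<bar>x - p\<bar> < d \<Longrightarrow> \<bar>deriv g x - deriv g p\<bar> < \<epsilon>"
    using assms(2) unfolding continuous_at_eps_delta dist_real_def by blast
  define e where "e = min d \<delta> / 2"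
  have e: "e > 0" "e < d" "e < \<delta>" using d \<delta> by (auto simp: e_def)
  have lt: "\<bar>g x - g y\<bar> \<le> (deriv g p + \<epsilon>) * \<bar>x - y\<bar>"
    if xy: "x < y" "\<bar>x - p\<bar> \<le> e" "\<bar>y - p\<bar> \<le> e" for x y
  proof -
    have "\<exists>u. u > x \<and> u < y \<and> g y - g x = (y - x) * deriv g u"
      by (rule MVT2) (use xy e dg in auto)
    then obtain u where u: "x < u" "u < y" "g y - g x = (y - x) * deriv g u" by blast
    have "\<bar>u - p\<bar> < d" using u xy e by auto
    then have "deriv g u \<le> deriv g p + \<epsilon>" using d(2)[of u] by auto
    then have "(y - x) * deriv g u \<le> (y - x) * (deriv g p + \<epsilon>)" using xy by (intro mult_left_mono) auto
    then show ?thesis using gmono[of x y] u xy by (simp add: mult.commute)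
  qed
  show ?thesis
  proof (rule that[OF e(1)])
    fix x y assume "\<bar>x - p\<bar> \<le> e" "\<bar>y - p\<bar> \<le> e"
    then show "\<bar>g x - g y\<bar> \<le> (deriv g p + \<epsilon>) * \<bar>x - y\<bar>"
      using lt[of x y] lt[of y x] by (cases x y rule: linorder_cases) (auto simp: abs_minus_commute)
  qed
qed

text \<open>The Hoelder condition on the derivative, integrated once. The exponent 1 + \<theta> is
  why exponentials with rates between l and (1 + \<theta>) l can absorb the nonlinear error.\<close>

lemma g_hoelder:
  obtains C \<theta> d where "C > 0" "0 < \<theta>" "\<theta> \<le> 1" "d > 0"
    "\<And>u. 0 \<le> u \<Longrightarrow> u \<le> d \<Longrightarrow> \<bar>g u - g0 * u\<bar> \<le> C * u powr (1 + \<theta>)"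
proof -
  obtain \<delta> C \<theta> where \<delta>: "\<delta> > 0" "\<And>x. \<bar>x\<bar> < \<delta> \<Longrightarrow> (g has_real_derivative deriv g x) (at x)"
    "C > 0" "0 < \<theta>" "\<theta> \<le> 1" "\<And>u. 0 < u \<Longrightarrow> u < \<delta> \<Longrightarrow> \<bar>deriv g u - g0\<bar> \<le> C * u powr \<theta>"
    using g_derivs by blast
  show ?thesis
  proof (rule that[of C \<theta> "\<delta>/2"])
    fix u assume u: "0 \<le> u" "u \<le> \<delta>/2"
    show "\<bar>g u - g0 * u\<bar> \<le> C * u powr (1 + \<theta>)"
    proof (cases "u = 0")
      case False
      have "\<exists>x. x > 0 \<and> x < u \<and> g u - g 0 = (u - 0) * deriv g x"
        by (rule MVT2) (use u False \<delta> in auto)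
      then obtain x where x: "0 < x" "x < u" "g u = u * deriv g x" by auto
      have "\<bar>g u - g0 * u\<bar> = u * \<bar>deriv g x - g0\<bar>"
      proof -
        have "g u - g0 * u = u * (deriv g x - g0)" by (simp add: x(3) algebra_simps)
        then show ?thesis using u by (simp add: abs_mult)
      qed
      also have "\<dots> \<le> u * (C * u powr \<theta>)"
      proof -
        have "\<bar>deriv g x - g0\<bar> \<le> C * x powr \<theta>" using \<delta>(6)[of x] x u by simp
        also have "\<dots> \<le> C * u powr \<theta>" using x \<delta> by (intro mult_left_mono powr_mono2) auto
        finally show ?thesis using u by (intro mult_left_mono)
      qed
      also have "\<dots> = C * u powr (1 + \<theta>)" using u False by (simp add: powr_add)
      finally show ?thesis .
    qed simp
  qed (use \<delta> in auto)
qed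

section \<open>The characteristic function: convexity and zeros\<close>

abbreviation "X z c \<equiv> chi g h z c"

lemma chi_deriv: "((\<lambda>z. X z c) has_real_derivative 2 * z - c - c * h * g0 * exp (- z * c * h)) (at z)"
  unfolding chi_def by (auto intro!: derivative_eq_intros simp: algebra_simps)

lemma chi_cont: "continuous_on S (\<lambda>p. X (snd p) (fst p))"
  unfolding chi_def by (intro continuous_intros)

lemma chi_cont_z: "continuous_on S (\<lambda>z. X z c)" and chi_cont_c: "continuous_on S (\<lambda>c. X z c)"
  unfolding chi_def by (intro continuous_intros)+

definition chi' :: "real \<Rightarrow> real \<Rightarrow> real" where
  "chi' c z = 2 * z - c - c * h * g0 * exp (- z * c * h)"

lemma chi'_strict_mono:
  assumes "u < v" shows "chi' c u < chi' c v"
proof -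
  have d: "(chi' c has_real_derivative 2 + (c * h)^2 * g0 * exp (- z * c * h)) (at z)" for z
    unfolding chi'_def by (auto intro!: derivative_eq_intros simp: algebra_simps power2_eq_square)
  have pos: "2 + (c * h)^2 * g0 * exp (- z * c * h) > 0" for z using g0 by (simp add: add_pos_nonneg)
  show ?thesis
    by (rule DERIV_pos_imp_increasing[OF assms]) (use d pos in blast)
qed

text \<open>Strict convexity in slope form; it limits the zeros to two and fixes the sign between
  them.\<close>

lemma chi_chord:
  assumes "x < y" "y < w"
  shows "(X y c - X x c) / (y - x) < (X w c - X y c) / (w - y)"
proof -
  obtain u where u: "x < u" "u < y" "X y c - X x c = (y - x) * chi' c u"
    using MVT2[of x y "\<lambda>z. X z c" "chi' c"] chi_deriv[of c] assms unfolding chi'_def by blast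
  obtain v where v: "y < v" "v < w" "X w c - X y c = (w - y) * chi' c v"
    using MVT2[of y w "\<lambda>z. X z c" "chi' c"] chi_deriv[of c] assms unfolding chi'_def by blast
  have "chi' c u < chi' c v"
    by (rule chi'_strict_mono) (use u v in auto)
  then show ?thesis using u v assms by simp
qed

lemma chi_mono_c: "0 \<le> c \<Longrightarrow> c < c' \<Longrightarrow> z > 0 \<Longrightarrow> X z c' < X z c"
proof -
  assume a: "0 \<le> c" "c < c'" "z > 0"
  have "c * z < c' * z" using a by simp
  moreover have "g0 * exp (- z * c' * h) \<le> g0 * exp (- z * c * h)"
    using a g0 h by (auto intro!: mult_left_mono mult_right_mono)
  ultimately show ?thesis unfolding chi_def by linarith
qed

lemma chi_pos_nonpos: "c \<le> 0 \<Longrightarrow> z \<ge> 0 \<Longrightarrow> X z c > 0"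
proof -
  assume a: "c \<le> 0" "z \<ge> 0"
  have "- z * c * h \<ge> 0" using a h by (simp add: mult_nonneg_nonpos mult_nonpos_nonneg)
  then have "exp (- z * c * h) \<ge> 1" by simp
  then have "g0 * exp (- z * c * h) \<ge> g0 * 1" using g0 by (intro mult_left_mono) auto
  moreover have "c * z \<le> 0" using a by (simp add: mult_nonpos_nonneg)
  ultimately show ?thesis using g0 zero_le_power2[of z] unfolding chi_def by linarith
qed

lemma chi_zero: "X 0 c = g0 - 1" by (simp add: chi_def)

lemma chi_large: "z \<ge> \<bar>c\<bar> + 2 \<Longrightarrow> X z c > 0"
proof -
  assume a: "z \<ge> \<bar>c\<bar> + 2"
  have "2 * 2 \<le> z * (z - c)" using a by (intro mult_mono) auto
  moreover have "g0 * exp (- z * c * h) > 0" using g0 by simp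
  moreover have "X z c = z * (z - c) - 1 + g0 * exp (- z * c * h)"
    by (simp add: chi_def power2_eq_square right_diff_distrib mult.commute)
  ultimately show ?thesis by linarith
qed

text \<open>The speed is constructed as the least c in [0, g0] for which \<open>X z c\<close> is
  nonpositive at some z \<ge> 0. By minimality the zero found there is a minimum over z \<ge> 0,
  hence double.\<close>

lemma c_sharp_char:
  "\<exists>z0>0. c_sharp g h > 0 \<and> X z0 (c_sharp g h) = 0 \<and> (\<forall>z\<ge>0. X z (c_sharp g h) \<ge> 0)"
proof -
  define Z where "Z = g0 + 2"
  let ?S = "({0..g0} \<times> {0..Z}) \<inter> (\<lambda>p. X (snd p) (fst p)) -` {..0}"
  have "closed ?S"
    by (rule continuous_closed_preimage[OF chi_cont]) (auto intro: closed_Times)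
  moreover have "bounded ?S"
    by (intro bounded_Int disjI1 compact_imp_bounded compact_Times compact_Icc)
  ultimately have comp: "compact ?S" using compact_eq_bounded_closed by blast
  \<comment> \<open>At speed g0 the rate z = 1 already gives a nonpositive value, so the search set
    is nonempty; \<open>chi_large\<close> is the reason why z may be confined to [0, Z].\<close>
  have mem: "(g0, 1) \<in> ?S"
  proof -
    have "g0 * exp (- 1 * g0 * h) \<le> g0 * 1" using g0 h by (intro mult_left_mono) auto
    then have "X 1 g0 \<le> 0" by (simp add: chi_def)
    then show ?thesis using g0 by (simp add: Z_def)
  qed
  have cf: "continuous_on ?S fst" by (intro continuous_intros)
  have "\<exists>p\<in>?S. \<forall>q\<in>?S. fst p \<le> fst q" by (rule continuous_attains_inf[OF comp _ cf]) (use mem in blast)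
  then obtain p where p: "p \<in> ?S" "\<And>q. q \<in> ?S \<Longrightarrow> fst p \<le> fst q" by blast
  obtain c0 z0 where pp: "p = (c0, z0)" by force
  have c0: "0 \<le> c0" "c0 \<le> g0" "0 \<le> z0" "X z0 c0 \<le> 0" using p(1) pp by auto
  have c0p: "c0 > 0" using chi_pos_nonpos[of c0 z0] c0 by (cases "c0 = 0") auto
  have z0p: "z0 > 0" using c0 chi_zero[of c0] g0 by (cases "z0 = 0") auto
  have bef: "X z c > 0" if "0 \<le> c" "c < c0" "z \<ge> 0" for c z
  proof (rule ccontr)
    assume "\<not> ?thesis"
    moreover from this have "z \<le> Z" using chi_large[of c z] that c0 unfolding Z_def by linarith
    ultimately have "(c, z) \<in> ?S" using that c0 by auto
    then show False using p(2) pp that by fastforce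
  qed
  have nn: "X z c0 \<ge> 0" if "z \<ge> 0" for z
  proof (rule ccontr)
    assume "\<not> ?thesis"
    moreover have "X z 0 > 0" using chi_pos_nonpos[of 0 z] that by simp
    ultimately obtain c where "0 \<le> c" "c \<le> c0" "X z c = 0"
      using IVT2'[of "\<lambda>c. X z c" c0 0 0] chi_cont_c c0 by force
    then show False using bef[of c z] that \<open>\<not> X z c0 \<ge> 0\<close> by (cases "c = c0") auto
  qed
  have r: "X z0 c0 = 0" using nn[of z0] c0 by simp
  have dd: "deriv (\<lambda>y. X y c) z = 2 * z - c - c * h * g0 * exp (- z * c * h)" for z c
    by (rule DERIV_imp_deriv[OF chi_deriv])
  have d0: "deriv (\<lambda>y. X y c0) z0 = 0"
    unfolding dd
  proof (rule DERIV_local_min[OF chi_deriv z0p])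
    show "\<forall>y. \<bar>z0 - y\<bar> < z0 \<longrightarrow> X z0 c0 \<le> X y c0" using nn r by auto
  qed
  have "c_sharp g h = c0" unfolding c_sharp_def
  proof (rule the_equality)
    show "\<exists>z>0. X z c0 = 0 \<and> deriv (\<lambda>y. X y c0) z = 0" using z0p r d0 by blast
    fix c assume "\<exists>z>0. X z c = 0 \<and> deriv (\<lambda>y. X y c) z = 0"
    then obtain z where z: "z > 0" "X z c = 0" "deriv (\<lambda>y. X y c) z = 0" by blast
    have cp: "c > 0" using chi_pos_nonpos[of c z] z by (cases "c > 0") auto
    show "c = c0"
    proof (rule ccontr)
      \<comment> \<open>Below c0 there is no positive zero. Above c0 the value at z0 is negative,
        whereas a double zero would be the minimum of a strictly convex function.\<close>
      assume "c \<noteq> c0"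
      then consider "c < c0" | "c > c0" by linarith
      then show False
      proof cases
        case 1 then show ?thesis using bef[of c z] cp z by simp
      next
        case 2
        then have n: "X z0 c < 0" using chi_mono_c[of c0 c z0] c0 r z0p by simp
        have d: "chi' c z = 0" using z(3) dd[of c z] by (simp add: chi'_def)
        consider "z0 < z" | "z < z0" using n z(2) by (cases z z0 rule: linorder_cases) auto
        then show False
        proof cases
          case 1
          obtain u where u: "z0 < u" "u < z" "X z c - X z0 c = (z - z0) * chi' c u"
            using MVT2[of z0 z "\<lambda>z. X z c" "chi' c"] chi_deriv[of c] 1 unfolding chi'_def by blast
          have "(z - z0) * chi' c u > 0" using u(3) n z by simp
          then have "chi' c u > 0" using 1 by (simp add: zero_less_mult_iff)
          then show ?thesis using chi'_strict_mono[OF u(2), of c] d by simp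
        next
          case 2
          obtain u where u: "z < u" "u < z0" "X z0 c - X z c = (z0 - z) * chi' c u"
            using MVT2[of z z0 "\<lambda>z. X z c" "chi' c"] chi_deriv[of c] 2 unfolding chi'_def by blast
          have "(z0 - z) * chi' c u < 0" using u(3) n z by simp
          then have "chi' c u < 0" using 2 by (simp add: mult_less_0_iff)
          then show ?thesis using chi'_strict_mono[OF u(1), of c] d by simp
        qed
      qed
    qed
  qed
  then show ?thesis using c0p z0p r nn by blast
qed

text \<open>For c > c_sharp the function is negative at the double zero belonging to c_sharp. The
  intermediate value theorem gives a zero on either side, and convexity excludes others.\<close>

lemma chi_roots:
  assumes c: "c > c_sharp g h"
  shows "0 < lambda1 g h c" "lambda1 g h c < lambda2 g h c" "X (lambda1 g h c) c = 0"
    "\<And>z. lambda1 g h c < z \<Longrightarrow> z < lambda2 g h c \<Longrightarrow> X z c < 0"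
proof -
  obtain z0 where z0: "c_sharp g h > 0" "z0 > 0" "X z0 (c_sharp g h) = 0" using c_sharp_char by blast
  have n: "X z0 c < 0" using chi_mono_c[of "c_sharp g h" c z0] z0 c by simp
  obtain l1 where l1: "0 \<le> l1" "l1 \<le> z0" "X l1 c = 0"
    using IVT2'[of "\<lambda>z. X z c" z0 0 0] chi_zero[of c] g0 n z0 chi_cont_z by force
  define Z where "Z = z0 + \<bar>c\<bar> + 2"
  have "X Z c > 0" by (rule chi_large) (use z0 in \<open>auto simp: Z_def\<close>)
  then obtain l2 where l2: "z0 \<le> l2" "l2 \<le> Z" "X l2 c = 0"
    using IVT'[of "\<lambda>z. X z c" z0 0 Z] n chi_cont_z by (force simp: Z_def)
  have l: "0 < l1" "l1 < z0" "z0 < l2" using l1 l2 n chi_zero[of c] g0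
    by (auto simp: order_less_le)
  have nz: "X z c \<noteq> 0" if ne: "z \<noteq> l1" "z \<noteq> l2" for z
  proof
    assume z: "X z c = 0"
    consider "z < l1" | "l1 < z" "z < l2" | "l2 < z" using ne by linarith
    then show False
    proof cases
      case 1 then show ?thesis using chi_chord[of z l1 l2 c] z l l1(3) l2(3) by simp
    next
      case 2 then show ?thesis using chi_chord[of l1 z l2 c] z l1(3) l2(3) by simp
    next
      case 3 then show ?thesis using chi_chord[of l1 l2 z c] z l l1(3) l2(3) by simp
    qed
  qed
  have S: "{z. z > 0 \<and> X z c = 0} = {l1, l2}" using nz l l1 l2 by auto
  have e: "lambda1 g h c = l1" "lambda2 g h c = l2" unfolding lambda1_def lambda2_def S using l by auto
  show "0 < lambda1 g h c" "lambda1 g h c < lambda2 g h c" "X (lambda1 g h c) c = 0"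
    using e l l1 by auto
  fix z assume z: "lambda1 g h c < z" "z < lambda2 g h c"
  show "X z c < 0"
  proof (rule ccontr)
    assume "\<not> ?thesis"
    then have p: "X z c \<ge> 0" by simp
    have "(X z c - X l1 c) / (z - l1) \<ge> 0" using z e(1) p unfolding l1(3) by simp
    moreover have "(X l2 c - X z c) / (l2 - z) \<le> 0"
      using z e(2) p unfolding l2(3) by (intro divide_nonpos_pos) auto
    ultimately show False using chi_chord[of l1 z l2 c] z e by linarith
  qed
qed

end

section \<open>The stationary linear equation\<close>

text \<open>For bounded continuous f this is the bounded solution of y' + a y = f. Written as an
  integral with positive kernel it is visibly monotone in f and makes sense for bounded measurable
  f.\<close>

definition expavg :: "real \<Rightarrow> (real \<Rightarrow> real) \<Rightarrow> real \<Rightarrow> real" where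
  "expavg a f z = (LINT s:{0<..}|lborel. exp (- a * s) * f (z - s))"

lemma exp_halfline:
  fixes a :: real assumes a: "a > 0"
  shows exp_halfline_integrable: "set_integrable lborel {0<..} (\<lambda>s. exp (- a * s))"
    and exp_halfline_integral: "(LINT s:{0<..}|lborel. exp (- a * s)) = 1 / a"
proof -
  have "((\<lambda>s. exp (- a * s)) has_integral exp (- a * 0) / a) {0..}"
    by (rule has_integral_exp_minus_to_infinity[OF a])
  moreover have "negligible {x \<in> {0<..} - {0..}. exp (- a * x) \<noteq> 0}" by (rule negligible_subset[of "{}"]) auto
  moreover have "negligible {x \<in> {0..} - {0<..}. exp (- a * x) \<noteq> 0}" by (rule negligible_subset[of "{0}"]) auto
  ultimately have hi: "((\<lambda>s. exp (- a * s)) has_integral 1 / a) {0<..}"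
    using has_integral_spike_set_eq[of "{0<..}" "{0..}" "\<lambda>s. exp (- a * s)" "1 / a"] by simp
  then have "(\<lambda>s. exp (- a * s)) absolutely_integrable_on {0<..}"
    by (intro nonnegative_absolutely_integrable_1) (auto simp: integrable_on_def)
  then show i: "set_integrable lborel {0<..} (\<lambda>s. exp (- a * s))"
    unfolding set_integrable_def by (subst (asm) integrable_completion) auto
  show "(LINT s:{0<..}|lborel. exp (- a * s)) = 1 / a"
    using set_borel_integral_eq_integral(2)[OF i] integral_unique[OF hi] by simp
qed

context
  fixes a :: real and B :: real
  assumes a: "a > 0"
begin

lemma expavg_integrable:
  assumes f: "f \<in> borel_measurable borel" "\<And>x. \<bar>f x\<bar> \<le> B"
  shows "set_integrable lborel {0<..} (\<lambda>s. exp (- a * s) * f (z - s))"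
  unfolding set_integrable_def
proof (rule Bochner_Integration.integrable_bound)
  show "integrable lborel (\<lambda>s. B * (indicator {0<..} s *\<^sub>R exp (- a * s)))"
    using exp_halfline_integrable[OF a] unfolding set_integrable_def by (rule integrable_mult_right)
  show "(\<lambda>s. indicator {0<..} s *\<^sub>R (exp (- a * s) * f (z - s))) \<in> borel_measurable lborel"
    using f(1) by simp
  have B: "B \<ge> 0" using f(2)[of 0] by linarith
  show "AE s in lborel. norm (indicator {0<..} s *\<^sub>R (exp (- a * s) * f (z - s)))
        \<le> norm (B * (indicator {0<..} s *\<^sub>R exp (- a * s)))"
    using f(2) B by (intro AE_I2) (auto simp: indicator_def abs_mult mult.commute)
qed

lemma expavg_mono:
  assumes "f \<in> borel_measurable borel" "\<And>x. \<bar>f x\<bar> \<le> B" "f' \<in> borel_measurable borel" "\<And>x. \<bar>f' x\<bar> \<le> B"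
    and "\<And>x. x < z \<Longrightarrow> f x \<le> f' x"
  shows "expavg a f z \<le> expavg a f' z"
  unfolding expavg_def
  by (rule set_integral_mono[OF expavg_integrable expavg_integrable]) (use assms in auto)

lemma expavg_mono_arg:
  assumes "f \<in> borel_measurable borel" "\<And>x. \<bar>f x\<bar> \<le> B" "mono f"
  shows "mono (expavg a f)"
proof (rule monoI)
  fix y z :: real assume "y \<le> z"
  then show "expavg a f y \<le> expavg a f z" unfolding expavg_def
    by (intro set_integral_mono[OF expavg_integrable expavg_integrable])
       (use assms in \<open>auto intro!: monoD[OF assms(3)]\<close>)
qed

lemma expavg_const: "expavg a (\<lambda>_. k) z = k / a"
  unfolding expavg_def using exp_halfline_integral[OF a] by simp

text \<open>Moves z from the integrand into the limit of integration, where it can be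
  differentiated.\<close>

lemma expavg_repr:
  "expavg a f z = exp (- a * z) * (LINT r:{..<z}|lborel. exp (a * r) * f r)"
proof -
  have "(LINT r:{..<z}|lborel. exp (a * r) * f r)
     = (\<integral>s. indicator {..<z} (z - s) *\<^sub>R (exp (a * (z - s)) * f (z - s)) \<partial>lborel)"
    unfolding set_lebesgue_integral_def
    by (subst lborel_integral_real_affine[where c="-1" and t=z]) auto
  also have "\<dots> = (\<integral>s. exp (a * z) * (indicator {0<..} s *\<^sub>R (exp (- a * s) * f (z - s))) \<partial>lborel)"
    by (rule Bochner_Integration.integral_cong)
       (auto simp: indicator_def exp_diff exp_minus algebra_simps divide_inverse)
  also have "\<dots> = exp (a * z) * expavg a f z"
    unfolding expavg_def set_lebesgue_integral_def by (rule integral_mult_right_zero)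
  finally show ?thesis by (simp add: exp_minus)
qed

lemma exp_weighted_integrable:
  assumes f: "f \<in> borel_measurable borel" "\<And>x. \<bar>f x\<bar> \<le> B"
  shows "set_integrable lborel {..<z} (\<lambda>r. exp (a * r) * f r)"
proof -
  have "integrable lborel (\<lambda>s. exp (a * z) * (indicator {0<..} s *\<^sub>R (exp (- a * s) * f (z - s))))"
    using expavg_integrable[OF f, of z] unfolding set_integrable_def by (rule integrable_mult_right)
  then have "integrable lborel (\<lambda>s. indicator {..<z} (z + (-1) * s) *\<^sub>R (exp (a * (z + (-1) * s)) * f (z + (-1) * s)))"
    by (rule Bochner_Integration.integrable_cong[THEN iffD1, rotated -1])
       (auto simp: indicator_def exp_diff exp_minus algebra_simps divide_inverse)
  then show ?thesis unfolding set_integrable_def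
    by (subst (asm) lborel_integrable_real_affine_iff) auto
qed

lemma expavg_deriv:
  assumes f: "continuous_on UNIV f" "\<And>x. \<bar>f x\<bar> \<le> B"
  shows "(expavg a f has_real_derivative f z - a * expavg a f z) (at z)"
proof -
  have fm: "f \<in> borel_measurable borel" using f(1) by (rule borel_measurable_continuous_onI)
  define G where "G = (\<lambda>r. exp (a * r) * f r)"
  define H where "H = (\<lambda>z. LINT r:{..<z}|lborel. G r)"
  have Gi: "set_integrable lborel {..<z} G" for z
    using exp_weighted_integrable[OF fm f(2)] by (simp add: G_def)
  have cG: "continuous_on S G" for S
    unfolding G_def using continuous_on_subset[OF f(1)] by (intro continuous_intros) auto
  \<comment> \<open>Splitting at z - 1 leaves a compact interval, to which the fundamental theorem
    applies.\<close>
  have H: "H y = H (z - 1) + integral {z - 1..y} G" if "y \<ge> z - 1" for y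
  proof -
    have "{..<y} = {..<z - 1} \<union> {z - 1..<y}" using that by auto
    then have e: "{..<y} = {..<z - 1} \<union> {z - 1..<y}" .
    have i2: "set_integrable lborel {z - 1..<y} G"
      by (rule set_integrable_subset[OF Gi[of y]]) auto
    have "H y = H (z - 1) + (LINT r:{z - 1..<y}|lborel. G r)"
      unfolding H_def by (subst e, rule set_integral_Un[OF _ Gi i2]) auto
    also have "(LINT r:{z - 1..<y}|lborel. G r) = integral {z - 1..<y} G"
      by (rule set_borel_integral_eq_integral(2)[OF i2])
    also have "\<dots> = integral {z - 1..y} G"
      by (rule integral_spike_set) (rule negligible_subset[of "{y}"]; auto)+
    finally show ?thesis .
  qed
  have "((\<lambda>y. integral {z - 1..y} G) has_real_derivative G z) (at z within {z - 1..z + 1})"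
    using integral_has_real_derivative[of "z - 1" "z + 1" G z] cG by simp
  then have d1: "((\<lambda>y. integral {z - 1..y} G) has_real_derivative G z) (at z)"
    using at_within_interior[of z "{z - 1..z + 1}"] by simp
  then have "((\<lambda>y. H (z - 1) + integral {z - 1..y} G) has_real_derivative G z) (at z)"
    using DERIV_add[OF DERIV_const d1, of "H (z - 1)"] by simp
  then have dH: "(H has_real_derivative G z) (at z)"
    by (rule has_field_derivative_transform_within_open[of _ _ _ "{z - 1<..}"]) (auto intro!: H[symmetric])
  have e: "expavg a f = (\<lambda>z. exp (- a * z) * H z)" by (rule ext) (simp add: expavg_repr H_def G_def)
  have de: "((\<lambda>z. exp (- a * z)) has_real_derivative - a * exp (- a * z)) (at z)"
    by (auto intro!: derivative_eq_intros)
  have "exp (- a * z) * G z = f z" by (simp add: G_def exp_minus)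
  then have "((\<lambda>z. exp (- a * z) * H z) has_real_derivative f z - a * (exp (- a * z) * H z)) (at z)"
    by (intro DERIV_cong[OF DERIV_mult[OF de dH]]) (simp add: algebra_simps)
  then show ?thesis by (simp add: e)
qed

lemma expavg_exp_mono:
  assumes f: "f \<in> borel_measurable borel" "\<And>x. \<bar>f x\<bar> \<le> B" "\<And>x. 0 \<le> f x" and "z \<le> y"
  shows "exp (a * z) * expavg a f z \<le> exp (a * y) * expavg a f y"
proof -
  have "(LINT r:{..<z}|lborel. exp (a * r) * f r) \<le> (LINT r:{..<y}|lborel. exp (a * r) * f r)"
    unfolding set_lebesgue_integral_def
  proof (rule integral_mono)
    show "integrable lborel (\<lambda>r. indicator {..<z} r *\<^sub>R (exp (a * r) * f r))"
      "integrable lborel (\<lambda>r. indicator {..<y} r *\<^sub>R (exp (a * r) * f r))"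
      using exp_weighted_integrable[OF f(1,2)] unfolding set_integrable_def by auto
  qed (use f(3) assms(4) in \<open>auto simp: indicator_def\<close>)
  then show ?thesis unfolding expavg_repr by (simp add: exp_minus field_simps)
qed

text \<open>f may be discontinuous: \<open>expavg_exp_mono\<close> for f and for B - f bounds the
  increments from both sides and gives the Lipschitz constant B. This smoothing later turns monotone
  envelopes into continuous functions.\<close>

lemma expavg_cont:
  assumes f: "f \<in> borel_measurable borel" "\<And>x. 0 \<le> f x" "\<And>x. f x \<le> B"
  shows "continuous_on UNIV (expavg a f)"
proof -
  have fb: "\<bar>f x\<bar> \<le> B" for x using f(2,3)[of x] by simp
  define I where "I = expavg a f"
  have lo: "exp (a * z) * I z \<le> exp (a * y) * I y" if "z \<le> y" for z y
    unfolding I_def by (rule expavg_exp_mono[OF f(1) fb f(2) that])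
  have "expavg a (\<lambda>x. B - f x) z = B / a - I z" for z
  proof -
    have "expavg a (\<lambda>x. B - f x) z = (LINT s:{0<..}|lborel. exp (- a * s) * B - exp (- a * s) * f (z - s))"
      unfolding expavg_def by (simp add: right_diff_distrib)
    also have "\<dots> = (LINT s:{0<..}|lborel. exp (- a * s) * B) - (LINT s:{0<..}|lborel. exp (- a * s) * f (z - s))"
      by (rule set_integral_diff) (use expavg_integrable[OF f(1) fb] exp_halfline_integrable[OF a] in auto)
    finally show ?thesis using exp_halfline_integral[OF a] by (simp add: I_def expavg_def)
  qed
  then have hi: "exp (a * z) * (B / a - I z) \<le> exp (a * y) * (B / a - I y)" if "z \<le> y" for z y
    using expavg_exp_mono[of "\<lambda>x. B - f x" z y] f that by simp
  have I: "0 \<le> I z" "I z \<le> B / a" for z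
  proof -
    have B: "B \<ge> 0" using f(2,3)[of 0] by linarith
    have "expavg a (\<lambda>_. 0) z \<le> I z" unfolding I_def by (rule expavg_mono) (use f B in auto)
    then show "0 \<le> I z" by (simp add: expavg_const)
    have "I z \<le> expavg a (\<lambda>_. B) z" unfolding I_def by (rule expavg_mono) (use f B in auto)
    then show "I z \<le> B / a" by (simp add: expavg_const)
  qed
  have key: "\<bar>I y - I z\<bar> \<le> B * (y - z)" if "z \<le> y" for y z
  proof -
    define q where "q = exp (- (a * (y - z)))"
    have q: "q > 0" "q \<le> 1" "1 - q \<le> a * (y - z)"
      using that a exp_ge_add_one_self[of "- (a * (y - z))"] by (auto simp: q_def)
    have eq: "exp (a * z) = q * exp (a * y)" by (simp add: q_def exp_minus exp_diff algebra_simps)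
    have "exp (a * y) * (q * I z) \<le> exp (a * y) * I y" using lo[OF that] by (simp add: eq mult_ac)
    then have 1: "q * I z \<le> I y" by simp
    have "exp (a * y) * (q * (B / a - I z)) \<le> exp (a * y) * (B / a - I y)" using hi[OF that] by (simp add: eq mult_ac)
    then have 2: "q * (B / a - I z) \<le> B / a - I y" by simp
    have "(1 - q) * I z \<le> (1 - q) * (B / a)" "(1 - q) * (B / a - I z) \<le> (1 - q) * (B / a)"
      by (rule mult_left_mono; use q I[of z] in linarith)+
    moreover have "(1 - q) * (B / a) \<le> (a * (y - z)) * (B / a)"
      using q I[of z] by (intro mult_right_mono) auto
    moreover have "(a * (y - z)) * (B / a) = B * (y - z)" using a by simp
    ultimately have "(1 - q) * I z \<le> B * (y - z)" "(1 - q) * (B / a - I z) \<le> B * (y - z)"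
      by linarith+
    then have "I z - q * I z \<le> B * (y - z)" "(B / a - I z) - q * (B / a - I z) \<le> B * (y - z)"
      by (simp_all only: left_diff_distrib mult_1)
    then show ?thesis using 1 2 by linarith
  qed
  have B: "B \<ge> 0" using f(2,3)[of 0] by linarith
  have "B-lipschitz_on UNIV I"
  proof (rule lipschitz_onI[OF _ B])
    fix x y :: real
    show "dist (I x) (I y) \<le> B * dist x y"
      using key[of x y] key[of y x] by (cases "x \<le> y") (auto simp: dist_real_def abs_minus_commute)
  qed
  then show ?thesis unfolding I_def by (rule lipschitz_on_continuous_on)
qed

text \<open>The moving point p serves both ends of the line, as t and as - t; dominated convergence
  does the rest.\<close>

lemma expavg_tendsto:
  fixes p :: "real \<Rightarrow> real"
  assumes f: "f \<in> borel_measurable borel" "\<And>x. \<bar>f x\<bar> \<le> B"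
    and lim: "\<And>s. ((\<lambda>t. f (p t - s)) \<longlongrightarrow> l) at_top"
  shows "((\<lambda>t. expavg a f (p t)) \<longlongrightarrow> l / a) at_top"
proof -
  have "((\<lambda>t. \<integral>s. indicator {0<..} s *\<^sub>R (exp (- a * s) * f (p t - s)) \<partial>lborel) \<longlongrightarrow>
      (\<integral>s. indicator {0<..} s *\<^sub>R (exp (- a * s) * l) \<partial>lborel)) at_top"
  proof (rule integral_dominated_convergence_at_top[where
      s="\<lambda>t s. indicator {0<..} s *\<^sub>R (exp (- a * s) * f (p t - s))" and
      f="\<lambda>s. indicator {0<..} s *\<^sub>R (exp (- a * s) * l)" and M=lborel and w="\<lambda>s. B * (indicator {0<..} s *\<^sub>R exp (- a * s))"])
    show "integrable lborel (\<lambda>s. B * (indicator {0<..} s *\<^sub>R exp (- a * s)))"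
      using exp_halfline_integrable[OF a] unfolding set_integrable_def by (rule integrable_mult_right)
    show "AE s in lborel. ((\<lambda>t. indicator {0<..} s *\<^sub>R (exp (- a * s) * f (p t - s)))
        \<longlongrightarrow> indicator {0<..} s *\<^sub>R (exp (- a * s) * l)) at_top"
      by (intro AE_I2 tendsto_intros lim)
    have B: "B \<ge> 0" using f(2)[of 0] by linarith
    show "\<forall>\<^sub>F t in at_top. AE s in lborel. norm (indicator {0<..} s *\<^sub>R (exp (- a * s) * f (p t - s)))
        \<le> B * (indicator {0<..} s *\<^sub>R exp (- a * s))"
      using f(2) B by (intro always_eventually allI AE_I2) (auto simp: indicator_def abs_mult mult.commute)
  qed (use f(1) in simp_all)
  moreover have "(\<integral>s. indicator {0<..} s *\<^sub>R (exp (- a * s) * l) \<partial>lborel) = l / a"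
    using expavg_const[of l 0] by (simp only: expavg_def set_lebesgue_integral_def)
  ultimately show ?thesis by (simp add: expavg_def set_lebesgue_integral_def)
qed

end

section \<open>The bounded inverse of the stationary linear operator\<close>

definition rb :: "real \<Rightarrow> real" where "rb c = (c + sqrt (c^2 + 4)) / 2"
definition ra :: "real \<Rightarrow> real" where "ra c = (sqrt (c^2 + 4) - c) / 2"

text \<open>\<open>rb c\<close> and \<open>- ra c\<close> are the roots of z^2 - c z - 1; the two
  identities are Vieta's formulas.\<close>

lemma ra_rb: "ra c > 0" "rb c > 0" "rb c = c + ra c" "ra c * rb c = 1"
proof -
  have "sqrt (c^2) < sqrt (c^2 + 4)" by (rule real_sqrt_less_mono) simp
  then have "\<bar>c\<bar> < sqrt (c^2 + 4)" by simp
  then show "ra c > 0" "rb c > 0" by (auto simp: ra_def rb_def)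
  show "rb c = c + ra c" by (simp add: ra_def rb_def field_simps)
  have "(sqrt (c^2 + 4) - c) * (c + sqrt (c^2 + 4)) = (sqrt (c^2 + 4))^2 - c^2"
    by (simp add: power2_eq_square algebra_simps)
  then show "ra c * rb c = 1" by (simp add: ra_def rb_def)
qed

text \<open>The bounded inverse of $-D^2 + cD + 1 = (D + a)(b - D)$.\<close>

definition Kop :: "real \<Rightarrow> (real \<Rightarrow> real) \<Rightarrow> real \<Rightarrow> real" where
  "Kop c f z = expavg (rb c) (\<lambda>x. expavg (ra c) f (- x)) (- z)"

context
  fixes c B :: real and f :: "real \<Rightarrow> real"
  assumes fm: "f \<in> borel_measurable borel" and f0: "\<And>x. 0 \<le> f x" and fB: "\<And>x. f x \<le> B"
begin

lemma f_abs: "\<bar>f x\<bar> \<le> B" using f0[of x] fB[of x] by simp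

lemma B_nonneg: "B \<ge> 0" using f0[of 0] fB[of 0] by linarith

lemma inner_bounds: "0 \<le> expavg (ra c) f z" "expavg (ra c) f z \<le> B / ra c"
proof -
  have "expavg (ra c) (\<lambda>_. 0) z \<le> expavg (ra c) f z"
    by (rule expavg_mono[where B=B]) (use ra_rb(1,2) fm f0 f_abs B_nonneg in auto)
  then show "0 \<le> expavg (ra c) f z" by (simp add: expavg_const ra_rb(1,2,4))
  have "expavg (ra c) f z \<le> expavg (ra c) (\<lambda>_. B) z"
    by (rule expavg_mono[where B=B]) (use ra_rb(1,2) fm fB f_abs B_nonneg in auto)
  then show "expavg (ra c) f z \<le> B / ra c" by (simp add: expavg_const ra_rb(1,2,4))
qed

lemma inner_cont: "continuous_on UNIV (expavg (ra c) f)"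
  by (rule expavg_cont[where B=B]) (use ra_rb(1,2) fm f0 fB in auto)

lemma outer_cont: "continuous_on UNIV (\<lambda>x. expavg (ra c) f (- x))"
  by (rule continuous_on_compose2[OF inner_cont]) (auto intro: continuous_intros)

lemma outer_meas: "(\<lambda>x. expavg (ra c) f (- x)) \<in> borel_measurable borel"
  by (rule borel_measurable_continuous_onI[OF outer_cont])

lemma inner_abs: "\<bar>expavg (ra c) f z\<bar> \<le> B / ra c"
  using inner_bounds[of z] by simp

lemma Kop_bounds: "0 \<le> Kop c f z" "Kop c f z \<le> B"
proof -
  have Ba: "B / ra c \<ge> 0" using inner_bounds order_trans by blast
  have "expavg (rb c) (\<lambda>_. 0) (- z) \<le> Kop c f z" unfolding Kop_def
    by (rule expavg_mono[where B="B / ra c"]) (use ra_rb(1,2) outer_meas inner_bounds inner_abs Ba in auto)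
  then show "0 \<le> Kop c f z" by (simp add: expavg_const ra_rb(1,2,4))
  have "Kop c f z \<le> expavg (rb c) (\<lambda>_. B / ra c) (- z)" unfolding Kop_def
    by (rule expavg_mono[where B="B / ra c"]) (use ra_rb(1,2) outer_meas inner_bounds inner_abs Ba in auto)
  also have "\<dots> = B / (ra c * rb c)" by (simp add: expavg_const ra_rb(1,2,4))
  finally show "Kop c f z \<le> B" by (simp add: ra_rb(4))
qed

lemma Kop_cont: "continuous_on UNIV (Kop c f)"
proof -
  have "continuous_on UNIV (expavg (rb c) (\<lambda>x. expavg (ra c) f (- x)))"
    by (rule expavg_cont[where B="B / ra c"]) (use ra_rb(1,2) outer_meas inner_bounds in auto)
  then show ?thesis
    unfolding Kop_def[abs_def] by (rule continuous_on_compose2) (auto intro: continuous_intros)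
qed

lemma Kop_mono_arg: "mono f \<Longrightarrow> mono (Kop c f)"
proof (rule monoI)
  fix y z :: real assume m: "mono f" and yz: "y \<le> z"
  have um: "mono (expavg (ra c) f)"
    by (rule expavg_mono_arg[where B=B]) (use ra_rb(1,2) fm f_abs m in auto)
  show "Kop c f y \<le> Kop c f z" unfolding Kop_def expavg_def[of "rb c"]
  proof (rule set_integral_mono)
    show "set_integrable lborel {0<..} (\<lambda>s. exp (- rb c * s) * expavg (ra c) f (- (- y - s)))"
      "set_integrable lborel {0<..} (\<lambda>s. exp (- rb c * s) * expavg (ra c) f (- (- z - s)))"
      using expavg_integrable[OF ra_rb(2)[of c] outer_meas inner_abs, of "- y"]
        expavg_integrable[OF ra_rb(2)[of c] outer_meas inner_abs, of "- z"] by auto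
  qed (use yz in \<open>auto intro!: monoD[OF um]\<close>)
qed

lemma Kop_scale: "r \<ge> 0 \<Longrightarrow> Kop c (\<lambda>x. r * f x) z = r * Kop c f z"
proof -
  have sc: "expavg a (\<lambda>x. r * F x) y = r * expavg a F y" for a F y
  proof -
    have "expavg a (\<lambda>x. r * F x) y = (LINT s:{0<..}|lborel. r * (exp (- a * s) * F (y - s)))"
      unfolding expavg_def by (simp add: mult.left_commute)
    then show ?thesis unfolding expavg_def by simp
  qed
  show ?thesis unfolding Kop_def by (simp add: sc)
qed

lemma Kop_limits:
  shows "(f \<longlongrightarrow> l) at_top \<Longrightarrow> (Kop c f \<longlongrightarrow> l) at_top"
    and "(f \<longlongrightarrow> l) at_bot \<Longrightarrow> (Kop c f \<longlongrightarrow> l) at_bot"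
proof -
  have lims: "LIM t at_top. t - s :> at_top" "LIM t at_top. t + s :> at_top" "LIM t at_top. s + t :> at_top" for s :: real
    using filterlim_tendsto_add_at_top[OF tendsto_const[of "- s"] filterlim_ident]
      filterlim_tendsto_add_at_top[OF tendsto_const[of s] filterlim_ident] by (simp_all add: add.commute)
  {
    assume l: "(f \<longlongrightarrow> l) at_top"
    have 1: "((\<lambda>t. expavg (ra c) f t) \<longlongrightarrow> l / ra c) at_top"
      by (rule expavg_tendsto[where B=B]) (use ra_rb(1,2) fm f_abs filterlim_compose[OF l lims(1)] in auto)
    have "((\<lambda>t. expavg (rb c) (\<lambda>x. expavg (ra c) f (- x)) (- t)) \<longlongrightarrow> l / ra c / rb c) at_top"
      by (rule expavg_tendsto[where B="B / ra c"])
         (use ra_rb(1,2) outer_meas inner_abs filterlim_compose[OF 1 lims(2)] filterlim_compose[OF 1 lims(3)] in auto)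
    then show "(Kop c f \<longlongrightarrow> l) at_top" unfolding Kop_def[abs_def] by (simp add: ra_rb(1,2,4))
  next
    assume l: "(f \<longlongrightarrow> l) at_bot"
    then have l': "((\<lambda>t. f (- t)) \<longlongrightarrow> l) at_top" by (simp add: filterlim_at_bot_mirror)
    have 1: "((\<lambda>t. expavg (ra c) f (- t)) \<longlongrightarrow> l / ra c) at_top"
      by (rule expavg_tendsto[where B=B])
         (use ra_rb(1,2) fm f_abs filterlim_compose[OF l' lims(2)] filterlim_compose[OF l' lims(3)] in auto)
    have "((\<lambda>t. expavg (rb c) (\<lambda>x. expavg (ra c) f (- x)) t) \<longlongrightarrow> l / ra c / rb c) at_top"
      by (rule expavg_tendsto[where B="B / ra c"])
         (use ra_rb(1,2) outer_meas inner_abs filterlim_compose[OF 1 lims(1)] in auto)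
    then have "((\<lambda>t. Kop c f (- t)) \<longlongrightarrow> l) at_top" unfolding Kop_def by (simp add: ra_rb(1,2,4))
    then show "(Kop c f \<longlongrightarrow> l) at_bot" by (simp add: filterlim_at_bot_mirror)
  }
qed

text \<open>Besides solving the equation, the inverse controls slopes from one side: dropping the
  nonnegative inner integral gives y1 \<le> rb y, and for nondecreasing f, which dominates ra times
  its past integral, also y2 \<le> rb y1. These serve as Harnack-type bounds for fronts.\<close>

lemma Kop_ode:
  assumes fc: "continuous_on UNIV f"
  defines "y1 \<equiv> \<lambda>z. rb c * Kop c f z - expavg (ra c) f z"
  defines "y2 \<equiv> \<lambda>z. c * y1 z + Kop c f z - f z"
  shows "(Kop c f has_real_derivative y1 z) (at z)" "(y1 has_real_derivative y2 z) (at z)"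
    "y1 z \<le> rb c * Kop c f z" "mono f \<Longrightarrow> y2 z \<le> rb c * y1 z"
proof -
  have du: "(expavg (ra c) f has_real_derivative f z - ra c * expavg (ra c) f z) (at z)" for z
    by (rule expavg_deriv[where B=B]) (use ra_rb(1,2) fc f_abs in auto)
  have dE: "(expavg (rb c) (\<lambda>x. expavg (ra c) f (- x)) has_real_derivative
     expavg (ra c) f (- x) - rb c * expavg (rb c) (\<lambda>x. expavg (ra c) f (- x)) x) (at x)" for x
    by (rule expavg_deriv[where B="B / ra c"]) (use ra_rb(1,2) outer_cont inner_abs in auto)
  show dy: "(Kop c f has_real_derivative y1 z) (at z)" for z
    using DERIV_chain2[OF dE[of "- z"] DERIV_minus[OF DERIV_ident]]
    unfolding Kop_def[abs_def] y1_def by simp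
  have eq: "rb c * y1 z - (f z - ra c * expavg (ra c) f z) = y2 z" for z
  proof -
    have "rb c * y1 z = c * y1 z + ra c * y1 z" using ra_rb(3)[of c] by (simp add: distrib_right)
    moreover have "ra c * y1 z = (ra c * rb c) * Kop c f z - ra c * expavg (ra c) f z"
      by (simp add: y1_def right_diff_distrib)
    ultimately show ?thesis using ra_rb(4)[of c] by (simp add: y2_def)
  qed
  have "(y1 has_real_derivative rb c * y1 z - (f z - ra c * expavg (ra c) f z)) (at z)"
    unfolding y1_def[abs_def] by (intro DERIV_diff DERIV_cmult dy[unfolded y1_def] du)
  then show "(y1 has_real_derivative y2 z) (at z)" by (simp only: eq)
  show "y1 z \<le> rb c * Kop c f z" using inner_bounds(1)[of z] by (simp add: y1_def)
  assume m: "mono f"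
  have "expavg (ra c) f z \<le> expavg (ra c) (\<lambda>_. f z) z"
    by (rule expavg_mono[where B=B]) (use ra_rb(1,2) fm f_abs in \<open>auto intro: monoD[OF m]\<close>)
  then have "ra c * expavg (ra c) f z \<le> f z" using ra_rb(1)[of c] by (simp add: expavg_const field_simps)
  then show "y2 z \<le> rb c * y1 z" using eq[of z] by linarith
qed

end

lemma Kop_mono:
  assumes f: "f \<in> borel_measurable borel" "\<And>x. 0 \<le> f x" "\<And>x. f x \<le> B"
    and f': "f' \<in> borel_measurable borel" "\<And>x. 0 \<le> f' x" "\<And>x. f' x \<le> B"
    and le: "\<And>x. f x \<le> f' x"
  shows "Kop c f z \<le> Kop c f' z"
proof -
  have le': "expavg (ra c) f x \<le> expavg (ra c) f' x" for x
    by (rule expavg_mono[where B=B]) (use ra_rb(1,2) f f' le f_abs[OF f] f_abs[OF f'] in auto)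
  show ?thesis unfolding Kop_def
    by (rule expavg_mono[OF ra_rb(2) outer_meas[OF f] inner_abs[OF f] outer_meas[OF f'] inner_abs[OF f'] le'])
qed

text \<open>With a = ra c and b = rb c the operator factors through u = b d - d1, and u exp (a z) is
  nondecreasing. A negative value of u would make d unbounded at - \<infinity>, so u \<ge> 0 and d
  exp (- b z) is nonincreasing; a negative value of d would then blow up at \<infinity>.\<close>

lemma elliptic_supersolution:
  fixes d d1 d2 :: "real \<Rightarrow> real"
  assumes d: "\<And>z. (d has_real_derivative d1 z) (at z)" and d1: "\<And>z. (d1 has_real_derivative d2 z) (at z)"
    and ineq: "\<And>z. d2 z - c * d1 z - d z \<le> 0" and bd: "\<And>z. \<bar>d z\<bar> \<le> B"
  shows elliptic_decay: "x \<le> y \<Longrightarrow> d y * exp (- rb c * y) \<le> d x * exp (- rb c * x)"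
    and elliptic_nonneg: "d x \<ge> 0"
proof -
  define a where "a = ra c"
  define b where "b = rb c"
  have ab: "a > 0" "b > 0" "b = c + a" "a * b = 1" unfolding a_def b_def by (rule ra_rb)+
  define u where "u = (\<lambda>z. b * d z - d1 z)"
  have up: "u x * exp (a * x) \<le> u y * exp (a * y)" if "x \<le> y" for x y
  proof (rule DERIV_nonneg_imp_nondecreasing[OF that])
    fix z
    have "((\<lambda>z. u z * exp (a * z)) has_real_derivative (b * d1 z - d2 z) * exp (a * z) + u z * (a * exp (a * z))) (at z)"
      unfolding u_def by (auto intro!: derivative_eq_intros d d1)
    moreover have "(b * d1 z - d2 z) * exp (a * z) + u z * (a * exp (a * z)) = (d z + c * d1 z - d2 z) * exp (a * z)"
    proof -
      have "a * (b * d z) = d z" using ab(4) by (simp flip: mult.assoc)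
      then have "(b * d1 z - d2 z) + u z * a = d z + c * d1 z - d2 z"
        unfolding u_def using ab(3) by (simp add: algebra_simps)
      moreover have "(b * d1 z - d2 z) * exp (a * z) + u z * (a * exp (a * z)) = ((b * d1 z - d2 z) + u z * a) * exp (a * z)"
        by (simp only: distrib_right mult.assoc)
      ultimately show ?thesis by (simp only:)
    qed
    moreover have "(d z + c * d1 z - d2 z) * exp (a * z) \<ge> 0" using ineq[of z] by simp
    ultimately show "\<exists>D. ((\<lambda>z. u z * exp (a * z)) has_real_derivative D) (at z) \<and> 0 \<le> D" by auto
  qed
  have dd: "((\<lambda>z. d z * exp (- b * z)) has_real_derivative - u z * exp (- b * z)) (at z)" for z
    unfolding u_def by (auto intro!: derivative_eq_intros d simp: algebra_simps)
  have u0: "u z0 \<ge> 0" for z0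
  proof (rule ccontr)
    assume "\<not> ?thesis"
    define m where "m = - u z0 * exp (a * z0)"
    have m: "m > 0" using \<open>\<not> u z0 \<ge> 0\<close> by (simp add: m_def mult_neg_pos)
    have um: "u z \<le> - m * exp (- a * z)" if "z \<le> z0" for z
    proof -
      have "u z * exp (a * z) * exp (- a * z) \<le> - m * exp (- a * z)"
        using up[OF that] by (intro mult_right_mono) (auto simp: m_def)
      then show ?thesis by (simp add: mult.assoc flip: exp_add)
    qed
    \<comment> \<open>If u z0 < 0, this combination is nondecreasing to the left of z0, yet at -
      \<infinity> its second term outgrows the first, because d is bounded.\<close>
    define E where "E = (\<lambda>z. d z * exp (- b * z) + m / (a + b) * exp (- (a + b) * z))"
    have Em: "E z \<le> E z0" if "z \<le> z0" for z
    proof (rule DERIV_nonneg_imp_nondecreasing[OF that])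
      fix y assume y: "z \<le> y" "y \<le> z0"
      have "(E has_real_derivative - u y * exp (- b * y) + m / (a + b) * (- (a + b) * exp (- (a + b) * y))) (at y)"
        unfolding E_def by (intro derivative_intros DERIV_cmult dd) (auto intro!: derivative_eq_intros)
      moreover have "m / (a + b) * (- (a + b) * exp (- (a + b) * y)) = - m * exp (- a * y) * exp (- b * y)"
      proof -
        have "a + b > 0" using ab(1,2) by simp
        then have "m / (a + b) * (- (a + b) * exp (- (a + b) * y)) = - m * exp (- (a + b) * y)"
        proof -
          have "m / k * (- k * x) = - m * x" if "k > 0" for k x :: real using that by simp
          then show ?thesis using \<open>a + b > 0\<close> by blast
        qed
        moreover have "exp (- (a + b) * y) = exp (- a * y) * exp (- b * y)"
          by (simp add: algebra_simps flip: exp_add)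
        ultimately show ?thesis by simp
      qed
      moreover have "- u y * exp (- b * y) - m * exp (- a * y) * exp (- b * y) \<ge> 0"
        using mult_right_mono[OF um[OF y(2)], of "exp (- b * y)"] by simp
      ultimately show "\<exists>D. (E has_real_derivative D) (at y) \<and> 0 \<le> D" by fastforce
    qed
    have B: "B \<ge> 0" using bd[of 0] by linarith
    define k where "k = m / (a + b)"
    have k: "k > 0" using m ab by (simp add: k_def)
    define z where "z = min (min z0 0) (- (\<bar>E z0\<bar> + B + 1) / (k * a))"
    have z: "z \<le> z0" "z \<le> 0" by (auto simp: z_def)
    have "z \<le> - (\<bar>E z0\<bar> + B + 1) / (k * a)" by (simp add: z_def)
    then have "z * (k * a) \<le> - (\<bar>E z0\<bar> + B + 1)" using k ab by (simp add: pos_le_divide_eq)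
    then have big: "k * (a * (- z)) \<ge> \<bar>E z0\<bar> + B + 1" by (simp add: algebra_simps)
    have "1 + a * (- z) \<le> exp (- a * z)" using exp_ge_add_one_self[of "a * (- z)"] by simp
    then have "a * (- z) \<le> exp (- a * z)" by linarith
    then have "k * (a * (- z)) \<le> k * exp (- a * z)" using k by (intro mult_left_mono) auto
    with big have bg: "k * exp (- a * z) \<ge> \<bar>E z0\<bar> + B + 1" by linarith
    have "d z * exp (- b * z) + k * exp (- a * z) * exp (- b * z) \<le> E z0"
    proof -
      have "exp (- (a + b) * z) = exp (- a * z) * exp (- b * z)" by (simp add: algebra_simps flip: exp_add)
      then have "E z = d z * exp (- b * z) + k * exp (- a * z) * exp (- b * z)"
        unfolding E_def k_def by (simp only: mult.assoc)
      then show ?thesis using Em[OF z(1)] by simp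
    qed
    then have "(d z + k * exp (- a * z)) * exp (- b * z) \<le> E z0" by (simp add: distrib_right)
    have "d z + k * exp (- a * z) \<ge> \<bar>E z0\<bar> + 1" using bg bd[of z] by linarith
    moreover have "exp (- b * z) \<ge> 1" using z(2) ab(2) by (simp add: mult_nonneg_nonpos)
    ultimately have "(\<bar>E z0\<bar> + 1) * 1 \<le> (d z + k * exp (- a * z)) * exp (- b * z)"
      by (intro mult_mono) auto
    then have "(\<bar>E z0\<bar> + 1) * 1 \<le> E z0"
      using \<open>(d z + k * exp (- a * z)) * exp (- b * z) \<le> E z0\<close> by linarith
    then have "\<bar>E z0\<bar> + 1 \<le> E z0" by (simp only: mult_1_right)
    then show False by linarith
  qed
  show dec: "d y * exp (- rb c * y) \<le> d x * exp (- rb c * x)" if "x \<le> y" for x y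
    unfolding b_def[symmetric]
  proof (rule DERIV_nonpos_imp_nonincreasing[OF that])
    fix z show "\<exists>D. ((\<lambda>z. d z * exp (- b * z)) has_real_derivative D) (at z) \<and> D \<le> 0"
      using dd[of z] u0[of z] by (intro exI[of _ "- u z * exp (- b * z)"]) auto
  qed
  show "d x \<ge> 0"
  proof (rule ccontr)
    assume n: "\<not> d x \<ge> 0"
    have B: "B \<ge> 0" using bd[of 0] by linarith
    \<comment> \<open>Chosen so that the linear lower bound 1 + b s of the exponential already
      pushes d (x + s) below - B.\<close>
    define s where "s = (B + 1) / (- d x * b)"
    have "- d x * b > 0" using n ab(2) by (simp add: mult_neg_pos)
    then have s: "s > 0" unfolding s_def using B by (intro divide_pos_pos) auto
    have "d (x + s) * exp (- b * (x + s)) \<le> d x * exp (- b * x)" using dec[of x "x + s"] s by (simp add: b_def)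
    then have "d (x + s) * exp (- b * (x + s)) * exp (b * (x + s)) \<le> d x * exp (- b * x) * exp (b * (x + s))"
      by (rule mult_right_mono) simp
    then have "d (x + s) \<le> d x * exp (b * s)" by (simp add: mult.assoc algebra_simps flip: exp_add)
    also have "\<dots> \<le> d x * (1 + b * s)" using n exp_ge_add_one_self[of "b * s"] by (intro mult_left_mono_neg) auto
    also have "\<dots> = d x - (B + 1)" 
    proof -
      have "d x * b * s = - (B + 1)" using n ab(2) by (auto simp: s_def)
      then show ?thesis by (simp add: distrib_left mult.assoc)
    qed
    finally show False using bd[of "x + s"] n by linarith
  qed
qed

text \<open>Reflection exchanges the two roots: \<open>rb (- c) = ra c\<close>.\<close>

lemma elliptic_growth:
  fixes d d1 d2 :: "real \<Rightarrow> real"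
  assumes d: "\<And>z. (d has_real_derivative d1 z) (at z)" and d1: "\<And>z. (d1 has_real_derivative d2 z) (at z)"
    and ineq: "\<And>z. d2 z - c * d1 z - d z \<le> 0" and bd: "\<And>z. \<bar>d z\<bar> \<le> B"
    and xy: "x \<le> y"
  shows "d x * exp (ra c * x) \<le> d y * exp (ra c * y)"
proof -
  have e: "rb (- c) = ra c" by (simp add: ra_def rb_def)
  have "d (- (- x)) * exp (- rb (- c) * (- x)) \<le> d (- (- y)) * exp (- rb (- c) * (- y))"
  proof (rule elliptic_decay[where d="\<lambda>z. d (- z)" and ?d1.0="\<lambda>z. - d1 (- z)" and ?d2.0="\<lambda>z. d2 (- z)" and B=B])
    fix z
    show "((\<lambda>z. d (- z)) has_real_derivative - d1 (- z)) (at z)"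
      using DERIV_chain2[OF d DERIV_minus[OF DERIV_ident]] by simp
    have "((\<lambda>z. d1 (- z)) has_real_derivative - d2 (- z)) (at z)"
      using DERIV_chain2[OF d1 DERIV_minus[OF DERIV_ident]] by simp
    then show "((\<lambda>z. - d1 (- z)) has_real_derivative d2 (- z)) (at z)" using DERIV_minus by fastforce
    show "d2 (- z) - - c * - d1 (- z) - d (- z) \<le> 0" using ineq[of "- z"] by simp
    show "\<bar>d (- z)\<bar> \<le> B" by (rule bd)
  qed (use xy in simp)
  then show ?thesis by (simp add: e)
qed

text \<open>A zero spreads to the right by \<open>elliptic_decay\<close> and to the left by
  \<open>elliptic_growth\<close>, each giving d \<le> 0 against d \<ge> 0.\<close>

lemma elliptic_strong:
  fixes d d1 d2 :: "real \<Rightarrow> real"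
  assumes d: "\<And>z. (d has_real_derivative d1 z) (at z)" "\<And>z. (d1 has_real_derivative d2 z) (at z)"
    and ineq: "\<And>z. d2 z - c * d1 z - d z \<le> 0" and bd: "\<And>z. \<bar>d z\<bar> \<le> B" and z: "d x = 0"
  shows "d y = 0"
proof -
  have n: "d y \<ge> 0" by (rule elliptic_nonneg[OF d ineq bd])
  have "d y \<le> 0"
  proof (cases "x \<le> y")
    case True
    from elliptic_decay[OF d ineq bd this] z show ?thesis by (simp add: mult_le_0_iff)
  next
    case False
    then have "y \<le> x" by simp
    from elliptic_growth[OF d ineq bd this] z show ?thesis by (simp add: mult_le_0_iff)
  qed
  with n show ?thesis by simp
qed

lemma mono_deriv_nonneg:
  fixes f :: "real \<Rightarrow> real"
  assumes "mono f" "(f has_real_derivative D) (at z)" shows "D \<ge> 0"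
proof (rule ccontr)
  assume "\<not> ?thesis"
  then obtain d where "d > 0" "\<And>k. k > 0 \<Longrightarrow> k < d \<Longrightarrow> f (z + k) < f z"
    using DERIV_neg_dec_right[OF assms(2)] by force
  from this(2)[of "d/2"] this(1) show False using monoD[OF assms(1), of z "z + d/2"] by simp
qed

text \<open>Under y2 \<le> b y1 a zero of y1 persists to the right, so y would reach its limit at a
  finite point.\<close>

lemma strict_deriv_pos:
  fixes y y1 y2 :: "real \<Rightarrow> real"
  assumes y: "\<And>z. (y has_real_derivative y1 z) (at z)" "\<And>z. (y1 has_real_derivative y2 z) (at z)"
    "\<And>z. y2 z \<le> b * y1 z" "\<And>z. y1 z \<ge> 0" and l: "(y \<longlongrightarrow> l) at_top" "\<And>z. y z < l"
  shows "y1 z0 > 0"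
proof (rule ccontr)
  assume "\<not> y1 z0 > 0"
  then have z: "y1 z0 = 0" using y(4)[of z0] by simp
  have d0: "y1 z = 0" if "z0 \<le> z" for z
  proof -
    have "y1 z * exp (- b * z) \<le> y1 z0 * exp (- b * z0)"
    proof (rule DERIV_nonpos_imp_nonincreasing[OF that])
      fix x
      have "((\<lambda>z. y1 z * exp (- b * z)) has_real_derivative (y2 x - b * y1 x) * exp (- b * x)) (at x)"
        by (auto intro!: derivative_eq_intros y(2) simp: algebra_simps)
      moreover have "(y2 x - b * y1 x) * exp (- b * x) \<le> 0"
        using y(3)[of x] by (intro mult_nonpos_nonneg) auto
      ultimately show "\<exists>D. ((\<lambda>z. y1 z * exp (- b * z)) has_real_derivative D) (at x) \<and> D \<le> 0" by blast
    qed
    then have "y1 z \<le> 0" using z by (simp add: mult_le_0_iff)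
    then show ?thesis using y(4)[of z] by simp
  qed
  have cst: "y z \<le> y z0" if "z0 \<le> z" for z
    by (rule DERIV_nonpos_imp_nonincreasing[OF that]) (use y(1) d0 in \<open>metis order_refl\<close>)
  have "l \<le> y z0"
  proof (rule tendsto_upperbound[OF l(1)])
    show "\<forall>\<^sub>F z in at_top. y z \<le> y z0" using eventually_ge_at_top[of z0] by eventually_elim (rule cst)
  qed simp
  then show False using l(2)[of z0] by simp
qed

section \<open>Maxima, limits and monotone envelopes on the real line\<close>

lemma attains_max_real:
  fixes f :: "real \<Rightarrow> real"
  assumes "continuous_on UNIV f" "\<And>x. x \<ge> N \<Longrightarrow> f x \<le> f z0" "\<And>x. x \<le> M \<Longrightarrow> f x \<le> f z0"
  shows "\<exists>z. \<forall>y. f y \<le> f z"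
proof -
  let ?S = "{min M z0..max N z0}"
  have "\<exists>z\<in>?S. \<forall>y\<in>?S. f y \<le> f z"
    by (rule continuous_attains_sup) (use assms(1) continuous_on_subset in auto)
  then obtain z where z: "z \<in> ?S" "\<And>y. y \<in> ?S \<Longrightarrow> f y \<le> f z" by blast
  have "f y \<le> f z" for y
  proof (cases "y \<in> ?S")
    case True then show ?thesis by (rule z)
  next
    case False
    then have "y \<le> M \<or> y \<ge> N" by auto
    then have "f y \<le> f z0" using assms by blast
    also have "\<dots> \<le> f z" by (rule z(2)) auto
    finally show ?thesis .
  qed
  then show ?thesis by blast
qed

lemma lim_shift:
  fixes f :: "real \<Rightarrow> real"
  shows "(f \<longlongrightarrow> l) at_top \<Longrightarrow> ((\<lambda>x. f (x - s)) \<longlongrightarrow> l) at_top"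
    and "(f \<longlongrightarrow> l) at_bot \<Longrightarrow> ((\<lambda>x. f (x - s)) \<longlongrightarrow> l) at_bot"
proof -
  assume "(f \<longlongrightarrow> l) at_top"
  moreover have "LIM x at_top. x - s :> at_top"
    using filterlim_tendsto_add_at_top[OF tendsto_const[of "- s"] filterlim_ident] by simp
  ultimately show "((\<lambda>x. f (x - s)) \<longlongrightarrow> l) at_top" by (rule filterlim_compose)
next
  assume "(f \<longlongrightarrow> l) at_bot"
  moreover have "LIM x at_bot. x - s :> at_bot"
    unfolding filterlim_at_bot
  proof
    fix Z show "\<forall>\<^sub>F x in at_bot. x - s \<le> Z"
      using eventually_le_at_bot[of "Z + s"] by eventually_elim simp
  qed
  ultimately show "((\<lambda>x. f (x - s)) \<longlongrightarrow> l) at_bot" by (rule filterlim_compose)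
qed

lemma mono_tendsto_sup:
  fixes f :: "real \<Rightarrow> real"
  assumes "mono f" "\<And>x. f x \<le> B"
  shows "\<exists>l. (f \<longlongrightarrow> l) at_top \<and> (\<forall>x. f x \<le> l)"
proof -
  have bd: "bdd_above (range f)" by (rule bdd_aboveI[of _ B]) (use assms(2) in auto)
  define l where "l = Sup (range f)"
  have le: "f x \<le> l" for x unfolding l_def by (rule cSup_upper[OF _ bd]) auto
  have "(f \<longlongrightarrow> l) at_top"
  proof (rule increasing_tendsto)
    fix x assume "x < l"
    then obtain y where y: "x < f y" unfolding l_def using less_cSup_iff[OF _ bd] by auto
    show "\<forall>\<^sub>F n in at_top. x < f n"
      using eventually_ge_at_top[of y]
    proof eventually_elim
      case (elim n)
      then show ?case using y monoD[OF assms(1), of y n] by simp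
    qed
  qed (simp add: le)
  with le show ?thesis by blast
qed

text \<open>For f bounded below this is its largest nondecreasing minorant. It brings in
  monotonicity before fronts are known to be monotone.\<close>

definition env :: "(real \<Rightarrow> real) \<Rightarrow> real \<Rightarrow> real" where "env f z = Inf (f ` {z..})"

lemma env:
  fixes f :: "real \<Rightarrow> real"
  assumes lo: "\<And>x. L \<le> f x"
  shows env_le: "z \<le> t \<Longrightarrow> env f z \<le> f t"
    and env_ge: "(\<And>t. z \<le> t \<Longrightarrow> x \<le> f t) \<Longrightarrow> x \<le> env f z"
    and env_mono: "mono (env f)"
    and env_at_top: "(f \<longlongrightarrow> l) at_top \<Longrightarrow> (env f \<longlongrightarrow> l) at_top"
    and env_at_bot: "(f \<longlongrightarrow> L) at_bot \<Longrightarrow> (env f \<longlongrightarrow> L) at_bot"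
proof -
  have le: "env f z \<le> f t" if "z \<le> t" for z t
    unfolding env_def by (rule cInf_lower) (use that lo in \<open>auto intro: bdd_belowI[of _ L]\<close>)
  have ge: "x \<le> env f z" if "\<And>t. z \<le> t \<Longrightarrow> x \<le> f t" for x z
    unfolding env_def by (rule cInf_greatest) (use that in auto)
  show "z \<le> t \<Longrightarrow> env f z \<le> f t" "(\<And>t. z \<le> t \<Longrightarrow> x \<le> f t) \<Longrightarrow> x \<le> env f z" using le ge by blast+
  show "mono (env f)" by (rule monoI, rule ge) (use le in force)
  show "(env f \<longlongrightarrow> l) at_top" if l: "(f \<longlongrightarrow> l) at_top"
  proof (rule order_tendstoI)
    fix a assume "a < l"
    then obtain a' where a': "a < a'" "a' < l" using dense by blast
    have "\<forall>\<^sub>F x in at_top. a' < f x" using order_tendstoD(1)[OF l a'(2)] .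
    then obtain N where N: "\<And>x. x \<ge> N \<Longrightarrow> a' < f x" unfolding eventually_at_top_linorder by blast
    show "\<forall>\<^sub>F x in at_top. a < env f x"
      using eventually_ge_at_top[of N]
    proof eventually_elim
      fix x assume "x \<ge> N"
      then have "a' \<le> env f x" by (intro ge less_imp_le[OF N]) simp
      then show "a < env f x" using a' by simp
    qed
  next
    fix a assume "a > l"
    from order_tendstoD(2)[OF l this] show "\<forall>\<^sub>F x in at_top. env f x < a"
    proof eventually_elim
      case (elim x)
      then show ?case using le[of x x] by simp
    qed
  qed
  show "(env f \<longlongrightarrow> L) at_bot" if l: "(f \<longlongrightarrow> L) at_bot"
  proof (rule tendsto_sandwich[OF _ _ tendsto_const l])
    show "\<forall>\<^sub>F x in at_bot. L \<le> env f x" by (intro always_eventually allI ge lo)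
    show "\<forall>\<^sub>F x in at_bot. env f x \<le> f x" by (intro always_eventually allI le) simp
  qed
qed

section \<open>Travelling fronts\<close>

context monostable
begin

text \<open>Wavefront profiles of speed c are fixed points of this operator. It preserves order, as
  the kernels are positive and g is nondecreasing.\<close>

definition Top :: "real \<Rightarrow> (real \<Rightarrow> real) \<Rightarrow> real \<Rightarrow> real" where
  "Top c \<psi> = Kop c (\<lambda>x. g (\<psi> (x - c * h)))"

lemma src_meas: "\<psi> \<in> borel_measurable borel \<Longrightarrow> (\<lambda>x. g (\<psi> (x - c * h))) \<in> borel_measurable borel"
proof -
  assume [measurable]: "\<psi> \<in> borel_measurable borel"
  have [measurable]: "g \<in> borel_measurable borel" by (rule borel_measurable_continuous_onI[OF g_cont])
  show ?thesis by measurable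
qed

lemma Top_mono:
  assumes "\<psi> \<in> borel_measurable borel" "\<And>x. 0 \<le> \<psi> x" "\<psi>' \<in> borel_measurable borel" "\<And>x. \<psi>' x \<le> B"
    and le: "\<And>x. \<psi> x \<le> \<psi>' x"
  shows "Top c \<psi> z \<le> Top c \<psi>' z"
  unfolding Top_def
proof (rule Kop_mono[where B="g B"])
  fix x
  have a: "0 \<le> \<psi>' (x - c * h)" "\<psi> (x - c * h) \<le> B"
    using assms(2,4) le order_trans by blast+
  show "0 \<le> g (\<psi> (x - c * h))" "g (\<psi> (x - c * h)) \<le> g B" "0 \<le> g (\<psi>' (x - c * h))"
    "g (\<psi>' (x - c * h)) \<le> g B" "g (\<psi> (x - c * h)) \<le> g (\<psi>' (x - c * h))"
    using a assms(2,4) le by (auto intro!: g_nonneg gmono)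
qed (use assms src_meas in auto)

lemma Top_facts:
  assumes "\<psi> \<in> borel_measurable borel" "\<And>x. 0 \<le> \<psi> x" "\<And>x. \<psi> x \<le> B"
  shows "0 \<le> Top c \<psi> z" "Top c \<psi> z \<le> g B" "continuous_on UNIV (Top c \<psi>)"
    "mono \<psi> \<Longrightarrow> mono (Top c \<psi>)"
    "(\<psi> \<longlongrightarrow> l) at_top \<Longrightarrow> (Top c \<psi> \<longlongrightarrow> g l) at_top"
    "(\<psi> \<longlongrightarrow> l) at_bot \<Longrightarrow> (Top c \<psi> \<longlongrightarrow> g l) at_bot"
proof -
  have gc: "isCont g x" for x using g_cont[of UNIV] by (simp add: continuous_on_eq_continuous_at)
  have f: "(\<lambda>x. g (\<psi> (x - c * h))) \<in> borel_measurable borel" "\<And>x. 0 \<le> g (\<psi> (x - c * h))"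
    "\<And>x. g (\<psi> (x - c * h)) \<le> g B"
    using assms src_meas by (auto intro!: g_nonneg gmono)
  show "0 \<le> Top c \<psi> z" "Top c \<psi> z \<le> g B" "continuous_on UNIV (Top c \<psi>)"
    unfolding Top_def by (rule Kop_bounds[OF f] Kop_cont[OF f])+
  show "mono (Top c \<psi>)" if "mono \<psi>" unfolding Top_def
    by (rule Kop_mono_arg[OF f]) (intro monoI gmono monoD[OF that], simp)
  show "(Top c \<psi> \<longlongrightarrow> g l) at_top" if "(\<psi> \<longlongrightarrow> l) at_top" unfolding Top_def
    by (rule Kop_limits(1)[OF f]) (rule isCont_tendsto_compose[OF gc lim_shift(1)[OF that]])
  show "(Top c \<psi> \<longlongrightarrow> g l) at_bot" if "(\<psi> \<longlongrightarrow> l) at_bot" unfolding Top_def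
    by (rule Kop_limits(2)[OF f]) (rule isCont_tendsto_compose[OF gc lim_shift(2)[OF that]])
qed

lemma Top_ode:
  assumes "continuous_on UNIV \<psi>" "\<And>x. 0 \<le> \<psi> x" "\<And>x. \<psi> x \<le> B"
  shows "\<exists>y1 y2. (\<forall>z. (Top c \<psi> has_real_derivative y1 z) (at z)) \<and>
    (\<forall>z. (y1 has_real_derivative y2 z) (at z)) \<and>
    (\<forall>z. y2 z - c * y1 z - Top c \<psi> z = - g (\<psi> (z - c * h))) \<and>
    (\<forall>z. y1 z \<le> rb c * Top c \<psi> z) \<and> (mono \<psi> \<longrightarrow> (\<forall>z. y2 z \<le> rb c * y1 z))"
proof -
  have m: "\<psi> \<in> borel_measurable borel" by (rule borel_measurable_continuous_onI[OF assms(1)])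
  have f: "(\<lambda>x. g (\<psi> (x - c * h))) \<in> borel_measurable borel" "\<And>x. 0 \<le> g (\<psi> (x - c * h))"
    "\<And>x. g (\<psi> (x - c * h)) \<le> g B"
    using assms src_meas[OF m] by (auto intro!: g_nonneg gmono)
  have fc: "continuous_on UNIV (\<lambda>x. g (\<psi> (x - c * h)))"
    by (rule continuous_on_compose2[OF g_cont[of UNIV]], rule continuous_on_compose2[OF assms(1)])
       (auto intro!: continuous_intros)
  define y1 where "y1 = (\<lambda>z. rb c * Top c \<psi> z - expavg (ra c) (\<lambda>x. g (\<psi> (x - c * h))) z)"
  show ?thesis
  proof (rule exI[of _ y1], rule exI[of _ "\<lambda>z. c * y1 z + Top c \<psi> z - g (\<psi> (z - c * h))"], intro conjI allI impI)
    assume "mono \<psi>"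
    from \<open>mono \<psi>\<close> have "mono (\<lambda>x. g (\<psi> (x - c * h)))" by (intro monoI gmono) (rule monoD, assumption, simp)
    then show "c * y1 z + Top c \<psi> z - g (\<psi> (z - c * h)) \<le> rb c * y1 z" for z
      unfolding y1_def Top_def by (rule Kop_ode(4)[OF f fc])
  qed (use Kop_ode[OF f fc] in \<open>auto simp: y1_def Top_def\<close>)
qed

text \<open>The infimum of all monotone supersolutions between \<open>sub\<close> and
  \<open>hi\<close> is again one, and so is its image under the operator; hence both agree.
  Restricting to monotone functions keeps the infimum measurable.\<close>

lemma knaster_tarski_profile:
  assumes sub: "sub \<in> borel_measurable borel" "\<And>z. 0 \<le> sub z" "\<And>z. sub z \<le> hi z" "\<And>z. sub z \<le> Top c sub z"
    and hi: "mono hi" "\<And>z. hi z \<le> B" "\<And>z. Top c hi z \<le> hi z"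
  shows "\<exists>\<psi>. mono \<psi> \<and> (\<forall>z. sub z \<le> \<psi> z \<and> \<psi> z \<le> hi z) \<and> Top c \<psi> = \<psi>"
proof -
  define S where "S = {\<psi>. mono \<psi> \<and> (\<forall>z. sub z \<le> \<psi> z \<and> \<psi> z \<le> hi z) \<and> (\<forall>z. Top c \<psi> z \<le> \<psi> z)}"
  have supS: "hi \<in> S" using sub hi by (auto simp: S_def)
  define m where "m = (\<lambda>z. INF \<psi>\<in>S. \<psi> z)"
  have m_le: "m z \<le> \<psi> z" if "\<psi> \<in> S" for \<psi> z unfolding m_def
    by (rule cINF_lower[OF _ that]) (auto simp: S_def intro!: bdd_belowI[of _ "sub z"])
  have m_ge: "x \<le> m z" if "\<And>\<psi>. \<psi> \<in> S \<Longrightarrow> x \<le> \<psi> z" for x z unfolding m_def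
    by (rule cINF_greatest) (use supS that in auto)
  have mm: "mono m"
  proof (rule monoI, rule m_ge)
    fix y z :: real and \<psi> assume "y \<le> z" "\<psi> \<in> S"
    then show "m y \<le> \<psi> z" using m_le[of \<psi> y] monoD[of \<psi> y z] by (auto simp: S_def)
  qed
  have sm: "sub z \<le> m z" for z by (rule m_ge) (simp add: S_def)
  have ms: "m z \<le> hi z" for z by (rule m_le[OF supS])
  have m0: "0 \<le> m z" for z using sm sub(2) order_trans by blast
  have mB: "m z \<le> B" for z using ms hi(2) order_trans by blast
  have meas: "mono f \<Longrightarrow> f \<in> borel_measurable borel" for f :: "real \<Rightarrow> real" by (rule borel_measurable_mono)
  have Tm: "Top c m z \<le> m z" for z
  proof (rule m_ge)
    fix \<psi> assume p: "\<psi> \<in> S"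
    have "Top c m z \<le> Top c \<psi> z"
    proof (rule Top_mono[where B=B])
      show "\<psi> x \<le> B" for x using p hi(2) by (auto simp: S_def intro: order_trans)
    qed (use p mm meas m0 m_le[OF p] in \<open>auto simp: S_def\<close>)
    also have "\<dots> \<le> \<psi> z" using p by (simp add: S_def)
    finally show "Top c m z \<le> \<psi> z" .
  qed
  have TmM: "mono (Top c m)" by (rule Top_facts(4)[OF meas[OF mm] m0 mB mm])
  have Tm0: "0 \<le> Top c m z" for z by (rule Top_facts(1)[OF meas[OF mm] m0 mB])
  have "Top c m \<in> S" unfolding S_def
  proof (intro CollectI conjI allI)
    fix z
    have "Top c sub z \<le> Top c m z"
      by (rule Top_mono[where B=B]) (use sub meas[OF mm] mB sm in auto)
    then show "sub z \<le> Top c m z" using sub(4)[of z] by linarith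
    show "Top c m z \<le> hi z" using Tm[of z] ms[of z] by linarith
    show "Top c (Top c m) z \<le> Top c m z"
      by (rule Top_mono[where B=B]) (use meas[OF mm] meas[OF TmM] Tm0 Tm mB in auto)
  qed (rule TmM)
  then have "m z \<le> Top c m z" for z by (rule m_le)
  with Tm have "Top c m = m" by (intro ext antisym)
  then show ?thesis using mm sm ms by blast
qed

text \<open>Monotonicity provides a limit at \<infinity>, which is a positive fixed point of g and
  hence \<kappa>, even if the a priori bound B is larger.\<close>

lemma wavefront_of_fixpoint:
  assumes "mono \<psi>" "\<And>z. 0 < \<psi> z" "\<And>z. \<psi> z \<le> B" "Top c \<psi> = \<psi>" "(\<psi> \<longlongrightarrow> 0) at_bot"
  shows "wavefront g h \<kappa> c \<psi>"
proof -
  have m: "\<psi> \<in> borel_measurable borel" by (rule borel_measurable_mono[OF assms(1)])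
  have p0: "0 \<le> \<psi> x" for x using assms(2)[of x] by simp
  have cont: "continuous_on UNIV \<psi>" using Top_facts(3)[OF m p0 assms(3), of c] assms(4) by simp
  obtain y1 y2 where y: "\<And>z. (\<psi> has_real_derivative y1 z) (at z)"
    "\<And>z. (y1 has_real_derivative y2 z) (at z)"
    "\<And>z. y2 z - c * y1 z - \<psi> z = - g (\<psi> (z - c * h))"
    using Top_ode[OF cont p0 assms(3), of c] unfolding assms(4) by blast
  obtain l where l: "(\<psi> \<longlongrightarrow> l) at_top" "\<And>x. \<psi> x \<le> l" using mono_tendsto_sup[OF assms(1,3)] by blast
  have "(\<psi> \<longlongrightarrow> g l) at_top" using Top_facts(5)[OF m p0 assms(3) l(1), of c] assms(4) by simp
  then have "g l = l" using l(1) by (intro tendsto_unique[of at_top]) auto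
  moreover have "l > 0" using assms(2)[of 0] l(2)[of 0] by linarith
  ultimately have "l = \<kappa>" using g_fixed[of l] by simp
  moreover have "c * y1 s = y2 s - \<psi> s + g (\<psi> (s - c * h))" for s using y(3)[of s] by simp
  ultimately show ?thesis unfolding wavefront_def using y(1,2) assms(2,5) l(1) by blast
qed

section \<open>A priori properties of an arbitrary wavefront\<close>

context
  fixes c \<phi>
  assumes front: "wavefront g h \<kappa> c \<phi>"
begin

lemma front_pos: "\<phi> z > 0" and front_bot: "(\<phi> \<longlongrightarrow> 0) at_bot" and front_top: "(\<phi> \<longlongrightarrow> \<kappa>) at_top"
  using front unfolding wavefront_def by blast+

lemma front_ode:
  "\<exists>\<phi>1 \<phi>2. (\<forall>z. (\<phi> has_real_derivative \<phi>1 z) (at z)) \<and> (\<forall>z. (\<phi>1 has_real_derivative \<phi>2 z) (at z)) \<and>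
    (\<forall>z. \<phi>2 z - c * \<phi>1 z - \<phi> z = - g (\<phi> (z - c * h)))"
proof -
  obtain \<phi>1 \<phi>2 where "\<forall>s. (\<phi> has_real_derivative \<phi>1 s) (at s) \<and> (\<phi>1 has_real_derivative \<phi>2 s) (at s) \<and>
     c * \<phi>1 s = \<phi>2 s - \<phi> s + g (\<phi> (s - c * h))"
    using front unfolding wavefront_def by blast
  then have "\<forall>z. (\<phi> has_real_derivative \<phi>1 z) (at z)" "\<forall>z. (\<phi>1 has_real_derivative \<phi>2 z) (at z)"
    "\<forall>z. \<phi>2 z - c * \<phi>1 z - \<phi> z = - g (\<phi> (z - c * h))" by (simp_all add: algebra_simps)
  then show ?thesis by blast
qed

lemma front_cont: "continuous_on S \<phi>"
  using front_ode by (meson DERIV_continuous_on has_field_derivative_at_within)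

text \<open>At a maximum above \<kappa> the equation would give \<phi> \<le> g (\<phi>) <
  \<phi>.\<close>

lemma front_le: "\<phi> z \<le> \<kappa>"
proof (rule ccontr)
  assume n: "\<not> ?thesis"
  obtain \<phi>1 \<phi>2 where o: "\<And>z. (\<phi> has_real_derivative \<phi>1 z) (at z)" "\<And>z. (\<phi>1 has_real_derivative \<phi>2 z) (at z)"
    "\<And>z. \<phi>2 z - c * \<phi>1 z - \<phi> z = - g (\<phi> (z - c * h))" using front_ode by blast
  obtain N where N: "\<And>x. x \<ge> N \<Longrightarrow> \<phi> x < \<phi> z"
    using order_tendstoD(2)[OF front_top, of "\<phi> z"] n by (auto simp: eventually_at_top_linorder)
  obtain M where M: "\<And>x. x \<le> M \<Longrightarrow> \<phi> x < \<phi> z"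
    using order_tendstoD(2)[OF front_bot, of "\<phi> z"] front_pos[of z] by (auto simp: eventually_at_bot_linorder)
  obtain y where y: "\<And>x. \<phi> x \<le> \<phi> y"
    using attains_max_real[OF front_cont, of N z M] N M by (meson less_imp_le)
  have "\<phi>1 y = 0" "\<phi>2 y \<le> 0"
    using local_max_derivatives[OF always_eventually[OF allI[OF o(1)]] o(2) always_eventually[OF allI[OF y]]] by auto
  then have "\<phi> y \<le> g (\<phi> (y - c * h))" using o(3)[of y] by simp
  also have "\<dots> \<le> g (\<phi> y)" by (intro gmono y)
  also have "\<dots> < \<phi> y" using g_less[of "\<phi> y"] n y[of z] by simp
  finally show False by simp
qed

text \<open>\<kappa> - \<phi> is a bounded supersolution of the linear equation, so touching
  \<kappa> once makes the front constant, against its limit 0.\<close>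

lemma front_less: "\<phi> z < \<kappa>"
proof (rule ccontr)
  assume n: "\<not> ?thesis"
  obtain \<phi>1 \<phi>2 where o: "\<And>z. (\<phi> has_real_derivative \<phi>1 z) (at z)" "\<And>z. (\<phi>1 has_real_derivative \<phi>2 z) (at z)"
    "\<And>z. \<phi>2 z - c * \<phi>1 z - \<phi> z = - g (\<phi> (z - c * h))" using front_ode by blast
  have z0: "\<kappa> - \<phi> z = 0" using n front_le[of z] by simp
  have "\<kappa> - \<phi> y = 0" for y
  proof (rule elliptic_strong[where d="\<lambda>z. \<kappa> - \<phi> z" and ?d1.0="\<lambda>z. - \<phi>1 z" and ?d2.0="\<lambda>z. - \<phi>2 z" and c=c and B=\<kappa> and x=z])
    fix z
    show "((\<lambda>z. \<kappa> - \<phi> z) has_real_derivative - \<phi>1 z) (at z)" using DERIV_diff[OF DERIV_const o(1)] by simp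
    show "((\<lambda>z. - \<phi>1 z) has_real_derivative - \<phi>2 z) (at z)" by (rule DERIV_minus[OF o(2)])
    show "- \<phi>2 z - c * - \<phi>1 z - (\<kappa> - \<phi> z) \<le> 0"
      using o(3)[of z] g_le_kap[OF front_le[of "z - c * h"]] by simp
    show "\<bar>\<kappa> - \<phi> z\<bar> \<le> \<kappa>" using front_le[of z] front_pos[of z] by simp
  qed (rule z0)
  then have "\<phi> = (\<lambda>_. \<kappa>)" by auto
  then have "((\<lambda>_. \<kappa>) \<longlongrightarrow> 0) (at_bot :: real filter)" using front_bot by simp
  then show False using kap by (simp add: tendsto_const_iff)
qed

lemma front_meas: "\<phi> \<in> borel_measurable borel"
  by (rule borel_measurable_continuous_onI[OF front_cont])

text \<open>The difference is a bounded solution of the homogeneous linear equation; nonnegativity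
  of both signs makes it vanish.\<close>

lemma front_fix: "Top c \<phi> = \<phi>"
proof
  fix x
  obtain \<phi>1 \<phi>2 where o: "\<And>z. (\<phi> has_real_derivative \<phi>1 z) (at z)" "\<And>z. (\<phi>1 has_real_derivative \<phi>2 z) (at z)"
    "\<And>z. \<phi>2 z - c * \<phi>1 z - \<phi> z = - g (\<phi> (z - c * h))" using front_ode by blast
  have p0: "0 \<le> \<phi> x" for x using front_pos[of x] by simp
  obtain y1 y2 where y: "\<And>z. (Top c \<phi> has_real_derivative y1 z) (at z)"
    "\<And>z. (y1 has_real_derivative y2 z) (at z)"
    "\<And>z. y2 z - c * y1 z - Top c \<phi> z = - g (\<phi> (z - c * h))"
    using Top_ode[OF front_cont p0 front_le, of c] by blast
  have bd: "0 \<le> Top c \<phi> z" "Top c \<phi> z \<le> \<kappa>" for z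
    using Top_facts(1,2)[OF front_meas p0 front_le] by auto
  have 1: "0 \<le> Top c \<phi> x - \<phi> x"
  proof (rule elliptic_nonneg[where d="\<lambda>z. Top c \<phi> z - \<phi> z" and x=x and ?d1.0="\<lambda>z. y1 z - \<phi>1 z" and ?d2.0="\<lambda>z. y2 z - \<phi>2 z" and c=c and B=\<kappa>])
    fix z
    show "y2 z - \<phi>2 z - c * (y1 z - \<phi>1 z) - (Top c \<phi> z - \<phi> z) \<le> 0"
      using y(3)[of z] o(3)[of z] by (simp add: algebra_simps)
    show "\<bar>Top c \<phi> z - \<phi> z\<bar> \<le> \<kappa>" using bd[of z] p0[of z] front_le[of z] by linarith
  qed (intro DERIV_diff y o)+
  have 2: "0 \<le> \<phi> x - Top c \<phi> x"
  proof (rule elliptic_nonneg[where d="\<lambda>z. \<phi> z - Top c \<phi> z" and x=x and ?d1.0="\<lambda>z. \<phi>1 z - y1 z" and ?d2.0="\<lambda>z. \<phi>2 z - y2 z" and c=c and B=\<kappa>])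
    fix z
    show "\<phi>2 z - y2 z - c * (\<phi>1 z - y1 z) - (\<phi> z - Top c \<phi> z) \<le> 0"
      using y(3)[of z] o(3)[of z] by (simp add: algebra_simps)
    show "\<bar>\<phi> z - Top c \<phi> z\<bar> \<le> \<kappa>" using bd[of z] p0[of z] front_le[of z] by linarith
  qed (intro DERIV_diff y o)+
  show "Top c \<phi> x = \<phi> x" using 1 2 by simp
qed

lemma front_decay: "x \<le> y \<Longrightarrow> \<phi> y * exp (- rb c * y) \<le> \<phi> x * exp (- rb c * x)"
proof -
  assume xy: "x \<le> y"
  obtain \<phi>1 \<phi>2 where o: "\<And>z. (\<phi> has_real_derivative \<phi>1 z) (at z)" "\<And>z. (\<phi>1 has_real_derivative \<phi>2 z) (at z)"
    "\<And>z. \<phi>2 z - c * \<phi>1 z - \<phi> z = - g (\<phi> (z - c * h))" using front_ode by blast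
  show ?thesis
  proof (rule elliptic_decay[OF o(1,2) _ _ xy])
    show "\<phi>2 z - c * \<phi>1 z - \<phi> z \<le> 0" for z using o(3)[of z] g_nonneg front_pos[of "z - c * h"] by (simp add: less_imp_le)
    show "\<bar>\<phi> z\<bar> \<le> \<kappa>" for z using front_le[of z] front_pos[of z] by simp
  qed
qed

abbreviation "en \<equiv> env \<phi>"

lemma en_facts: "mono en" "0 \<le> en z" "en z \<le> \<phi> z" "(en \<longlongrightarrow> 0) at_bot" "(en \<longlongrightarrow> \<kappa>) at_top"
    "en \<in> borel_measurable borel" "en z \<le> \<kappa>"
proof -
  have p0: "0 \<le> \<phi> x" for x using front_pos[of x] by simp
  show m: "mono en" by (rule env_mono[OF p0])
  show "0 \<le> en z" by (rule env_ge[OF p0]) (rule p0)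
  show le: "en z \<le> \<phi> z" by (rule env_le[OF p0]) simp
  show "(en \<longlongrightarrow> 0) at_bot" by (rule env_at_bot[OF p0 front_bot])
  show "(en \<longlongrightarrow> \<kappa>) at_top" by (rule env_at_top[OF p0 front_top])
  show "en \<in> borel_measurable borel" by (rule borel_measurable_mono[OF m])
  show "en z \<le> \<kappa>" using le front_le[of z] by linarith
qed

text \<open>If c \<le> 0, the delayed argument lies to the right, so the monotone envelope is a
  supersolution of the undelayed profile equation. Its second iterate v is smooth, nondecreasing and
  concave; being bounded it is constant, against its limits 0 and \<kappa>.\<close>

lemma front_speed_pos: "c > 0"
proof (rule ccontr)
  assume c0: "\<not> c > 0"
  have p0: "0 \<le> \<phi> x" for x using front_pos[of x] by simp
  define y where "y = Kop c (\<lambda>x. g (en x))"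
  \<comment> \<open>The envelope may jump: the first iterate y is continuous, and the second is then
    twice differentiable.\<close>
  define v where "v = Kop c (\<lambda>x. g (y x))"
  have gc: "isCont g x" for x using g_cont[of UNIV] by (simp add: continuous_on_eq_continuous_at)
  have gm: "f \<in> borel_measurable borel \<Longrightarrow> (\<lambda>x. g (f x)) \<in> borel_measurable borel" for f :: "real \<Rightarrow> real"
    using src_meas[of f 0] by simp
  have f: "(\<lambda>x. g (en x)) \<in> borel_measurable borel" "\<And>x. 0 \<le> g (en x)" "\<And>x. g (en x) \<le> \<kappa>"
    using en_facts(2,6,7) gm by (auto intro!: g_nonneg g_le_kap)
  have fmono: "mono (\<lambda>x. g (en x))" by (intro monoI gmono monoD[OF en_facts(1)])
  have y: "0 \<le> y z" "y z \<le> \<kappa>" "continuous_on UNIV y" "mono y" for z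
    unfolding y_def by (rule Kop_bounds[OF f] Kop_cont[OF f] Kop_mono_arg[OF f fmono])+
  have lim: "(y \<longlongrightarrow> 0) at_bot" "(y \<longlongrightarrow> \<kappa>) at_top" unfolding y_def
    using Kop_limits[OF f] isCont_tendsto_compose[OF gc en_facts(4)] isCont_tendsto_compose[OF gc en_facts(5)]
    by simp_all
  have yen: "y z \<le> en z" for z
  proof (rule env_ge[OF p0])
    fix t assume "z \<le> t"
    then have "y z \<le> y t" using y(4) by (rule monoD[rotated])
    also have "y t \<le> Top c \<phi> t" unfolding y_def Top_def
    proof (rule Kop_mono[OF f])
      fix x
      have "- (c * h) \<ge> 0" using c0 h by (simp add: mult_nonpos_nonneg)
      then show "g (en x) \<le> g (\<phi> (x - c * h))" by (intro gmono env_le[OF p0]) simp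
    qed (use src_meas[OF front_meas] front_le p0 in \<open>auto intro!: g_nonneg g_le_kap\<close>)
    finally show "y z \<le> \<phi> t" by (simp add: front_fix)
  qed
  have gyc: "continuous_on UNIV (\<lambda>x. g (y x))" by (rule continuous_on_compose2[OF g_cont y(3)]) auto
  have f2: "(\<lambda>x. g (y x)) \<in> borel_measurable borel" "\<And>x. 0 \<le> g (y x)" "\<And>x. g (y x) \<le> \<kappa>"
    using borel_measurable_continuous_onI[OF gyc] y by (auto intro!: g_nonneg g_le_kap)
  have f2mono: "mono (\<lambda>x. g (y x))" by (intro monoI gmono monoD[OF y(4)])
  have v: "0 \<le> v z" "v z \<le> \<kappa>" "mono v" for z
    unfolding v_def by (rule Kop_bounds[OF f2] Kop_mono_arg[OF f2 f2mono])+
  have vy: "v z \<le> y z" for z unfolding v_def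
    by (subst (2) y_def) (rule Kop_mono[OF f2 f], intro gmono yen)
  have vlim: "(v \<longlongrightarrow> 0) at_bot" "(v \<longlongrightarrow> \<kappa>) at_top" unfolding v_def
    using Kop_limits[OF f2] isCont_tendsto_compose[OF gc lim(1)] isCont_tendsto_compose[OF gc lim(2)]
    by simp_all
  define v1 where "v1 = (\<lambda>z. rb c * v z - expavg (ra c) (\<lambda>x. g (y x)) z)"
  define v2 where "v2 = (\<lambda>z. c * v1 z + v z - g (y z))"
  have d: "(v has_real_derivative v1 z) (at z)" "(v1 has_real_derivative v2 z) (at z)" for z
    using Kop_ode(1,2)[OF f2 gyc] unfolding v_def v1_def v2_def by auto
  have v1n: "v1 z \<ge> 0" for z by (rule mono_deriv_nonneg[OF v(3) d(1)])
  \<comment> \<open>Concavity: v \<le> y \<le> g y, and c v1 \<le> 0 by the sign of c.\<close>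
  have v2n: "v2 z \<le> 0" for z
  proof -
    have "v z \<le> g (y z)" using vy[of z] g_ge[OF y(1,2), of z] by linarith
    moreover have "c * v1 z \<le> 0" using c0 v1n[of z] by (simp add: mult_nonpos_nonneg)
    ultimately show ?thesis by (simp add: v2_def)
  qed
  have v1z: "v1 z0 = 0" for z0
  proof (rule ccontr)
    assume "v1 z0 \<noteq> 0"
    then have p: "v1 z0 > 0" using v1n[of z0] by simp
    have ge: "v1 z0 \<le> v1 z" if "z \<le> z0" for z
      by (rule DERIV_nonpos_imp_nonincreasing[OF that]) (use d(2) v2n in blast)
    define s where "s = (\<kappa> + 1) / v1 z0"
    have s: "s > 0" using p kap by (simp add: s_def)
    obtain t where t: "z0 - s < t" "t < z0" "v z0 - v (z0 - s) = (z0 - (z0 - s)) * v1 t"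
      using MVT2[of "z0 - s" z0 v v1] s d(1) by auto
    have "s * v1 z0 \<le> s * v1 t" using ge[of t] t s by (intro mult_left_mono) auto
    then have "v z0 - v (z0 - s) \<ge> \<kappa> + 1" using t(3) p by (simp add: s_def)
    then show False using v(1)[of "z0 - s"] v(2)[of z0] by linarith
  qed
  have "(v has_real_derivative 0) (at x)" for x using d(1)[of x] by (simp add: v1z)
  then have "v z = v 0" for z by (intro DERIV_isconst_all) simp
  then have "v = (\<lambda>_. v 0)" by blast
  then have "((\<lambda>_. v 0) \<longlongrightarrow> 0) (at_bot :: real filter)" "((\<lambda>_. v 0) \<longlongrightarrow> \<kappa>) (at_top :: real filter)"
    using vlim by metis+
  then show False using kap by (simp add: tendsto_const_iff)
qed

text \<open>A later dip of \<phi> below a fixed fraction of \<phi> z would contain an interior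
  minimum m. The delayed value is at least \<phi> m: to the right of z by minimality, and within c h
  to the left of z by \<open>front_decay\<close>, which dictates the fraction. Then g (\<phi> m)
  \<le> \<phi> m, which is impossible below \<kappa>.\<close>

lemma env_lower: "exp (- rb c * (c * h)) * \<phi> z \<le> en z"
proof (rule env_ge[of 0])
  show "0 \<le> \<phi> x" for x using front_pos[of x] by simp
next
  fix s assume zs: "z \<le> s"
  define k where "k = exp (- rb c * (c * h))"
  have ch: "c * h \<ge> 0" using front_speed_pos h by simp
  have k: "0 < k" "k \<le> 1" using ch ra_rb(2)[of c] by (auto simp: k_def)
  obtain \<phi>1 \<phi>2 where o: "\<And>z. (\<phi> has_real_derivative \<phi>1 z) (at z)" "\<And>z. (\<phi>1 has_real_derivative \<phi>2 z) (at z)"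
    "\<And>z. \<phi>2 z - c * \<phi>1 z - \<phi> z = - g (\<phi> (z - c * h))" using front_ode by blast
  show "exp (- rb c * (c * h)) * \<phi> z \<le> \<phi> s"
  proof (rule ccontr)
    assume "\<not> ?thesis"
    then have n: "\<phi> s < k * \<phi> z" by (simp add: k_def)
    have kz: "k * \<phi> z \<le> \<phi> z" using k front_pos[of z] by simp
    have "\<phi> s < \<kappa>" by (rule front_less)
    then obtain N where N: "\<And>x. x \<ge> N \<Longrightarrow> \<phi> s < \<phi> x"
      using order_tendstoD(1)[OF front_top] by (auto simp: eventually_at_top_linorder)
    \<comment> \<open>Beyond N the front exceeds \<phi> s, so the minimum over this compact interval
      is one over the whole half-line.\<close>
    have "\<exists>m\<in>{z..max N s}. \<forall>y\<in>{z..max N s}. \<phi> m \<le> \<phi> y"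
      by (rule continuous_attains_inf) (use zs front_cont in auto)
    then obtain m where m: "z \<le> m" "\<And>y. z \<le> y \<Longrightarrow> y \<le> max N s \<Longrightarrow> \<phi> m \<le> \<phi> y" by auto
    have ms: "\<phi> m \<le> \<phi> s" using m(2)[of s] zs by simp
    have mall: "\<phi> m \<le> \<phi> y" if "z \<le> y" for y
    proof (cases "y \<le> max N s")
      case False
      then have "\<phi> s < \<phi> y" by (intro N) simp
      then show ?thesis using ms by simp
    qed (use m that in auto)
    have "m \<noteq> z" using ms n kz by auto
    then have mz: "z < m" using m by simp
    have "\<forall>\<^sub>F y in nhds m. \<phi> m \<le> \<phi> y"
      using eventually_nhds_in_open[of "{z<..}" m] mz by (auto elim!: eventually_mono intro: mall)
    from local_min_derivatives[OF always_eventually[OF allI[OF o(1)]] o(2) this]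
    have "\<phi>1 m = 0" "\<phi>2 m \<ge> 0" by auto
    then have ge: "g (\<phi> (m - c * h)) \<le> \<phi> m" using o(3)[of m] by simp
    have "\<phi> m \<le> \<phi> (m - c * h)"
    proof (cases "z \<le> m - c * h")
      case True then show ?thesis by (rule mall)
    next
      case False
      define x where "x = m - c * h"
      have x: "x \<le> z" "z - x \<le> c * h" using False mz by (auto simp: x_def)
      have "\<phi> z * exp (- rb c * z) \<le> \<phi> x * exp (- rb c * x)" by (rule front_decay[OF x(1)])
      then have "\<phi> z * exp (- rb c * z) * exp (rb c * x) \<le> \<phi> x * exp (- rb c * x) * exp (rb c * x)"
        by (rule mult_right_mono) simp
      then have "\<phi> z * exp (- rb c * (z - x)) \<le> \<phi> x"
        by (simp add: mult.assoc algebra_simps flip: exp_add)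
      moreover have "k \<le> exp (- rb c * (z - x))" unfolding k_def using x ra_rb(2)[of c] by simp
      then have "\<phi> z * k \<le> \<phi> z * exp (- rb c * (z - x))" using front_pos[of z] by simp
      ultimately have "k * \<phi> z \<le> \<phi> x" by (simp add: mult.commute)
      then show ?thesis using ms n by (simp add: x_def)
    qed
    then have "g (\<phi> m) \<le> \<phi> m" using gmono[of "\<phi> m" "\<phi> (m - c * h)"] ge by linarith
    then show False using g_gt[OF front_pos front_less, of m] by simp
  qed
qed

text \<open>The envelope satisfies Top c en \<le> en. Two iterations make it twice differentiable,
  and the inequality survives because \<Phi> = Top c A with \<Phi> \<le> A. The lower bound by a
  multiple of \<phi>, obtained through \<open>env_lower\<close>, passes slow decay of \<phi> on to
  \<Phi>.\<close>

lemma monotone_supersolution: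
  "\<exists>\<Phi> \<Phi>1 \<Phi>2 k. k > 0 \<and> (\<forall>z. (\<Phi> has_real_derivative \<Phi>1 z) (at z)) \<and> (\<forall>z. (\<Phi>1 has_real_derivative \<Phi>2 z) (at z)) \<and>
    (\<forall>z. \<Phi>2 z - c * \<Phi>1 z - \<Phi> z \<le> - g (\<Phi> (z - c * h))) \<and> (\<forall>z. \<Phi>1 z > 0) \<and> (\<forall>z. \<Phi>2 z \<le> rb c * \<Phi>1 z) \<and>
    (\<forall>z. \<Phi>1 z \<le> rb c * \<Phi> z) \<and>
    (\<forall>z. 0 < \<Phi> z \<and> \<Phi> z < \<kappa> \<and> k * \<phi> z \<le> \<Phi> z) \<and> (\<Phi> \<longlongrightarrow> 0) at_bot \<and> (\<Phi> \<longlongrightarrow> \<kappa>) at_top"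
proof -
  have p0: "0 \<le> \<phi> x" for x using front_pos[of x] by simp
  obtain L where L: "L > 0" "\<And>u v. \<bar>g u - g v\<bar> \<le> L * \<bar>u - v\<bar>" using g_lipschitz by blast
  define k where "k = exp (- rb c * (c * h))"
  define L' where "L' = max L 1"
  have L': "L' \<ge> 1" "\<And>u. u \<ge> 0 \<Longrightarrow> g u \<le> L' * u"
  proof -
    show "g u \<le> L' * u" if "u \<ge> 0" for u
    proof -
      have "g u \<le> L * u" using L(2)[of u 0] that by simp
      also have "\<dots> \<le> L' * u" using that by (intro mult_right_mono) (auto simp: L'_def)
      finally show ?thesis .
    qed
  qed (simp add: L'_def)
  have ch: "c * h \<ge> 0" using front_speed_pos h by simp
  have k: "0 < k" "k \<le> 1" using ch ra_rb(2)[of c] by (auto simp: k_def)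
  define A where "A = Top c en"
  define \<Phi> where "\<Phi> = Top c A"
  note e = en_facts
  have A: "0 \<le> A z" "A z \<le> \<kappa>" "continuous_on UNIV A" "mono A" "(A \<longlongrightarrow> 0) at_bot" "(A \<longlongrightarrow> \<kappa>) at_top" for z
    using Top_facts[OF e(6,2,7)] Top_facts(5)[OF e(6,2,7,5)] Top_facts(6)[OF e(6,2,7,4)] e(1) unfolding A_def by auto
  have Am: "A \<in> borel_measurable borel" by (rule borel_measurable_continuous_onI[OF A(3)])
  have P: "0 \<le> \<Phi> z" "\<Phi> z \<le> \<kappa>" "continuous_on UNIV \<Phi>" "mono \<Phi>" "(\<Phi> \<longlongrightarrow> 0) at_bot" "(\<Phi> \<longlongrightarrow> \<kappa>) at_top" for z
    using Top_facts[OF Am A(1,2)] Top_facts(5)[OF Am A(1,2,6)] Top_facts(6)[OF Am A(1,2,5)] A(4) unfolding \<Phi>_def by auto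
  have Ae: "A z \<le> en z" for z
  proof (rule env_ge[OF p0])
    fix t assume "z \<le> t"
    then have "A z \<le> A t" using A(4) by (rule monoD[rotated])
    also have "A t \<le> Top c \<phi> t" unfolding A_def by (rule Top_mono[OF e(6,2) front_meas front_le e(3)])
    finally show "A z \<le> \<phi> t" by (simp add: front_fix)
  qed
  have PA: "\<Phi> z \<le> A z" for z unfolding \<Phi>_def
    by (subst (2) A_def) (rule Top_mono[OF Am A(1) e(6,7) Ae])
  \<comment> \<open>The operator shrinks the multiple of \<phi> at most by L': r g (\<phi>) / L'
    \<le> r \<phi> \<le> g (r \<phi>), since g lies above the diagonal on [0, \<kappa>].\<close>
  have scale: "r / L' * \<phi> z \<le> Top c \<psi> z"
    if "\<psi> \<in> borel_measurable borel" "\<And>x. \<psi> x \<le> \<kappa>" "\<And>x. r * \<phi> x \<le> \<psi> x" "0 < r" "r \<le> 1" for r \<psi> z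
  proof -
    have f: "(\<lambda>x. g (\<phi> (x - c * h))) \<in> borel_measurable borel" "\<And>x. 0 \<le> g (\<phi> (x - c * h))"
      "\<And>x. g (\<phi> (x - c * h)) \<le> \<kappa>"
      using src_meas[OF front_meas] p0 front_le by (auto intro!: g_nonneg g_le_kap)
    have r: "0 \<le> r / L'" "r / L' \<le> 1" using that L' by auto
    have psi0: "0 \<le> \<psi> x" for x using that(3)[of x] mult_nonneg_nonneg[of r "\<phi> x"] p0[of x] that(4) by linarith
    have "r / L' * Top c \<phi> z = Kop c (\<lambda>x. r / L' * g (\<phi> (x - c * h))) z"
      unfolding Top_def by (rule Kop_scale[OF f r(1), symmetric])
    also have "\<dots> \<le> Top c \<psi> z" unfolding Top_def
    proof (rule Kop_mono[where B=\<kappa>])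
      fix x
      show "r / L' * g (\<phi> (x - c * h)) \<le> \<kappa>"
        using f(2,3)[of x] r mult_mono[of "r / L'" 1 "g (\<phi> (x - c * h))" \<kappa>] by simp
      have "r / L' * g (\<phi> (x - c * h)) \<le> r / L' * (L' * \<phi> (x - c * h))"
        using L'(2) p0 r by (intro mult_left_mono) auto
      also have "\<dots> = r * \<phi> (x - c * h)" using L'(1) by simp
      also have "\<dots> \<le> g (r * \<phi> (x - c * h))"
      proof (rule g_ge)
        show "0 \<le> r * \<phi> (x - c * h)" using p0 that by simp
        show "r * \<phi> (x - c * h) \<le> \<kappa>" using that(2,3)[of "x - c * h"] by linarith
      qed
      also have "\<dots> \<le> g (\<psi> (x - c * h))" by (intro gmono that)
      finally show "r / L' * g (\<phi> (x - c * h)) \<le> g (\<psi> (x - c * h))" .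
      show "0 \<le> r / L' * g (\<phi> (x - c * h))" using r(1) f(2) by (rule mult_nonneg_nonneg)
    qed (use f src_meas that(1,2) psi0 in \<open>auto intro!: g_nonneg g_le_kap\<close>)
    finally show ?thesis by (simp add: front_fix)
  qed
  have kA: "k / L' * \<phi> z \<le> A z" for z unfolding A_def
    by (rule scale) (use e k env_lower in \<open>auto simp: k_def\<close>)
  have kL: "0 < k / L'" "k / L' \<le> 1" using k L' by auto
  have kP: "k / L' / L' * \<phi> z \<le> \<Phi> z" for z unfolding \<Phi>_def
    by (rule scale) (use Am A kL kA in auto)
  have kLL: "0 < k / L' / L'" using k L' by auto
  have Ppos: "0 < \<Phi> z" for z using kP[of z] mult_pos_pos[OF kLL front_pos[of z]] by linarith
  have Plt: "\<Phi> z < \<kappa>" for z using PA[of z] Ae[of z] e(3)[of z] front_less[of z] by linarith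
  obtain y1 y2 where y: "\<And>z. (\<Phi> has_real_derivative y1 z) (at z)"
    "\<And>z. (y1 has_real_derivative y2 z) (at z)"
    "\<And>z. y2 z - c * y1 z - \<Phi> z = - g (A (z - c * h))"  "\<And>z. y2 z \<le> rb c * y1 z"
    "\<And>z. y1 z \<le> rb c * \<Phi> z"
    using Top_ode[OF A(3,1,2), of c] A(4) unfolding \<Phi>_def by blast
  have y1n: "y1 z \<ge> 0" for z by (rule mono_deriv_nonneg[OF P(4) y(1)])
  have y1p: "y1 z > 0" for z by (rule strict_deriv_pos[OF y(1,2,4) y1n P(6) Plt])
  have sup: "y2 z - c * y1 z - \<Phi> z \<le> - g (\<Phi> (z - c * h))" for z
    using y(3)[of z] gmono[OF PA[of "z - c * h"]] by simp
  show ?thesis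
    by (rule exI[of _ \<Phi>], rule exI[of _ y1], rule exI[of _ y2], rule exI[of _ "k / L' / L'"], intro conjI allI)
       (use kLL y sup y1p Ppos Plt kP P(5,6) in auto)
qed

end

end

section \<open>Decay of pushed fronts\<close>

lemma powr_scale_exp:
  fixes b :: real
  assumes "b > 0"
  shows "(b * exp y) powr (1 + \<theta>) = b * b powr \<theta> * exp ((1 + \<theta>) * y)"
proof -
  have "(b * exp y) powr (1 + \<theta>) = b powr (1 + \<theta>) * exp (y * (1 + \<theta>))"
    using assms by (simp add: powr_mult exp_powr_real)
  also have "b powr (1 + \<theta>) = b * b powr \<theta>" using assms by (simp add: powr_add)
  finally show ?thesis by (simp add: mult.commute)
qed

section \<open>Glued supersolutions, truncated subsolutions, slower fronts\<close>

context monostable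
begin

text \<open>At a positive maximum of Top c r - r the function r coincides with p on z < 0 or with q
  on z > z1. The smooth piece lies above r nearby and at the delayed point, so it can be tested in
  place of r. This is why p \<le> q is asked on the whole delay window left of z1.\<close>

lemma glued_supersolution:
  fixes p p1 p2 q q1 q2 :: "real \<Rightarrow> real"
  assumes c: "c > 0" and z1: "z1 < 0"
    and p: "\<And>z. (p has_real_derivative p1 z) (at z)" "\<And>z. (p1 has_real_derivative p2 z) (at z)"
    and q: "\<And>z. (q has_real_derivative q1 z) (at z)" "\<And>z. (q1 has_real_derivative q2 z) (at z)"
    and p_super: "\<And>z. z \<le> 0 \<Longrightarrow> p2 z - c * p1 z - p z \<le> - g (p (z - c * h))"
    and q_super: "\<And>z. z \<ge> z1 \<Longrightarrow> q2 z - c * q1 z - q z \<le> - g (q (z - c * h))"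
    and pq: "\<And>z. z1 - c * h \<le> z \<Longrightarrow> z \<le> z1 \<Longrightarrow> p z \<le> q z" and qp: "q 0 \<le> p 0"
    and mp: "mono p" and mq: "mono q" and p0: "\<And>z. 0 \<le> p z" and qB: "\<And>z. q z \<le> B"
    and limp: "(p \<longlongrightarrow> 0) at_bot" and limq: "(q \<longlongrightarrow> S) at_top" and S: "S \<ge> \<kappa>"
  defines "r \<equiv> \<lambda>z. if z \<le> z1 then p z else if z \<le> 0 then min (p z) (q z) else q z"
  shows "mono r" "r z \<le> max (p 0) B" "(r \<longlongrightarrow> 0) at_bot" "Top c r z \<le> r z"
proof -
  have ch: "c * h \<ge> 0" using c h by simp
  have rp: "r x \<le> p x" if "x \<le> 0" for x using that by (simp add: r_def)
  have rq: "r x \<le> q x" if "x \<ge> z1 - c * h" for x using pq[of x] that by (auto simp: r_def)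
  have q0: "0 \<le> q x" if "x \<ge> z1" for x
    using p0[of z1] pq[of z1] ch monoD[OF mq that] by simp
  have r0: "0 \<le> r x" for x using p0[of x] q0[of x] z1 by (auto simp: r_def)
  show mr: "mono r"
  proof (rule monoI)
    fix x y :: real assume xy: "x \<le> y"
    have pxy: "p x \<le> p y" "q x \<le> q y" using mp mq xy by (auto dest: monoD)
    have "p x \<le> q y" if "x \<le> z1" "z1 \<le> y"
    proof -
      have "p x \<le> p z1" "q z1 \<le> q y" using monoD[OF mp that(1)] monoD[OF mq that(2)] by auto
      then show ?thesis using pq[of z1] ch by simp
    qed
    then show "r x \<le> r y" using xy pxy z1 unfolding r_def by auto
  qed
  show rB: "r x \<le> max (p 0) B" for x
  proof (cases "x \<le> 0")
    case True
    then show ?thesis using rp[OF True] monoD[OF mp True] by simp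
  next
    case False
    then show ?thesis using qB[of x] z1 by (simp add: r_def)
  qed
  have ev: "\<forall>\<^sub>F x in at_bot. r x = p x"
    using eventually_le_at_bot[of z1] by eventually_elim (simp add: r_def)
  show limr: "(r \<longlongrightarrow> 0) at_bot" using tendsto_cong[OF ev] limp by simp
  have ev': "\<forall>\<^sub>F x in at_top. r x = q x"
    using eventually_gt_at_top[of 0] by eventually_elim (use z1 in \<open>simp add: r_def\<close>)
  have limr': "(r \<longlongrightarrow> S) at_top" using tendsto_cong[OF ev'] limq by simp
  have pc: "continuous_on A p" and qc: "continuous_on A q" for A
    using p(1) q(1) by (meson DERIV_continuous_on has_field_derivative_at_within)+
  have rc: "continuous_on UNIV r"
  proof -
    have "continuous_on ({z1..0} \<union> {0..}) (\<lambda>z. if z \<le> 0 then min (p z) (q z) else q z)"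
      by (rule continuous_on_If) (use qp z1 in \<open>auto intro!: continuous_intros pc qc\<close>)
    moreover have "{z1..0} \<union> {0..} = {z1..}" using z1 by auto
    ultimately have "continuous_on {z1..} (\<lambda>z. if z \<le> 0 then min (p z) (q z) else q z)" by simp
    then have "continuous_on ({..z1} \<union> {z1..}) r" unfolding r_def
      by (intro continuous_on_If pc) (use z1 pq[of z1] ch in auto)
    moreover have "{..z1} \<union> {z1..} = UNIV" by auto
    ultimately show ?thesis by simp
  qed
  have rm: "r \<in> borel_measurable borel" by (rule borel_measurable_continuous_onI[OF rc])
  obtain y1 y2 where y: "\<And>z. (Top c r has_real_derivative y1 z) (at z)"
    "\<And>z. (y1 has_real_derivative y2 z) (at z)" "\<And>z. y2 z - c * y1 z - Top c r z = - g (r (z - c * h))"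
    using Top_ode[OF rc r0 rB, of c] by blast
  define y where "y = Top c r"
  note yy = y[folded y_def]
  have yc: "continuous_on UNIV y" unfolding y_def by (rule Top_facts(3)[OF rm r0 rB])
  have limy: "(y \<longlongrightarrow> 0) at_bot" "(y \<longlongrightarrow> g S) at_top" unfolding y_def
    using Top_facts(6)[OF rm r0 rB limr] Top_facts(5)[OF rm r0 rB limr'] by auto
  \<comment> \<open>Makes the difference tend to a nonpositive value at \<infinity>, so that a
    positive supremum is attained.\<close>
  have gS: "g S \<le> S" using g_less[of S] S by (cases "S = \<kappa>") auto
  show "Top c r z \<le> r z"
  proof (rule ccontr)
    assume "\<not> ?thesis"
    then have wz: "y z - r z > 0" by (simp add: y_def)
    have l1: "((\<lambda>x. y x - r x) \<longlongrightarrow> 0 - 0) at_bot" by (intro tendsto_diff limy limr)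
    have l2: "((\<lambda>x. y x - r x) \<longlongrightarrow> g S - S) at_top" by (intro tendsto_diff limy limr')
    obtain M where M: "\<And>x. x \<le> M \<Longrightarrow> y x - r x < y z - r z"
      using order_tendstoD(2)[OF l1, of "y z - r z"] wz by (auto simp: eventually_at_bot_linorder)
    obtain N where N: "\<And>x. x \<ge> N \<Longrightarrow> y x - r x < y z - r z"
      using order_tendstoD(2)[OF l2, of "y z - r z"] wz gS by (auto simp: eventually_at_top_linorder)
    have "\<exists>z0. \<forall>x. y x - r x \<le> y z0 - r z0"
      by (rule attains_max_real[of _ N z M]) (use M N less_imp_le yc rc in \<open>auto intro!: continuous_intros\<close>)
    then obtain z0 where z0: "\<And>x. y x - r x \<le> y z0 - r z0" by blast
    have pos: "y z0 > r z0" using z0[of z] wz by simp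
    \<comment> \<open>The seam conditions leave only these cases: up to z1 the function is p, from 0
      on it is q, and in between it is one of them.\<close>
    consider "z0 < 0" "r z0 = p z0" | "z1 < z0" "r z0 = q z0"
      using z1 pq[of z1] qp unfolding r_def by (smt (verit) min_def)
    then show False
    proof cases
      case 1
      have "\<forall>\<^sub>F x in nhds z0. x \<in> {..<0}" using 1 by (intro eventually_nhds_in_open) auto
      then have ev: "\<forall>\<^sub>F x in nhds z0. y x - p x \<le> y z0 - p z0"
      proof eventually_elim
        case (elim x)
        then show ?case using z0[of x] rp[of x] 1 by simp
      qed
      have d1: "\<forall>\<^sub>F x in nhds z0. ((\<lambda>x. y x - p x) has_real_derivative y1 x - p1 x) (at x)"
        by (intro always_eventually allI DERIV_diff yy p)
      have d2: "((\<lambda>x. y1 x - p1 x) has_real_derivative y2 z0 - p2 z0) (at z0)"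
        by (intro DERIV_diff yy p)
      have e: "y1 z0 = p1 z0" "y2 z0 \<le> p2 z0" using local_max_derivatives[OF d1 d2 ev] by auto
      have "g (r (z0 - c * h)) \<le> g (p (z0 - c * h))" using 1 ch by (intro gmono rp) simp
      then have "y z0 \<le> p z0" using yy(3)[of z0] e p_super[of z0] 1 by simp
      then show False using pos 1 by simp
    next
      case 2
      have "\<forall>\<^sub>F x in nhds z0. x \<in> {z1<..}" using 2 by (intro eventually_nhds_in_open) auto
      then have ev: "\<forall>\<^sub>F x in nhds z0. y x - q x \<le> y z0 - q z0"
      proof eventually_elim
        case (elim x)
        then show ?case using z0[of x] rq[of x] 2 ch by simp
      qed
      have d1: "\<forall>\<^sub>F x in nhds z0. ((\<lambda>x. y x - q x) has_real_derivative y1 x - q1 x) (at x)"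
        by (intro always_eventually allI DERIV_diff yy q)
      have d2: "((\<lambda>x. y1 x - q1 x) has_real_derivative y2 z0 - q2 z0) (at z0)"
        by (intro DERIV_diff yy q)
      have e: "y1 z0 = q1 z0" "y2 z0 \<le> q2 z0" using local_max_derivatives[OF d1 d2 ev] by auto
      have "g (r (z0 - c * h)) \<le> g (q (z0 - c * h))" using 2 by (intro gmono rq) simp
      then have "y z0 \<le> q z0" using yy(3)[of z0] e q_super[of z0] 2 by simp
      then show False using pos 2 by simp
    qed
  qed
qed

text \<open>On exponentials the linearised operator multiplies by the characteristic function; the
  delayed term is split off so that the true nonlinearity can replace it.\<close>

lemma two_exp_ode:
  fixes a b l n c :: real
  shows "((\<lambda>z. a * exp (n * z) + b * exp (l * z)) has_real_derivative a * n * exp (n * z) + b * l * exp (l * z)) (at z)"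
    "((\<lambda>z. a * n * exp (n * z) + b * l * exp (l * z)) has_real_derivative a * n^2 * exp (n * z) + b * l^2 * exp (l * z)) (at z)"
    "(a * n^2 * exp (n * z) + b * l^2 * exp (l * z)) - c * (a * n * exp (n * z) + b * l * exp (l * z))
       - (a * exp (n * z) + b * exp (l * z))
     = a * X n c * exp (n * z) + b * X l c * exp (l * z)
       - g0 * (a * exp (n * (z - c * h)) + b * exp (l * (z - c * h)))"
proof -
  show "((\<lambda>z. a * exp (n * z) + b * exp (l * z)) has_real_derivative a * n * exp (n * z) + b * l * exp (l * z)) (at z)"
    "((\<lambda>z. a * n * exp (n * z) + b * l * exp (l * z)) has_real_derivative a * n^2 * exp (n * z) + b * l^2 * exp (l * z)) (at z)"
    by (auto intro!: derivative_eq_intros simp: power2_eq_square)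
  have e: "exp (m * (z - c * h)) = exp (m * z) * exp (- m * c * h)" for m
    by (simp add: algebra_simps flip: exp_add)
  show "(a * n^2 * exp (n * z) + b * l^2 * exp (l * z)) - c * (a * n * exp (n * z) + b * l * exp (l * z))
       - (a * exp (n * z) + b * exp (l * z))
     = a * X n c * exp (n * z) + b * X l c * exp (l * z)
       - g0 * (a * exp (n * (z - c * h)) + b * exp (l * (z - c * h)))"
    unfolding e chi_def by (simp add: algebra_simps)
qed

lemma exp_tendsto_at_bot: "n > 0 \<Longrightarrow> ((\<lambda>z::real. exp (n * z)) \<longlongrightarrow> 0) at_bot"
  by (rule filterlim_compose[OF exp_at_bot])
     (rule filterlim_tendsto_pos_mult_at_bot[OF tendsto_const _ filterlim_ident])

text \<open>The negative term with the faster rate n yields a reserve of order exp (n z), because X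
  n c < 0. It pays for the Hoelder error, which is of order exp ((1 + \<theta>) l z) and hence no
  larger for z < 0.\<close>

lemma truncated_subsolution:
  assumes c: "c > 0" and l: "0 < l" "l < n" "n \<le> (1 + \<theta>) * l" and X: "X l c = 0" "X n c \<le> - s" "s > 0"
    and H: "C > 0" "0 < \<theta>" "\<theta> \<le> 1" "\<And>u. 0 \<le> u \<Longrightarrow> u \<le> d \<Longrightarrow> \<bar>g u - g0 * u\<bar> \<le> C * u powr (1 + \<theta>)"
    and b: "0 < b" "b \<le> d" "C * b powr \<theta> \<le> s" and z1: "z1 < 0"
  defines "v \<equiv> \<lambda>z. max 0 (b * exp (l * z) - b * exp (- (n - l) * z1) * exp (n * z))"
  shows "v \<in> borel_measurable borel" "0 \<le> v z" "v z \<le> b * exp (l * z)" "z \<ge> z1 \<Longrightarrow> v z = 0" "z < z1 \<Longrightarrow> v z > 0"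
    "v z \<le> Top c v z"
proof -
  \<comment> \<open>Places the zero of w exactly at z1; z1 < 0 gives K \<ge> 1.\<close>
  define K where "K = exp (- (n - l) * z1)"
  define w where "w = (\<lambda>z. (- b * K) * exp (n * z) + b * exp (l * z))"
  have vw: "v z = max 0 (w z)" for z by (simp add: v_def w_def K_def)
  have K: "K \<ge> 1" using l z1 by (simp add: K_def mult_nonpos_nonpos)
  have wf: "w z = b * exp (l * z) * (1 - exp ((n - l) * (z - z1)))" for z
    unfolding w_def K_def by (simp add: algebra_simps flip: exp_add)
  have wpos: "w z > 0 \<longleftrightarrow> z < z1" for z
    unfolding wf using b l by (simp add: zero_less_mult_iff mult_less_0_iff)
  have wle: "w z \<le> b * exp (l * z)" for z
    using b K by (simp add: w_def)
  have wc: "continuous_on A w" for A unfolding w_def by (intro continuous_intros)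
  have vc: "continuous_on UNIV v" unfolding vw by (intro continuous_intros wc)
  show vm: "v \<in> borel_measurable borel" by (rule borel_measurable_continuous_onI[OF vc])
  show v0: "0 \<le> v z" for z by (simp add: vw)
  show vle: "v z \<le> b * exp (l * z)" for z using wle[of z] b by (simp add: vw)
  show vz: "z \<ge> z1 \<Longrightarrow> v z = 0" for z using wpos[of z] by (simp add: vw)
  show vp: "z < z1 \<Longrightarrow> v z > 0" for z using wpos[of z] by (simp add: vw)
  have vb: "v z \<le> b" for z
  proof (cases "z \<ge> z1")
    case True then show ?thesis using vz b by simp
  next
    case False
    then have "l * z \<le> 0" using l z1 by (simp add: mult_nonneg_nonpos)
    then have "b * exp (l * z) \<le> b * 1" using b by (intro mult_left_mono) auto
    then show ?thesis using vle[of z] by simp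
  qed
  obtain y1 y2 where y: "\<And>z. (Top c v has_real_derivative y1 z) (at z)"
    "\<And>z. (y1 has_real_derivative y2 z) (at z)" "\<And>z. y2 z - c * y1 z - Top c v z = - g (v (z - c * h))"
    using Top_ode[OF vc v0 vb, of c] by blast
  define y where "y = Top c v"
  note yy = y[folded y_def]
  have y0: "0 \<le> y z" for z unfolding y_def by (rule Top_facts(1)[OF vm v0 vb])
  have yc: "continuous_on UNIV y" unfolding y_def by (rule Top_facts(3)[OF vm v0 vb])
  have ch: "c * h \<ge> 0" using c h by simp
  show "v z \<le> Top c v z"
  proof (rule ccontr)
    assume "\<not> ?thesis"
    then have wz: "v z - y z > 0" by (simp add: y_def)
    have "((\<lambda>x. b * exp (l * x)) \<longlongrightarrow> b * 0) at_bot" by (intro tendsto_intros exp_tendsto_at_bot l)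
    then obtain M where M: "\<And>x. x \<le> M \<Longrightarrow> b * exp (l * x) < v z - y z"
      using order_tendstoD(2)[of "\<lambda>x. b * exp (l * x)" "b * 0" at_bot "v z - y z"] wz
      by (auto simp: eventually_at_bot_linorder)
    have "\<exists>z0. \<forall>x. v x - y x \<le> v z0 - y z0"
    proof (rule attains_max_real[of _ z1 z M])
      show "continuous_on UNIV (\<lambda>x. v x - y x)" by (intro continuous_intros vc yc)
      show "v x - y x \<le> v z - y z" if "x \<ge> z1" for x using vz[OF that] y0[of x] wz by linarith
      show "v x - y x \<le> v z - y z" if "x \<le> M" for x using vle[of x] M[OF that] y0[of x] by linarith
    qed
    then obtain z0 where z0: "\<And>x. v x - y x \<le> v z0 - y z0" by blast
    have pos: "v z0 > y z0" using z0[of z] wz by simp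
    then have "v z0 > 0" using y0[of z0] by linarith
    \<comment> \<open>A positive difference forces v z0 > 0, so the maximum lies left of z1, where v
      is the smooth function w.\<close>
    then have zz: "z0 < z1" using vz[of z0] by (cases "z0 < z1") auto
    have vw0: "v x = w x" if "x < z1" for x using wpos[of x] that by (simp add: vw)
    define dw where "dw = (\<lambda>z. (- b * K) * n * exp (n * z) + b * l * exp (l * z))"
    define ddw where "ddw = (\<lambda>z. (- b * K) * n^2 * exp (n * z) + b * l^2 * exp (l * z))"
    have "\<forall>\<^sub>F x in nhds z0. x \<in> {..<z1}" using zz by (intro eventually_nhds_in_open) auto
    then have ev: "\<forall>\<^sub>F x in nhds z0. w x - y x \<le> w z0 - y z0"
    proof eventually_elim
      case (elim x)
      then show ?case using z0[of x] vw0[of x] vw0[OF zz] by simp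
    qed
    have d1: "\<forall>\<^sub>F x in nhds z0. ((\<lambda>x. w x - y x) has_real_derivative dw x - y1 x) (at x)"
      unfolding w_def dw_def by (intro always_eventually allI DERIV_diff yy two_exp_ode(1))
    have d2: "((\<lambda>x. dw x - y1 x) has_real_derivative ddw z0 - y2 z0) (at z0)"
      unfolding dw_def ddw_def by (intro DERIV_diff yy two_exp_ode(2))
    have e: "dw z0 = y1 z0" "ddw z0 \<le> y2 z0" using local_max_derivatives[OF d1 d2 ev] by auto
    define u where "u = v (z0 - c * h)"
    have uw: "u = w (z0 - c * h)" unfolding u_def using zz ch by (intro vw0) simp
    have u0: "0 \<le> u" "u \<le> b * exp (l * z0)"
    proof -
      show "0 \<le> u" unfolding u_def by (rule v0)
      have "u \<le> b * exp (l * (z0 - c * h))" unfolding u_def by (rule vle)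
      also have "\<dots> \<le> b * exp (l * z0)" using b l ch by (intro mult_left_mono) auto
      finally show "u \<le> b * exp (l * z0)" .
    qed
    have ud: "u \<le> d" using vb[of "z0 - c * h"] b unfolding u_def by linarith
    have "u powr (1 + \<theta>) \<le> (b * exp (l * z0)) powr (1 + \<theta>)" using u0 H by (intro powr_mono2) auto
    also have "\<dots> = b * b powr \<theta> * exp ((1 + \<theta>) * l * z0)"
      using powr_scale_exp[OF b(1), of "l * z0" \<theta>] by (simp add: mult.assoc)
    also have "\<dots> \<le> b * b powr \<theta> * exp (n * z0)"
      using b l zz z1 mult_right_mono_neg[OF l(3), of z0] by (intro mult_left_mono) auto
    finally have "C * u powr (1 + \<theta>) \<le> C * (b * b powr \<theta> * exp (n * z0))" using H by (intro mult_left_mono) auto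
    also have "\<dots> = (C * b powr \<theta>) * (b * exp (n * z0))" by simp
    also have "\<dots> \<le> s * (b * exp (n * z0))" using b by (intro mult_right_mono) auto
    also have "\<dots> \<le> K * (s * (b * exp (n * z0)))" using K b X by simp
    finally have Cu: "C * u powr (1 + \<theta>) \<le> s * b * K * exp (n * z0)" by (simp add: mult_ac)
    have eq: "ddw z0 - c * dw z0 - w z0 = (- b * K) * X n c * exp (n * z0) - g0 * u"
      using two_exp_ode(3)[of "- b * K" n z0 b l c] X(1) unfolding ddw_def dw_def w_def uw by simp
    have "(b * K) * (- X n c) * exp (n * z0) \<ge> (b * K) * s * exp (n * z0)"
      using b K X by (intro mult_right_mono mult_left_mono) auto
    then have "ddw z0 - c * dw z0 - w z0 \<ge> s * b * K * exp (n * z0) - g0 * u" unfolding eq by (simp add: mult_ac)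
    moreover have "g u \<ge> g0 * u - C * u powr (1 + \<theta>)" using H(4)[OF u0(1) ud] by linarith
    ultimately have "ddw z0 - c * dw z0 - w z0 \<ge> - g u" using Cu by linarith
    then have "w z0 \<le> y z0" using e yy(3)[of z0] by (simp add: u_def)
    then show False using pos vw0[OF zz] by simp
  qed
qed

text \<open>Since \<open>\<phi>\<close> is not \<open>O(exp (\<nu> z))\<close>, a translate \<open>F\<close> of the monotone supersolution exceeds
  \<open>2 a exp (\<nu> z)\<close> far to the left, while \<open>F 0 = a / 2\<close>. Hence \<open>p = a exp (\<nu> z) + b exp (l z)\<close> on the left can be
  glued to \<open>Q = (1 + \<rho>) F (\<zeta> z)\<close> on the right. Both are supersolutions for a speed \<open>c' < c\<close>: \<open>p\<close> because
  \<open>X \<nu> c' < 0 = X l c'\<close>, and \<open>Q\<close> because the factor and the distortion \<open>\<zeta>\<close> of the argument make it strict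
  for \<open>c\<close>. The term \<open>b exp (l z)\<close> leaves room for a nontrivial subsolution below.\<close>

lemma slower_wavefront:
  assumes front: "wavefront g h \<kappa> c \<phi>"
    and H: "C > 0" "0 < \<theta>" "\<theta> \<le> 1" "dH > 0" "\<And>u. 0 \<le> u \<Longrightarrow> u \<le> dH \<Longrightarrow> \<bar>g u - g0 * u\<bar> \<le> C * u powr (1 + \<theta>)"
    and l1: "0 < l1" "l1 < \<nu>" "X l1 c = 0" "X \<nu> c < 0" "\<nu> \<le> (1 + \<theta>) * l1"
    and slow: "\<And>D z0. \<exists>z\<le>z0. \<phi> z > D * exp (\<nu> * z)"
  shows "\<exists>c'<c. \<exists>\<psi>. wavefront g h \<kappa> c' \<psi>"
proof -
  have c0: "c > 0" by (rule front_speed_pos[OF front])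
  have ch: "c * h \<ge> 0" using c0 h by simp
  have nu: "\<nu> > 0" using l1 by simp
  define \<beta> where "\<beta> = rb c"
  have \<beta>: "\<beta> > 0" by (simp only: \<beta>_def ra_rb(2))
  obtain \<Phi> \<Phi>1 \<Phi>2 k where P: "k > 0" "\<And>z. (\<Phi> has_real_derivative \<Phi>1 z) (at z)"
    "\<And>z. (\<Phi>1 has_real_derivative \<Phi>2 z) (at z)" "\<And>z. \<Phi>2 z - c * \<Phi>1 z - \<Phi> z \<le> - g (\<Phi> (z - c * h))"
    "\<And>z. \<Phi>1 z > 0" "\<And>z. \<Phi>2 z \<le> \<beta> * \<Phi>1 z" "\<And>z. \<Phi>1 z \<le> \<beta> * \<Phi> z"
    "\<And>z. 0 < \<Phi> z" "\<And>z. \<Phi> z < \<kappa>" "\<And>z. k * \<phi> z \<le> \<Phi> z" "(\<Phi> \<longlongrightarrow> 0) at_bot" "(\<Phi> \<longlongrightarrow> \<kappa>) at_top"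
    using monotone_supersolution[OF front] unfolding \<beta>_def[symmetric] by blast
  have Pc: "continuous_on A \<Phi>" for A
    using P(2) by (meson DERIV_continuous_on has_field_derivative_at_within)
  \<comment> \<open>Half of the negative characteristic value: \<open>X \<nu> c' < - s\<close>
    survives for speeds c' close to c.\<close>
  define s where "s = - X \<nu> c / 2"
  have s: "s > 0" using l1 by (simp add: s_def)
  \<comment> \<open>So small that values up to 2 a lie in the Hoelder range and the error
    coefficient 2 C (2 a)^\<theta> is at most s; moreover the level a / 2 is taken by
    \<Phi>.\<close>
  define a where "a = min (min (\<kappa> / 2) (dH / 2)) ((s / (2 * C)) powr (1 / \<theta>) / 2)"
  have a: "a > 0" "a \<le> \<kappa> / 2" "2 * a \<le> dH" "2 * a \<le> (s / (2 * C)) powr (1 / \<theta>)"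
    using kap H s by (auto simp: a_def)
  have aC: "2 * (C * (2 * a) powr \<theta>) \<le> s"
  proof -
    have "(2 * a) powr \<theta> \<le> ((s / (2 * C)) powr (1 / \<theta>)) powr \<theta>"
      using a H by (intro powr_mono2) auto
    also have "\<dots> = s / (2 * C)" using s H by (simp add: powr_powr)
    finally have "2 * C * (2 * a) powr \<theta> \<le> 2 * C * (s / (2 * C))" using H by (intro mult_left_mono) auto
    then show ?thesis using H by simp
  qed
  have "\<exists>x0. \<Phi> x0 = a / 2"
  proof -
    obtain x1 where x1: "\<Phi> x1 < a / 2"
      using order_tendstoD(2)[OF P(11), of "a / 2"] a by (auto simp: eventually_at_bot_linorder)
    obtain x2 where x2: "\<And>x. x \<ge> x2 \<Longrightarrow> \<Phi> x > a / 2"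
      using order_tendstoD(1)[OF P(12), of "a / 2"] a kap by (auto simp: eventually_at_top_linorder)
    have "\<exists>x. x1 \<le> x \<and> x \<le> max x1 x2 \<and> \<Phi> x = a / 2"
      by (rule IVT') (use x1 x2[of "max x1 x2"] Pc in auto)
    then show ?thesis by blast
  qed
  then obtain x0 where x0: "\<Phi> x0 = a / 2" by blast
  define F where "F = (\<lambda>z. \<Phi> (z + x0))"
  define F1 where "F1 = (\<lambda>z. \<Phi>1 (z + x0))"
  define F2 where "F2 = (\<lambda>z. \<Phi>2 (z + x0))"
  have dF: "(F has_real_derivative F1 z) (at z)" "(F1 has_real_derivative F2 z) (at z)" for z
    using P(2,3)[of "z + x0"] unfolding F_def F1_def F2_def DERIV_shift by auto
  have F: "F2 z - c * F1 z - F z \<le> - g (F (z - c * h))" "F1 z > 0" "F2 z \<le> \<beta> * F1 z" "F1 z \<le> \<beta> * \<kappa>"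
    "0 < F z" "F z < \<kappa>" for z
  proof -
    have "\<beta> * \<Phi> (z + x0) \<le> \<beta> * \<kappa>" using \<beta> P(9) by (simp add: less_imp_le)
    then show "F1 z \<le> \<beta> * \<kappa>" unfolding F1_def using P(7)[of "z + x0"] by linarith
    have "z - c * h + x0 = z + x0 - c * h" by simp
    then show "F2 z - c * F1 z - F z \<le> - g (F (z - c * h))"
      unfolding F_def F1_def F2_def using P(4)[of "z + x0"] by (simp only:)
  qed (use P in \<open>auto simp: F_def F1_def F2_def\<close>)
  have F1c: "continuous_on A F1" for A
    using dF by (meson DERIV_continuous_on has_field_derivative_at_within)
  have Fmono: "F x \<le> F y" if "x \<le> y" for x y
    by (rule DERIV_nonneg_imp_nondecreasing[OF that]) (use dF(1) F(2) less_imp_le in blast)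
  have F0: "F 0 = a / 2" by (simp add: F_def x0)
  have Ftop: "(F \<longlongrightarrow> \<kappa>) at_top" unfolding F_def using lim_shift(1)[OF P(12), of "- x0"] by simp
  \<comment> \<open>The factor exp (\<nu> c h) makes the inequality at y0 enough for the whole
    window [y0, y0 + c h], as F is nondecreasing; the offset 1 keeps z1 negative.\<close>
  obtain y0 where y0: "y0 \<le> - (c * h) - 1" "F y0 \<ge> 2 * a * exp (\<nu> * (c * h)) * exp (\<nu> * y0)"
  proof -
    define D where "D = 2 * a * exp (\<nu> * (c * h)) * exp (- \<nu> * x0) / k"
    obtain z where z: "z \<le> x0 - (c * h) - 1" "\<phi> z > D * exp (\<nu> * z)" using slow by blast
    have "k * (D * exp (\<nu> * z)) \<le> k * \<phi> z" using z P(1) by simp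
    also have "\<dots> \<le> F (z - x0)" using P(10) by (simp add: F_def)
    also have "k * (D * exp (\<nu> * z)) = 2 * a * exp (\<nu> * (c * h)) * (exp (- \<nu> * x0) * exp (\<nu> * z))"
      using P(1) by (simp add: D_def)
    also have "exp (- \<nu> * x0) * exp (\<nu> * z) = exp (\<nu> * (z - x0))" by (simp add: algebra_simps flip: exp_add)
    finally show ?thesis using that[of "z - x0"] z by simp
  qed
  define z1 where "z1 = y0 + c * h"
  have z1: "z1 < 0" "y0 \<le> z1" "y0 < 0" using y0 ch by (auto simp: z1_def)
  have Fp: "2 * a * exp (\<nu> * z) \<le> F z" if "y0 \<le> z" "z \<le> z1" for z
  proof -
    have "2 * a * exp (\<nu> * z) \<le> 2 * a * exp (\<nu> * z1)" using that a nu by simp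
    also have "\<dots> = 2 * a * exp (\<nu> * (c * h)) * exp (\<nu> * y0)" by (simp add: z1_def algebra_simps flip: exp_add)
    also have "\<dots> \<le> F z" using y0(2) Fmono[OF that(1)] by linarith
    finally show ?thesis .
  qed
  define q where "q = (gk + 1) / 2"
  have q: "0 < q" "q < 1" using gk0 gk1 by (auto simp: q_def)
  obtain d1 where d1: "d1 > 0" "\<And>x y. \<bar>x - \<kappa>\<bar> \<le> d1 \<Longrightarrow> \<bar>y - \<kappa>\<bar> \<le> d1 \<Longrightarrow> \<bar>g x - g y\<bar> \<le> q * \<bar>x - y\<bar>"
  proof (rule local_slope[of \<kappa> "(1 - gk) / 2"])
    fix d assume "d > 0" "\<And>x y. \<bar>x - \<kappa>\<bar> \<le> d \<Longrightarrow> \<bar>y - \<kappa>\<bar> \<le> d \<Longrightarrow> \<bar>g x - g y\<bar> \<le> (gk + (1 - gk) / 2) * \<bar>x - y\<bar>"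
    moreover have "gk + (1 - gk) / 2 = q" by (simp add: q_def field_simps)
    ultimately show thesis using that[of d] by simp
  qed (use gk1 in auto)
  obtain N0 where N0: "N0 \<ge> 0" "\<And>z. z \<ge> N0 \<Longrightarrow> F (z - c * h) \<ge> \<kappa> - d1" "\<And>z. z \<ge> N0 \<Longrightarrow> F (z - c * h) \<ge> \<kappa> / 2"
  proof -
    have "max (\<kappa> - d1) (\<kappa> / 2) < \<kappa>" using d1 kap by simp
    from order_tendstoD(1)[OF Ftop this] obtain N where "\<And>z. z \<ge> N \<Longrightarrow> F z > max (\<kappa> - d1) (\<kappa> / 2)"
      by (auto simp: eventually_at_top_linorder)
    then have N: "F z \<ge> \<kappa> - d1" "F z \<ge> \<kappa> / 2" if "z \<ge> N" for z
      using that by (meson less_imp_le max.bounded_iff max_less_iff_conj)+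
    show ?thesis
      by (rule that[of "max 0 (N + c * h)"]) (use N in auto)
  qed
  \<comment> \<open>Near \<kappa> the slope q < 1 puts g ((1 + \<rho>) G) below (1 + \<rho>) g G by
    at least s0 \<rho>; this is the margin to the right of N0.\<close>
  define s0 where "s0 = \<kappa> / 2 * (1 - q)"
  have s0: "s0 > 0" using kap q by (simp add: s0_def)
  \<comment> \<open>3 \<beta> covers the second-order error of the distortion, F2 (2 e + e^2) \<le>
    3 \<beta> e F1; the extra 2 leaves the gain - 2 e F1.\<close>
  define R where "R = 3 * \<beta> + 2"
  have R: "R > 0" using \<beta> by (simp add: R_def)
  \<comment> \<open>Gluing needs Q \<le> p at 0: F \<eta> < 3 a / 4, multiplied by 1 + \<rho> \<le>
    4 / 3, stays below a.\<close>
  obtain \<eta> where \<eta>: "\<eta> > 0" "F \<eta> < 3 * a / 4"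
  proof -
    have "isCont F 0" using dF(1) DERIV_isCont by blast
    then have "(F \<longlongrightarrow> F 0) (at_right 0)" unfolding isCont_def using filterlim_at_split by blast
    moreover have "F 0 < 3 * a / 4" using F0 a by simp
    ultimately have "\<forall>\<^sub>F x in at_right 0. F x < 3 * a / 4" by (rule order_tendstoD(2))
    then obtain b where b: "b > 0" "\<And>y. 0 < y \<Longrightarrow> y < b \<Longrightarrow> F y < 3 * a / 4"
      unfolding eventually_at_right_field by auto
    show ?thesis by (rule that[of "b / 2"]) (use b in auto)
  qed
  define E0 where "E0 = exp (- R * y0)"
  have E0: "E0 > 0" by (simp add: E0_def)
  define \<epsilon> where "\<epsilon> = min (\<eta> / E0) (1 / (R * E0))"
  have \<epsilon>: "\<epsilon> > 0" "\<epsilon> * E0 \<le> \<eta>" "\<epsilon> * R * E0 \<le> 1"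
  proof -
    show "\<epsilon> > 0" using \<eta> E0 R by (simp add: \<epsilon>_def)
    have "\<epsilon> \<le> \<eta> / E0" "\<epsilon> \<le> 1 / (R * E0)" by (simp_all add: \<epsilon>_def)
    then show "\<epsilon> * E0 \<le> \<eta>" "\<epsilon> * R * E0 \<le> 1" using E0 R by (simp_all add: pos_le_divide_eq mult.assoc)
  qed
  \<comment> \<open>\<zeta> fixes y0, has slope 1 + e with e decaying at rate R, and moves points to
    the right by at most \<eta>; the choice of \<epsilon> ensures this bound and e \<le> 1 to the
    right of y0.\<close>
  define \<zeta> where "\<zeta> = (\<lambda>z. z + \<epsilon> * (E0 - exp (- R * z)))"
  define e where "e = (\<lambda>z. \<epsilon> * R * exp (- R * z))"
  have e0: "e z > 0" for z using \<epsilon> R by (simp add: e_def)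
  have e1: "e z \<le> 1" if "z \<ge> y0" for z
  proof -
    have "exp (- R * z) \<le> E0" unfolding E0_def using that R by simp
    then have "\<epsilon> * R * exp (- R * z) \<le> \<epsilon> * R * E0" using \<epsilon>(1) R by (intro mult_left_mono) auto
    then show ?thesis using \<epsilon>(3) unfolding e_def by linarith
  qed
  have ede: "e y \<le> e x" if "x \<le> y" for x y using that \<epsilon>(1) R by (simp add: e_def)
  have dz: "(\<zeta> has_real_derivative 1 + e z) (at z)" for z
    unfolding \<zeta>_def e_def by (auto intro!: derivative_eq_intros simp: algebra_simps)
  have de: "(e has_real_derivative - R * e z) (at z)" for z
    unfolding e_def by (auto intro!: derivative_eq_intros simp: algebra_simps)
  have zge: "z \<le> \<zeta> z" if "z \<ge> y0" for z
  proof -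
    have "exp (- R * z) \<le> E0" unfolding E0_def using that R by simp
    then show ?thesis using \<epsilon>(1) by (simp add: \<zeta>_def)
  qed
  have zle: "\<zeta> z \<le> z + \<eta>" for z
  proof -
    have "\<epsilon> * (E0 - exp (- R * z)) \<le> \<epsilon> * E0" using \<epsilon>(1) by (intro mult_left_mono) auto
    then show ?thesis using \<epsilon>(2) by (simp add: \<zeta>_def)
  qed
  have zmono: "\<zeta> x \<le> \<zeta> y" if "x \<le> y" for x y
  proof -
    have "\<epsilon> * (E0 - exp (- R * x)) \<le> \<epsilon> * (E0 - exp (- R * y))"
      using that \<epsilon>(1) R by (intro mult_left_mono) auto
    then show ?thesis using that by (simp add: \<zeta>_def)
  qed
  \<comment> \<open>Concavity of \<zeta>: a delay t becomes at least (1 + e) t, which can make up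
    for the shorter delay c' h.\<close>
  have zstep: "\<zeta> (z - t) \<le> \<zeta> z - t - e z * t" if "t \<ge> 0" for z t
  proof -
    have "exp (- R * (z - t)) = exp (- R * z) * exp (R * t)" by (simp add: algebra_simps flip: exp_add)
    moreover have "exp (R * t) \<ge> 1 + R * t" by (rule exp_ge_add_one_self)
    then have "exp (- R * z) * exp (R * t) \<ge> exp (- R * z) * (1 + R * t)" by (intro mult_left_mono) auto
    ultimately have "exp (- R * (z - t)) \<ge> exp (- R * z) + R * t * exp (- R * z)" by (simp add: algebra_simps)
    then have "\<epsilon> * exp (- R * (z - t)) \<ge> \<epsilon> * (exp (- R * z) + R * t * exp (- R * z))"
      using \<epsilon>(1) by (intro mult_left_mono) auto
    then show ?thesis by (simp add: \<zeta>_def e_def algebra_simps)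
  qed
  obtain p0 where p0: "p0 > 0" "\<And>x. z1 \<le> x \<Longrightarrow> x \<le> N0 + \<eta> \<Longrightarrow> p0 \<le> F1 x"
  proof -
    have "\<exists>x\<in>{z1..N0 + \<eta>}. \<forall>y\<in>{z1..N0 + \<eta>}. F1 x \<le> F1 y"
      by (rule continuous_attains_inf) (use z1 N0 \<eta> F1c in auto)
    then obtain x where "\<forall>y\<in>{z1..N0 + \<eta>}. F1 x \<le> F1 y" by blast
    then show ?thesis using that[of "F1 x"] F(2) by auto
  qed
  obtain L where L: "L > 0" "\<And>u v. \<bar>g u - g v\<bar> \<le> L * \<bar>u - v\<bar>" using g_lipschitz by blast
  define eN where "eN = e N0"
  have eN: "eN > 0" using e0 by (simp add: eN_def)
  \<comment> \<open>Small enough for (1 + \<rho>) F to stay within d1 of \<kappa> far right, and for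
    the loss L \<rho> \<kappa> not to exceed the gain eN p0 on the compact middle part.\<close>
  define \<rho> where "\<rho> = min (1/3) (min (d1 / \<kappa>) (eN * p0 / (L * \<kappa>)))"
  have \<rho>: "\<rho> > 0" "\<rho> \<le> 1/3" "\<rho> * \<kappa> \<le> d1" "L * \<rho> * \<kappa> \<le> eN * p0"
  proof -
    show "\<rho> > 0" using d1 kap eN p0 L by (simp add: \<rho>_def)
    show "\<rho> \<le> 1/3" unfolding \<rho>_def by (rule min.cobounded1)
    have "\<rho> \<le> d1 / \<kappa>" "\<rho> \<le> eN * p0 / (L * \<kappa>)" by (auto simp: \<rho>_def)
    then show "\<rho> * \<kappa> \<le> d1" "L * \<rho> * \<kappa> \<le> eN * p0" using kap L by (simp_all add: pos_le_divide_eq mult_ac)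
  qed
  define P1 where "P1 = \<beta> * \<kappa>"
  have P1: "P1 > 0" using \<beta> kap by (simp add: P1_def)
  obtain \<delta>X where dX: "\<delta>X > 0" "\<And>c'. \<bar>c' - c\<bar> < \<delta>X \<Longrightarrow> X \<nu> c' < - s"
  proof -
    have "isCont (\<lambda>c'. X \<nu> c') c" using chi_cont_c[of UNIV \<nu>] by (simp add: continuous_on_eq_continuous_at)
    moreover have "X \<nu> c < - s" using l1(4) by (simp add: s_def)
    ultimately have "\<forall>\<^sub>F c' in at c. X \<nu> c' < - s" unfolding isCont_def by (intro order_tendstoD(2)) auto
    then obtain d where "d > 0" "\<And>c'. c' \<noteq> c \<Longrightarrow> \<bar>c' - c\<bar> < d \<Longrightarrow> X \<nu> c' < - s"
      unfolding eventually_at by (auto simp: dist_real_def)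
    then show ?thesis using that[of d] \<open>X \<nu> c < - s\<close> by metis
  qed
  \<comment> \<open>In order: the characteristic value at \<nu> stays below - s; c' \<ge> c / 2; the
    speed loss is at most the gain eN; the lost delay \<delta> h is covered by e c' h; right of N0
    the loss stays below s0 \<rho>.\<close>
  define \<delta> where "\<delta> = min (min (\<delta>X / 2) (c / 2)) (min (min eN (eN * c / 2)) (s0 * \<rho> / (2 * P1 * (1 + L * h))))"
  have LH: "1 + L * h > 0" using L h by (simp add: add_pos_nonneg)
  have \<delta>: "\<delta> > 0" "\<delta> < \<delta>X" "\<delta> \<le> c / 2" "\<delta> \<le> eN" "\<delta> \<le> eN * c / 2" "2 * P1 * (1 + L * h) * \<delta> \<le> s0 * \<rho>"
  proof -
    have "2 * P1 * (1 + L * h) > 0" using P1 LH by simp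
    then have "s0 * \<rho> / (2 * P1 * (1 + L * h)) > 0" using s0 \<rho> by simp
    then show "\<delta> > 0" using dX c0 eN by (simp add: \<delta>_def)
    have "\<delta> \<le> \<delta>X / 2" unfolding \<delta>_def by (simp only: min_le_iff_disj order_refl simp_thms)
    then show "\<delta> < \<delta>X" using dX by linarith
    show "\<delta> \<le> c / 2" "\<delta> \<le> eN" "\<delta> \<le> eN * c / 2"
      unfolding \<delta>_def by (simp_all only: min_le_iff_disj order_refl simp_thms)
    have "\<delta> \<le> s0 * \<rho> / (2 * P1 * (1 + L * h))" by (simp add: \<delta>_def)
    then show "2 * P1 * (1 + L * h) * \<delta> \<le> s0 * \<rho>"
      using \<open>2 * P1 * (1 + L * h) > 0\<close> by (simp add: pos_le_divide_eq mult_ac)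
  qed
  define c' where "c' = c - \<delta>"
  have c': "0 < c'" "c' < c" "c / 2 \<le> c'" using \<delta> c0 by (auto simp: c'_def)
  have c'h: "0 \<le> c' * h" "c' * h \<le> c * h" using c' h by (auto intro: mult_right_mono)
  have Xn: "X \<nu> c' < - s" by (rule dX(2)) (use \<delta> in \<open>simp add: c'_def\<close>)
  \<comment> \<open>Lowering the speed makes the characteristic function positive at l1 and leaves
    it negative at \<nu>, so a zero lies strictly between.\<close>
  obtain l where l: "l1 < l" "l < \<nu>" "X l c' = 0"
  proof -
    have "X l1 c' > 0" using chi_mono_c[of c' c l1] c' l1 by simp
    moreover have "X \<nu> c' < 0" using Xn s by linarith
    ultimately obtain x where "l1 \<le> x" "x \<le> \<nu>" "X x c' = 0"
      using IVT2'[of "\<lambda>z. X z c'" \<nu> 0 l1] chi_cont_z l1 by force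
    then show ?thesis using that[of x] \<open>X l1 c' > 0\<close> \<open>X \<nu> c' < 0\<close> by (metis less_irrefl order_less_le)
  qed
  have l0: "0 < l" and lnu: "\<nu> \<le> (1 + \<theta>) * l"
  proof -
    show "0 < l" using l l1 by simp
    have "(1 + \<theta>) * l1 \<le> (1 + \<theta>) * l" using l H by (intro mult_left_mono) auto
    then show "\<nu> \<le> (1 + \<theta>) * l" using l1(5) by linarith
  qed
  \<comment> \<open>Then b \<le> a exp (\<nu> z) for z \<ge> y0, so on the delay window p is at most
    2 a exp (\<nu> z).\<close>
  define b where "b = a * exp (\<nu> * y0)"
  have b: "0 < b" "b \<le> a"
  proof -
    show "0 < b" using a by (simp add: b_def)
    have "exp (\<nu> * y0) \<le> 1" using nu z1 by (simp add: mult_nonneg_nonpos)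
    then show "b \<le> a" using a by (simp add: b_def)
  qed
  define p where "p = (\<lambda>z. a * exp (\<nu> * z) + b * exp (l * z))"
  define p1 where "p1 = (\<lambda>z. a * \<nu> * exp (\<nu> * z) + b * l * exp (l * z))"
  define p2 where "p2 = (\<lambda>z. a * \<nu>^2 * exp (\<nu> * z) + b * l^2 * exp (l * z))"
  have dp: "(p has_real_derivative p1 z) (at z)" "(p1 has_real_derivative p2 z) (at z)" for z
    unfolding p_def p1_def p2_def by (rule two_exp_ode)+
  have mp: "mono p" unfolding p_def
    using a b nu l0 by (intro monoI add_mono mult_left_mono) auto
  have ppos: "0 < p z" for z using a b by (simp add: p_def add_pos_pos)
  have ple: "p z \<le> 2 * a * exp (l * z)" if "z \<le> 0" for z
  proof -
    have "exp (\<nu> * z) \<le> exp (l * z)" using that l by (simp add: mult_right_mono_neg)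
    then have "a * exp (\<nu> * z) \<le> a * exp (l * z)" using a by (intro mult_left_mono) auto
    moreover have "b * exp (l * z) \<le> a * exp (l * z)" using b by (intro mult_right_mono) auto
    ultimately show ?thesis unfolding p_def by linarith
  qed
  have p_super: "p2 z - c' * p1 z - p z \<le> - g (p (z - c' * h))" if z: "z \<le> 0" for z
  proof -
    define u where "u = p (z - c' * h)"
    have u0: "0 \<le> u" using ppos by (simp add: u_def less_imp_le)
    have "u \<le> p z" unfolding u_def using c'h by (intro monoD[OF mp]) simp
    then have uz: "u \<le> 2 * a * exp (l * z)" using ple[OF z] by linarith
    have "exp (l * z) \<le> 1" using l0 z by (simp add: mult_nonneg_nonpos)
    then have "2 * a * exp (l * z) \<le> 2 * a * 1" using a by (intro mult_left_mono) auto
    then have ud: "u \<le> dH" using uz a by linarith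
    have "u powr (1 + \<theta>) \<le> (2 * a * exp (l * z)) powr (1 + \<theta>)" using u0 uz H by (intro powr_mono2) auto
    also have "\<dots> = 2 * a * (2 * a) powr \<theta> * exp ((1 + \<theta>) * l * z)"
      using powr_scale_exp[of "2 * a" "l * z" \<theta>] a by (simp add: mult.assoc)
    also have "\<dots> \<le> 2 * a * (2 * a) powr \<theta> * exp (\<nu> * z)"
      using a z mult_right_mono_neg[OF lnu, of z] by (intro mult_left_mono) auto
    finally have "C * u powr (1 + \<theta>) \<le> C * (2 * a * (2 * a) powr \<theta> * exp (\<nu> * z))"
      using H by (intro mult_left_mono) auto
    also have "\<dots> = 2 * (C * (2 * a) powr \<theta>) * (a * exp (\<nu> * z))" by simp
    also have "\<dots> \<le> s * (a * exp (\<nu> * z))" using aC a by (intro mult_right_mono) auto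
    finally have Cu: "C * u powr (1 + \<theta>) \<le> s * (a * exp (\<nu> * z))" .
    have "p2 z - c' * p1 z - p z = a * X \<nu> c' * exp (\<nu> * z) - g0 * u"
      using two_exp_ode(3)[of a \<nu> z b l c'] l(3) unfolding p_def p1_def p2_def u_def by simp
    moreover have "a * X \<nu> c' * exp (\<nu> * z) \<le> - s * (a * exp (\<nu> * z))"
    proof -
      have "X \<nu> c' * (a * exp (\<nu> * z)) \<le> - s * (a * exp (\<nu> * z))" using Xn a by (intro mult_right_mono) auto
      then show ?thesis by (simp add: mult_ac)
    qed
    moreover have "g u \<le> g0 * u + C * u powr (1 + \<theta>)" using H(5)[OF u0 ud] by linarith
    ultimately show ?thesis using Cu unfolding u_def by linarith
  qed
  define Q where "Q = (\<lambda>z. (1 + \<rho>) * F (\<zeta> z))"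
  define Q1 where "Q1 = (\<lambda>z. (1 + \<rho>) * (F1 (\<zeta> z) * (1 + e z)))"
  define Q2 where "Q2 = (\<lambda>z. (1 + \<rho>) * (F2 (\<zeta> z) * (1 + e z)^2 + F1 (\<zeta> z) * (- R * e z)))"
  have dQ: "(Q has_real_derivative Q1 z) (at z)" for z
    unfolding Q_def Q1_def by (intro DERIV_cmult DERIV_chain2[OF dF(1) dz])
  have dQ1: "(Q1 has_real_derivative Q2 z) (at z)" for z
  proof -
    have "((\<lambda>z. F1 (\<zeta> z) * (1 + e z)) has_real_derivative F2 (\<zeta> z) * (1 + e z) * (1 + e z) + (0 + - R * e z) * F1 (\<zeta> z)) (at z)"
      by (intro DERIV_mult DERIV_chain2[OF dF(2) dz] DERIV_add DERIV_const de)
    then have "((\<lambda>z. F1 (\<zeta> z) * (1 + e z)) has_real_derivative F2 (\<zeta> z) * (1 + e z)^2 + F1 (\<zeta> z) * (- R * e z)) (at z)"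
      by (rule DERIV_cong) (simp add: power2_eq_square mult_ac)
    then show ?thesis unfolding Q1_def Q2_def by (rule DERIV_cmult)
  qed
  have Q_super: "Q2 z - c' * Q1 z - Q z \<le> - g (Q (z - c' * h))" if z: "z \<ge> z1" for z
  proof -
    let ?E = "e z" and ?y = "\<zeta> z"
    define G where "G = F (?y - c * h)"
    have G: "0 < G" "G < \<kappa>" using F by (auto simp: G_def)
    have E: "0 < ?E" "?E \<le> 1" using e0 e1 z z1 by auto
    have f2: "F2 ?y * (2 * ?E + ?E^2) \<le> \<beta> * F1 ?y * (3 * ?E)"
    proof -
      have "F2 ?y * (2 * ?E + ?E^2) \<le> \<beta> * F1 ?y * (2 * ?E + ?E^2)"
        using F(3) E by (intro mult_right_mono) auto
      also have "\<dots> \<le> \<beta> * F1 ?y * (3 * ?E)"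
      proof (rule mult_left_mono)
        have "?E^2 \<le> ?E" using E by (simp add: power2_eq_square mult_left_le)
        then show "2 * ?E + ?E^2 \<le> 3 * ?E" by simp
        show "0 \<le> \<beta> * F1 ?y" using \<beta> F(2)[of ?y] by simp
      qed
      finally show ?thesis .
    qed
    \<comment> \<open>The left side of the profile equation at speed c' for F composed with \<zeta>.
      Expanding around speed c leaves \<delta> F1 as a loss and multiples of e F1 as gains.\<close>
    define W where "W = F2 ?y * (1 + ?E)^2 + F1 ?y * (- R * ?E) - c' * (F1 ?y * (1 + ?E)) - F ?y"
    have "W = (F2 ?y - c * F1 ?y - F ?y) + F2 ?y * (2 * ?E + ?E^2) + F1 ?y * (\<delta> - c' * ?E - R * ?E)"
      unfolding W_def c'_def by (simp add: power2_eq_square algebra_simps)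
    also have "\<dots> \<le> - g G + \<beta> * F1 ?y * (3 * ?E) + F1 ?y * (\<delta> - c' * ?E - R * ?E)"
      using F(1)[of ?y] f2 unfolding G_def by linarith
    also have "\<dots> = - g G + F1 ?y * (\<delta> - 2 * ?E) - F1 ?y * (c' * ?E)" by (simp add: R_def algebra_simps)
    also have "\<dots> \<le> - g G + F1 ?y * (\<delta> - 2 * ?E)"
      using F(2)[of ?y] c'(1) E(1) by simp
    finally have W: "W \<le> - g G + F1 ?y * (\<delta> - 2 * ?E)" .
    have eqQ: "Q2 z - c' * Q1 z - Q z = (1 + \<rho>) * W"
      unfolding Q_def Q1_def Q2_def W_def by (simp add: algebra_simps)
    define T where "T = F (\<zeta> (z - c' * h))"
    have zs: "\<zeta> (z - c' * h) \<le> ?y - c' * h - ?E * (c' * h)" by (rule zstep[OF c'h(1)])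
    show ?thesis
    \<comment> \<open>Left of N0 the distortion provides the gain and the factor 1 + \<rho> causes
      the loss; to the right the roles are exchanged.\<close>
    proof (cases "z \<le> N0")
      case True
      have En: "eN \<le> ?E" unfolding eN_def by (rule ede[OF True])
      have "\<delta> \<le> eN * c'"
      proof -
        have "eN * (c / 2) \<le> eN * c'" using c'(3) eN by (intro mult_left_mono) auto
        then show ?thesis using \<delta>(5) by simp
      qed
      also have "\<dots> \<le> ?E * c'" using En c'(1) by (intro mult_right_mono) auto
      finally have "\<delta> * h \<le> ?E * c' * h" using h by (rule mult_right_mono)
      then have "\<zeta> (z - c' * h) \<le> ?y - c * h" using zs by (simp add: c'_def algebra_simps)
      then have TG: "T \<le> G" unfolding T_def G_def by (rule Fmono)
      have pF: "p0 \<le> F1 ?y"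
        by (rule p0(2)) (use zge[of z] z z1 zle[of z] True in linarith)+
      have "F1 ?y * (\<delta> - 2 * ?E) \<le> F1 ?y * (- eN)"
        using F(2)[of ?y] \<delta>(4) En by (intro mult_left_mono) auto
      also have "\<dots> \<le> p0 * (- eN)" using pF eN by (intro mult_right_mono_neg) auto
      finally have "W \<le> - g G - eN * p0" using W by (simp add: mult.commute)
      then have W2: "(1 + \<rho>) * W \<le> (1 + \<rho>) * (- g G - eN * p0)" using \<rho> by (intro mult_left_mono) auto
      have gG: "g G \<ge> 0" using G by (intro g_nonneg) simp
      have "g (Q (z - c' * h)) \<le> g ((1 + \<rho>) * G)"
        unfolding Q_def using TG \<rho> by (intro gmono mult_left_mono) (auto simp: T_def)
      also have "\<dots> \<le> g G + L * (\<rho> * G)"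
        using L(2)[of "(1 + \<rho>) * G" G] \<rho> G by (simp add: algebra_simps)
      also have "L * (\<rho> * G) \<le> L * \<rho> * \<kappa>" using L \<rho> G by simp
      finally have "g (Q (z - c' * h)) \<le> g G + eN * p0" using \<rho>(4) by linarith
      moreover have "\<rho> * (g G + eN * p0) \<ge> 0" using \<rho> gG eN p0 by simp
      ultimately show ?thesis using W2 eqQ by (simp add: algebra_simps)
    next
      case False
      then have zN: "N0 \<le> ?y" using zge[of z] z z1 by linarith
      have "F1 ?y * (\<delta> - 2 * ?E) \<le> F1 ?y * \<delta>" using F(2)[of ?y] E by (intro mult_left_mono) auto
      also have "\<dots> \<le> P1 * \<delta>" using F(4)[of ?y] \<delta>(1) by (intro mult_right_mono) (auto simp: P1_def)
      finally have "W \<le> - g G + P1 * \<delta>" using W by linarith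
      then have W2: "(1 + \<rho>) * W \<le> (1 + \<rho>) * (- g G + P1 * \<delta>)" using \<rho> by (intro mult_left_mono) auto
      have "\<zeta> (z - c' * h) \<le> ?y - c * h + \<delta> * h"
      proof -
        have "0 \<le> ?E * (c' * h)" using E c'h by simp
        moreover have "c' * h = c * h - \<delta> * h" by (simp add: c'_def left_diff_distrib)
        ultimately show ?thesis using zs by linarith
      qed
      then have "T \<le> F (?y - c * h + \<delta> * h)" unfolding T_def by (rule Fmono)
      also have "\<dots> \<le> G + P1 * (\<delta> * h)"
      proof -
        have dh: "0 \<le> \<delta> * h" using \<delta> h by simp
        have "F (?y - c * h + \<delta> * h) - P1 * (?y - c * h + \<delta> * h) \<le> F (?y - c * h) - P1 * (?y - c * h)"
        proof (rule DERIV_nonpos_imp_nonincreasing[where f="\<lambda>x. F x - P1 * x"])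
          show "?y - c * h \<le> ?y - c * h + \<delta> * h" using dh by simp
          fix x
          have "((\<lambda>x. F x - P1 * x) has_real_derivative F1 x - P1 * 1) (at x)"
            by (intro DERIV_diff dF DERIV_cmult DERIV_ident)
          moreover have "F1 x - P1 * 1 \<le> 0" using F(4)[of x] by (simp add: P1_def)
          ultimately show "\<exists>D. ((\<lambda>x. F x - P1 * x) has_real_derivative D) (at x) \<and> D \<le> 0" by blast
        qed
        then show ?thesis unfolding G_def by (simp add: algebra_simps)
      qed
      finally have TG: "T \<le> G + P1 * (\<delta> * h)" .
      have nonneg: "0 \<le> (1 + \<rho>) * (P1 * (\<delta> * h))" using \<rho> P1 \<delta> h by simp
      have "g (Q (z - c' * h)) \<le> g ((1 + \<rho>) * G + (1 + \<rho>) * (P1 * (\<delta> * h)))"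
      proof (rule gmono)
        have "(1 + \<rho>) * T \<le> (1 + \<rho>) * (G + P1 * (\<delta> * h))" using TG \<rho> by (intro mult_left_mono) auto
        then show "Q (z - c' * h) \<le> (1 + \<rho>) * G + (1 + \<rho>) * (P1 * (\<delta> * h))"
          unfolding Q_def T_def by (simp only: distrib_left)
      qed
      also have "\<dots> \<le> g ((1 + \<rho>) * G) + L * ((1 + \<rho>) * (P1 * (\<delta> * h)))"
        using L(2)[of "(1 + \<rho>) * G + (1 + \<rho>) * (P1 * (\<delta> * h))" "(1 + \<rho>) * G"] nonneg by simp
      also have "g ((1 + \<rho>) * G) \<le> (1 + \<rho>) * g G - s0 * \<rho>"
      proof -
        have Gk: "G \<ge> \<kappa> - d1" "G \<ge> \<kappa> / 2" using N0(2,3)[OF zN] by (auto simp: G_def)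
        have "\<rho> * G \<le> \<rho> * \<kappa>" "0 \<le> \<rho> * G" using G \<rho> by auto
        then have "\<bar>(1 + \<rho>) * G - \<kappa>\<bar> \<le> d1" "\<bar>G - \<kappa>\<bar> \<le> d1"
          using Gk G \<rho>(3) unfolding distrib_right by auto
        from d1(2)[OF this] have "g ((1 + \<rho>) * G) - g G \<le> q * (\<rho> * G)"
          using \<open>0 \<le> \<rho> * G\<close> by (simp add: algebra_simps)
        moreover have "\<rho> * G \<le> \<rho> * g G" using g_ge[of G] G \<rho> by simp
        moreover have "\<rho> * (1 - q) * (\<kappa> / 2) \<le> \<rho> * (1 - q) * G" using Gk q \<rho> by (intro mult_left_mono) auto
        ultimately show ?thesis unfolding s0_def by (simp add: algebra_simps)
      qed
      finally have gQ: "g (Q (z - c' * h)) \<le> (1 + \<rho>) * g G - s0 * \<rho> + L * ((1 + \<rho>) * (P1 * (\<delta> * h)))" by simp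
      have "(1 + \<rho>) * (P1 * (1 + L * h) * \<delta>) \<le> 2 * (P1 * (1 + L * h) * \<delta>)"
        using \<rho> P1 LH \<delta> by (intro mult_right_mono) auto
      then have "(1 + \<rho>) * (P1 * (1 + L * h) * \<delta>) \<le> s0 * \<rho>" using \<delta>(6) by (simp add: mult_ac)
      moreover have "(1 + \<rho>) * (P1 * (1 + L * h) * \<delta>) = (1 + \<rho>) * (P1 * \<delta>) + L * ((1 + \<rho>) * (P1 * (\<delta> * h)))"
        by (simp add: algebra_simps)
      moreover have "(1 + \<rho>) * (- g G + P1 * \<delta>) = - ((1 + \<rho>) * g G) + (1 + \<rho>) * (P1 * \<delta>)"
        by (simp add: algebra_simps)
      ultimately show ?thesis using gQ W2 eqQ by linarith
    qed
  qed
  define r where "r = (\<lambda>z. if z \<le> z1 then p z else if z \<le> 0 then min (p z) (Q z) else Q z)"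
  have QF: "F z \<le> Q z" if "z \<ge> y0" for z
  proof -
    have "F z \<le> F (\<zeta> z)" by (rule Fmono[OF zge[OF that]])
    also have "\<dots> \<le> (1 + \<rho>) * F (\<zeta> z)" using \<rho> F(5)[of "\<zeta> z"] by (simp add: distrib_right)
    finally show ?thesis by (simp add: Q_def)
  qed
  have pQ: "p z \<le> Q z" if "z1 - c' * h \<le> z" "z \<le> z1" for z
  proof -
    have zy: "y0 \<le> z" using that c'h unfolding z1_def by linarith
    have "b * exp (l * z) \<le> b * 1" using b l0 that z1 by (intro mult_left_mono) (auto simp: mult_nonneg_nonpos)
    also have "\<dots> \<le> a * exp (\<nu> * z)" unfolding b_def using a nu zy by simp
    finally have "p z \<le> 2 * a * exp (\<nu> * z)" by (simp add: p_def)
    also have "\<dots> \<le> F z" by (rule Fp[OF zy that(2)])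
    also have "\<dots> \<le> Q z" by (rule QF[OF zy])
    finally show ?thesis .
  qed
  have Q0: "Q 0 \<le> p 0"
  proof -
    have "F (\<zeta> 0) \<le> F \<eta>" using zle[of 0] by (intro Fmono) simp
    then have "F (\<zeta> 0) \<le> 3 * a / 4" using \<eta> by simp
    then have "(1 + \<rho>) * F (\<zeta> 0) \<le> (4/3) * (3 * a / 4)" using \<rho> F(5)[of "\<zeta> 0"] by (intro mult_mono) auto
    then show ?thesis using b by (simp add: Q_def p_def)
  qed
  have mQ: "mono Q" unfolding Q_def using \<rho> by (intro monoI mult_left_mono Fmono zmono) auto
  have QB: "Q z \<le> 2 * \<kappa>" for z
    unfolding Q_def using \<rho> F(5,6)[of "\<zeta> z"] kap by (intro mult_mono) auto
  have limp: "(p \<longlongrightarrow> 0) at_bot"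
  proof -
    have "(p \<longlongrightarrow> a * 0 + b * 0) at_bot" unfolding p_def
      by (intro tendsto_intros exp_tendsto_at_bot nu l0)
    then show ?thesis by simp
  qed
  have limQ: "(Q \<longlongrightarrow> (1 + \<rho>) * \<kappa>) at_top"
  proof -
    have "LIM z at_top. \<zeta> z :> at_top"
    proof (rule filterlim_at_top_mono[OF filterlim_ident])
      show "\<forall>\<^sub>F z in at_top. z \<le> \<zeta> z" using eventually_ge_at_top[of y0] by eventually_elim (rule zge)
    qed
    then show ?thesis unfolding Q_def by (intro tendsto_intros filterlim_compose[OF Ftop])
  qed
  have Sk: "(1 + \<rho>) * \<kappa> \<ge> \<kappa>" using \<rho> kap by (simp add: distrib_right)
  have gl: "mono r" "r z \<le> max (p 0) (2 * \<kappa>)" "(r \<longlongrightarrow> 0) at_bot" "Top c' r z \<le> r z" for z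
    unfolding r_def
    by (rule glued_supersolution[OF c'(1) z1(1) dp dQ dQ1 _ _ _ Q0 mp mQ less_imp_le[OF ppos] QB limp limQ Sk];
        fact p_super Q_super pQ)+
  \<comment> \<open>Built from the same b and l as p, hence below p, and zero from z1 on. It keeps
    the fixed point from being trivial.\<close>
  define v where "v = (\<lambda>z. max 0 (b * exp (l * z) - b * exp (- (\<nu> - l) * z1) * exp (\<nu> * z)))"
  have bC: "C * b powr \<theta> \<le> s"
  proof -
    have "b powr \<theta> \<le> (2 * a) powr \<theta>" using b H by (intro powr_mono2) auto
    then have "C * b powr \<theta> \<le> C * (2 * a) powr \<theta>" using H by simp
    moreover have "0 \<le> C * (2 * a) powr \<theta>" using H by simp
    ultimately show ?thesis using aC by linarith
  qed
  have bd: "b \<le> dH" using b a by linarith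
  have tr: "v \<in> borel_measurable borel" "0 \<le> v z" "v z \<le> b * exp (l * z)" "z \<ge> z1 \<Longrightarrow> v z = 0"
    "z < z1 \<Longrightarrow> v z > 0" "v z \<le> Top c' v z" for z
    unfolding v_def
  proof -
    note T = truncated_subsolution[OF c'(1) l0 l(2) lnu l(3) less_imp_le[OF Xn] s H(1,2,3) _ b(1) bd bC z1(1)]
    let ?v = "\<lambda>z. max 0 (b * exp (l * z) - b * exp (- (\<nu> - l) * z1) * exp (\<nu> * z))"
    show "?v \<in> borel_measurable borel" by (rule T(1)) (fact H(5))
    show "0 \<le> ?v z" by (rule T(2)) (fact H(5))
    show "?v z \<le> b * exp (l * z)" by (rule T(3)) (fact H(5))
    show "?v z = 0" if "z \<ge> z1" by (rule T(4)[OF _ that]) (fact H(5))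
    show "?v z > 0" if "z < z1" by (rule T(5)[OF _ that]) (fact H(5))
    show "?v z \<le> Top c' ?v z" by (rule T(6)) (fact H(5))
  qed
  have vr: "v z \<le> r z" for z
  proof (cases "z \<le> z1")
    case True
    have "v z \<le> b * exp (l * z)" by (rule tr(3))
    also have "\<dots> \<le> p z" using a by (simp add: p_def)
    finally show ?thesis using True by (simp add: r_def)
  next
    case False
    have "0 \<le> Q z" using \<rho> F(5)[of "\<zeta> z"] by (simp add: Q_def)
    then show ?thesis using False tr(4)[of z] ppos[of z] by (simp add: r_def)
  qed
  obtain \<psi> where \<psi>: "mono \<psi>" "\<And>z. v z \<le> \<psi> z" "\<And>z. \<psi> z \<le> r z" "Top c' \<psi> = \<psi>"
    using knaster_tarski_profile[OF tr(1,2) vr tr(6) gl(1,2,4)] by blast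
  have psipos: "0 < \<psi> z" for z
  proof -
    define y where "y = min z (z1 - 1)"
    have "0 < v y" by (rule tr(5)) (simp add: y_def)
    also have "\<dots> \<le> \<psi> y" by (rule \<psi>)
    also have "\<dots> \<le> \<psi> z" by (rule monoD[OF \<psi>(1)]) (simp add: y_def)
    finally show ?thesis .
  qed
  have "(\<psi> \<longlongrightarrow> 0) at_bot"
    by (rule tendsto_sandwich[OF _ _ tendsto_const gl(3)])
       (use psipos \<psi>(3) in \<open>auto intro!: always_eventually less_imp_le\<close>)
  then have "wavefront g h \<kappa> c' \<psi>"
    using wavefront_of_fixpoint[OF \<psi>(1) psipos order_trans[OF \<psi>(3) gl(2)] \<psi>(4)] by blast
  then show ?thesis using c'(2) by blast
qed

text \<open>Minimality of the speed rules out decay slower than exp (\<nu> z), but only for \<nu>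
  \<le> (1 + \<theta>) l1. This weak bound makes \<phi> negligible against \<delta> exp (m z) at -
  \<infinity> when m < \<nu>; the maximum principle then gives \<phi> \<le> A exp (l z) + \<delta>
  exp (m z), and \<delta> can go to 0.\<close>

lemma pushed_front_decay:
  assumes front: "wavefront g h \<kappa> c \<phi>" and cs: "c = c_star g h \<kappa>" and pushed: "c > c_sharp g h"
    and l: "lambda1 g h c < l" "l < lambda2 g h c"
  shows "\<exists>D>0. \<forall>z. \<phi> z \<le> D * exp (l * z)"
proof -
  have c0: "c > 0" by (rule front_speed_pos[OF front])
  have ch: "c * h \<ge> 0" using c0 h by simp
  obtain C \<theta> dH where H: "C > 0" "0 < \<theta>" "\<theta> \<le> 1" "dH > 0"
    "\<And>u. 0 \<le> u \<Longrightarrow> u \<le> dH \<Longrightarrow> \<bar>g u - g0 * u\<bar> \<le> C * u powr (1 + \<theta>)" using g_hoelder by blast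
  note cr = chi_roots[OF pushed]
  define l1 where "l1 = lambda1 g h c"
  have l1: "0 < l1" "X l1 c = 0" using cr by (auto simp: l1_def)
  define \<nu> where "\<nu> = min l ((1 + \<theta>) * l1)"
  have nu: "l1 < \<nu>" "\<nu> \<le> l" "\<nu> \<le> (1 + \<theta>) * l1" using l l1 H by (auto simp: \<nu>_def l1_def algebra_simps)
  have Xneg: "X x c < 0" if "l1 < x" "x \<le> l" for x using cr(4)[of x] that l by (simp add: l1_def)
  have "\<exists>D z0. \<forall>z\<le>z0. \<phi> z \<le> D * exp (\<nu> * z)"
  proof (rule ccontr)
    assume "\<not> ?thesis"
    then have slow: "\<exists>z\<le>z0. \<phi> z > D * exp (\<nu> * z)" for D z0 by (meson not_le)
    obtain c' \<psi> where c': "c' < c" "wavefront g h \<kappa> c' \<psi>"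
      using slower_wavefront[OF front H l1(1) nu(1) l1(2) Xneg[OF nu(1,2)] nu(3) slow] by blast
    have "c_star g h \<kappa> \<le> c'" unfolding c_star_def
    proof (rule cInf_lower)
      show "bdd_below {c. \<exists>\<phi>. wavefront g h \<kappa> c \<phi>}"
        by (rule bdd_belowI[of _ 0]) (auto dest!: front_speed_pos)
    qed (use c' in blast)
    then show False using c'(1) cs by simp
  qed
  then obtain D0 z0 where D0: "\<And>z. z \<le> z0 \<Longrightarrow> \<phi> z \<le> D0 * exp (\<nu> * z)" by blast
  define m where "m = (l1 + \<nu>) / 2"
  have m: "l1 < m" "m < \<nu>" "m \<le> l" using nu by (auto simp: m_def)
  \<comment> \<open>Both exponentials remain strict supersolutions when the slope g0 is raised by
    \<epsilon>, which covers the nonlinearity for small \<phi>.\<close>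
  define \<epsilon> where "\<epsilon> = min (- X l c) (- X m c) / 2"
  have \<epsilon>: "\<epsilon> > 0" "X l c + \<epsilon> < 0" "X m c + \<epsilon> < 0"
    using Xneg[of l] Xneg[of m] m nu by (auto simp: \<epsilon>_def min_def)
  obtain d where d: "d > 0" "\<And>x y. \<bar>x - 0\<bar> \<le> d \<Longrightarrow> \<bar>y - 0\<bar> \<le> d \<Longrightarrow> \<bar>g x - g y\<bar> \<le> (g0 + \<epsilon>) * \<bar>x - y\<bar>"
    by (rule local_slope[of 0 \<epsilon>]) (use \<epsilon> in auto)
  obtain z2 where z2: "\<And>z. z \<le> z2 \<Longrightarrow> \<phi> z \<le> d"
    using order_tendstoD(2)[OF front_bot[OF front] d(1)]
    by (auto simp: eventually_at_bot_linorder intro: less_imp_le)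
  have gd: "g (\<phi> z) \<le> (g0 + \<epsilon>) * \<phi> z" if "z \<le> z2" for z
    using d(2)[of "\<phi> z" 0] z2[OF that] front_pos[OF front, of z] d(1) by simp
  \<comment> \<open>Makes A exp (l z) equal to the trivial bound \<kappa> at z2.\<close>
  define A where "A = \<kappa> * exp (- l * z2)"
  have A: "A > 0" using kap by (simp add: A_def)
  obtain \<phi>1 \<phi>2 where o: "\<And>z. (\<phi> has_real_derivative \<phi>1 z) (at z)" "\<And>z. (\<phi>1 has_real_derivative \<phi>2 z) (at z)"
    "\<And>z. \<phi>2 z - c * \<phi>1 z - \<phi> z = - g (\<phi> (z - c * h))" using front_ode[OF front] by blast
  have key: "\<phi> z \<le> A * exp (l * z) + \<delta> * exp (m * z)" if z: "z \<le> z2" and \<delta>: "\<delta> > 0" for z \<delta>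
  proof (rule ccontr)
    assume ng: "\<not> ?thesis"
    define S where "S = (\<lambda>z. A * exp (l * z) + \<delta> * exp (m * z))"
    define S1 where "S1 = (\<lambda>z. A * l * exp (l * z) + \<delta> * m * exp (m * z))"
    define S2 where "S2 = (\<lambda>z. A * l^2 * exp (l * z) + \<delta> * m^2 * exp (m * z))"
    have dS: "(S has_real_derivative S1 z) (at z)" "(S1 has_real_derivative S2 z) (at z)" for z
      unfolding S_def S1_def S2_def by (rule two_exp_ode)+
    have Spos: "S z > 0" for z using A \<delta> by (simp add: S_def add_pos_pos)
    have Ssup: "S2 z - c * S1 z - S z + (g0 + \<epsilon>) * S (z - c * h) < 0" for z
    proof -
      have "exp (l * (z - c * h)) \<le> exp (l * z)" "exp (m * (z - c * h)) \<le> exp (m * z)"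
        using ch l1 m nu by auto
      then have "\<epsilon> * (A * exp (l * (z - c * h))) \<le> \<epsilon> * (A * exp (l * z))"
        "\<epsilon> * (\<delta> * exp (m * (z - c * h))) \<le> \<epsilon> * (\<delta> * exp (m * z))"
        using A \<delta> \<epsilon>(1) by simp_all
      moreover have "(X l c + \<epsilon>) * (A * exp (l * z)) < 0" "(X m c + \<epsilon>) * (\<delta> * exp (m * z)) < 0"
        using \<epsilon> A \<delta> by (auto intro!: mult_neg_pos)
      moreover have "S2 z - c * S1 z - S z = A * X l c * exp (l * z) + \<delta> * X m c * exp (m * z)
          - g0 * (A * exp (l * (z - c * h)) + \<delta> * exp (m * (z - c * h)))"
        unfolding S_def S1_def S2_def by (rule two_exp_ode)
      ultimately show ?thesis unfolding S_def by (simp add: algebra_simps)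
    qed
    have ratio: "continuous_on B (\<lambda>z. \<phi> z / S z)" for B
      by (intro continuous_intros front_cont[OF front])
         (use dS Spos in \<open>auto intro: DERIV_continuous_on has_field_derivative_at_within simp: less_imp_neq[symmetric]\<close>)
    obtain z3 where z3: "z3 \<le> z" "\<And>x. x \<le> z3 \<Longrightarrow> \<phi> x \<le> S x"
    proof -
      have "((\<lambda>x. D0 * exp ((\<nu> - m) * x)) \<longlongrightarrow> D0 * 0) at_bot"
        by (intro tendsto_intros exp_tendsto_at_bot) (use m in simp)
      then have "\<forall>\<^sub>F x in at_bot. D0 * exp ((\<nu> - m) * x) < \<delta>" using \<delta> by (intro order_tendstoD(2)[of _ "D0 * 0"]) auto
      then obtain M where M: "\<And>x. x \<le> M \<Longrightarrow> D0 * exp ((\<nu> - m) * x) < \<delta>" by (auto simp: eventually_at_bot_linorder)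
      show ?thesis
      proof (rule that[of "min z (min M z0)"])
        fix x assume x: "x \<le> min z (min M z0)"
        have "\<phi> x \<le> D0 * exp (\<nu> * x)" using D0 x by simp
        also have "\<dots> = (D0 * exp ((\<nu> - m) * x)) * exp (m * x)" by (simp add: algebra_simps flip: exp_add)
        also have "\<dots> \<le> \<delta> * exp (m * x)" using M[of x] x by (intro mult_right_mono) auto
        also have "\<dots> \<le> S x" using A by (simp add: S_def)
        finally show "\<phi> x \<le> S x" .
      qed simp
    qed
    \<comment> \<open>The quotient is at most 1 at z3 and below 1 at z2, so a maximum k > 1 lies
      inside; there \<phi> touches k S from below.\<close>
    have "\<exists>y\<in>{z3..z2}. \<forall>x\<in>{z3..z2}. \<phi> x / S x \<le> \<phi> y / S y"
      by (rule continuous_attains_sup) (use z3 z ratio in auto)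
    then obtain y where y: "z3 \<le> y" "y \<le> z2" "\<And>x. z3 \<le> x \<Longrightarrow> x \<le> z2 \<Longrightarrow> \<phi> x / S x \<le> \<phi> y / S y" by auto
    define k where "k = \<phi> y / S y"
    have "1 < \<phi> z / S z" using ng Spos[of z] by (simp add: S_def)
    then have k1: "k > 1" using y(3)[OF z3(1) z] by (simp add: k_def)
    have ky: "\<phi> y = k * S y" using Spos[of y] by (simp add: k_def)
    have le: "\<phi> x \<le> k * S x" if "x \<le> z2" for x
    proof (cases "x \<le> z3")
      case True
      then have "\<phi> x \<le> S x" by (rule z3)
      also have "\<dots> \<le> k * S x" using k1 Spos[of x] by simp
      finally show ?thesis .
    next
      case False
      then show ?thesis using y(3)[of x] that Spos[of x] by (simp add: k_def pos_divide_le_eq)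
    qed
    have "y \<noteq> z2"
    proof
      assume "y = z2"
      have "\<phi> z2 \<le> \<kappa>" by (rule front_le[OF front])
      also have "\<dots> = A * exp (l * z2)" by (simp add: A_def flip: exp_add)
      also have "\<dots> < S z2" using \<delta> by (simp add: S_def)
      finally have "\<phi> y < 1 * S y" using \<open>y = z2\<close> by simp
      also have "\<dots> < k * S y" using k1 Spos[of y] by (intro mult_strict_right_mono) auto
      finally show False using ky by simp
    qed
    then have yz: "y < z2" using y by simp
    have "\<forall>\<^sub>F x in nhds y. x \<in> {..<z2}" using yz by (intro eventually_nhds_in_open) auto
    then have ev: "\<forall>\<^sub>F x in nhds y. \<phi> x - k * S x \<le> \<phi> y - k * S y"
    proof eventually_elim
      case (elim x)
      then show ?case using le[of x] ky by simp
    qed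
    have e1: "\<forall>\<^sub>F x in nhds y. ((\<lambda>x. \<phi> x - k * S x) has_real_derivative \<phi>1 x - k * S1 x) (at x)"
      by (intro always_eventually allI DERIV_diff DERIV_cmult o dS)
    have e2: "((\<lambda>x. \<phi>1 x - k * S1 x) has_real_derivative \<phi>2 y - k * S2 y) (at y)"
      by (intro DERIV_diff DERIV_cmult o dS)
    have e: "\<phi>1 y = k * S1 y" "\<phi>2 y \<le> k * S2 y" using local_max_derivatives[OF e1 e2 ev] by auto
    have "g (\<phi> (y - c * h)) \<le> (g0 + \<epsilon>) * \<phi> (y - c * h)" using yz ch by (intro gd) simp
    also have "\<dots> \<le> (g0 + \<epsilon>) * (k * S (y - c * h))"
      using yz ch g0 \<epsilon> by (intro mult_left_mono le) auto
    finally have "0 \<le> k * S2 y - c * (k * S1 y) - k * S y + (g0 + \<epsilon>) * (k * S (y - c * h))"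
      using o(3)[of y] e ky by simp
    also have "\<dots> = k * (S2 y - c * S1 y - S y + (g0 + \<epsilon>) * S (y - c * h))" by (simp add: algebra_simps)
    also have "\<dots> < 0" using k1 Ssup[of y] by (intro mult_pos_neg) auto
    finally show False by simp
  qed
  have "\<phi> z \<le> A * exp (l * z)" for z
  proof (cases "z \<le> z2")
    case True
    show ?thesis
    proof (rule field_le_epsilon)
      fix e :: real assume "e > 0"
      then show "\<phi> z \<le> A * exp (l * z) + e" using key[OF True, of "e / exp (m * z)"] by simp
    qed
  next
    case False
    have "\<phi> z \<le> \<kappa> * 1" using front_le[OF front] by simp
    also have "\<dots> \<le> \<kappa> * exp (l * (z - z2))" using False kap l1 nu by (intro mult_left_mono) auto
    also have "\<dots> = A * exp (l * z)" by (simp add: A_def algebra_simps flip: exp_add)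
    finally show ?thesis .
  qed
  then show ?thesis using A by blast
qed

text \<open>Outside a compact interval the shifted inequality propagates by itself: on the left exp
  (l z) is a strict supersolution and \<phi> is o of it, on the right g has slope below 1. N1 and N2
  are independent of \<tau>, as the sliding argument requires.\<close>

lemma front_comparison:
  assumes front: "wavefront g h \<kappa> c \<phi>" and l: "0 < l" "l < l'" "X l c < 0"
    and D: "\<And>z. \<phi> z \<le> D * exp (l' * z)"
  shows "\<exists>N1 N2. N1 \<le> N2 \<and> (\<forall>\<tau>\<ge>0. (\<forall>z\<in>{N1..N2}. \<phi> z \<le> \<phi> (z + \<tau>)) \<longrightarrow> (\<forall>z. \<phi> z \<le> \<phi> (z + \<tau>)))"
proof -
  have c0: "c > 0" by (rule front_speed_pos[OF front])
  have ch: "c * h \<ge> 0" using c0 h by simp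
  note pos = front_pos[OF front]
  obtain \<phi>1 \<phi>2 where o: "\<And>z. (\<phi> has_real_derivative \<phi>1 z) (at z)" "\<And>z. (\<phi>1 has_real_derivative \<phi>2 z) (at z)"
    "\<And>z. \<phi>2 z - c * \<phi>1 z - \<phi> z = - g (\<phi> (z - c * h))" using front_ode[OF front] by blast
  define \<epsilon> where "\<epsilon> = - X l c / 2"
  have \<epsilon>: "\<epsilon> > 0" "X l c + \<epsilon> < 0" using l by (auto simp: \<epsilon>_def)
  obtain d0 where d0: "d0 > 0" "\<And>x y. \<bar>x - 0\<bar> \<le> d0 \<Longrightarrow> \<bar>y - 0\<bar> \<le> d0 \<Longrightarrow> \<bar>g x - g y\<bar> \<le> (g0 + \<epsilon>) * \<bar>x - y\<bar>"
    by (rule local_slope[of 0 \<epsilon>]) (use \<epsilon> in auto)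
  obtain d1 where d1: "d1 > 0" "\<And>x y. \<bar>x - \<kappa>\<bar> \<le> d1 \<Longrightarrow> \<bar>y - \<kappa>\<bar> \<le> d1 \<Longrightarrow> \<bar>g x - g y\<bar> \<le> (gk + (1 - gk) / 2) * \<bar>x - y\<bar>"
    by (rule local_slope[of \<kappa> "(1 - gk) / 2"]) (use gk1 in auto)
  obtain N1 where N1: "\<And>z. z \<le> N1 \<Longrightarrow> \<phi> z < d0"
    using order_tendstoD(2)[OF front_bot[OF front] d0(1)] by (auto simp: eventually_at_bot_linorder)
  have "\<kappa> - d1 < \<kappa>" using d1 by simp
  from order_tendstoD(1)[OF front_top[OF front] this] obtain M where M: "\<And>z. z \<ge> M \<Longrightarrow> \<kappa> - d1 < \<phi> z"
    by (auto simp: eventually_at_top_linorder)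
  define N2 where "N2 = max N1 (M + c * h)"
  have N2: "N1 \<le> N2" "\<And>z. z \<ge> N2 \<Longrightarrow> \<kappa> - d1 < \<phi> (z - c * h)" using M by (auto simp: N2_def)
  have main: "\<phi> z \<le> \<phi> (z + \<tau>)" if \<tau>: "\<tau> \<ge> 0" and mid: "\<And>z. N1 \<le> z \<Longrightarrow> z \<le> N2 \<Longrightarrow> \<phi> z \<le> \<phi> (z + \<tau>)" for z \<tau>
  proof -
    define f where "f = (\<lambda>z. \<phi> z - \<phi> (z + \<tau>))"
    define f1 where "f1 = (\<lambda>z. \<phi>1 z - \<phi>1 (z + \<tau>))"
    define f2 where "f2 = (\<lambda>z. \<phi>2 z - \<phi>2 (z + \<tau>))"
    have df: "(f has_real_derivative f1 z) (at z)" "(f1 has_real_derivative f2 z) (at z)" for z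
    proof -
      have s: "((\<lambda>z. \<phi> (z + \<tau>)) has_real_derivative \<phi>1 (z + \<tau>)) (at z)" "((\<lambda>z. \<phi>1 (z + \<tau>)) has_real_derivative \<phi>2 (z + \<tau>)) (at z)"
        using o(1,2)[of "z + \<tau>"] by (simp_all add: DERIV_shift)
      show "(f has_real_derivative f1 z) (at z)" "(f1 has_real_derivative f2 z) (at z)"
        unfolding f_def f1_def f2_def by (intro DERIV_diff o s)+
    qed
    have fode: "f2 z - c * f1 z - f z = g (\<phi> (z + \<tau> - c * h)) - g (\<phi> (z - c * h))" for z
      using o(3)[of z] o(3)[of "z + \<tau>"] unfolding f_def f1_def f2_def by (simp add: algebra_simps)
    have fc: "continuous_on A f" for A
      using df(1) by (meson DERIV_continuous_on has_field_derivative_at_within)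
    have fle: "f z < \<phi> z" for z using pos[of "z + \<tau>"] by (simp add: f_def)
    have left: "f z \<le> 0" if zN: "z \<le> N1" for z
    proof (rule ccontr)
      assume ng: "\<not> f z \<le> 0"
      \<comment> \<open>f exp (- l z) is maximised instead of f: by the faster rate l' it falls
        below m0 far to the left, so a positive maximum is attained.\<close>
      define m0 where "m0 = f z * exp (- l * z)"
      have m0: "m0 > 0" using ng by (simp add: m0_def)
      have "((\<lambda>x. D * exp ((l' - l) * x)) \<longlongrightarrow> D * 0) at_bot"
        by (intro tendsto_intros exp_tendsto_at_bot) (use l in simp)
      then have "\<forall>\<^sub>F x in at_bot. D * exp ((l' - l) * x) < m0" using m0 by (intro order_tendstoD(2)[of _ "D * 0"]) auto
      then obtain M' where M': "\<And>x. x \<le> M' \<Longrightarrow> D * exp ((l' - l) * x) < m0" by (auto simp: eventually_at_bot_linorder)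
      define z3 where "z3 = min z M'"
      have "\<exists>y\<in>{z3..N1}. \<forall>x\<in>{z3..N1}. f x * exp (- l * x) \<le> f y * exp (- l * y)"
        by (rule continuous_attains_sup) (use zN in \<open>auto simp: z3_def intro!: continuous_intros fc\<close>)
      then obtain y where y: "z3 \<le> y" "y \<le> N1" "\<And>x. z3 \<le> x \<Longrightarrow> x \<le> N1 \<Longrightarrow> f x * exp (- l * x) \<le> f y * exp (- l * y)" by auto
      define m where "m = f y * exp (- l * y)"
      have mm: "m \<ge> m0" using y(3)[of z] zN by (simp add: m_def m0_def z3_def)
      have m: "m > 0" using mm m0 by simp
      have fy: "f y = m * exp (l * y)" by (simp add: m_def mult.assoc flip: exp_add)
      have le: "f x \<le> m * exp (l * x)" if "x \<le> N1" for x
      proof -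
        have "f x * exp (- l * x) \<le> m"
        proof (cases "x \<ge> z3")
          case True then show ?thesis using y(3) that by (simp add: m_def)
        next
          case False
          have "f x * exp (- l * x) \<le> D * exp (l' * x) * exp (- l * x)"
            using fle[of x] D[of x] by (intro mult_right_mono) auto
          also have "\<dots> = D * exp ((l' - l) * x)" by (simp add: algebra_simps flip: exp_add)
          also have "\<dots> < m0" using False by (intro M') (simp add: z3_def)
          finally show ?thesis using mm by simp
        qed
        then have "f x * exp (- l * x) * exp (l * x) \<le> m * exp (l * x)" by (rule mult_right_mono) simp
        then show ?thesis by (simp add: mult.assoc flip: exp_add)
      qed
      have "f N1 \<le> 0" using mid[of N1] N2 by (simp add: f_def)
      moreover have "f y > 0" using fy m by simp
      ultimately have "y \<noteq> N1" by auto
      then have yN: "y < N1" using y by simp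
      have "\<forall>\<^sub>F x in nhds y. x \<in> {..<N1}" using yN by (intro eventually_nhds_in_open) auto
      then have ev: "\<forall>\<^sub>F x in nhds y. f x - m * exp (l * x) \<le> f y - m * exp (l * y)"
      proof eventually_elim
        case (elim x)
        then show ?case using le[of x] fy by simp
      qed
      have e1: "\<forall>\<^sub>F x in nhds y. ((\<lambda>x. f x - m * exp (l * x)) has_real_derivative f1 x - m * l * exp (l * x)) (at x)"
        by (intro always_eventually allI DERIV_diff df) (auto intro!: derivative_eq_intros)
      have e2: "((\<lambda>x. f1 x - m * l * exp (l * x)) has_real_derivative f2 y - m * l^2 * exp (l * y)) (at y)"
        by (intro DERIV_diff df) (auto intro!: derivative_eq_intros simp: power2_eq_square)
      have e: "f1 y = m * l * exp (l * y)" "f2 y \<le> m * l^2 * exp (l * y)"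
        using local_max_derivatives[OF e1 e2 ev] by auto
      define u where "u = \<phi> (y - c * h)"
      define v where "v = \<phi> (y + \<tau> - c * h)"
      have uv: "u - v \<le> m * exp (l * (y - c * h))"
        using le[of "y - c * h"] yN ch by (simp add: u_def v_def f_def algebra_simps)
      have "g u - g v \<le> (g0 + \<epsilon>) * (m * exp (l * (y - c * h)))"
      proof (cases "u \<le> v")
        case True
        then have "g u - g v \<le> 0" using gmono[of u v] by simp
        also have "0 \<le> (g0 + \<epsilon>) * (m * exp (l * (y - c * h)))" using m g0 \<epsilon> by simp
        finally show ?thesis .
      next
        case False
        have "0 < u" "u \<le> d0" "0 < v" using pos N1[of "y - c * h"] yN ch by (auto simp: u_def v_def)
        then have "g u - g v \<le> (g0 + \<epsilon>) * (u - v)" using d0(2)[of u v] False by simp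
        also have "\<dots> \<le> (g0 + \<epsilon>) * (m * exp (l * (y - c * h)))" using uv g0 \<epsilon> by (intro mult_left_mono) auto
        finally show ?thesis .
      qed
      moreover have "f2 y - c * f1 y - f y = g v - g u" using fode[of y] by (simp add: u_def v_def)
      moreover have "exp (l * (y - c * h)) = exp (l * y) * exp (- l * c * h)" by (simp add: algebra_simps flip: exp_add)
      ultimately have "0 \<le> m * l^2 * exp (l * y) - c * (m * l * exp (l * y)) - m * exp (l * y)
          + (g0 + \<epsilon>) * (m * (exp (l * y) * exp (- l * c * h)))" using e fy by simp
      also have "\<dots> = m * exp (l * y) * (X l c + \<epsilon> * exp (- l * c * h))"
        by (simp add: chi_def algebra_simps power2_eq_square)
      also have "\<dots> < 0"
      proof -
        have "\<epsilon> * exp (- l * c * h) \<le> \<epsilon> * 1" using \<epsilon> l ch by (intro mult_left_mono) (auto simp: mult.assoc)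
        then have "X l c + \<epsilon> * exp (- l * c * h) < 0" using \<epsilon> by linarith
        then show ?thesis using m by (intro mult_pos_neg) auto
      qed
      finally show False by simp
    qed
    have leftmid: "f z \<le> 0" if "z \<le> N2" for z
      using left[of z] mid[of z] that by (cases "z \<le> N1") (auto simp: f_def)
    have "f z \<le> 0"
    proof (rule ccontr)
      assume ng: "\<not> f z \<le> 0"
      have "((\<lambda>x. \<phi> x - \<phi> (x - - \<tau>)) \<longlongrightarrow> \<kappa> - \<kappa>) at_top"
        by (intro tendsto_diff front_top[OF front] lim_shift(1)[OF front_top[OF front]])
      then have "(f \<longlongrightarrow> 0) at_top" by (simp add: f_def[abs_def])
      then obtain N where N: "\<And>x. x \<ge> N \<Longrightarrow> f x < f z"
        using order_tendstoD(2)[of f 0 at_top "f z"] ng by (auto simp: eventually_at_top_linorder)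
      have "\<exists>y. \<forall>x. f x \<le> f y"
        by (rule attains_max_real[OF fc, of N z N2]) (use N leftmid ng in \<open>force intro: less_imp_le\<close>)+
      then obtain y where y: "\<And>x. f x \<le> f y" by blast
      have fy: "f y > 0" using y[of z] ng by simp
      then have yN: "y > N2" using leftmid[of y] by (cases "y > N2") auto
      have e: "f1 y = 0" "f2 y \<le> 0"
        using local_max_derivatives[OF always_eventually[OF allI[OF df(1)]] df(2) always_eventually[OF allI[OF y]]] by auto
      define u where "u = \<phi> (y - c * h)"
      define v where "v = \<phi> (y + \<tau> - c * h)"
      have uv: "u - v \<le> f y" using y[of "y - c * h"] by (simp add: u_def v_def f_def algebra_simps)
      have fg: "f y \<le> g u - g v" using fode[of y] e by (simp add: u_def v_def)
      have "u > v"
      proof (rule ccontr)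
        assume "\<not> u > v"
        then have "g u \<le> g v" by (intro gmono) simp
        then show False using fg fy by simp
      qed
      have uvr: "\<kappa> - d1 < u" "u \<le> \<kappa>" "\<kappa> - d1 < v" "v \<le> \<kappa>"
        using N2(2)[of y] N2(2)[of "y + \<tau>"] yN \<tau> front_le[OF front] by (auto simp: u_def v_def)
      define q where "q = gk + (1 - gk) / 2"
      have q: "q < 1" using gk1 by (simp add: q_def field_simps)
      have "g u - g v \<le> q * (u - v)" using d1(2)[of u v] uvr \<open>u > v\<close> by (simp add: q_def)
      also have "\<dots> < 1 * (u - v)" using q \<open>u > v\<close> by (intro mult_strict_right_mono) auto
      finally show False using fg uv by simp
    qed
    then show ?thesis by (simp add: f_def)
  qed
  show ?thesis
    by (rule exI[of _ N1], rule exI[of _ N2]) (use N2(1) main in auto)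
qed

text \<open>Sliding: let t be the least shift from which on all translates dominate. If t > 0, the
  strong maximum principle makes the inequality strict, uniformly on [N1, N2], and
  \<open>front_comparison\<close> extends slightly smaller shifts to the whole line.\<close>

lemma front_mono:
  assumes front: "wavefront g h \<kappa> c \<phi>" and l: "0 < l" "l < l'" "X l c < 0"
    and D: "\<And>z. \<phi> z \<le> D * exp (l' * z)"
  shows "mono \<phi>"
proof -
  obtain N1 N2 where N: "N1 \<le> N2"
    and cmp: "\<And>\<tau>. \<tau> \<ge> 0 \<Longrightarrow> (\<And>z. z \<in> {N1..N2} \<Longrightarrow> \<phi> z \<le> \<phi> (z + \<tau>)) \<Longrightarrow> (\<forall>z. \<phi> z \<le> \<phi> (z + \<tau>))"
    using front_comparison[OF assms] by blast
  have p0: "0 \<le> \<phi> z" for z using front_pos[OF front, of z] by simp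
  obtain \<phi>1 \<phi>2 where o: "\<And>z. (\<phi> has_real_derivative \<phi>1 z) (at z)" "\<And>z. (\<phi>1 has_real_derivative \<phi>2 z) (at z)"
    "\<And>z. \<phi>2 z - c * \<phi>1 z - \<phi> z = - g (\<phi> (z - c * h))" and "\<And>z. \<phi>1 z \<le> rb c * \<phi> z"
    using Top_ode[OF front_cont[OF front] p0 front_le[OF front], of c] unfolding front_fix[OF front] by blast
  define P1 where "P1 = rb c * \<kappa>"
  have P1: "P1 > 0" using kap ra_rb(2)[of c] by (simp add: P1_def)
  have o4: "\<phi>1 z \<le> P1" for z
  proof -
    have "rb c * \<phi> z \<le> P1" unfolding P1_def using ra_rb(2)[of c] front_le[OF front, of z] by simp
    then show ?thesis using \<open>\<phi>1 z \<le> rb c * \<phi> z\<close> by linarith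
  qed
  have lip: "\<phi> y - \<phi> x \<le> P1 * (y - x)" if "x \<le> y" for x y
  proof -
    have "\<phi> y - P1 * y \<le> \<phi> x - P1 * x"
    proof (rule DERIV_nonpos_imp_nonincreasing[OF that, where f="\<lambda>x. \<phi> x - P1 * x"])
      fix x
      have "((\<lambda>x. \<phi> x - P1 * x) has_real_derivative \<phi>1 x - P1 * 1) (at x)"
        by (intro DERIV_diff o DERIV_cmult DERIV_ident)
      then show "\<exists>D. ((\<lambda>x. \<phi> x - P1 * x) has_real_derivative D) (at x) \<and> D \<le> 0" using o4[of x] by fastforce
    qed
    then show ?thesis by (simp add: algebra_simps)
  qed
  \<comment> \<open>Asking for all larger shifts as well makes S upward closed, so every \<tau>
    above its infimum is admissible.\<close>
  define S where "S = {\<tau>. \<tau> \<ge> 0 \<and> (\<forall>\<tau>'\<ge>\<tau>. \<forall>z. \<phi> z \<le> \<phi> (z + \<tau>'))}"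
  have bdd: "bdd_below S" by (rule bdd_belowI[of _ 0]) (simp add: S_def)
  have "S \<noteq> {}"
  proof -
    have "\<exists>x\<in>{N1..N2}. \<forall>y\<in>{N1..N2}. \<phi> y \<le> \<phi> x"
      by (rule continuous_attains_sup) (use N front_cont[OF front] in auto)
    then obtain x where x: "\<And>y. y \<in> {N1..N2} \<Longrightarrow> \<phi> y \<le> \<phi> x" by blast
    obtain M where M: "\<And>y. y \<ge> M \<Longrightarrow> \<phi> x < \<phi> y"
      using order_tendstoD(1)[OF front_top[OF front] front_less[OF front, of x]] by (auto simp: eventually_at_top_linorder)
    have "max 0 (M - N1) \<in> S" unfolding S_def
    proof (intro CollectI conjI allI impI)
      fix \<tau> z assume t: "max 0 (M - N1) \<le> \<tau>"
      have "\<forall>z. \<phi> z \<le> \<phi> (z + \<tau>)"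
      proof (rule cmp)
        fix y assume y: "y \<in> {N1..N2}"
        then have "\<phi> x < \<phi> (y + \<tau>)" using t by (intro M) auto
        then show "\<phi> y \<le> \<phi> (y + \<tau>)" using x[OF y] by simp
      qed (use t in simp)
      then show "\<phi> z \<le> \<phi> (z + \<tau>)" ..
    qed simp
    then show ?thesis by blast
  qed
  define t where "t = Inf S"
  have t0: "t \<ge> 0" unfolding t_def by (rule cInf_greatest[OF \<open>S \<noteq> {}\<close>]) (simp add: S_def)
  have above: "\<phi> z \<le> \<phi> (z + \<tau>)" if tt: "\<tau> > t" for z \<tau>
  proof -
    obtain s where "s \<in> S" "s < \<tau>"
      using cInf_lessD[OF \<open>S \<noteq> {}\<close>, of \<tau>] tt unfolding t_def by blast
    then show ?thesis by (simp add: S_def)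
  qed
  have at: "\<phi> z \<le> \<phi> (z + t)" for z
  proof (rule field_le_epsilon)
    fix e :: real assume e: "e > 0"
    have "\<phi> z \<le> \<phi> (z + (t + e / P1))" by (rule above) (use e P1 in simp)
    also have "\<dots> \<le> \<phi> (z + t) + P1 * (e / P1)" using lip[of "z + t" "z + (t + e / P1)"] e P1 by simp
    finally show "\<phi> z \<le> \<phi> (z + t) + e" using P1 by simp
  qed
  have "t = 0"
  proof (rule ccontr)
    assume "t \<noteq> 0"
    then have tp: "t > 0" using t0 by simp
    have strict: "\<phi> (z + t) - \<phi> z > 0" for z
    proof (rule ccontr)
      assume "\<not> ?thesis"
      then have z: "\<phi> (z + t) - \<phi> z = 0" using at[of z] by simp
      \<comment> \<open>One contact would make \<phi> periodic with period t, which its limit 0 at -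
        \<infinity> forbids.\<close>
      have per: "\<phi> (y + t) - \<phi> y = 0" for y
      proof (rule elliptic_strong[where d="\<lambda>z. \<phi> (z + t) - \<phi> z" and ?d1.0="\<lambda>z. \<phi>1 (z + t) - \<phi>1 z"
            and ?d2.0="\<lambda>z. \<phi>2 (z + t) - \<phi>2 z" and c=c and B=\<kappa> and x=z])
        fix x
        have s: "((\<lambda>z. \<phi> (z + t)) has_real_derivative \<phi>1 (x + t)) (at x)" "((\<lambda>z. \<phi>1 (z + t)) has_real_derivative \<phi>2 (x + t)) (at x)"
          using o(1,2)[of "x + t"] by (simp_all add: DERIV_shift)
        show "((\<lambda>z. \<phi> (z + t) - \<phi> z) has_real_derivative \<phi>1 (x + t) - \<phi>1 x) (at x)" by (intro DERIV_diff s o)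
        show "((\<lambda>z. \<phi>1 (z + t) - \<phi>1 z) has_real_derivative \<phi>2 (x + t) - \<phi>2 x) (at x)" by (intro DERIV_diff s o)
        have "x + t - c * h = x - c * h + t" by simp
        then have "g (\<phi> (x - c * h)) \<le> g (\<phi> (x + t - c * h))" using at[of "x - c * h"] by (simp only: gmono)
        then show "\<phi>2 (x + t) - \<phi>2 x - c * (\<phi>1 (x + t) - \<phi>1 x) - (\<phi> (x + t) - \<phi> x) \<le> 0"
          using o(3)[of x] o(3)[of "x + t"] by (simp add: algebra_simps)
        show "\<bar>\<phi> (x + t) - \<phi> x\<bar> \<le> \<kappa>" using p0[of x] p0[of "x + t"] front_le[OF front, of x] front_le[OF front, of "x + t"] by linarith
      qed (rule z)
      have per': "\<phi> (0 - real n * t) = \<phi> 0" for n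
      proof (induction n)
        case (Suc n)
        have "\<phi> (0 - real (Suc n) * t) = \<phi> (0 - real (Suc n) * t + t)"
          using per[of "0 - real (Suc n) * t"] by (simp only: right_minus_eq)
        also have "0 - real (Suc n) * t + t = 0 - real n * t" by (simp add: algebra_simps)
        finally show ?case using Suc by simp
      qed simp
      obtain M where M: "\<And>y. y \<le> M \<Longrightarrow> \<phi> y < \<phi> 0"
        using order_tendstoD(2)[OF front_bot[OF front] front_pos[OF front, of 0]] by (auto simp: eventually_at_bot_linorder)
      obtain n where "real n * t > - M" using reals_Archimedean3[OF tp] by blast
      then have "\<phi> (0 - real n * t) < \<phi> 0" by (intro M) simp
      then show False using per'[of n] by simp
    qed
    have "\<exists>x\<in>{N1..N2}. \<forall>y\<in>{N1..N2}. \<phi> (x + t) - \<phi> x \<le> \<phi> (y + t) - \<phi> y"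
    proof (rule continuous_attains_inf)
      have "continuous_on {N1..N2} (\<lambda>x. \<phi> (x + t))"
        by (rule continuous_on_compose2[OF front_cont[OF front, of UNIV]]) (auto intro!: continuous_intros)
      then show "continuous_on {N1..N2} (\<lambda>x. \<phi> (x + t) - \<phi> x)" by (intro continuous_on_diff front_cont[OF front])
    qed (use N in auto)
    then obtain x where x: "\<And>y. y \<in> {N1..N2} \<Longrightarrow> \<phi> (x + t) - \<phi> x \<le> \<phi> (y + t) - \<phi> y" by blast
    define m where "m = \<phi> (x + t) - \<phi> x"
    have m: "m > 0" using strict by (simp add: m_def)
    \<comment> \<open>\<phi> increases at most at rate P1, so reducing the shift by e consumes at
      most the margin m.\<close>
    define e where "e = min t (m / P1)"
    have e: "e > 0" "e \<le> t" "P1 * e \<le> m"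
    proof -
      show "e > 0" using tp m P1 by (simp add: e_def)
      have "e \<le> m / P1" by (simp add: e_def)
      then show "P1 * e \<le> m" using P1 by (simp add: pos_le_divide_eq mult.commute)
    qed (simp add: e_def)
    have "t - e \<in> S" unfolding S_def
    proof (intro CollectI conjI allI impI)
      fix \<tau> z assume tau: "t - e \<le> \<tau>"
      have "\<forall>z. \<phi> z \<le> \<phi> (z + \<tau>)" if "\<tau> \<le> t"
      proof (rule cmp)
        fix y assume y: "y \<in> {N1..N2}"
        have "\<phi> (y + t) - \<phi> (y + \<tau>) \<le> P1 * ((y + t) - (y + \<tau>))" by (rule lip) (use that in simp)
        also have "\<dots> \<le> P1 * e" using tau P1 by (intro mult_left_mono) auto
        also have "\<dots> \<le> \<phi> (y + t) - \<phi> y" using e(3) x[OF y] by (simp add: m_def)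
        finally show "\<phi> y \<le> \<phi> (y + \<tau>)" by simp
      qed (use tau e in simp)
      then show "\<phi> z \<le> \<phi> (z + \<tau>)" using above[of \<tau> z] by (cases "\<tau> \<le> t") auto
    qed (use e in simp)
    then have "t \<le> t - e" unfolding t_def by (rule cInf_lower[OF _ bdd])
    then show False using e by simp
  qed
  show ?thesis
  proof (rule monoI)
    fix x y :: real assume "x \<le> y"
    then show "\<phi> x \<le> \<phi> y" using at[of x] above[of "y - x" x] \<open>t = 0\<close> by (cases "x = y") auto
  qed
qed

text \<open>A rate l' between lam and lambda2 turns the O-bound into o (exp (lam z)), and \<phi>1
  \<le> rb \<phi> passes this to the derivative. At \<infinity>, \<phi>1 exp (- rb z) being
  nonincreasing bounds \<phi>1 z by a multiple of the increment over [z - 1, z], which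
  vanishes.\<close>

lemma pushed_front_properties:
  assumes front: "wavefront g h \<kappa> c \<phi>" and cs: "c = c_star g h \<kappa>" and pushed: "c > c_sharp g h"
    and lam: "lambda1 g h c < lam" "lam < lambda2 g h c"
  shows "\<exists>\<phi>1 \<phi>2. (\<forall>z. (\<phi> has_real_derivative \<phi>1 z) (at z)) \<and> (\<forall>z. (\<phi>1 has_real_derivative \<phi>2 z) (at z)) \<and>
    (\<forall>z. \<phi>2 z - c * \<phi>1 z - \<phi> z = - g (\<phi> (z - c * h))) \<and> (\<forall>z. \<phi>1 z > 0) \<and>
    ((\<lambda>z. \<phi> z * exp (- lam * z)) \<longlongrightarrow> 0) at_bot \<and>
    ((\<lambda>z. \<phi>1 z * exp (- lam * z)) \<longlongrightarrow> 0) at_bot \<and> (\<phi>1 \<longlongrightarrow> 0) at_top"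
proof -
  note cr = chi_roots[OF pushed]
  define l' where "l' = (lam + lambda2 g h c) / 2"
  have l': "lam < l'" "l' < lambda2 g h c" "lambda1 g h c < l'" using lam by (auto simp: l'_def)
  have lam0: "lam > 0" using cr lam by simp
  obtain D where D: "D > 0" "\<And>z. \<phi> z \<le> D * exp (l' * z)"
    using pushed_front_decay[OF front cs pushed l'(3,2)] by blast
  have m: "mono \<phi>" by (rule front_mono[OF front lam0 l'(1) cr(4)[OF lam] D(2)])
  have p0: "0 \<le> \<phi> z" for z using front_pos[OF front, of z] by simp
  obtain \<phi>1 \<phi>2 where o: "\<And>z. (\<phi> has_real_derivative \<phi>1 z) (at z)" "\<And>z. (\<phi>1 has_real_derivative \<phi>2 z) (at z)"
    "\<And>z. \<phi>2 z - c * \<phi>1 z - \<phi> z = - g (\<phi> (z - c * h))" "\<And>z. \<phi>1 z \<le> rb c * \<phi> z" "\<And>z. \<phi>2 z \<le> rb c * \<phi>1 z"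
    using Top_ode[OF front_cont[OF front] p0 front_le[OF front], of c] m unfolding front_fix[OF front] by blast
  have n1: "\<phi>1 z \<ge> 0" for z by (rule mono_deriv_nonneg[OF m o(1)])
  have pos1: "\<phi>1 z > 0" for z
    by (rule strict_deriv_pos[OF o(1,2,5) n1 front_top[OF front] front_less[OF front]])
  have "((\<lambda>x. D * exp ((l' - lam) * x)) \<longlongrightarrow> D * 0) at_bot"
    by (intro tendsto_intros exp_tendsto_at_bot) (use l' in simp)
  then have Dlim: "((\<lambda>x. D * exp ((l' - lam) * x)) \<longlongrightarrow> 0) at_bot" by simp
  have lim0: "((\<lambda>z. \<phi> z * exp (- lam * z)) \<longlongrightarrow> 0) at_bot"
  proof (rule tendsto_sandwich[OF _ _ tendsto_const Dlim])
    show "\<forall>\<^sub>F z in at_bot. \<phi> z * exp (- lam * z) \<le> D * exp ((l' - lam) * z)"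
    proof (intro always_eventually allI)
      fix z
      have "\<phi> z * exp (- lam * z) \<le> D * exp (l' * z) * exp (- lam * z)" by (intro mult_right_mono D) simp
      also have "\<dots> = D * exp ((l' - lam) * z)" by (simp add: algebra_simps flip: exp_add)
      finally show "\<phi> z * exp (- lam * z) \<le> D * exp ((l' - lam) * z)" .
    qed
  qed (use p0 in simp)
  have lim1: "((\<lambda>z. \<phi>1 z * exp (- lam * z)) \<longlongrightarrow> 0) at_bot"
  proof (rule tendsto_sandwich[OF _ _ tendsto_const])
    show "((\<lambda>z. rb c * (\<phi> z * exp (- lam * z))) \<longlongrightarrow> 0) at_bot" by (rule tendsto_mult_right_zero[OF lim0])
    show "\<forall>\<^sub>F z in at_bot. \<phi>1 z * exp (- lam * z) \<le> rb c * (\<phi> z * exp (- lam * z))"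
      using o(4) by (intro always_eventually allI) (simp add: mult_right_mono flip: mult.assoc)
  qed (use n1 in simp)
  have lim2: "(\<phi>1 \<longlongrightarrow> 0) at_top"
  proof (rule tendsto_sandwich[OF _ _ tendsto_const])
    have "((\<lambda>z. exp (rb c) * (\<phi> z - \<phi> (z - 1))) \<longlongrightarrow> exp (rb c) * (\<kappa> - \<kappa>)) at_top"
      by (intro tendsto_intros front_top[OF front] lim_shift(1)[OF front_top[OF front]])
    then show "((\<lambda>z. exp (rb c) * (\<phi> z - \<phi> (z - 1))) \<longlongrightarrow> 0) at_top" by simp
    show "\<forall>\<^sub>F z in at_top. \<phi>1 z \<le> exp (rb c) * (\<phi> z - \<phi> (z - 1))"
    proof (intro always_eventually allI)
      fix z
      obtain t where t: "z - 1 < t" "t < z" "\<phi> z - \<phi> (z - 1) = (z - (z - 1)) * \<phi>1 t"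
        using MVT2[of "z - 1" z \<phi> \<phi>1] o(1) by auto
      have "\<phi>1 z * exp (- rb c * z) \<le> \<phi>1 t * exp (- rb c * t)"
      proof (rule DERIV_nonpos_imp_nonincreasing[where f="\<lambda>z. \<phi>1 z * exp (- rb c * z)"])
        fix x
        have "((\<lambda>z. \<phi>1 z * exp (- rb c * z)) has_real_derivative (\<phi>2 x - rb c * \<phi>1 x) * exp (- rb c * x)) (at x)"
          by (auto intro!: derivative_eq_intros o(2) simp: algebra_simps)
        moreover have "(\<phi>2 x - rb c * \<phi>1 x) * exp (- rb c * x) \<le> 0"
          using o(5)[of x] by (intro mult_nonpos_nonneg) auto
        ultimately show "\<exists>D. ((\<lambda>z. \<phi>1 z * exp (- rb c * z)) has_real_derivative D) (at x) \<and> D \<le> 0" by blast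
      qed (use t in simp)
      then have "\<phi>1 z * exp (- rb c * z) * exp (rb c * z) \<le> \<phi>1 t * exp (- rb c * t) * exp (rb c * z)"
        by (rule mult_right_mono) simp
      then have "\<phi>1 z \<le> \<phi>1 t * exp (rb c * (z - t))" by (simp add: mult.assoc algebra_simps flip: exp_add)
      also have "\<dots> \<le> \<phi>1 t * exp (rb c * 1)"
        using n1[of t] t ra_rb(2)[of c] by (intro mult_left_mono) auto
      finally show "\<phi>1 z \<le> exp (rb c) * (\<phi> z - \<phi> (z - 1))" using t(3) by (simp add: mult.commute)
    qed
  qed (use n1 in simp)
  show ?thesis
    by (rule exI[of _ \<phi>1], rule exI[of _ \<phi>2]) (use o pos1 lim0 lim1 lim2 in auto)
qed

end

section \<open>Barriers\<close>

text \<open>Stability uses the pushed front through these facts: strict monotonicity, decay faster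
  than exp (lam z), vanishing slope at \<infinity>, and a negative characteristic value at
  lam.\<close>

locale stable_front = monostable +
  fixes c lam :: real and \<phi> \<phi>1 \<phi>2 :: "real \<Rightarrow> real"
  assumes front: "wavefront g h \<kappa> c \<phi>"
    and d\<phi>: "\<And>z. (\<phi> has_real_derivative \<phi>1 z) (at z)" "\<And>z. (\<phi>1 has_real_derivative \<phi>2 z) (at z)"
    and ode: "\<And>z. \<phi>2 z - c * \<phi>1 z - \<phi> z = - g (\<phi> (z - c * h))"
    and \<phi>1_pos: "\<And>z. \<phi>1 z > 0"
    and lim_\<phi>: "((\<lambda>z. \<phi> z * exp (- lam * z)) \<longlongrightarrow> 0) at_bot"
    and lim_\<phi>1: "((\<lambda>z. \<phi>1 z * exp (- lam * z)) \<longlongrightarrow> 0) at_bot" "(\<phi>1 \<longlongrightarrow> 0) at_top"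
    and lam0: "lam > 0" and Xlam: "X lam c < 0"
begin

lemma c_pos: "c > 0" by (rule front_speed_pos[OF front])
lemma ch_nonneg: "c * h \<ge> 0" using c_pos h by simp

lemma \<phi>_pos: "0 < \<phi> z" and \<phi>_less: "\<phi> z < \<kappa>"
  by (rule front_pos[OF front] front_less[OF front])+

lemma \<phi>_cont: "continuous_on A \<phi>" and \<phi>1_cont: "continuous_on A \<phi>1"
  using d\<phi> by (meson DERIV_continuous_on has_field_derivative_at_within)+

lemma \<phi>_mono: "x \<le> y \<Longrightarrow> \<phi> x \<le> \<phi> y"
  by (rule DERIV_nonneg_imp_nondecreasing[where f=\<phi>], assumption)
     (intro exI conjI, rule d\<phi>(1), rule less_imp_le[OF \<phi>1_pos])

lemma \<phi>_strict: "x < y \<Longrightarrow> \<phi> x < \<phi> y"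
  by (rule DERIV_pos_imp_increasing[where f=\<phi>], assumption)
     (intro exI conjI, rule d\<phi>(1), rule \<phi>1_pos)

text \<open>A smooth substitute for \<^const>\<open>eta\<close>, equivalent up to a factor 2.\<close>

definition e :: "real \<Rightarrow> real" where "e z = 1 / (1 + exp (- lam * z))"
definition e1 :: "real \<Rightarrow> real" where "e1 z = lam * e z * (1 - e z)"
definition e2 :: "real \<Rightarrow> real" where "e2 z = lam^2 * e z * (1 - e z) * (1 - 2 * e z)"

lemma den_pos: "1 + exp (- lam * z) > 0" by (simp add: add_pos_pos)

lemma e_pos: "0 < e z" and e_less: "e z < 1"
  using den_pos[of z] by (simp_all add: e_def)

lemma de: "(e has_real_derivative e1 z) (at z)"
proof -
  have n: "1 + exp (- lam * z) \<noteq> 0" using den_pos[of z] by simp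
  have "(e has_real_derivative lam * exp (- lam * z) / (1 + exp (- lam * z))^2) (at z)"
    unfolding e_def[abs_def] using n
    by (auto intro!: derivative_eq_intros simp: power2_eq_square field_simps)
  moreover have "1 - e z = exp (- lam * z) / (1 + exp (- lam * z))"
    unfolding e_def using n by (simp add: diff_divide_distrib[symmetric] field_simps)
  ultimately show ?thesis by (simp add: e1_def e_def power2_eq_square)
qed

lemma de1: "(e1 has_real_derivative e2 z) (at z)"
proof -
  have "(e1 has_real_derivative lam * e1 z * (1 - e z) + lam * e z * (- e1 z)) (at z)"
    unfolding e1_def[abs_def] by (auto intro!: derivative_eq_intros de[unfolded e1_def] simp: e1_def)
  then show ?thesis by (rule DERIV_cong) (simp add: e1_def e2_def power2_eq_square algebra_simps)
qed

lemma e1_bounds: "0 \<le> e1 z" "e1 z \<le> lam * e z"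
  using e_pos[of z] e_less[of z] lam0 by (auto simp: e1_def mult_left_le)

lemma e_mono: "x \<le> y \<Longrightarrow> e x \<le> e y"
  by (rule DERIV_nonneg_imp_nondecreasing[where f=e], assumption)
     (intro exI conjI, rule de, rule e1_bounds(1))

lemma e_cont: "continuous_on A e"
  using de by (meson DERIV_continuous_on has_field_derivative_at_within)

lemma exp_eq_e: "exp (lam * z) = e z * (1 + exp (lam * z))"
proof -
  have "e z = exp (lam * z) / (1 + exp (lam * z))"
    unfolding e_def using den_pos[of z] by (simp add: exp_minus field_simps)
  then show ?thesis by (simp add: add_pos_pos less_imp_neq[symmetric])
qed

lemma e_le_exp: "e z \<le> exp (lam * z)"
  using e_pos[of z] by (subst exp_eq_e) (simp add: distrib_left)

lemma e_le_eta: "e z \<le> eta lam z"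
  using e_le_exp[of z] e_less[of z] by (simp add: eta_def)

lemma exp_le_2e: "z \<le> 0 \<Longrightarrow> exp (lam * z) \<le> 2 * e z"
proof -
  assume "z \<le> 0"
  then have "exp (lam * z) \<le> 1" using lam0 by (simp add: mult_nonneg_nonpos)
  then have "e z * (1 + exp (lam * z)) \<le> e z * 2" using e_pos[of z] by (intro mult_left_mono) auto
  then show ?thesis using exp_eq_e[of z] by simp
qed

lemma e_ge_half: "z \<ge> 0 \<Longrightarrow> e z \<ge> 1/2"
  using e_mono[of 0 z] by (simp add: e_def)

text \<open>Translations change the weight by a bounded factor only, so bounded shifts can be moved
  in and out of error terms.\<close>

lemma e_shift: "e (z + b) \<le> exp (lam * \<bar>b\<bar>) * e z"
proof (cases "b \<ge> 0")
  case True
  have "exp (- lam * z) = exp (- lam * (z + b)) * exp (lam * b)" by (simp add: algebra_simps flip: exp_add)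
  then have "1 + exp (- lam * z) \<le> exp (lam * b) * (1 + exp (- lam * (z + b)))"
    using True lam0 by (simp add: distrib_left mult.commute)
  then show ?thesis unfolding e_def using True den_pos[of z] den_pos[of "z + b"] by (simp add: field_simps)
next
  case False
  have "e (z + b) \<le> 1 * e z" using e_mono[of "z + b" z] False by simp
  also have "\<dots> \<le> exp (lam * \<bar>b\<bar>) * e z" using e_pos[of z] lam0 by (intro mult_right_mono) auto
  finally show ?thesis .
qed

text \<open>Near - \<infinity> the delay multiplies the weight by about exp (- lam c h), which is
  how the characteristic function enters.\<close>

lemma e_delay: "e (z - c * h) \<le> exp (- lam * c * h) * (1 + exp (lam * z)) * e z"
proof -
  have "e (z - c * h) \<le> exp (lam * (z - c * h))" by (rule e_le_exp)
  also have "\<dots> = exp (- lam * c * h) * exp (lam * z)" by (simp add: algebra_simps flip: exp_add)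
  also have "\<dots> = exp (- lam * c * h) * (e z * (1 + exp (lam * z)))" by (subst exp_eq_e) simp
  finally show ?thesis by (simp add: mult_ac)
qed

lemma e_lims: "(e \<longlongrightarrow> 0) at_bot" "(e \<longlongrightarrow> 1) at_top" "((\<lambda>z. exp (lam * z)) \<longlongrightarrow> 0) at_bot"
proof -
  show l: "((\<lambda>z. exp (lam * z)) \<longlongrightarrow> 0) at_bot" by (rule exp_tendsto_at_bot[OF lam0])
  show "(e \<longlongrightarrow> 0) at_bot"
    by (rule tendsto_sandwich[OF _ _ tendsto_const l]) (use e_pos e_le_exp in \<open>auto intro!: always_eventually less_imp_le\<close>)
  have "((\<lambda>z. exp (lam * - z)) \<longlongrightarrow> 0) at_top"
    using l by (simp add: filterlim_at_bot_mirror)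
  then have "((\<lambda>z. 1 / (1 + exp (- lam * z))) \<longlongrightarrow> 1 / (1 + 0)) at_top"
    by (intro tendsto_intros) auto
  then show "(e \<longlongrightarrow> 1) at_top" by (simp add: e_def[abs_def])
qed

lemma e_abs_bounds: "\<bar>- e2 z + c * e1 z + e z\<bar> \<le> lam^2 + c * lam + 1"
proof -
  have e: "0 < e z" "e z < 1" by (rule e_pos e_less)+
  have "\<bar>e z * (1 - e z) * (1 - 2 * e z)\<bar> \<le> 1 * 1 * 1"
    unfolding abs_mult using e by (intro mult_mono) auto
  then have "lam^2 * \<bar>e z * (1 - e z) * (1 - 2 * e z)\<bar> \<le> lam^2 * 1" by (intro mult_left_mono) auto
  then have "\<bar>e2 z\<bar> \<le> lam^2" by (simp add: e2_def abs_mult mult.assoc)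
  moreover have "e1 z \<le> lam" 
  proof -
    have "lam * e z \<le> lam * 1" using e lam0 by (intro mult_left_mono) auto
    then show ?thesis using e1_bounds(2)[of z] by simp
  qed
  then have "c * e1 z \<le> c * lam" using c_pos by simp
  moreover have "0 \<le> c * e1 z" using c_pos e1_bounds(1) by simp
  ultimately show ?thesis using e by (simp add: abs_le_iff)
qed

text \<open>The last inequality is the supersolution condition for \<open>\<phi> (z + S t) + Q t * e (z + S t)\<close> with
  \<open>Q' = - \<gamma> Q\<close> and \<open>S' = K \<gamma> Q\<close>: at \<open>- \<infinity>\<close> it rests on \<open>X lam c < 0\<close>, at \<open>\<infinity>\<close> on \<open>g' \<kappa> < 1\<close>, and in
  between on \<open>\<phi>1 > 0\<close> and a large \<open>K\<close>. The factor \<open>r\<close> pays for the delay.\<close>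

definition squeeze_consts :: "real \<Rightarrow> real \<Rightarrow> real \<Rightarrow> real \<Rightarrow> bool" where
  "squeeze_consts K \<gamma> q0 r \<longleftrightarrow> K > 0 \<and> \<gamma> > 0 \<and> q0 > 0 \<and> r \<ge> 1 \<and> exp (\<gamma> * h + lam * (K * q0 * exp (\<gamma> * h))) \<le> r \<and>
    (\<forall>q \<zeta> \<rho>. 0 < q \<longrightarrow> q \<le> q0 \<longrightarrow> \<bar>\<rho>\<bar> \<le> r * q * e (\<zeta> - c * h) \<longrightarrow>
      \<bar>g (\<phi> (\<zeta> - c * h) + \<rho>) - g (\<phi> (\<zeta> - c * h))\<bar> + \<gamma> * q * e \<zeta> + K * \<gamma> * q * (q * e1 \<zeta>)
      \<le> K * \<gamma> * q * \<phi>1 \<zeta> + q * (- e2 \<zeta> + c * e1 \<zeta> + e \<zeta>))"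

text \<open>The constants are fixed in the order r, \<gamma>, K, q0, each depending on earlier ones:
  r > 1 fits into the gaps at both ends, \<gamma> is small against these gaps, K is large so that
  the gain from \<phi>1 wins on the compact middle part, and q0 makes the terms quadratic in the
  amplitude small.\<close>

lemma squeeze_consts_exist: "\<exists>K \<gamma> q0 r. squeeze_consts K \<gamma> q0 r"
proof -
  \<comment> \<open>The gap - X lam c is split into quarters: one covers the slope error together
    with r, one \<gamma>, one the term with K q0, and one is left over.\<close>
  define \<mu> where "\<mu> = - X lam c / 4"
  have \<mu>: "\<mu> > 0" using Xlam by (simp add: \<mu>_def)
  define s where "s = g0 + \<mu> / 2"
  define q\<kappa> where "q\<kappa> = (gk + 1) / 2"
  have qk: "0 < q\<kappa>" "q\<kappa> < 1" using gk0 gk1 by (auto simp: q\<kappa>_def)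
  have s: "s > 0" using g0 \<mu> by (simp add: s_def)
  \<comment> \<open>Above 1, yet with s r \<le> g0 + \<mu> for the left end and q\<kappa> r < 1 for
    the right end.\<close>
  define r where "r = min ((g0 + \<mu>) / s) (2 / (1 + q\<kappa>))"
  have r: "r > 1" "s * r \<le> g0 + \<mu>" "q\<kappa> * r < 1"
  proof -
    have "(g0 + \<mu>) / s > 1" using s \<mu> by (simp add: s_def)
    moreover have "2 / (1 + q\<kappa>) > 1" using qk by simp
    ultimately show "r > 1" by (simp add: r_def)
    have "r \<le> (g0 + \<mu>) / s" by (simp add: r_def)
    then show "s * r \<le> g0 + \<mu>" using s by (simp add: pos_le_divide_eq mult.commute)
    have "r \<le> 2 / (1 + q\<kappa>)" by (simp add: r_def)
    then have "q\<kappa> * r \<le> q\<kappa> * (2 / (1 + q\<kappa>))" using qk by (intro mult_left_mono) auto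
    also have "\<dots> < 1" using qk by (simp add: field_simps)
    finally show "q\<kappa> * r < 1" .
  qed
  define \<nu> where "\<nu> = (1 - q\<kappa> * r) / 2"
  have \<nu>: "\<nu> > 0" using r by (simp add: \<nu>_def)
  \<comment> \<open>The linear part divided by e; its limit at - \<infinity> is 1 + c lam - lam^2,
    the part of - X lam c without the delayed term.\<close>
  define M where "M = (\<lambda>z. 1 + c * lam * (1 - e z) - lam^2 * ((1 - e z) * (1 - 2 * e z)))"
  have Me: "- e2 z + c * e1 z + e z = M z * e z" for z
    by (simp add: M_def e1_def e2_def algebra_simps)
  have lM: "(M \<longlongrightarrow> 1 + c * lam - lam^2) at_bot"
  proof -
    have "(M \<longlongrightarrow> 1 + c * lam * (1 - 0) - lam^2 * ((1 - 0) * (1 - 2 * 0))) at_bot"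
      unfolding M_def by (intro tendsto_intros e_lims)
    then show ?thesis by simp
  qed
  have lM': "((\<lambda>z. M z * e z) \<longlongrightarrow> 1) at_top"
  proof -
    have "((\<lambda>z. M z * e z) \<longlongrightarrow> (1 + c * lam * (1 - 1) - lam^2 * ((1 - 1) * (1 - 2 * 1))) * 1) at_top"
      unfolding M_def by (intro tendsto_intros e_lims)
    then show ?thesis by simp
  qed
  define k where "k = exp (- lam * c * h)"
  have k: "0 < k" "k \<le> 1" using lam0 ch_nonneg by (auto simp: k_def mult.assoc)
  have "((\<lambda>z. M z - s * r * (k * (1 + exp (lam * z)))) \<longlongrightarrow> (1 + c * lam - lam^2) - s * r * (k * (1 + 0))) at_bot"
    by (intro tendsto_intros lM e_lims)
  moreover have "(1 + c * lam - lam^2) - s * r * (k * (1 + 0)) > 2 * \<mu>"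
  proof -
    have "X lam c = lam^2 - c * lam - 1 + g0 * k" by (simp add: chi_def k_def)
    moreover have "X lam c = - 4 * \<mu>" by (simp add: \<mu>_def)
    ultimately have "1 + c * lam - lam^2 = 4 * \<mu> + g0 * k" by linarith
    moreover have "s * r * k \<le> (g0 + \<mu>) * k" using r k by (intro mult_right_mono) auto
    moreover have "\<mu> * k \<le> \<mu> * 1" using k \<mu> by (intro mult_left_mono) auto
    moreover have "(g0 + \<mu>) * k = g0 * k + \<mu> * k" by (rule distrib_right)
    moreover have "s * r * (k * (1 + 0)) = s * r * k" "\<mu> * 1 = \<mu>" by simp_all
    ultimately show ?thesis using \<mu> by linarith
  qed
  ultimately have "\<forall>\<^sub>F z in at_bot. M z - s * r * (k * (1 + exp (lam * z))) > 2 * \<mu>"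
    by (rule order_tendstoD(1))
  then obtain N1 where N1: "\<And>z. z \<le> N1 \<Longrightarrow> M z - s * r * (k * (1 + exp (lam * z))) > 2 * \<mu>"
    unfolding eventually_at_bot_linorder by blast
  have "1 > q\<kappa> * r + \<nu>" using r by (simp add: \<nu>_def field_simps)
  from order_tendstoD(1)[OF lM' this] obtain N2 where N2: "\<And>z. z \<ge> N2 \<Longrightarrow> M z * e z > q\<kappa> * r + \<nu>"
    by (auto simp: eventually_at_top_linorder)
  obtain d0 where d0: "d0 > 0" "\<And>x y. \<bar>x - 0\<bar> \<le> d0 \<Longrightarrow> \<bar>y - 0\<bar> \<le> d0 \<Longrightarrow> \<bar>g x - g y\<bar> \<le> (g0 + \<mu> / 2) * \<bar>x - y\<bar>"
    by (rule local_slope[of 0 "\<mu> / 2"]) (use \<mu> in auto)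
  obtain d1 where d1: "d1 > 0" "\<And>x y. \<bar>x - \<kappa>\<bar> \<le> d1 \<Longrightarrow> \<bar>y - \<kappa>\<bar> \<le> d1 \<Longrightarrow> \<bar>g x - g y\<bar> \<le> (gk + (1 - gk) / 2) * \<bar>x - y\<bar>"
    by (rule local_slope[of \<kappa> "(1 - gk) / 2"]) (use gk1 in auto)
  have qk': "gk + (1 - gk) / 2 = q\<kappa>" by (simp add: q\<kappa>_def field_simps)
  obtain N3 where N3: "\<And>z. z \<le> N3 \<Longrightarrow> \<phi> z < d0 / 2"
    using order_tendstoD(2)[OF front_bot[OF front], of "d0 / 2"] d0(1) by (auto simp: eventually_at_bot_linorder)
  obtain N4 where N4: "\<And>z. z \<ge> N4 \<Longrightarrow> \<kappa> - d1 / 2 < \<phi> z"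
    using order_tendstoD(1)[OF front_top[OF front], of "\<kappa> - d1 / 2"] d1(1) by (auto simp: eventually_at_top_linorder)
  define A where "A = min N1 N3"
  define B where "B = max A (max N2 (N4 + c * h))"
  have AB: "A \<le> B" by (simp add: B_def)
  have "\<exists>x\<in>{A..B}. \<forall>y\<in>{A..B}. \<phi>1 x \<le> \<phi>1 y"
    by (rule continuous_attains_inf) (use AB \<phi>1_cont in auto)
  then obtain x where x: "\<And>y. y \<in> {A..B} \<Longrightarrow> \<phi>1 x \<le> \<phi>1 y" by blast
  define p0 where "p0 = \<phi>1 x"
  have p0: "p0 > 0" "\<And>y. A \<le> y \<Longrightarrow> y \<le> B \<Longrightarrow> p0 \<le> \<phi>1 y" using \<phi>1_pos x by (auto simp: p0_def)
  obtain L where L: "L > 0" "\<And>u v. \<bar>g u - g v\<bar> \<le> L * \<bar>u - v\<bar>" using g_lipschitz by blast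
  \<comment> \<open>One half of ln r is reserved for \<gamma> h, the other for the shift term lam K
    q0 exp (\<gamma> h).\<close>
  define lr where "lr = ln r / 2"
  have lr: "lr > 0" using r by (simp add: lr_def)
  define \<gamma> where "\<gamma> = min (min \<mu> (\<nu> / 2)) (lr / (1 + h))"
  have \<gamma>: "\<gamma> > 0" "\<gamma> \<le> \<mu>" "\<gamma> \<le> \<nu> / 2" "\<gamma> * h \<le> lr"
  proof -
    show "\<gamma> > 0" using \<mu> \<nu> lr h by (simp add: \<gamma>_def)
    show "\<gamma> \<le> \<mu>" "\<gamma> \<le> \<nu> / 2" unfolding \<gamma>_def by (simp_all only: min_le_iff_disj order_refl simp_thms)
    have "\<gamma> \<le> lr / (1 + h)" unfolding \<gamma>_def by (rule min.cobounded2)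
    then have "\<gamma> * (1 + h) \<le> lr" using h by (simp add: pos_le_divide_eq)
    moreover have "\<gamma> * h \<le> \<gamma> * (1 + h)" using \<open>\<gamma> > 0\<close> by simp
    ultimately show "\<gamma> * h \<le> lr" by linarith
  qed
  define C where "C = lam^2 + c * lam + 1"
  have C: "C > 0" using c_pos lam0 by (simp add: C_def add_pos_pos)
  \<comment> \<open>Half of the gain K \<gamma> p0 equals the sum of the losses in the middle
    region; the other half pays for the e1 term.\<close>
  define K where "K = 2 * (L * r + \<gamma> + C) / (\<gamma> * p0)"
  have K: "K > 0" using L r \<gamma> C p0 by (simp add: K_def add_pos_pos)
  have Kp: "K * \<gamma> * (p0 / 2) = L * r + \<gamma> + C" using \<gamma> p0 by (simp add: K_def)
  \<comment> \<open>In order: the e1 term at the left end, at the right end and in the middle; the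
    second half of ln r; perturbations that stay where the local slopes at 0 and \<kappa> are
    valid.\<close>
  define q0 where "q0 = min (min (\<mu> / (K * \<gamma> * lam)) (\<nu> / 2 / (K * \<gamma> * lam)))
     (min (min (p0 / (2 * lam)) (lr / (lam * (K * exp (\<gamma> * h))))) (min (d0 / (2 * r)) (d1 / (2 * r))))"
  have Kl: "K * \<gamma> * lam > 0" "lam * (K * exp (\<gamma> * h)) > 0" using K \<gamma> lam0 by auto
  have q0: "q0 > 0" using \<mu> \<nu> Kl p0 lam0 lr d0 d1 r by (simp add: q0_def)
  have q0': "q0 \<le> \<mu> / (K * \<gamma> * lam)" "q0 \<le> \<nu> / 2 / (K * \<gamma> * lam)" "q0 \<le> p0 / (2 * lam)"
    "q0 \<le> lr / (lam * (K * exp (\<gamma> * h)))" "q0 \<le> d0 / (2 * r)" "q0 \<le> d1 / (2 * r)"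
    unfolding q0_def by (simp_all only: min_le_iff_disj order_refl simp_thms)
  have q: "K * \<gamma> * lam * q0 \<le> \<mu>" "K * \<gamma> * lam * q0 \<le> \<nu> / 2" "lam * q0 \<le> p0 / 2"
    "lam * (K * q0 * exp (\<gamma> * h)) \<le> lr" "r * q0 \<le> d0 / 2" "r * q0 \<le> d1 / 2"
  proof -
    show "K * \<gamma> * lam * q0 \<le> \<mu>" using q0'(1) Kl by (simp add: pos_le_divide_eq mult_ac)
    show "K * \<gamma> * lam * q0 \<le> \<nu> / 2" using q0'(2) Kl by (simp add: pos_le_divide_eq mult_ac)
    show "lam * q0 \<le> p0 / 2" using q0'(3) lam0 by (simp add: pos_le_divide_eq mult_ac)
    show "lam * (K * q0 * exp (\<gamma> * h)) \<le> lr" using q0'(4) Kl by (simp add: pos_le_divide_eq mult_ac)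
    show "r * q0 \<le> d0 / 2" "r * q0 \<le> d1 / 2" using q0'(5,6) r by (simp_all add: pos_le_divide_eq mult_ac)
  qed
  have core: "\<bar>g (\<phi> (\<zeta> - c * h) + \<rho>) - g (\<phi> (\<zeta> - c * h))\<bar> + \<gamma> * p * e \<zeta> + K * \<gamma> * p * (p * e1 \<zeta>)
      \<le> K * \<gamma> * p * \<phi>1 \<zeta> + p * (- e2 \<zeta> + c * e1 \<zeta> + e \<zeta>)"
    if p: "0 < p" "p \<le> q0" and \<rho>: "\<bar>\<rho>\<bar> \<le> r * p * e (\<zeta> - c * h)" for p \<zeta> \<rho>
  proof -
    define Dg where "Dg = \<bar>g (\<phi> (\<zeta> - c * h) + \<rho>) - g (\<phi> (\<zeta> - c * h))\<bar>"
    have rp: "\<bar>\<rho>\<bar> \<le> r * p"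
    proof -
      have "r * p * e (\<zeta> - c * h) \<le> r * p * 1" using r p e_less[of "\<zeta> - c * h"] by (intro mult_left_mono) auto
      then show ?thesis using \<rho> by simp
    qed
    have rpq: "r * p \<le> r * q0" using p r by simp
    have ez: "0 < e \<zeta>" "e \<zeta> < 1" by (rule e_pos e_less)+
    have e1z: "K * \<gamma> * p * (p * e1 \<zeta>) \<le> (K * \<gamma> * lam * q0) * (p * e \<zeta>)"
    proof -
      have "p * e1 \<zeta> \<le> q0 * (lam * e \<zeta>)" using p e1_bounds[of \<zeta>] by (intro mult_mono) auto
      then have "K * \<gamma> * p * (p * e1 \<zeta>) \<le> K * \<gamma> * p * (q0 * (lam * e \<zeta>))" using K \<gamma> p by (intro mult_left_mono) auto
      then show ?thesis by (simp add: mult_ac)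
    qed
    have pe: "0 < p * e \<zeta>" using p ez by simp
    have ph: "0 \<le> K * \<gamma> * p * \<phi>1 \<zeta>" using K \<gamma> p \<phi>1_pos[of \<zeta>] by simp
    consider "\<zeta> < A" | "A \<le> \<zeta>" "\<zeta> \<le> B" | "B < \<zeta>" by linarith
    then have "Dg + \<gamma> * p * e \<zeta> + K * \<gamma> * p * (p * e1 \<zeta>) \<le> K * \<gamma> * p * \<phi>1 \<zeta> + p * (M \<zeta> * e \<zeta>)"
    proof cases
      case 1
      then have z: "\<zeta> \<le> N1" "\<zeta> \<le> N3" by (auto simp: A_def)
      have "\<phi> (\<zeta> - c * h) < d0 / 2" using z(2) ch_nonneg by (intro N3) simp
      then have "\<bar>\<phi> (\<zeta> - c * h) + \<rho> - 0\<bar> \<le> d0" "\<bar>\<phi> (\<zeta> - c * h) - 0\<bar> \<le> d0"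
        using \<phi>_pos[of "\<zeta> - c * h"] rp rpq q(5) by linarith+
      from d0(2)[OF this] have "Dg \<le> s * \<bar>\<rho>\<bar>" by (simp add: Dg_def s_def)
      also have "\<dots> \<le> s * (r * p * (k * (1 + exp (lam * \<zeta>)) * e \<zeta>))"
      proof (rule mult_left_mono)
        have "r * p * e (\<zeta> - c * h) \<le> r * p * (k * (1 + exp (lam * \<zeta>)) * e \<zeta>)"
          unfolding k_def using e_delay[of \<zeta>] r p by (intro mult_left_mono) auto
        then show "\<bar>\<rho>\<bar> \<le> r * p * (k * (1 + exp (lam * \<zeta>)) * e \<zeta>)" using \<rho> by linarith
      qed (use s in simp)
      also have "\<dots> = (s * r * (k * (1 + exp (lam * \<zeta>)))) * (p * e \<zeta>)" by simp
      also have "\<dots> \<le> (M \<zeta> - 2 * \<mu>) * (p * e \<zeta>)" using N1[OF z(1)] pe by (intro mult_right_mono) auto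
      finally have "Dg \<le> (M \<zeta> - 2 * \<mu>) * (p * e \<zeta>)" .
      moreover have "\<gamma> * (p * e \<zeta>) \<le> \<mu> * (p * e \<zeta>)" using \<gamma> pe by (intro mult_right_mono) auto
      moreover have "(K * \<gamma> * lam * q0) * (p * e \<zeta>) \<le> \<mu> * (p * e \<zeta>)" using q(1) pe by (intro mult_right_mono) auto
      ultimately show ?thesis using e1z ph by (simp add: algebra_simps)
    next
      case 2
      have "Dg \<le> L * \<bar>\<rho>\<bar>" using L(2)[of "\<phi> (\<zeta> - c * h) + \<rho>" "\<phi> (\<zeta> - c * h)"] by (simp add: Dg_def)
      also have "\<dots> \<le> L * (r * p)" using rp L by (intro mult_left_mono) auto
      finally have 1: "Dg \<le> p * (L * r)" by (simp add: mult_ac)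
      have 2: "\<gamma> * p * e \<zeta> \<le> p * \<gamma>" using ez \<gamma> p by (simp add: mult_left_le mult.commute)
      have "K * \<gamma> * p * (p * e1 \<zeta>) \<le> K * \<gamma> * p * (p0 / 2)"
      proof (rule mult_left_mono)
        have "lam * e \<zeta> \<le> lam * 1" using ez lam0 by (intro mult_left_mono) auto
        then have "e1 \<zeta> \<le> lam" using e1_bounds(2)[of \<zeta>] by linarith
        then have "p * e1 \<zeta> \<le> q0 * lam" using p e1_bounds(1)[of \<zeta>] by (intro mult_mono) auto
        then show "p * e1 \<zeta> \<le> p0 / 2" using q(3) by (simp add: mult.commute)
      qed (use K \<gamma> p in simp)
      moreover have "K * \<gamma> * p * p0 \<le> K * \<gamma> * p * \<phi>1 \<zeta>"
        using p0(2)[OF \<open>A \<le> \<zeta>\<close> \<open>\<zeta> \<le> B\<close>] K \<gamma> p by (intro mult_left_mono) auto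
      moreover have "K * \<gamma> * p * p0 = 2 * (K * \<gamma> * p * (p0 / 2))" by simp
      moreover have "K * \<gamma> * p * (p0 / 2) = p * (L * r + \<gamma> + C)" using Kp by (simp add: mult_ac)
      ultimately have 3: "K * \<gamma> * p * (p * e1 \<zeta>) + p * (L * r + \<gamma> + C) \<le> K * \<gamma> * p * \<phi>1 \<zeta>" by linarith
      have "- C \<le> M \<zeta> * e \<zeta>" using e_abs_bounds[of \<zeta>] unfolding Me C_def by linarith
      then have "p * (- C) \<le> p * (M \<zeta> * e \<zeta>)" using p by (intro mult_left_mono) auto
      then show ?thesis using 1 2 3 by (simp add: distrib_left)
    next
      case 3
      then have z: "\<zeta> \<ge> N2" "\<zeta> - c * h \<ge> N4" by (auto simp: B_def)
      have "\<kappa> - d1 / 2 < \<phi> (\<zeta> - c * h)" using z(2) by (rule N4)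
      then have "\<bar>\<phi> (\<zeta> - c * h) + \<rho> - \<kappa>\<bar> \<le> d1" "\<bar>\<phi> (\<zeta> - c * h) - \<kappa>\<bar> \<le> d1"
        using \<phi>_less[of "\<zeta> - c * h"] rp rpq q(6) d1(1) by linarith+
      from d1(2)[OF this] have "Dg \<le> q\<kappa> * \<bar>\<rho>\<bar>" by (simp add: Dg_def qk')
      also have "\<dots> \<le> q\<kappa> * (r * p)" using rp qk by (intro mult_left_mono) auto
      finally have 1: "Dg \<le> p * (q\<kappa> * r)" by (simp add: mult_ac)
      have "(\<gamma> + K * \<gamma> * lam * q0) * (p * e \<zeta>) \<le> \<nu> * (p * e \<zeta>)" using \<gamma>(3) q(2) pe by (intro mult_right_mono) auto
      also have "\<dots> \<le> p * \<nu>" using ez p \<nu> by (simp add: mult_left_le mult_ac)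
      finally have 2: "(\<gamma> + K * \<gamma> * lam * q0) * (p * e \<zeta>) \<le> p * \<nu>" .
      have "p * (q\<kappa> * r + \<nu>) \<le> p * (M \<zeta> * e \<zeta>)" using N2[OF z(1)] p by (intro mult_left_mono) auto
      then show ?thesis using 1 2 e1z ph by (simp add: algebra_simps)
    qed
    then show ?thesis unfolding Dg_def Me .
  qed
  have "\<gamma> * h + lam * (K * q0 * exp (\<gamma> * h)) \<le> ln r" using \<gamma>(4) q(4) by (simp add: lr_def)
  then have "exp (\<gamma> * h + lam * (K * q0 * exp (\<gamma> * h))) \<le> exp (ln r)" by (simp only: exp_le_cancel_iff)
  also have "exp (ln r) = r" using r by simp
  finally have "exp (\<gamma> * h + lam * (K * q0 * exp (\<gamma> * h))) \<le> r" .
  then have "squeeze_consts K \<gamma> q0 r" unfolding squeeze_consts_def using K \<gamma> q0 r core by auto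
  then show ?thesis by blast
qed

text \<open>At - \<infinity> this is the fast decay of the pushed front; at \<infinity> the weight
  is close to 1 while \<phi>1 vanishes. It makes shifts of the front cheap far out.\<close>

lemma \<phi>1_small:
  assumes "\<epsilon> > 0" shows "\<exists>M. \<forall>z. \<bar>z\<bar> \<ge> M \<longrightarrow> \<phi>1 z \<le> \<epsilon> * e z"
proof -
  obtain M1 where M1: "\<And>z. z \<le> M1 \<Longrightarrow> \<phi>1 z * exp (- lam * z) < \<epsilon> / 2"
    using order_tendstoD(2)[OF lim_\<phi>1(1), of "\<epsilon> / 2"] assms by (auto simp: eventually_at_bot_linorder)
  obtain M2 where M2: "\<And>z. z \<ge> M2 \<Longrightarrow> \<phi>1 z < \<epsilon> / 2"
    using order_tendstoD(2)[OF lim_\<phi>1(2), of "\<epsilon> / 2"] assms by (auto simp: eventually_at_top_linorder)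
  have a: "\<phi>1 z \<le> \<epsilon> * e z" if "z \<le> M1" "z \<le> 0" for z
  proof -
    have "\<phi>1 z = (\<phi>1 z * exp (- lam * z)) * exp (lam * z)" by (simp add: mult.assoc flip: exp_add)
    also have "\<dots> \<le> \<epsilon> / 2 * exp (lam * z)" using M1[OF that(1)] by (intro mult_right_mono) auto
    also have "\<dots> \<le> \<epsilon> / 2 * (2 * e z)" using exp_le_2e[OF that(2)] assms by (intro mult_left_mono) auto
    finally show ?thesis by simp
  qed
  have b: "\<phi>1 z \<le> \<epsilon> * e z" if "z \<ge> M2" "z \<ge> 0" for z
  proof -
    have "\<epsilon> * (1/2) \<le> \<epsilon> * e z" using e_ge_half[OF that(2)] assms by (intro mult_left_mono) auto
    then show ?thesis using M2[OF that(1)] by simp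
  qed
  show ?thesis
  proof (intro exI[of _ "\<bar>M1\<bar> + \<bar>M2\<bar>"] allI impI)
    fix z assume "\<bar>M1\<bar> + \<bar>M2\<bar> \<le> \<bar>z\<bar>"
    then have "(z \<le> M1 \<and> z \<le> 0) \<or> (z \<ge> M2 \<and> z \<ge> 0)" by linarith
    then show "\<phi>1 z \<le> \<epsilon> * e z" using a b by blast
  qed
qed

lemma \<phi>1_le_e: "\<exists>C>0. \<forall>z. \<phi>1 z \<le> C * e z"
proof -
  obtain M where M: "\<And>z. \<bar>z\<bar> \<ge> M \<Longrightarrow> \<phi>1 z \<le> 1 * e z" using \<phi>1_small[of 1] by auto
  have "\<exists>x\<in>{-\<bar>M\<bar>..\<bar>M\<bar>}. \<forall>y\<in>{-\<bar>M\<bar>..\<bar>M\<bar>}. \<phi>1 y / e y \<le> \<phi>1 x / e x"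
    by (rule continuous_attains_sup)
       (use e_pos in \<open>auto intro!: continuous_intros \<phi>1_cont e_cont simp: less_imp_neq[symmetric]\<close>)
  then obtain x where x: "\<And>y. y \<in> {-\<bar>M\<bar>..\<bar>M\<bar>} \<Longrightarrow> \<phi>1 y / e y \<le> \<phi>1 x / e x" by blast
  define C where "C = max 1 (\<phi>1 x / e x)"
  have "\<phi>1 z \<le> C * e z" for z
  proof (cases "\<bar>z\<bar> \<ge> M")
    case True
    have "1 * e z \<le> C * e z" using e_pos[of z] by (intro mult_right_mono) (auto simp: C_def)
    then show ?thesis using M[OF True] by linarith
  next
    case False
    then have "\<phi>1 z / e z \<le> \<phi>1 x / e x" by (intro x) auto
    also have "\<dots> \<le> C" by (simp add: C_def)
    finally show ?thesis using e_pos[of z] by (simp add: pos_divide_le_eq)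
  qed
  then show ?thesis by (intro exI[of _ C]) (simp add: C_def)
qed

text \<open>With the sign \<sigma>, upper and lower barriers are treated at once: increasing the
  shift parameter weakens either bound.\<close>

lemma sign_mono: "\<sigma> = 1 \<or> \<sigma> = -1 \<Longrightarrow> x \<le> y \<Longrightarrow> \<sigma> * \<phi> (z + \<sigma> * x) \<le> \<sigma> * \<phi> (z + \<sigma> * y)"
  using \<phi>_mono[of "z + x" "z + y"] \<phi>_mono[of "z - y" "z - x"] by auto

lemma sign_diff:
  assumes s: "\<sigma> = 1 \<or> \<sigma> = -1" and xy: "x \<le> y" and C: "\<And>t. x \<le> t \<Longrightarrow> t \<le> y \<Longrightarrow> \<phi>1 (z + \<sigma> * t) \<le> C"
  shows "\<sigma> * \<phi> (z + \<sigma> * y) - \<sigma> * \<phi> (z + \<sigma> * x) \<le> C * (y - x)"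
proof -
  have ss: "\<sigma> * \<sigma> = 1" using s by auto
  have "\<sigma> * \<phi> (z + \<sigma> * y) - C * y \<le> \<sigma> * \<phi> (z + \<sigma> * x) - C * x"
  proof (rule DERIV_nonpos_imp_nonincreasing[OF xy, where f="\<lambda>x. \<sigma> * \<phi> (z + \<sigma> * x) - C * x"])
    fix t assume t: "x \<le> t" "t \<le> y"
    have "((\<lambda>t. z + \<sigma> * t) has_real_derivative \<sigma>) (at t)" by (auto intro!: derivative_eq_intros)
    from DERIV_chain2[OF d\<phi>(1) this]
    have "((\<lambda>x. \<sigma> * \<phi> (z + \<sigma> * x) - C * x) has_real_derivative \<sigma> * (\<phi>1 (z + \<sigma> * t) * \<sigma>) - C * 1) (at t)"
      by (intro DERIV_diff DERIV_cmult DERIV_ident)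
    moreover have "\<sigma> * (\<phi>1 (z + \<sigma> * t) * \<sigma>) = \<phi>1 (z + \<sigma> * t)" using ss by (simp add: mult_ac)
    ultimately show "\<exists>D. ((\<lambda>x. \<sigma> * \<phi> (z + \<sigma> * x) - C * x) has_real_derivative D) (at t) \<and> D \<le> 0"
      using C[OF t] by fastforce
  qed
  then show ?thesis by (simp add: algebra_simps)
qed

lemma e_shift_abs: "\<bar>b\<bar> \<le> d \<Longrightarrow> e (z + b) \<le> exp (lam * d) * e z"
proof -
  assume b: "\<bar>b\<bar> \<le> d"
  have "exp (lam * \<bar>b\<bar>) * e z \<le> exp (lam * d) * e z" using b lam0 e_pos[of z] by (intro mult_right_mono) auto
  then show ?thesis using e_shift[of z b] by linarith
qed

section \<open>Barriers with decaying amplitude and bounded shift\<close>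

definition Qf :: "real \<Rightarrow> real \<Rightarrow> real \<Rightarrow> real \<Rightarrow> real" where
  "Qf \<gamma> q t0 t = q * exp (- \<gamma> * (t - t0))"
text \<open>Solves S' = K \<gamma> Q and starts with S = b at t0 - h, the beginning of the delay
  window, so that S \<ge> b wherever the barrier is evaluated; the total shift is K q exp (\<gamma>
  h).\<close>

definition Sf :: "real \<Rightarrow> real \<Rightarrow> real \<Rightarrow> real \<Rightarrow> real \<Rightarrow> real \<Rightarrow> real" where
  "Sf K \<gamma> q b t0 t = b + K * q * exp (\<gamma> * h) - K * Qf \<gamma> q t0 t"

text \<open>For \<open>\<sigma> = 1\<close> a supersolution, for \<open>\<sigma> = -1\<close> a subsolution (Fife--McLeod).\<close>

definition Wf :: "real \<Rightarrow> real \<Rightarrow> real \<Rightarrow> real \<Rightarrow> real \<Rightarrow> real \<Rightarrow> real \<Rightarrow> real \<Rightarrow> real" where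
  "Wf K \<gamma> \<sigma> q b t0 t z = \<phi> (z + \<sigma> * Sf K \<gamma> q b t0 t) + \<sigma> * Qf \<gamma> q t0 t * e (z + \<sigma> * Sf K \<gamma> q b t0 t)"

text \<open>Since S is nondecreasing and g monotone, the delayed barrier may be replaced by \<phi>
  (\<zeta> - c h) + \<sigma> \<rho>; the larger amplitude and the different shift one delay earlier
  are absorbed in r. What remains is the inequality in \<open>squeeze_consts\<close>, whose K-terms
  come from the moving shift.\<close>

lemma Wf_solution:
  assumes sq: "squeeze_consts K \<gamma> q0 r" and s: "\<sigma> = 1 \<or> \<sigma> = -1" and q: "0 < q" "q \<le> q0" and t: "t \<ge> t0"
  shows "\<exists>Wt Wz Wzz. ((\<lambda>\<tau>. Wf K \<gamma> \<sigma> q b t0 \<tau> z) has_real_derivative Wt) (at t) \<and>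
     (\<forall>y. ((\<lambda>x. Wf K \<gamma> \<sigma> q b t0 t x) has_real_derivative Wz y) (at y)) \<and> (Wz has_real_derivative Wzz) (at z) \<and>
     \<sigma> * (Wt - Wzz + c * Wz z + Wf K \<gamma> \<sigma> q b t0 t z - g (Wf K \<gamma> \<sigma> q b t0 (t - h) (z - c * h))) \<ge> 0"
proof -
  have K: "K > 0" "\<gamma> > 0" "q0 > 0" "r \<ge> 1" "exp (\<gamma> * h + lam * (K * q0 * exp (\<gamma> * h))) \<le> r"
    and core: "\<And>q \<zeta> \<rho>. 0 < q \<Longrightarrow> q \<le> q0 \<Longrightarrow> \<bar>\<rho>\<bar> \<le> r * q * e (\<zeta> - c * h) \<Longrightarrow>
      \<bar>g (\<phi> (\<zeta> - c * h) + \<rho>) - g (\<phi> (\<zeta> - c * h))\<bar> + \<gamma> * q * e \<zeta> + K * \<gamma> * q * (q * e1 \<zeta>)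
      \<le> K * \<gamma> * q * \<phi>1 \<zeta> + q * (- e2 \<zeta> + c * e1 \<zeta> + e \<zeta>)"
    using sq unfolding squeeze_consts_def by blast+
  have ss: "\<sigma> * \<sigma> = 1" using s by auto
  define Q where "Q = Qf \<gamma> q t0"
  define S where "S = Sf K \<gamma> q b t0"
  have W: "Wf K \<gamma> \<sigma> q b t0 = (\<lambda>t z. \<phi> (z + \<sigma> * S t) + \<sigma> * Q t * e (z + \<sigma> * S t))"
    by (intro ext) (simp add: Wf_def Q_def S_def)
  have dQ: "(Q has_real_derivative - \<gamma> * Q t) (at t)" for t
    unfolding Q_def Qf_def[abs_def] by (auto intro!: derivative_eq_intros simp: algebra_simps)
  have dS: "(S has_real_derivative K * (\<gamma> * Q t)) (at t)" for t
  proof -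
    have "((\<lambda>t. b + K * q * exp (\<gamma> * h) - K * Q t) has_real_derivative 0 + 0 - K * (- \<gamma> * Q t)) (at t)"
      by (intro DERIV_diff DERIV_add DERIV_const DERIV_cmult dQ)
    then show ?thesis unfolding S_def Sf_def[abs_def] Q_def by simp
  qed
  have Q0: "Q t > 0" for t using q by (simp add: Q_def Qf_def)
  have Qt: "Q t \<le> q0"
  proof -
    have "q * exp (- \<gamma> * (t - t0)) \<le> q * 1" using q K t by (intro mult_left_mono) auto
    then show ?thesis using q(2) unfolding Q_def Qf_def mult_1_right by linarith
  qed
  have Qh: "Q (t - h) = Q t * exp (\<gamma> * h)"
    unfolding Q_def Qf_def by (simp add: algebra_simps flip: exp_add)
  have Sh: "S t - S (t - h) = K * (Q (t - h) - Q t)"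
    unfolding S_def Sf_def Q_def[symmetric] by (simp add: algebra_simps)
  have Qhge: "Q t \<le> Q (t - h)"
    unfolding Qh using Q0[of t] K h by simp
  have Sh0: "0 \<le> S t - S (t - h)" unfolding Sh using K Qhge by simp
  have Sh1: "S t - S (t - h) \<le> K * q0 * exp (\<gamma> * h)"
  proof -
    have "Q (t - h) - Q t \<le> q0 * exp (\<gamma> * h)"
      unfolding Qh using Q0[of t] mult_right_mono[OF Qt exp_ge_zero, of "\<gamma> * h"] by linarith
    then show ?thesis unfolding Sh using K by (simp add: mult.assoc)
  qed
  define \<zeta> where "\<zeta> = z + \<sigma> * S t"
  define Wt where "Wt = \<phi>1 \<zeta> * (\<sigma> * (K * (\<gamma> * Q t))) + (\<sigma> * (- \<gamma> * Q t) * e \<zeta> + (e1 \<zeta> * (\<sigma> * (K * (\<gamma> * Q t)))) * (\<sigma> * Q t))"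
  define Wz where "Wz = (\<lambda>y. \<phi>1 (y + \<sigma> * S t) + \<sigma> * Q t * e1 (y + \<sigma> * S t))"
  define Wzz where "Wzz = \<phi>2 \<zeta> + \<sigma> * Q t * e2 \<zeta>"
  have dz: "((\<lambda>\<tau>. z + \<sigma> * S \<tau>) has_real_derivative \<sigma> * (K * (\<gamma> * Q t))) (at t)"
    using DERIV_add[OF DERIV_const DERIV_cmult[OF dS]] by simp
  have 1: "((\<lambda>\<tau>. Wf K \<gamma> \<sigma> q b t0 \<tau> z) has_real_derivative Wt) (at t)"
    unfolding W Wt_def \<zeta>_def
    by (intro DERIV_add DERIV_mult DERIV_cmult dQ DERIV_chain2[OF d\<phi>(1) dz] DERIV_chain2[OF de dz])
  have sh: "((\<lambda>y. f (y + k)) has_real_derivative f' (y + k)) (at y)"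
    if "\<And>y. (f has_real_derivative f' y) (at y)" for f f' :: "real \<Rightarrow> real" and k y
    using that[of "y + k"] by (simp add: DERIV_shift)
  have 2: "((\<lambda>x. Wf K \<gamma> \<sigma> q b t0 t x) has_real_derivative Wz y) (at y)" for y
    unfolding W Wz_def by (intro DERIV_add DERIV_cmult sh d\<phi> de)
  have 3: "(Wz has_real_derivative Wzz) (at z)"
    unfolding Wz_def Wzz_def \<zeta>_def by (intro DERIV_add DERIV_cmult sh d\<phi> de1)
  define W' where "W' = Wf K \<gamma> \<sigma> q b t0 (t - h) (z - c * h)"
  define \<zeta>' where "\<zeta>' = z - c * h + \<sigma> * S (t - h)"
  define \<rho> where "\<rho> = r * Q t * e (\<zeta> - c * h)"
  have W'e: "W' = \<phi> \<zeta>' + \<sigma> * Q (t - h) * e \<zeta>'" by (simp add: W'_def W \<zeta>'_def)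
  have "Q (t - h) * e \<zeta>' \<le> \<rho>"
  proof -
    have zz: "\<zeta>' = (\<zeta> - c * h) + (- \<sigma>) * (S t - S (t - h))" by (simp add: \<zeta>'_def \<zeta>_def algebra_simps)
    have "\<bar>(- \<sigma>) * (S t - S (t - h))\<bar> \<le> K * q0 * exp (\<gamma> * h)" using Sh0 Sh1 s by (auto simp: abs_mult)
    then have "e \<zeta>' \<le> exp (lam * (K * q0 * exp (\<gamma> * h))) * e (\<zeta> - c * h)" unfolding zz by (rule e_shift_abs)
    then have "Q (t - h) * e \<zeta>' \<le> Q (t - h) * (exp (lam * (K * q0 * exp (\<gamma> * h))) * e (\<zeta> - c * h))"
      using Q0[of "t - h"] by (intro mult_left_mono) auto
    also have "\<dots> = exp (\<gamma> * h + lam * (K * q0 * exp (\<gamma> * h))) * (Q t * e (\<zeta> - c * h))"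
      unfolding Qh exp_add by (simp add: mult_ac)
    also have "\<dots> \<le> r * (Q t * e (\<zeta> - c * h))" using K(5) Q0[of t] e_pos[of "\<zeta> - c * h"] by (intro mult_right_mono) auto
    finally show ?thesis by (simp add: \<rho>_def mult.assoc)
  qed
  moreover have "\<sigma> * \<phi> \<zeta>' \<le> \<sigma> * \<phi> (\<zeta> - c * h)"
    using sign_mono[OF s, of "S (t - h)" "S t" "z - c * h"] Sh0 by (simp add: \<zeta>'_def \<zeta>_def algebra_simps)
  moreover have "\<sigma> * W' = \<sigma> * \<phi> \<zeta>' + Q (t - h) * e \<zeta>'" unfolding W'e using ss by (simp add: distrib_left flip: mult.assoc)
  moreover have "\<sigma> * (\<phi> (\<zeta> - c * h) + \<sigma> * \<rho>) = \<sigma> * \<phi> (\<zeta> - c * h) + \<rho>" using ss by (simp add: distrib_left flip: mult.assoc)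
  ultimately have le: "\<sigma> * W' \<le> \<sigma> * (\<phi> (\<zeta> - c * h) + \<sigma> * \<rho>)" by linarith
  have gle: "\<sigma> * g W' \<le> \<sigma> * g (\<phi> (\<zeta> - c * h) + \<sigma> * \<rho>)"
    using s le gmono[of W' "\<phi> (\<zeta> - c * h) + \<sigma> * \<rho>"] gmono[of "\<phi> (\<zeta> - c * h) + \<sigma> * \<rho>" W'] by auto
  define Dg where "Dg = \<bar>g (\<phi> (\<zeta> - c * h) + \<sigma> * \<rho>) - g (\<phi> (\<zeta> - c * h))\<bar>"
  have gD: "\<sigma> * g (\<phi> (\<zeta> - c * h) + \<sigma> * \<rho>) \<le> \<sigma> * g (\<phi> (\<zeta> - c * h)) + Dg"
    using s unfolding Dg_def by auto
  have "\<bar>\<sigma> * \<rho>\<bar> \<le> r * Q t * e (\<zeta> - c * h)"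
    using s K(4) Q0[of t] e_pos[of "\<zeta> - c * h"] by (auto simp: \<rho>_def abs_mult)
  from core[OF Q0 Qt this]
  have co: "Dg + \<gamma> * Q t * e \<zeta> + K * \<gamma> * Q t * (Q t * e1 \<zeta>) \<le> K * \<gamma> * Q t * \<phi>1 \<zeta> + Q t * (- e2 \<zeta> + c * e1 \<zeta> + e \<zeta>)"
    by (simp add: Dg_def)
  have Wtz: "Wf K \<gamma> \<sigma> q b t0 t z = \<phi> \<zeta> + \<sigma> * Q t * e \<zeta>" "Wz z = \<phi>1 \<zeta> + \<sigma> * Q t * e1 \<zeta>"
    by (simp_all add: W Wz_def \<zeta>_def)
  have eq: "\<sigma> * (Wt - Wzz + c * Wz z + Wf K \<gamma> \<sigma> q b t0 t z - g W')
     = (\<sigma> * \<sigma>) * (K * \<gamma> * Q t * \<phi>1 \<zeta>) - (\<sigma> * \<sigma>) * (\<gamma> * Q t * e \<zeta>) + (\<sigma> * \<sigma>) * (\<sigma> * (K * \<gamma> * Q t * (Q t * e1 \<zeta>)))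
       + (\<sigma> * \<sigma>) * (Q t * (- e2 \<zeta> + c * e1 \<zeta> + e \<zeta>)) - \<sigma> * (\<phi>2 \<zeta> - c * \<phi>1 \<zeta> - \<phi> \<zeta>) - \<sigma> * g W'"
    unfolding Wtz unfolding Wt_def Wzz_def by (simp add: algebra_simps)
  have k1: "0 \<le> K * \<gamma> * Q t * (Q t * e1 \<zeta>)" using K Q0[of t] e1_bounds(1)[of \<zeta>] by simp
  have "\<sigma> * (K * \<gamma> * Q t * (Q t * e1 \<zeta>)) \<ge> - (K * \<gamma> * Q t * (Q t * e1 \<zeta>))" using s k1 by auto
  moreover have "\<sigma> * (\<phi>2 \<zeta> - c * \<phi>1 \<zeta> - \<phi> \<zeta>) = - (\<sigma> * g (\<phi> (\<zeta> - c * h)))" unfolding ode by simp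
  ultimately have "\<sigma> * (Wt - Wzz + c * Wz z + Wf K \<gamma> \<sigma> q b t0 t z - g W') \<ge> 0"
    unfolding eq ss using co gle gD by simp
  then show ?thesis using 1 2 3 unfolding W'_def by blast
qed

lemma Wf_bounds:
  assumes "\<sigma> = 1 \<or> \<sigma> = -1" "0 < q" "K > 0" "\<gamma> > 0" "t \<ge> t0 - h"
  shows "\<sigma> * \<phi> (z + \<sigma> * b) \<le> \<sigma> * Wf K \<gamma> \<sigma> q b t0 t z"
    "\<sigma> * Wf K \<gamma> \<sigma> q b t0 t z \<le> \<sigma> * \<phi> (z + \<sigma> * (b + K * q * exp (\<gamma> * h)))
        + Qf \<gamma> q t0 t * exp (lam * (\<bar>b\<bar> + K * q * exp (\<gamma> * h))) * e z"
    "0 \<le> Sf K \<gamma> q b t0 t - b" "Sf K \<gamma> q b t0 t - b \<le> K * q * exp (\<gamma> * h)"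
    "\<sigma> * Wf K \<gamma> \<sigma> q b t0 t z = \<sigma> * \<phi> (z + \<sigma> * Sf K \<gamma> q b t0 t) + Qf \<gamma> q t0 t * e (z + \<sigma> * Sf K \<gamma> q b t0 t)"
proof -
  have ss: "\<sigma> * \<sigma> = 1" using assms by auto
  define Q where "Q = Qf \<gamma> q t0 t"
  define S where "S = Sf K \<gamma> q b t0 t"
  have Q: "0 < Q" "Q \<le> q * exp (\<gamma> * h)"
  proof -
    show "0 < Q" using assms by (simp add: Q_def Qf_def)
    have "\<gamma> * (t0 - t) \<le> \<gamma> * h" using assms by (intro mult_left_mono) auto
    then have "exp (- \<gamma> * (t - t0)) \<le> exp (\<gamma> * h)" by (simp add: algebra_simps)
    then show "Q \<le> q * exp (\<gamma> * h)" using assms by (simp add: Q_def Qf_def)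
  qed
  have S: "0 \<le> S - b" "S - b \<le> K * q * exp (\<gamma> * h)"
  proof -
    have "K * Q \<le> K * (q * exp (\<gamma> * h))" using Q assms by (intro mult_left_mono) auto
    then show "0 \<le> S - b" by (simp add: S_def Sf_def Q_def)
    have "0 \<le> K * Q" using Q assms by simp
    then show "S - b \<le> K * q * exp (\<gamma> * h)" by (simp add: S_def Sf_def Q_def)
  qed
  show "0 \<le> Sf K \<gamma> q b t0 t - b" "Sf K \<gamma> q b t0 t - b \<le> K * q * exp (\<gamma> * h)" using S by (simp_all add: S_def)
  have W: "\<sigma> * Wf K \<gamma> \<sigma> q b t0 t z = \<sigma> * \<phi> (z + \<sigma> * S) + Q * e (z + \<sigma> * S)"
    using ss by (simp add: Wf_def Q_def S_def distrib_left flip: mult.assoc)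
  then show "\<sigma> * Wf K \<gamma> \<sigma> q b t0 t z = \<sigma> * \<phi> (z + \<sigma> * Sf K \<gamma> q b t0 t) + Qf \<gamma> q t0 t * e (z + \<sigma> * Sf K \<gamma> q b t0 t)"
    by (simp add: Q_def S_def)
  have "0 < Q * e (z + \<sigma> * S)" using Q e_pos by simp
  then show "\<sigma> * \<phi> (z + \<sigma> * b) \<le> \<sigma> * Wf K \<gamma> \<sigma> q b t0 t z"
    unfolding W using sign_mono[OF assms(1), of b S z] S by linarith
  have "\<bar>\<sigma> * S\<bar> \<le> \<bar>b\<bar> + K * q * exp (\<gamma> * h)" using assms(1) S by (auto simp: abs_mult)
  then have "e (z + \<sigma> * S) \<le> exp (lam * (\<bar>b\<bar> + K * q * exp (\<gamma> * h))) * e z" by (rule e_shift_abs)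
  then have "Q * e (z + \<sigma> * S) \<le> Q * (exp (lam * (\<bar>b\<bar> + K * q * exp (\<gamma> * h))) * e z)" using Q by (intro mult_left_mono) auto
  moreover have "\<sigma> * \<phi> (z + \<sigma> * S) \<le> \<sigma> * \<phi> (z + \<sigma> * (b + K * q * exp (\<gamma> * h)))"
    by (rule sign_mono[OF assms(1)]) (use S in simp)
  ultimately show "\<sigma> * Wf K \<gamma> \<sigma> q b t0 t z \<le> \<sigma> * \<phi> (z + \<sigma> * (b + K * q * exp (\<gamma> * h)))
        + Qf \<gamma> q t0 t * exp (lam * (\<bar>b\<bar> + K * q * exp (\<gamma> * h))) * e z"
    unfolding W Q_def[symmetric] by (simp add: mult.assoc)
qed

lemma Wf_cont: "continuous_on A (\<lambda>(t, z). Wf K \<gamma> \<sigma> q b t0 t z)"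
proof -
  have Sc: "continuous_on A (\<lambda>p. snd p + \<sigma> * Sf K \<gamma> q b t0 (fst p))"
    unfolding Sf_def Qf_def by (intro continuous_intros)
  have "continuous_on A (\<lambda>p. \<phi> (snd p + \<sigma> * Sf K \<gamma> q b t0 (fst p)))"
    by (rule continuous_on_compose2[OF \<phi>_cont[of UNIV] Sc]) simp
  moreover have "continuous_on A (\<lambda>p. e (snd p + \<sigma> * Sf K \<gamma> q b t0 (fst p)))"
    by (rule continuous_on_compose2[OF e_cont[of UNIV] Sc]) simp
  moreover have "continuous_on A (\<lambda>p. Qf \<gamma> q t0 (fst p))" unfolding Qf_def by (intro continuous_intros)
  ultimately show ?thesis unfolding Wf_def case_prod_beta by (intro continuous_intros)
qed

end

section \<open>Convergence\<close>

locale evolution = stable_front +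
  fixes w wt wz wzz :: "real \<Rightarrow> real \<Rightarrow> real"
  assumes wcont: "continuous_on ({-h..} \<times> UNIV) (\<lambda>(t, z). w t z)"
    and wbdd: "\<And>T. bounded ((\<lambda>(t, z). w t z) ` ({-h..T} \<times> UNIV))"
    and winit: "\<And>s z. -h \<le> s \<Longrightarrow> s \<le> 0 \<Longrightarrow> 0 \<le> w s z \<and> w s z \<le> \<kappa>"
    and dwt: "\<And>t z. t > 0 \<Longrightarrow> ((\<lambda>\<tau>. w \<tau> z) has_real_derivative wt t z) (at t)"
    and dwz: "\<And>t z. t > 0 \<Longrightarrow> ((\<lambda>y. w t y) has_real_derivative wz t z) (at z)"
    and dwzz: "\<And>t z. t > 0 \<Longrightarrow> ((\<lambda>y. wz t y) has_real_derivative wzz t z) (at z)"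
    and pde: "\<And>t z. t > 0 \<Longrightarrow> wt t z = wzz t z - c * wz t z - w t z + g (w (t - h) (z - c * h))"
begin

text \<open>Order preservation and the Lipschitz bound of g turn the delayed difference into - L max
  0 (- D). The zero-order term - D has the favourable sign where D < 0, the only place where the
  minimum principle asks for the inequality.\<close>

lemma comparison:
  assumes s: "\<sigma> = 1 \<or> \<sigma> = -1" and t0: "t0 \<ge> 0"
    and Ucont: "continuous_on ({t0..T} \<times> UNIV) (\<lambda>(t, z). U t z)"
    and Ubd: "\<And>t z. t0 \<le> t \<Longrightarrow> t \<le> T \<Longrightarrow> \<sigma> * U t z \<ge> - C"
    and Uinit: "\<And>t z. t0 - h \<le> t \<Longrightarrow> t \<le> t0 \<Longrightarrow> \<sigma> * w t z \<le> \<sigma> * U t z"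
    and U: "\<And>t z. t0 < t \<Longrightarrow> t \<le> T \<Longrightarrow> \<exists>Ut Uz Uzz. ((\<lambda>\<tau>. U \<tau> z) has_real_derivative Ut) (at t) \<and>
     (\<forall>y. ((\<lambda>x. U t x) has_real_derivative Uz y) (at y)) \<and> (Uz has_real_derivative Uzz) (at z) \<and>
     \<sigma> * (Ut - Uzz + c * Uz z + U t z - g (U (t - h) (z - c * h))) \<ge> 0"
    and t: "t0 \<le> t" "t \<le> T"
  shows "\<sigma> * w t z \<le> \<sigma> * U t z"
proof -
  obtain L where L: "L > 0" "\<And>u v. \<bar>g u - g v\<bar> \<le> L * \<bar>u - v\<bar>" using g_lipschitz by blast
  have gd: "\<sigma> * g a - \<sigma> * g b \<ge> - (L * max 0 (- (\<sigma> * a - \<sigma> * b)))" for a b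
  proof (cases "\<sigma> * a \<ge> \<sigma> * b")
    case True
    then have "\<sigma> * g a \<ge> \<sigma> * g b" using s gmono[of b a] gmono[of a b] by auto
    moreover have "L * max 0 (- (\<sigma> * a - \<sigma> * b)) \<ge> 0" using L by simp
    ultimately show ?thesis by linarith
  next
    case False
    then have "max 0 (- (\<sigma> * a - \<sigma> * b)) = \<bar>a - b\<bar>" using s by auto
    moreover have "\<sigma> * g a - \<sigma> * g b \<ge> - \<bar>g a - g b\<bar>" using s by auto
    ultimately show ?thesis using L(2)[of a b] by simp
  qed
  obtain M where M: "\<And>t z. -h \<le> t \<Longrightarrow> t \<le> T \<Longrightarrow> \<bar>w t z\<bar> \<le> M"
    using wbdd[of T] unfolding bounded_iff by force
  have "\<sigma> * U t z - \<sigma> * w t z \<ge> 0"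
  proof (rule delayed_parabolic_min_principle[where D="\<lambda>t z. \<sigma> * U t z - \<sigma> * w t z" and ?t0.0=t0 and T=T and L=L and c=c and C="C + M"])
    show "continuous_on ({t0..T} \<times> UNIV) (\<lambda>(t, z). \<sigma> * U t z - \<sigma> * w t z)"
    proof -
      have "continuous_on ({t0..T} \<times> UNIV) (\<lambda>(t, z). w t z)"
        by (rule continuous_on_subset[OF wcont]) (use t0 h in auto)
      then show ?thesis using Ucont unfolding case_prod_beta by (intro continuous_intros)
    qed
    show "- (C + M) \<le> \<sigma> * U t z - \<sigma> * w t z" if "t0 \<le> t" "t \<le> T" for t z
    proof -
      have "\<sigma> * w t z \<le> M" using M[of t z] s that t0 h by auto
      then show ?thesis using Ubd[OF that, of z] by linarith
    qed
    show "0 \<le> \<sigma> * U t z - \<sigma> * w t z" if "t0 - h \<le> t" "t \<le> t0" for t z using Uinit[OF that, of z] by simp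
    fix t z assume tt: "t0 < t" "t \<le> T" and neg: "\<sigma> * U t z - \<sigma> * w t z < 0"
    from U[OF tt, of z] obtain Ut Uz Uzz where dU: "((\<lambda>\<tau>. U \<tau> z) has_real_derivative Ut) (at t)"
     "\<And>y. ((\<lambda>x. U t x) has_real_derivative Uz y) (at y)" "(Uz has_real_derivative Uzz) (at z)"
     "\<sigma> * (Ut - Uzz + c * Uz z + U t z - g (U (t - h) (z - c * h))) \<ge> 0" by blast
    have tp: "t > 0" using tt t0 by simp
    have "\<sigma> * Ut - \<sigma> * wt t z \<ge> (\<sigma> * Uzz - \<sigma> * wzz t z) - c * (\<sigma> * Uz z - \<sigma> * wz t z) - (\<sigma> * U t z - \<sigma> * w t z)
        + (\<sigma> * g (U (t - h) (z - c * h)) - \<sigma> * g (w (t - h) (z - c * h)))"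
      using dU(4) unfolding pde[OF tp] by (simp add: algebra_simps)
    then have "\<sigma> * Ut - \<sigma> * wt t z \<ge> (\<sigma> * Uzz - \<sigma> * wzz t z) - c * (\<sigma> * Uz z - \<sigma> * wz t z)
        - L * max 0 (- (\<sigma> * U (t - h) (z - c * h) - \<sigma> * w (t - h) (z - c * h)))"
      using gd[of "U (t - h) (z - c * h)" "w (t - h) (z - c * h)"] neg by linarith
    then show "\<exists>Dt Dz Dzz. ((\<lambda>\<tau>. \<sigma> * U \<tau> z - \<sigma> * w \<tau> z) has_real_derivative Dt) (at t) \<and>
         (\<forall>\<^sub>F y in nhds z. ((\<lambda>x. \<sigma> * U t x - \<sigma> * w t x) has_real_derivative Dz y) (at y)) \<and>
         (Dz has_real_derivative Dzz) (at z) \<and>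
         Dt \<ge> Dzz - c * Dz z - L * max 0 (- (\<sigma> * U (t - h) (z - c * h) - \<sigma> * w (t - h) (z - c * h)))"
      by (intro exI[of _ "\<sigma> * Ut - \<sigma> * wt t z"], intro exI[of _ "\<lambda>y. \<sigma> * Uz y - \<sigma> * wz t y"],
          intro exI[of _ "\<sigma> * Uzz - \<sigma> * wzz t z"] conjI always_eventually allI)
        (intro DERIV_diff DERIV_cmult dU dwt dwz dwzz tp | assumption)+
  qed (use t h L in auto)
  then show ?thesis by simp
qed

lemma w_range:
  assumes "t \<ge> - h" shows "0 \<le> w t z" "w t z \<le> \<kappa>"
proof -
  have "0 \<le> w t z \<and> w t z \<le> \<kappa>"
  proof (cases "t \<le> 0")
    case True then show ?thesis using winit assms by blast
  next
    case False
    have "-1 * w t z \<le> -1 * (\<lambda>_ _. 0) t z"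
    proof (rule comparison[where T=t and ?t0.0=0 and C=0])
      show "\<exists>Ut Uz Uzz. ((\<lambda>\<tau>. 0) has_real_derivative Ut) (at t) \<and>
        (\<forall>y. ((\<lambda>x. 0) has_real_derivative Uz y) (at y)) \<and> (Uz has_real_derivative Uzz) (at z) \<and>
        -1 * (Ut - Uzz + c * Uz z + 0 - g 0) \<ge> 0" for t z
        by (rule exI[of _ 0], rule exI[of _ "\<lambda>_. 0"], rule exI[of _ 0]) simp
    qed (use False winit in auto)
    moreover have "1 * w t z \<le> 1 * (\<lambda>_ _. \<kappa>) t z"
    proof (rule comparison[where T=t and ?t0.0=0 and C=0])
      show "\<exists>Ut Uz Uzz. ((\<lambda>\<tau>. \<kappa>) has_real_derivative Ut) (at t) \<and>
        (\<forall>y. ((\<lambda>x. \<kappa>) has_real_derivative Uz y) (at y)) \<and> (Uz has_real_derivative Uzz) (at z) \<and>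
        1 * (Ut - Uzz + c * Uz z + \<kappa> - g \<kappa>) \<ge> 0" for t z
        by (rule exI[of _ 0], rule exI[of _ "\<lambda>_. 0"], rule exI[of _ 0]) simp
    qed (use False winit kap in auto)
    ultimately show ?thesis by simp
  qed
  then show "0 \<le> w t z" "w t z \<le> \<kappa>" by auto
qed

text \<open>On [t - 1, t] the delayed nonlinearity is a forcing with values in [0, \<kappa>], so the
  gradient bound holds with one constant for all times.\<close>

lemma w_lipschitz: "t \<ge> 1 \<Longrightarrow> \<bar>w t x - w t y\<bar> \<le> 2 * \<kappa> * \<bar>x - y\<bar>"
proof -
  assume t: "t \<ge> 1"
  have "\<bar>w (t - 1 + 1) x - w (t - 1 + 1) y\<bar> \<le> 2 * \<kappa> * \<bar>x - y\<bar>"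
  proof (rule parabolic_gradient_bound[where f="\<lambda>t z. g (w (t - h) (z - c * h))"])
    show "continuous_on ({t - 1..t - 1 + 1} \<times> UNIV) (\<lambda>(t, z). w t z)"
      by (rule continuous_on_subset[OF wcont]) (use t h in auto)
    fix s z
    show "0 \<le> w s z \<and> w s z \<le> \<kappa>" if "t - 1 \<le> s" using w_range[of s z] that t h by simp
    assume s: "t - 1 < s"
    show "0 \<le> g (w (s - h) (z - c * h)) \<and> g (w (s - h) (z - c * h)) \<le> \<kappa>"
      using w_range[of "s - h" "z - c * h"] s t by (auto intro: g_nonneg g_le_kap)
    have "s > 0" using s t by simp
    then show "((\<lambda>\<tau>. w \<tau> z) has_real_derivative wt s z) (at s)" "((\<lambda>y. w s y) has_real_derivative wz s z) (at z)"
      "((\<lambda>y. wz s y) has_real_derivative wzz s z) (at z)"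
      "wt s z = wzz s z - c * wz s z - w s z + g (w (s - h) (z - c * h))"
      by (rule dwt dwz dwzz pde)+
  qed (rule kap)
  then show ?thesis by simp
qed

text \<open>The barrier starts with amplitude r q rather than q: within the initial window its shift
  has already moved away from b, and r pays for translating the weight.\<close>

lemma squeeze:
  assumes sq: "squeeze_consts K \<gamma> q0 r" and s: "\<sigma> = 1 \<or> \<sigma> = -1" and t0: "t0 \<ge> 0" and q: "0 < q" "r * q \<le> q0"
    and init: "\<And>s z. t0 - h \<le> s \<Longrightarrow> s \<le> t0 \<Longrightarrow> \<sigma> * w s z \<le> \<sigma> * \<phi> (z + \<sigma> * b) + q * e (z + \<sigma> * b)"
    and t: "t \<ge> t0 - h"
  shows "\<sigma> * w t z \<le> \<sigma> * Wf K \<gamma> \<sigma> (r * q) b t0 t z"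
proof -
  have K: "K > 0" "\<gamma> > 0" "q0 > 0" "r \<ge> 1" "exp (\<gamma> * h + lam * (K * q0 * exp (\<gamma> * h))) \<le> r"
    using sq unfolding squeeze_consts_def by blast+
  have rq: "0 < r * q" using K q by simp
  have i: "\<sigma> * w s z \<le> \<sigma> * Wf K \<gamma> \<sigma> (r * q) b t0 s z" if st: "t0 - h \<le> s" "s \<le> t0" for s z
  proof -
    note Wb = Wf_bounds[OF assms(2) rq K(1,2) st(1), of b]
    define S where "S = Sf K \<gamma> (r * q) b t0 s"
    define Q where "Q = Qf \<gamma> (r * q) t0 s"
    have Q: "r * q \<le> Q"
    proof -
      have "r * q * 1 \<le> r * q * exp (- \<gamma> * (s - t0))" using rq K st by (intro mult_left_mono) (auto simp: mult_nonpos_nonpos mult_le_0_iff)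
      then show ?thesis by (simp add: Q_def Qf_def)
    qed
    have S: "0 \<le> S - b" "S - b \<le> K * q0 * exp (\<gamma> * h)"
    proof -
      show "0 \<le> S - b" using Wb(3) by (simp add: S_def)
      have "K * (r * q) * exp (\<gamma> * h) \<le> K * q0 * exp (\<gamma> * h)" using K q by (intro mult_right_mono mult_left_mono) auto
      then show "S - b \<le> K * q0 * exp (\<gamma> * h)" using Wb(4) unfolding S_def by linarith
    qed
    have zz: "z + \<sigma> * b = (z + \<sigma> * S) + \<sigma> * (b - S)" by (simp add: algebra_simps)
    have "\<bar>\<sigma> * (b - S)\<bar> \<le> K * q0 * exp (\<gamma> * h)" using S s by (auto simp: abs_mult)
    then have "e (z + \<sigma> * b) \<le> exp (lam * (K * q0 * exp (\<gamma> * h))) * e (z + \<sigma> * S)" unfolding zz by (rule e_shift_abs)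
    also have "\<dots> \<le> r * e (z + \<sigma> * S)"
    proof (rule mult_right_mono)
      have "exp (lam * (K * q0 * exp (\<gamma> * h))) \<le> exp (\<gamma> * h + lam * (K * q0 * exp (\<gamma> * h)))" using K h by simp
      then show "exp (lam * (K * q0 * exp (\<gamma> * h))) \<le> r" using K(5) by linarith
    qed (use e_pos less_imp_le in blast)
    finally have "q * e (z + \<sigma> * b) \<le> q * (r * e (z + \<sigma> * S))" using q by (intro mult_left_mono) auto
    also have "\<dots> = (r * q) * e (z + \<sigma> * S)" by simp
    also have "\<dots> \<le> Q * e (z + \<sigma> * S)" using Q e_pos[of "z + \<sigma> * S"] by (intro mult_right_mono) auto
    finally have "q * e (z + \<sigma> * b) \<le> Q * e (z + \<sigma> * S)" .
    moreover have "\<sigma> * \<phi> (z + \<sigma> * b) \<le> \<sigma> * \<phi> (z + \<sigma> * S)" by (rule sign_mono[OF s]) (use S in simp)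
    ultimately show ?thesis using init[OF st, of z] Wb(5)[of z] unfolding Q_def S_def by linarith
  qed
  show ?thesis
  proof (cases "t \<le> t0")
    case True then show ?thesis using i t by blast
  next
    case False
    show ?thesis
    proof (rule comparison[where U="Wf K \<gamma> \<sigma> (r * q) b t0" and T=t and ?t0.0=t0 and C=\<kappa>, OF s t0 Wf_cont _ i])
      fix s z assume "t0 \<le> s" "s \<le> t"
      then have "t0 - h \<le> s" using h by simp
      from Wf_bounds(1)[OF assms(2) rq K(1,2) this, of z b]
      show "- \<kappa> \<le> \<sigma> * Wf K \<gamma> \<sigma> (r * q) b t0 s z" using s \<phi>_pos[of "z + \<sigma> * b"] \<phi>_less[of "z + \<sigma> * b"] kap by auto
    qed (use False Wf_solution[OF sq s rq q(2)] in auto)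
  qed
qed

text \<open>For \<open>\<sigma> = 1\<close> the shifts \<open>b\<close> whose translate \<open>\<phi> (z + b)\<close> eventually bounds the solution from above,
  for \<open>\<sigma> = -1\<close> those for which \<open>\<phi> (z - b)\<close> bounds it from below.\<close>

definition dominating_shifts :: "real \<Rightarrow> real set" where
  "dominating_shifts \<sigma> = {b. \<forall>\<epsilon>>0. \<exists>T. \<forall>t\<ge>T. \<forall>z. \<sigma> * w t z \<le> \<sigma> * \<phi> (z + \<sigma> * b) + \<epsilon> * e z}"

text \<open>The amplitude of the barrier dies out, whereas the accumulated shift K r q exp (\<gamma>
  h) stays: it is the price of an initial error q.\<close>

lemma dominating_shift_of_initial_bound:
  assumes sq: "squeeze_consts K \<gamma> q0 r" and s: "\<sigma> = 1 \<or> \<sigma> = -1" and t0: "t0 \<ge> 0" and q: "0 < q" "r * q \<le> q0"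
    and init: "\<And>s z. t0 - h \<le> s \<Longrightarrow> s \<le> t0 \<Longrightarrow> \<sigma> * w s z \<le> \<sigma> * \<phi> (z + \<sigma> * b) + q * e (z + \<sigma> * b)"
  shows "b + K * (r * q) * exp (\<gamma> * h) \<in> dominating_shifts \<sigma>"
  unfolding dominating_shifts_def
proof (intro CollectI allI impI)
  fix \<epsilon> :: real assume \<epsilon>: "\<epsilon> > 0"
  have K: "K > 0" "\<gamma> > 0" "q0 > 0" "r \<ge> 1" using sq unfolding squeeze_consts_def by blast+
  have rq: "0 < r * q" using K q by simp
  define C where "C = exp (lam * (\<bar>b\<bar> + K * (r * q) * exp (\<gamma> * h)))"
  have C: "C > 0" by (simp add: C_def)
  \<comment> \<open>From this time on the amplitude, enlarged by the translation factor C, is at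
    most \<epsilon>.\<close>
  define T where "T = max t0 (t0 + ln (r * q * C / \<epsilon>) / \<gamma>)"
  have "\<sigma> * w t z \<le> \<sigma> * \<phi> (z + \<sigma> * (b + K * (r * q) * exp (\<gamma> * h))) + \<epsilon> * e z" if t: "t \<ge> T" for t z
  proof -
    have t1: "t \<ge> t0" "t - t0 \<ge> ln (r * q * C / \<epsilon>) / \<gamma>" using t unfolding T_def by linarith+
    have t2: "t \<ge> t0 - h" using t1 h by simp
    have "ln (r * q * C / \<epsilon>) \<le> \<gamma> * (t - t0)" using t1(2) K by (simp add: pos_divide_le_eq mult.commute)
    then have "exp (ln (r * q * C / \<epsilon>)) \<le> exp (\<gamma> * (t - t0))" by (simp only: exp_le_cancel_iff)
    then have "r * q * C / \<epsilon> \<le> exp (\<gamma> * (t - t0))" using rq C \<epsilon> by simp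
    then have "r * q * C \<le> exp (\<gamma> * (t - t0)) * \<epsilon>" using \<epsilon> by (simp add: pos_divide_le_eq)
    then have "r * q * C * exp (- \<gamma> * (t - t0)) \<le> exp (\<gamma> * (t - t0)) * \<epsilon> * exp (- \<gamma> * (t - t0))"
      by (intro mult_right_mono) auto
    also have "\<dots> = \<epsilon>" by (simp add: exp_minus)
    finally have "Qf \<gamma> (r * q) t0 t * C \<le> \<epsilon>" unfolding Qf_def by (simp add: mult_ac)
    then have "Qf \<gamma> (r * q) t0 t * C * e z \<le> \<epsilon> * e z" using e_pos[of z] by (intro mult_right_mono) auto
    moreover have "\<sigma> * w t z \<le> \<sigma> * Wf K \<gamma> \<sigma> (r * q) b t0 t z" by (rule squeeze[OF sq s t0 q init t2])
    moreover have "\<sigma> * Wf K \<gamma> \<sigma> (r * q) b t0 t z \<le> \<sigma> * \<phi> (z + \<sigma> * (b + K * (r * q) * exp (\<gamma> * h)))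
        + Qf \<gamma> (r * q) t0 t * C * e z"
      unfolding C_def by (rule Wf_bounds(2)[OF s rq K(1,2) t2])
    ultimately show ?thesis by linarith
  qed
  then show "\<exists>T. \<forall>t\<ge>T. \<forall>z. \<sigma> * w t z \<le> \<sigma> * \<phi> (z + \<sigma> * (b + K * (r * q) * exp (\<gamma> * h))) + \<epsilon> * e z"
    by blast
qed

text \<open>Otherwise the lower translate would exceed the upper one at the origin by a fixed
  amount.\<close>

lemma dominating_shifts_sum: assumes "b \<in> dominating_shifts 1" "b' \<in> dominating_shifts (-1)" shows "b + b' \<ge> 0"
proof (rule ccontr)
  assume "\<not> ?thesis"
  then have "\<phi> b < \<phi> (- b')" by (intro \<phi>_strict) simp
  then have ep: "(\<phi> (- b') - \<phi> b) / 4 > 0" by simp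
  define \<epsilon> where "\<epsilon> = (\<phi> (- b') - \<phi> b) / 4"
  obtain T where T: "\<And>t z. t \<ge> T \<Longrightarrow> 1 * w t z \<le> 1 * \<phi> (z + 1 * b) + \<epsilon> * e z"
    using assms(1) ep unfolding dominating_shifts_def \<epsilon>_def by blast
  obtain T' where T': "\<And>t z. t \<ge> T' \<Longrightarrow> (-1) * w t z \<le> (-1) * \<phi> (z + (-1) * b') + \<epsilon> * e z"
    using assms(2) ep unfolding dominating_shifts_def \<epsilon>_def by blast
  have "\<epsilon> * e 0 \<le> \<epsilon> * 1" using ep e_less[of 0] unfolding \<epsilon>_def[symmetric] by (intro mult_left_mono) auto
  then show False using T[of "max T T'" 0] T'[of "max T T'" 0] ep unfolding \<epsilon>_def[symmetric]
    by (simp add: \<epsilon>_def)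
qed

text \<open>Lowering a shift slightly costs a proportional multiple of the weight, because \<phi>1
  is bounded by a multiple of e; so the infimum inherits the property.\<close>

lemma dominating_shifts_Inf:
  assumes s: "\<sigma> = 1 \<or> \<sigma> = -1" and ne: "dominating_shifts \<sigma> \<noteq> {}" and bd: "bdd_below (dominating_shifts \<sigma>)"
  shows "Inf (dominating_shifts \<sigma>) \<in> dominating_shifts \<sigma>"
proof -
  define I where "I = Inf (dominating_shifts \<sigma>)"
  have "\<exists>T. \<forall>t\<ge>T. \<forall>z. \<sigma> * w t z \<le> \<sigma> * \<phi> (z + \<sigma> * I) + \<epsilon> * e z" if \<epsilon>: "\<epsilon> > 0" for \<epsilon>
  proof -
  obtain C where C: "C > 0" "\<And>z. \<phi>1 z \<le> C * e z" using \<phi>1_le_e by blast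
  define k where "k = exp (lam * (\<bar>I\<bar> + 1))"
  have k: "k > 0" by (simp add: k_def)
  define \<delta> where "\<delta> = min 1 (\<epsilon> / (2 * C * k))"
  have \<delta>: "\<delta> > 0" "\<delta> \<le> 1" "\<delta> \<le> \<epsilon> / (2 * C * k)" using \<epsilon> C k by (auto simp: \<delta>_def)
  have \<delta>': "C * k * \<delta> \<le> \<epsilon> / 2" using \<delta>(3) C k by (simp add: pos_le_divide_eq mult_ac)
  obtain b where b: "b \<in> dominating_shifts \<sigma>" "b < I + \<delta>"
    using cInf_lessD[OF ne, of "I + \<delta>"] \<delta> unfolding I_def by auto
  have Ib: "I \<le> b" unfolding I_def by (rule cInf_lower[OF b(1) bd])
  obtain T where T: "\<And>t z. t \<ge> T \<Longrightarrow> \<sigma> * w t z \<le> \<sigma> * \<phi> (z + \<sigma> * b) + \<epsilon> / 2 * e z"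
    using b(1) \<epsilon> half_gt_zero[OF \<epsilon>] unfolding dominating_shifts_def by blast
  have "\<sigma> * w t z \<le> \<sigma> * \<phi> (z + \<sigma> * I) + \<epsilon> * e z" if t: "t \<ge> T" for t z
  proof -
    have "\<sigma> * \<phi> (z + \<sigma> * b) - \<sigma> * \<phi> (z + \<sigma> * I) \<le> (C * k * e z) * (b - I)"
    proof (rule sign_diff[OF s Ib])
      fix x assume "I \<le> x" "x \<le> b"
      then have "\<bar>\<sigma> * x\<bar> \<le> \<bar>I\<bar> + 1" using s b(2) \<delta>(2) by (auto simp: abs_mult)
      then have "e (z + \<sigma> * x) \<le> k * e z" unfolding k_def by (rule e_shift_abs)
      then have "C * e (z + \<sigma> * x) \<le> C * (k * e z)" using C by (intro mult_left_mono) auto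
      then show "\<phi>1 (z + \<sigma> * x) \<le> C * k * e z" using C(2)[of "z + \<sigma> * x"] by (simp add: mult_ac)
    qed
    also have "\<dots> \<le> (C * k * e z) * \<delta>" using b(2) C k e_pos[of z] by (intro mult_left_mono) auto
    also have "\<dots> = (C * k * \<delta>) * e z" by simp
    also have "\<dots> \<le> \<epsilon> / 2 * e z" using \<delta>' e_pos[of z] by (intro mult_right_mono) auto
    finally show ?thesis using T[OF t, of z] by (simp add: field_simps)
  qed
  then show ?thesis by blast
  qed
  then have "I \<in> dominating_shifts \<sigma>" unfolding dominating_shifts_def mem_Collect_eq by (intro allI impI)
  then show ?thesis unfolding I_def .
qed

text \<open>The improvement step: near the origin the gap to the translate spreads by the parabolic lower bound,
  and far away \<open>\<phi>1 = o(e)\<close> makes a small shift cheap.\<close>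

lemma dominating_shifts_improve:
  assumes s: "\<sigma> = 1 \<or> \<sigma> = -1" and b: "b \<in> dominating_shifts \<sigma>" and c1: "c1 > 0"
    and freq: "\<And>T. \<exists>t\<ge>T. \<sigma> * \<phi> (\<sigma> * b) - \<sigma> * w t 0 \<ge> c1"
  shows "\<exists>b'<b. b' \<in> dominating_shifts \<sigma>"
proof -
  obtain K \<gamma> q0 r where sq: "squeeze_consts K \<gamma> q0 r" using squeeze_consts_exist by blast
  have K: "K > 0" "\<gamma> > 0" "q0 > 0" "r \<ge> 1" using sq unfolding squeeze_consts_def by blast+
  have r: "r > 0" using K by simp
  define K1 where "K1 = K * r * exp (\<gamma> * h)"
  have K1: "K1 > 0" using K r by (simp add: K1_def)
  have K1q: "K * (r * x) * exp (\<gamma> * h) = K1 * x" for x by (simp add: K1_def)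
  define k where "k = exp (lam * (\<bar>b\<bar> + 1))"
  have k: "k > 0" by (simp add: k_def)
  \<comment> \<open>Far out, a shift by \<delta> will cost \<eta> k^2 \<delta> of amplitude, which
    in turn costs K1 \<eta> k^2 \<delta> \<le> \<delta> / 4 of shift: the balance is favourable.
    Each k comes from one translation of the weight.\<close>
  define \<eta> where "\<eta> = min (1 / (4 * K1 * k^2)) (q0 / (2 * r * k^2))"
  have \<eta>: "\<eta> > 0" "\<eta> \<le> 1 / (4 * K1 * k^2)" "\<eta> \<le> q0 / (2 * r * k^2)" using K1 k K r by (auto simp: \<eta>_def)
  have \<eta>1: "K1 * (\<eta> * k^2) \<le> 1 / 4" using \<eta>(2) K1 k by (simp add: pos_le_divide_eq mult_ac)
  have \<eta>2: "r * (\<eta> * k^2) \<le> q0 / 2" using \<eta>(3) r k by (simp add: pos_le_divide_eq mult_ac)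
  obtain M0 where M0: "\<And>z. \<bar>z\<bar> \<ge> M0 \<Longrightarrow> \<phi>1 z \<le> \<eta> * e z" using \<phi>1_small[OF \<eta>(1)] by blast
  define M where "M = \<bar>M0\<bar> + \<bar>b\<bar> + 1"
  have M: "M > 0" by (simp add: M_def)
  obtain P where P: "P > 0" "\<And>z. \<phi>1 z \<le> P * e z" using \<phi>1_le_e by blast
  have P1: "\<phi>1 z \<le> P" for z
  proof -
    have "P * e z \<le> P * 1" using P e_less[of z] by (intro mult_left_mono) auto
    then show ?thesis using P(2)[of z] by simp
  qed
  \<comment> \<open>Radius on which a gap c1 at the origin is still at least c1 / 2, using the
    Lipschitz constants P of \<phi> and 2 \<kappa> of w.\<close>
  define \<rho> where "\<rho> = c1 / (2 * (P + 2 * \<kappa>))"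
  have Pk: "P + 2 * \<kappa> > 0" using P kap by simp
  have scale: "x * (c1 / (2 * x)) = c1 / 2" if "x > 0" for x using that by simp
  have \<rho>: "\<rho> > 0" "(P + 2 * \<kappa>) * \<rho> = c1 / 2" using Pk c1 scale[of "P + 2 * \<kappa>"] unfolding \<rho>_def by auto
  have c2: "c1 / 2 > 0" using c1 by simp
  from spreading_lower_bound[OF h c2 \<rho>(1) M, of c]
  obtain \<epsilon>1 where \<epsilon>1: "\<epsilon>1 > 0" and spread: "\<forall>d t0. continuous_on ({t0..t0+1+h} \<times> UNIV) (\<lambda>(t, z). d t z) \<longrightarrow>
     (\<forall>t z. t0 \<le> t \<longrightarrow> t \<le> t0+1+h \<longrightarrow> 0 \<le> d t z) \<longrightarrow> (\<forall>z. \<bar>z\<bar> \<le> \<rho> \<longrightarrow> c1 / 2 \<le> d t0 z) \<longrightarrow>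
     (\<forall>t z. t0 < t \<longrightarrow> t \<le> t0+1+h \<longrightarrow> (\<exists>dt dz dzz. ((\<lambda>\<tau>. d \<tau> z) has_real_derivative dt) (at t) \<and>
        (\<forall>y. ((\<lambda>x. d t x) has_real_derivative dz y) (at y)) \<and> (dz has_real_derivative dzz) (at z) \<and>
        dt \<ge> dzz - c * dz z - d t z)) \<longrightarrow>
     (\<forall>t z. t0+1 \<le> t \<longrightarrow> t \<le> t0+1+h \<longrightarrow> \<bar>z\<bar> \<le> M \<longrightarrow> \<epsilon>1 \<le> d t z)"
    by (elim exE conjE) (rule that)
  \<comment> \<open>\<epsilon>1 is the gap gained on the ball of radius M; one half pays for the
    shift \<delta>, the other for the effects of the amplitude q'.\<close>
  define \<delta> where "\<delta> = min 1 (\<epsilon>1 / (2 * P))"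
  have \<delta>: "\<delta> > 0" "\<delta> \<le> 1" "\<delta> \<le> \<epsilon>1 / (2 * P)" using \<epsilon>1 P by (auto simp: \<delta>_def)
  have P\<delta>: "P * \<delta> \<le> \<epsilon>1 / 2" using \<delta>(3) P by (simp add: pos_le_divide_eq mult_ac)
  have PK: "P * K1 + r > 0" using P K1 r by (simp add: add_pos_pos)
  define q' where "q' = min (min (\<delta> / (4 * K1)) (q0 / (2 * r))) (\<epsilon>1 / (2 * (P * K1 + r)))"
  have q': "q' > 0" using \<delta> K1 K r \<epsilon>1 PK by (simp add: q'_def)
  have "q' \<le> \<delta> / (4 * K1)" "q' \<le> q0 / (2 * r)" "q' \<le> \<epsilon>1 / (2 * (P * K1 + r))"
    unfolding q'_def by (simp_all only: min_le_iff_disj order_refl simp_thms)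
  then have q'1: "K1 * q' \<le> \<delta> / 4" "r * q' \<le> q0 / 2" "(P * K1 + r) * q' \<le> \<epsilon>1 / 2"
    using K1 r PK by (simp_all only: pos_le_divide_eq mult_pos_pos zero_less_numeral) (simp_all add: algebra_simps)
  have rq': "0 < r * q'" "r * q' \<le> q0" using q' r q'1 K by simp_all
  define \<epsilon> where "\<epsilon> = q' / k"
  have \<epsilon>: "\<epsilon> > 0" "\<epsilon> * k = q'" using q' k by (simp_all add: \<epsilon>_def)
  obtain T where T: "\<And>t z. t \<ge> T \<Longrightarrow> \<sigma> * w t z \<le> \<sigma> * \<phi> (z + \<sigma> * b) + \<epsilon> * e z"
    using b \<epsilon>(1) unfolding dominating_shifts_def by blast
  \<comment> \<open>Beyond T + h the bound with shift b holds on the whole delay window ending at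
    t0; beyond time 1 the solution is Lipschitz in space.\<close>
  obtain t0 where t0: "t0 \<ge> max (T + h) 1" "\<sigma> * \<phi> (\<sigma> * b) - \<sigma> * w t0 0 \<ge> c1" using freq by blast
  have t01: "t0 \<ge> T + h" "t0 \<ge> 1" "t0 \<ge> 0" using t0 by auto
  have ek: "e z \<le> k * e (z + \<sigma> * x)" if "\<bar>x\<bar> \<le> \<bar>b\<bar> + 1" for x z
  proof -
    have "\<bar>- (\<sigma> * x)\<bar> \<le> \<bar>b\<bar> + 1" using that s by (auto simp: abs_mult)
    from e_shift_abs[OF this, of "z + \<sigma> * x"] show ?thesis by (simp add: k_def)
  qed
  have init: "\<sigma> * w s z \<le> \<sigma> * \<phi> (z + \<sigma> * b) + q' * e (z + \<sigma> * b)" if "t0 - h \<le> s" "s \<le> t0" for s z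
  proof -
    have "\<epsilon> * e z \<le> \<epsilon> * (k * e (z + \<sigma> * b))" using ek[of b z] \<epsilon> by (intro mult_left_mono) auto
    then have "\<epsilon> * e z \<le> q' * e (z + \<sigma> * b)" unfolding \<epsilon>(2)[symmetric] mult.assoc .
    moreover have "s \<ge> T" using that t01 by simp
    ultimately show ?thesis using T[of s z] by linarith
  qed
  define W where "W = Wf K \<gamma> \<sigma> (r * q') b t0"
  \<comment> \<open>The gap is taken to the barrier, not to the limiting translate: the barrier
    satisfies a one-sided differential inequality, so the gap obeys a linear one, with the delayed
    term dropped by sign.\<close>
  define d where "d = (\<lambda>t z. \<sigma> * W t z - \<sigma> * w t z)"
  have dnn: "0 \<le> d t z" if "t \<ge> t0 - h" for t z
    using squeeze[OF sq s t01(3) q' rq'(2) init that] by (simp add: d_def W_def)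
  have dlow: "\<forall>t z. t0 + 1 \<le> t \<longrightarrow> t \<le> t0 + 1 + h \<longrightarrow> \<bar>z\<bar> \<le> M \<longrightarrow> \<epsilon>1 \<le> d t z"
  proof (rule spread[THEN spec[of _ d], THEN spec[of _ t0], THEN mp, THEN mp, THEN mp, THEN mp]; (intro allI impI)?)
    have "continuous_on ({t0..t0+1+h} \<times> UNIV) (\<lambda>(t, z). w t z)"
      by (rule continuous_on_subset[OF wcont]) (use t01 h in auto)
    moreover have "continuous_on ({t0..t0+1+h} \<times> UNIV) (\<lambda>(t, z). W t z)" unfolding W_def by (rule Wf_cont)
    ultimately show "continuous_on ({t0..t0+1+h} \<times> UNIV) (\<lambda>(t, z). d t z)"
      unfolding d_def case_prod_beta by (intro continuous_intros)
    show "0 \<le> d t z" if "t0 \<le> t" for t z using that h by (intro dnn) simp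
    show "c1 / 2 \<le> d t0 z" if z: "\<bar>z\<bar> \<le> \<rho>" for z
    proof -
      have lip: "\<phi> y - \<phi> x \<le> P * (y - x)" if "x \<le> y" for x y
        using sign_diff[of 1 x y 0 P] that P1 by simp
      have "\<sigma> * \<phi> (z + \<sigma> * b) \<ge> \<sigma> * \<phi> (\<sigma> * b) - P * \<bar>z\<bar>"
      proof (cases "z \<ge> 0")
        case True
        then show ?thesis using s lip[of "\<sigma> * b" "z + \<sigma> * b"] \<phi>_mono[of "\<sigma> * b" "z + \<sigma> * b"] P by auto
      next
        case False
        then show ?thesis using s lip[of "z + \<sigma> * b" "\<sigma> * b"] \<phi>_mono[of "z + \<sigma> * b" "\<sigma> * b"] P
          by (auto simp: algebra_simps mult_nonneg_nonpos)
      qed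
      moreover have "\<sigma> * w t0 z \<le> \<sigma> * w t0 0 + 2 * \<kappa> * \<bar>z\<bar>"
        using w_lipschitz[OF t01(2), of z 0] s by auto
      moreover have "(P + 2 * \<kappa>) * \<bar>z\<bar> \<le> c1 / 2"
        unfolding \<rho>(2)[symmetric] using z Pk by (intro mult_left_mono) auto
      moreover have "(P + 2 * \<kappa>) * \<bar>z\<bar> = P * \<bar>z\<bar> + 2 * \<kappa> * \<bar>z\<bar>" by (rule distrib_right)
      moreover have "\<sigma> * \<phi> (z + \<sigma> * b) \<le> \<sigma> * W t0 z"
        unfolding W_def by (rule Wf_bounds(1)[OF s rq'(1) K(1,2)]) (use h in simp)
      ultimately show ?thesis using t0(2) unfolding d_def by linarith
    qed
    fix t z assume t: "t0 < t"
    have tp: "t > 0" "t \<ge> t0" using t t01 by simp_all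
    from Wf_solution[OF sq s rq' tp(2), of b z] obtain Wt Wz Wzz where
      dW: "((\<lambda>\<tau>. W \<tau> z) has_real_derivative Wt) (at t)" "\<And>y. ((\<lambda>x. W t x) has_real_derivative Wz y) (at y)"
        "(Wz has_real_derivative Wzz) (at z)"
        "\<sigma> * (Wt - Wzz + c * Wz z + W t z - g (W (t - h) (z - c * h))) \<ge> 0"
      unfolding W_def[symmetric] by blast
    have "0 \<le> d (t - h) (z - c * h)" by (rule dnn) (use tp in simp)
    then have "\<sigma> * g (w (t - h) (z - c * h)) \<le> \<sigma> * g (W (t - h) (z - c * h))"
      unfolding d_def using s gmono[of "w (t - h) (z - c * h)" "W (t - h) (z - c * h)"]
        gmono[of "W (t - h) (z - c * h)" "w (t - h) (z - c * h)"] by auto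
    then have ineq: "\<sigma> * Wt - \<sigma> * wt t z \<ge> (\<sigma> * Wzz - \<sigma> * wzz t z) - c * (\<sigma> * Wz z - \<sigma> * wz t z) - d t z"
      using dW(4) unfolding pde[OF tp(1)] d_def by (simp add: algebra_simps)
    show "\<exists>dt dz dzz. ((\<lambda>\<tau>. d \<tau> z) has_real_derivative dt) (at t) \<and>
        (\<forall>y. ((\<lambda>x. d t x) has_real_derivative dz y) (at y)) \<and> (dz has_real_derivative dzz) (at z) \<and>
        dt \<ge> dzz - c * dz z - d t z"
    proof (rule exI[of _ "\<sigma> * Wt - \<sigma> * wt t z"], rule exI[of _ "\<lambda>y. \<sigma> * Wz y - \<sigma> * wz t y"],
        rule exI[of _ "\<sigma> * Wzz - \<sigma> * wzz t z"], intro conjI allI)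
      show "((\<lambda>\<tau>. d \<tau> z) has_real_derivative \<sigma> * Wt - \<sigma> * wt t z) (at t)"
        unfolding d_def by (intro DERIV_diff DERIV_cmult dW dwt tp)
      show "((\<lambda>x. d t x) has_real_derivative \<sigma> * Wz y - \<sigma> * wz t y) (at y)" for y
        unfolding d_def by (intro DERIV_diff DERIV_cmult dW dwz tp)
      show "((\<lambda>y. \<sigma> * Wz y - \<sigma> * wz t y) has_real_derivative \<sigma> * Wzz - \<sigma> * wzz t z) (at z)"
        by (intro DERIV_diff DERIV_cmult dW dwzz tp)
      show "\<sigma> * Wt - \<sigma> * wt t z \<ge> (\<sigma> * Wzz - \<sigma> * wzz t z) - c * (\<sigma> * Wz z - \<sigma> * wz t z) - d t z"
        by (rule ineq)
    qed
  qed
  \<comment> \<open>The amplitude covering the shift \<delta> far out, plus the amplitude already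
    present.\<close>
  define q where "q = \<delta> * (\<eta> * k^2) + q'"
  have q: "q > 0" using \<delta> \<eta> k q' by (simp add: q_def add_pos_pos)
  have qK1: "K1 * q \<le> \<delta> / 2"
  proof -
    have "\<delta> * (K1 * (\<eta> * k^2)) \<le> \<delta> * (1 / 4)" using \<delta> \<eta>1 by (intro mult_left_mono) auto
    moreover have "K1 * q = \<delta> * (K1 * (\<eta> * k^2)) + K1 * q'" by (simp add: q_def algebra_simps)
    ultimately show ?thesis using q'1(1) by linarith
  qed
  have qr: "r * q \<le> q0"
  proof -
    have "\<delta> * (r * (\<eta> * k^2)) \<le> 1 * (q0 / 2)" using \<delta> \<eta>2 r \<eta> k by (intro mult_mono) auto
    moreover have "r * q = \<delta> * (r * (\<eta> * k^2)) + r * q'" by (simp add: q_def algebra_simps)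
    ultimately show ?thesis using q'1(2) by linarith
  qed
  \<comment> \<open>Restart at t0 + 1 + h with shift b - \<delta>: the new delay window begins at t0
    + 1, when the gap has spread. Inside the ball \<epsilon>1 pays for the change, outside the
    smallness of \<phi>1.\<close>
  have "(b - \<delta>) + K * (r * q) * exp (\<gamma> * h) \<in> dominating_shifts \<sigma>"
  proof (rule dominating_shift_of_initial_bound[OF sq s _ q qr])
    show "t0 + 1 + h \<ge> 0" using t01 h by simp
    fix t z assume tt: "t0 + 1 + h - h \<le> t" "t \<le> t0 + 1 + h"
    show "\<sigma> * w t z \<le> \<sigma> * \<phi> (z + \<sigma> * (b - \<delta>)) + q * e (z + \<sigma> * (b - \<delta>))"
    proof (cases "\<bar>z\<bar> \<le> M")
      case True
      define Q where "Q = Qf \<gamma> (r * q') t0 t"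
      define S where "S = Sf K \<gamma> (r * q') b t0 t"
      have th: "t0 - h \<le> t" using tt h by simp
      have Q: "Q \<le> r * q'"
      proof -
        have "r * q' * exp (- \<gamma> * (t - t0)) \<le> r * q' * 1" using rq' K tt h by (intro mult_left_mono) auto
        then show ?thesis unfolding Q_def Qf_def mult_1_right .
      qed
      have Q0: "Q > 0" using rq' by (simp add: Q_def Qf_def)
      note B = Wf_bounds(3,4,5)[OF s rq'(1) K(1,2) th, of b]
      have S: "b \<le> S" "S - b \<le> K1 * q'" using B(1,2) unfolding S_def K1q by simp_all
      have "\<sigma> * W t z = \<sigma> * \<phi> (z + \<sigma> * S) + Q * e (z + \<sigma> * S)" using B(3)[of z] by (simp add: W_def S_def Q_def)
      moreover have "Q * e (z + \<sigma> * S) \<le> r * q' * 1"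
        using Q Q0 e_less[of "z + \<sigma> * S"] e_pos[of "z + \<sigma> * S"] by (intro mult_mono) auto
      moreover have "\<sigma> * \<phi> (z + \<sigma> * S) - \<sigma> * \<phi> (z + \<sigma> * (b - \<delta>)) \<le> P * (S - (b - \<delta>))"
        by (rule sign_diff[OF s]) (use S \<delta> P1 in auto)
      moreover have "P * (S - (b - \<delta>)) \<le> P * (K1 * q' + \<delta>)" using S P by (intro mult_left_mono) auto
      moreover have "P * (K1 * q' + \<delta>) + r * q' = (P * K1 + r) * q' + P * \<delta>" by (simp add: algebra_simps)
      moreover have "\<epsilon>1 \<le> \<sigma> * W t z - \<sigma> * w t z" using dlow[rule_format, of t z] tt True unfolding d_def by simp
      moreover have "r * q' * 1 = r * q'" by simp
      moreover have "0 \<le> q * e (z + \<sigma> * (b - \<delta>))" using q e_pos[of "z + \<sigma> * (b - \<delta>)"] by simp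
      ultimately show ?thesis using q'1(3) P\<delta> by linarith
    next
      case False
      have "\<sigma> * \<phi> (z + \<sigma> * b) - \<sigma> * \<phi> (z + \<sigma> * (b - \<delta>)) \<le> (\<eta> * k * e z) * (b - (b - \<delta>))"
      proof (rule sign_diff[OF s])
        show "b - \<delta> \<le> b" using \<delta> by simp
        fix x assume x: "b - \<delta> \<le> x" "x \<le> b"
        have ax: "\<bar>\<sigma> * x\<bar> \<le> \<bar>b\<bar> + 1" using x s \<delta> by (auto simp: abs_mult)
        then have "\<bar>z + \<sigma> * x\<bar> \<ge> M0" using False unfolding M_def by linarith
        then have "\<phi>1 (z + \<sigma> * x) \<le> \<eta> * e (z + \<sigma> * x)" by (rule M0)
        also have "\<dots> \<le> \<eta> * (k * e z)"
          using e_shift_abs[OF ax, of z] \<eta> unfolding k_def by (intro mult_left_mono) auto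
        finally show "\<phi>1 (z + \<sigma> * x) \<le> \<eta> * k * e z" by (simp add: mult.assoc)
      qed
      moreover have "\<sigma> * w t z \<le> \<sigma> * \<phi> (z + \<sigma> * b) + \<epsilon> * e z" by (rule T) (use tt t01 h in simp)
      moreover have "(\<delta> * \<eta> * k + \<epsilon>) * e z \<le> (\<delta> * \<eta> * k + \<epsilon>) * (k * e (z + \<sigma> * (b - \<delta>)))"
        using ek[of "b - \<delta>" z] \<delta> \<eta> k \<epsilon> by (intro mult_left_mono) auto
      moreover have "(\<delta> * \<eta> * k + \<epsilon>) * (k * e (z + \<sigma> * (b - \<delta>))) = q * e (z + \<sigma> * (b - \<delta>))"
        unfolding q_def \<epsilon>(2)[symmetric] by (simp add: algebra_simps power2_eq_square)
      moreover have "(\<delta> * \<eta> * k + \<epsilon>) * e z = (\<eta> * k * e z) * (b - (b - \<delta>)) + \<epsilon> * e z" by (simp add: algebra_simps)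
      ultimately show ?thesis by linarith
    qed
  qed
  moreover have "(b - \<delta>) + K * (r * q) * exp (\<gamma> * h) < b" unfolding K1q using qK1 \<delta> by linarith
  ultimately show ?thesis by blast
qed

text \<open>The infima p and m of the two shift sets are attained and p + m \<ge> 0. If p + m > 0,
  then w t 0 cannot be close to both \<phi> p and \<phi> (- m), so one of the two shifts could be
  improved. Hence both translates coincide.\<close>

lemma convergence_from_barriers:
  assumes ne: "dominating_shifts 1 \<noteq> {}" "dominating_shifts (-1) \<noteq> {}"
  shows "\<exists>z0. \<forall>\<epsilon>>0. \<exists>T. \<forall>t\<ge>T. \<forall>z. \<bar>w t z - \<phi> (z + z0)\<bar> \<le> \<epsilon> * e z"
proof -
  obtain a a' where a: "a \<in> dominating_shifts 1" "a' \<in> dominating_shifts (-1)" using ne by blast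
  have bd1: "bdd_below (dominating_shifts 1)" by (rule bdd_belowI[of _ "- a'"]) (use dominating_shifts_sum[OF _ a(2)] in force)
  have bd2: "bdd_below (dominating_shifts (-1))" by (rule bdd_belowI[of _ "- a"]) (use dominating_shifts_sum[OF a(1)] in force)
  define p where "p = Inf (dominating_shifts 1)"
  define m where "m = Inf (dominating_shifts (-1))"
  have p: "p \<in> dominating_shifts 1" unfolding p_def by (rule dominating_shifts_Inf) (use ne bd1 in auto)
  have m: "m \<in> dominating_shifts (-1)" unfolding m_def by (rule dominating_shifts_Inf) (use ne bd2 in auto)
  have "p + m \<ge> 0" by (rule dominating_shifts_sum[OF p m])
  moreover have "\<not> p + m > 0"
  proof
    assume "p + m > 0"
    then have "\<phi> (- m) < \<phi> p" by (intro \<phi>_strict) simp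
    \<comment> \<open>Half of the distance: if w t 0 stays less than c1 below \<phi> p for all late
      t, it stays at least c1 above \<phi> (- m).\<close>
    define c1 where "c1 = (\<phi> p - \<phi> (- m)) / 2"
    have c1: "c1 > 0" using \<open>\<phi> (- m) < \<phi> p\<close> by (simp add: c1_def)
    show False
    proof (cases "\<forall>T. \<exists>t\<ge>T. \<phi> p - w t 0 \<ge> c1")
      case True
      have "\<exists>b'<p. b' \<in> dominating_shifts 1" by (rule dominating_shifts_improve[OF _ p c1]) (use True in auto)
      then show False using cInf_lower[OF _ bd1] unfolding p_def by force
    next
      case False
      then obtain T0 where T0: "\<And>t. t \<ge> T0 \<Longrightarrow> \<phi> p - w t 0 < c1" by force
      have "\<exists>b'<m. b' \<in> dominating_shifts (-1)"
      proof (rule dominating_shifts_improve[OF _ m c1])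
        fix T
        show "\<exists>t\<ge>T. - 1 * \<phi> (- 1 * m) - - 1 * w t 0 \<ge> c1"
          by (rule exI[of _ "max T T0"]) (use T0[of "max T T0"] in \<open>simp add: c1_def\<close>)
      qed simp
      then show False using cInf_lower[OF _ bd2] unfolding m_def by force
    qed
  qed
  ultimately have mp: "m = - p" by simp
  have "\<exists>T. \<forall>t\<ge>T. \<forall>z. \<bar>w t z - \<phi> (z + p)\<bar> \<le> \<epsilon> * e z" if \<epsilon>: "\<epsilon> > 0" for \<epsilon>
  proof -
    obtain T1 where T1: "\<And>t z. t \<ge> T1 \<Longrightarrow> 1 * w t z \<le> 1 * \<phi> (z + 1 * p) + \<epsilon> * e z"
      using p \<epsilon> unfolding dominating_shifts_def by blast
    obtain T2 where T2: "\<And>t z. t \<ge> T2 \<Longrightarrow> (-1) * w t z \<le> (-1) * \<phi> (z + (-1) * m) + \<epsilon> * e z"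
      using m \<epsilon> unfolding dominating_shifts_def by blast
    have "\<bar>w t z - \<phi> (z + p)\<bar> \<le> \<epsilon> * e z" if "t \<ge> max T1 T2" for t z
      using T1[of t z] T2[of t z] that by (simp add: mp abs_le_iff)
    then show ?thesis by blast
  qed
  then show ?thesis by blast
qed

text \<open>To the right the weight is at least 1/2 and the front nearly \<kappa>, which dominates w
  \<le> \<kappa>. To the left q e (z + b) is comparable to q exp (lam (z + b)) and, for \<mu> \<ge>
  lam and z \<le> 0, dominates A exp (\<mu> z) once b is large.\<close>

lemma upper_barrier:
  assumes A: "A > 0" and \<mu>: "\<mu> \<ge> lam" and dec: "\<And>s z. -h \<le> s \<Longrightarrow> s \<le> 0 \<Longrightarrow> w s z \<le> A * exp (\<mu> * z)"
  shows "dominating_shifts 1 \<noteq> {}"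
proof -
  obtain K \<gamma> q0 r where sq: "squeeze_consts K \<gamma> q0 r" using squeeze_consts_exist by blast
  have K: "K > 0" "\<gamma> > 0" "q0 > 0" "r \<ge> 1" using sq unfolding squeeze_consts_def by blast+
  define q where "q = q0 / r"
  have q: "q > 0" "r * q \<le> q0" using K by (simp_all add: q_def)
  have "\<kappa> - q / 2 < \<kappa>" using q by simp
  from order_tendstoD(1)[OF front_top[OF front] this]
  obtain Y where Y: "\<And>z. z \<ge> Y \<Longrightarrow> \<kappa> - q / 2 < \<phi> z" unfolding eventually_at_top_linorder by blast
  define Y' where "Y' = max Y 0"
  define D where "D = A * (1 + exp (lam * Y')) / q"
  have D: "D > 0" using A q by (simp add: D_def add_pos_pos)
  define b where "b = max Y' (ln D / lam)"
  have b: "b \<ge> Y'" "b \<ge> ln D / lam" by (simp_all add: b_def)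
  have bD: "D \<le> exp (lam * b)"
  proof -
    have "ln D \<le> lam * b" using b(2) lam0 by (simp add: pos_divide_le_eq mult.commute)
    then have "exp (ln D) \<le> exp (lam * b)" by (simp only: exp_le_cancel_iff)
    then show ?thesis using D by simp
  qed
  have "b + K * (r * q) * exp (\<gamma> * h) \<in> dominating_shifts 1"
  proof (rule dominating_shift_of_initial_bound[OF sq _ _ q, where ?t0.0=0])
    fix s z assume s: "0 - h \<le> s" "s \<le> 0"
    have "w s z \<le> \<phi> (z + b) + q * e (z + b)"
    proof (cases "z + b \<ge> Y'")
      case True
      have "q * (1/2) \<le> q * e (z + b)" using e_ge_half[of "z + b"] True q by (intro mult_left_mono) (auto simp: Y'_def)
      moreover have "\<kappa> - q / 2 < \<phi> (z + b)" using True by (intro Y) (simp add: Y'_def)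
      ultimately show ?thesis using winit[of s z] s by simp
    next
      case False
      define E where "E = exp (lam * (z + b))"
      have E: "E > 0" "E \<le> exp (lam * Y')" using False lam0 by (simp_all add: E_def)
      have eE: "e (z + b) * (1 + E) = E" unfolding E_def by (rule exp_eq_e[symmetric])
      have "e (z + b) * (1 + E) \<le> e (z + b) * (1 + exp (lam * Y'))"
        using E e_pos[of "z + b"] by (intro mult_left_mono) auto
      then have E2: "E \<le> e (z + b) * (1 + exp (lam * Y'))" unfolding eE .
      have z0: "z \<le> 0" using False b by simp
      then have "\<mu> * z \<le> lam * z" using \<mu> by (rule mult_right_mono_neg[rotated])
      then have "A * exp (\<mu> * z) \<le> A * exp (lam * z)" using A by simp
      also have "\<dots> * (1 + exp (lam * Y')) = q * (D * exp (lam * z))" using q by (simp add: D_def)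
      finally have 1: "A * exp (\<mu> * z) * (1 + exp (lam * Y')) \<le> q * (D * exp (lam * z))"
        by (simp add: add_pos_pos)
      have "D * exp (lam * z) \<le> exp (lam * b) * exp (lam * z)" using bD by (intro mult_right_mono) auto
      also have "\<dots> = E" by (simp add: E_def distrib_left flip: exp_add)
      finally have "q * (D * exp (lam * z)) \<le> q * (e (z + b) * (1 + exp (lam * Y')))"
        using E2 q by (intro mult_left_mono) auto
      with 1 have "A * exp (\<mu> * z) * (1 + exp (lam * Y')) \<le> (q * e (z + b)) * (1 + exp (lam * Y'))" by simp
      then have "A * exp (\<mu> * z) \<le> q * e (z + b)" 
        using mult_le_cancel_right_pos[of "1 + exp (lam * Y')"] by (simp add: add_pos_pos)
      moreover have "w s z \<le> A * exp (\<mu> * z)" using s by (intro dec) auto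
      ultimately show ?thesis using \<phi>_pos[of "z + b"] by linarith
    qed
    then show "1 * w s z \<le> 1 * \<phi> (z + 1 * b) + q * e (z + 1 * b)" by simp
  qed auto
  then show ?thesis by blast
qed

text \<open>The data exceed only some positive level on the right, whereas the lower barrier wants
  values near \<kappa>. The plateau m + \<delta> (t + h) may rise because g y \<ge> y + G on
  [m, k1]; the term N exp (- z + \<beta> t) gives up a moving boundary layer on the left.\<close>

lemma invasion:
  assumes m: "0 < m" "2 * m \<le> \<kappa>" and B: "\<And>s z. -h \<le> s \<Longrightarrow> s \<le> 0 \<Longrightarrow> z \<ge> B \<Longrightarrow> w s z \<ge> 2 * m" and k': "k' < \<kappa>"
  shows "\<exists>T\<ge>h. \<exists>B'. \<forall>s z. T - h \<le> s \<longrightarrow> s \<le> T \<longrightarrow> z \<ge> B' \<longrightarrow> w s z \<ge> k'"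
proof -
  obtain L where L: "L > 0" "\<And>u v. \<bar>g u - g v\<bar> \<le> L * \<bar>u - v\<bar>" using g_lipschitz by blast
  define k1 where "k1 = (max m k' + \<kappa>) / 2"
  have k1: "m < k1" "k' < k1" "k1 < \<kappa>" using m k' unfolding k1_def by (auto simp: max_def)
  have "\<exists>x\<in>{m..k1}. \<forall>y\<in>{m..k1}. g x - x \<le> g y - y"
    by (rule continuous_attains_inf) (use k1 in \<open>auto intro!: continuous_intros g_cont\<close>)
  then obtain x where x: "x \<in> {m..k1}" "\<And>y. y \<in> {m..k1} \<Longrightarrow> g x - x \<le> g y - y" by blast
  define G where "G = g x - x"
  have G: "G > 0" using g_gt[of x] x(1) m k1 by (auto simp: G_def)
  have Gg: "g y \<ge> y + G" if "m \<le> y" "y \<le> k1" for y using x(2)[of y] that by (simp add: G_def)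
  \<comment> \<open>\<delta> (1 + h) \<le> G lets the plateau rise despite the delay, \<le> m keeps
    it below 2 m on the initial window, and \<le> k1 - m makes T at least 1 + h.\<close>
  define \<delta> where "\<delta> = min G (min m (k1 - m)) / (1 + h)"
  have \<delta>0: "\<delta> > 0" using G m k1 h by (simp add: \<delta>_def)
  have "\<delta> * (1 + h) = min G (min m (k1 - m))" using h by (simp add: \<delta>_def)
  then have \<delta>: "\<delta> * (1 + h) \<le> G" "\<delta> * (1 + h) \<le> m" "\<delta> * (1 + h) \<le> k1 - m" by (simp_all add: min_def)
  define T where "T = (k1 - m) / \<delta>"
  have T: "\<delta> * T = k1 - m" using \<delta>0 by (simp add: T_def)
  have Th: "T \<ge> 1 + h" using \<delta>(3) \<delta>0 by (simp add: T_def pos_le_divide_eq mult.commute)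
  \<comment> \<open>Exactly what the boundary term loses through the drift c and through the
    Lipschitz bound at the delayed argument.\<close>
  define \<beta> where "\<beta> = c + L * exp (c * h)"
  have \<beta>: "\<beta> > 0" using c_pos L by (simp add: \<beta>_def add_pos_pos)
  \<comment> \<open>On the initial window and for z < B the boundary term is then at least \<kappa>
    \<ge> 2 m, so the subsolution is nonpositive there.\<close>
  define N where "N = \<kappa> * exp (B + \<beta> * h)"
  have N: "N > 0" using kap by (simp add: N_def)
  define mt where "mt = (\<lambda>t. m + \<delta> * (t + h))"
  define U where "U = (\<lambda>t z. mt t - N * exp (- z + \<beta> * t))"
  have low: "U t z \<le> w t z" if "0 \<le> t" "t \<le> T" for t z
  proof -
    have "-1 * w t z \<le> -1 * U t z"
    proof (rule comparison[where ?t0.0=0 and T=T and C="m + \<delta> * (T + h)"])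
      show "continuous_on ({0..T} \<times> UNIV) (\<lambda>(t, z). U t z)"
        unfolding U_def mt_def case_prod_beta by (intro continuous_intros)
      show "- 1 * U t z \<ge> - (m + \<delta> * (T + h))" if "t \<le> T" for t z
      proof -
        have "\<delta> * (t + h) \<le> \<delta> * (T + h)" using \<delta>0 that by (intro mult_left_mono) auto
        moreover have "N * exp (- z + \<beta> * t) \<ge> 0" using N by simp
        ultimately show ?thesis unfolding U_def mt_def mult_minus1 by linarith
      qed
      show "- 1 * w t z \<le> - 1 * U t z" if t: "0 - h \<le> t" "t \<le> 0" for t z
      proof -
        have "\<delta> * (t + h) \<le> \<delta> * (1 + h)" using \<delta>0 t by (intro mult_left_mono) auto
        then have mt2: "mt t \<le> 2 * m" using \<delta>(2) by (simp add: mt_def)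
        show ?thesis
        proof (cases "z \<ge> B")
          case True
          have "w t z \<ge> 2 * m" using B[of t z] t True by simp
          moreover have "N * exp (- z + \<beta> * t) \<ge> 0" using N by simp
          ultimately show ?thesis using mt2 unfolding U_def mult_minus1 by linarith
        next
          case False
          have "\<beta> * (- h) \<le> \<beta> * t" using \<beta> t by (intro mult_left_mono) auto
          then have "0 \<le> B + \<beta> * h + (- z + \<beta> * t)" using False by simp
          then have "1 \<le> exp (B + \<beta> * h + (- z + \<beta> * t))" by (simp only: one_le_exp_iff)
          then have "\<kappa> * 1 \<le> \<kappa> * exp (B + \<beta> * h + (- z + \<beta> * t))" using kap by (intro mult_left_mono) auto
          also have "\<dots> = N * exp (- z + \<beta> * t)" by (simp only: N_def exp_add mult.assoc)
          finally show ?thesis using mt2 m winit[of t z] t unfolding U_def by simp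
        qed
      qed
      fix t z assume t: "0 < t" "t \<le> T"
      define E where "E = N * exp (- z + \<beta> * t)"
      have E: "E > 0" using N by (simp add: E_def)
      have Uz: "((\<lambda>x. U t x) has_real_derivative N * exp (- y + \<beta> * t)) (at y)" for y
        unfolding U_def by (auto intro!: derivative_eq_intros)
      have Uzz: "((\<lambda>y. N * exp (- y + \<beta> * t)) has_real_derivative - E) (at z)"
        unfolding E_def by (auto intro!: derivative_eq_intros)
      have Ut: "((\<lambda>\<tau>. U \<tau> z) has_real_derivative \<delta> - \<beta> * E) (at t)"
        unfolding E_def U_def mt_def by (auto intro!: derivative_eq_intros)
      have mth: "mt (t - h) = mt t - \<delta> * h" by (simp add: mt_def algebra_simps)
      have mtr: "m \<le> mt (t - h)" "mt (t - h) \<le> k1"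
      proof -
        show "m \<le> mt (t - h)" using \<delta>0 t by (simp add: mt_def)
        have "\<delta> * t \<le> \<delta> * T" using \<delta>0 t by (intro mult_left_mono) auto
        then show "mt (t - h) \<le> k1" using T by (simp add: mt_def)
      qed
      have "mt (t - h) - U (t - h) (z - c * h) = N * exp (- (z - c * h) + \<beta> * (t - h))" by (simp add: U_def)
      also have "\<dots> \<le> N * exp (c * h + (- z + \<beta> * t))"
      proof -
        have "- (z - c * h) + \<beta> * (t - h) \<le> c * h + (- z + \<beta> * t)" using \<beta> h by (simp add: algebra_simps)
        then show ?thesis using N by simp
      qed
      also have "\<dots> = exp (c * h) * E" by (simp add: E_def exp_add)
      finally have le: "mt (t - h) - U (t - h) (z - c * h) \<le> exp (c * h) * E" .
      have ge: "0 \<le> mt (t - h) - U (t - h) (z - c * h)" using N by (simp add: U_def)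
      have "g (mt (t - h)) - g (U (t - h) (z - c * h)) \<le> L * (exp (c * h) * E)"
      proof -
        have "L * \<bar>mt (t - h) - U (t - h) (z - c * h)\<bar> \<le> L * (exp (c * h) * E)"
          using le ge L by (intro mult_left_mono) auto
        then show ?thesis using L(2)[of "mt (t - h)" "U (t - h) (z - c * h)"] by linarith
      qed
      then have gU: "g (U (t - h) (z - c * h)) \<ge> mt t - \<delta> * h + G - L * exp (c * h) * E"
        using Gg[OF mtr] unfolding mth by (simp add: mult.assoc)
      have UE: "U t z = mt t - E" by (simp add: U_def E_def)
      have "(\<delta> - \<beta> * E) - (- E) + c * E + U t z - g (U (t - h) (z - c * h)) \<le> 0"
        unfolding UE using gU \<delta>(1) by (simp add: \<beta>_def algebra_simps)
      then have fin: "- 1 * ((\<delta> - \<beta> * E) - (- E) + c * (N * exp (- z + \<beta> * t)) + U t z - g (U (t - h) (z - c * h))) \<ge> 0"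
        by (simp add: E_def)
      show "\<exists>Ut Uz Uzz. ((\<lambda>\<tau>. U \<tau> z) has_real_derivative Ut) (at t) \<and>
       (\<forall>y. ((\<lambda>x. U t x) has_real_derivative Uz y) (at y)) \<and> (Uz has_real_derivative Uzz) (at z) \<and>
       - 1 * (Ut - Uzz + c * Uz z + U t z - g (U (t - h) (z - c * h))) \<ge> 0"
        by (rule exI[of _ "\<delta> - \<beta> * E"], rule exI[of _ "\<lambda>y. N * exp (- y + \<beta> * t)"], rule exI[of _ "- E"],
            intro conjI allI Ut Uz Uzz fin)
    qed (use that in auto)
    then show ?thesis by simp
  qed
  define B' where "B' = \<beta> * T + ln (N / (k1 - k'))"
  have "w s z \<ge> k'" if s: "T - h \<le> s" "s \<le> T" and z: "z \<ge> B'" for s z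
  proof -
    have "\<delta> * T \<le> \<delta> * (s + h)" using \<delta>0 s by (intro mult_left_mono) auto
    then have ms: "mt s \<ge> k1" using T by (simp add: mt_def)
    have "\<beta> * s \<le> \<beta> * T" using \<beta> s by (intro mult_left_mono) auto
    then have "- z + \<beta> * s \<le> - ln (N / (k1 - k'))" using z by (simp add: B'_def)
    then have "exp (- z + \<beta> * s) \<le> exp (- ln (N / (k1 - k')))" by (simp only: exp_le_cancel_iff)
    also have "\<dots> = (k1 - k') / N" using N k1 by (simp add: exp_minus)
    finally have "N * exp (- z + \<beta> * s) \<le> k1 - k'" using N by (simp add: pos_le_divide_eq mult.commute)
    moreover have "U s z \<le> w s z" using s Th by (intro low) auto
    ultimately show ?thesis using ms unfolding U_def by linarith
  qed
  then show ?thesis using Th by (intro exI[of _ T] conjI exI[of _ B']) auto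
qed

text \<open>On the left the correction q e alone dominates the front, by its fast decay, so w \<ge>
  0 suffices; on the right \<open>invasion\<close> has lifted w to within q e Y of \<kappa>. Hence
  the barrier starts at the later time T.\<close>

lemma lower_barrier:
  assumes m: "0 < m" "2 * m \<le> \<kappa>" and B: "\<And>s z. -h \<le> s \<Longrightarrow> s \<le> 0 \<Longrightarrow> z \<ge> B \<Longrightarrow> w s z \<ge> 2 * m"
  shows "dominating_shifts (-1) \<noteq> {}"
proof -
  obtain K \<gamma> q0 r where sq: "squeeze_consts K \<gamma> q0 r" using squeeze_consts_exist by blast
  have K: "K > 0" "\<gamma> > 0" "q0 > 0" "r \<ge> 1" using sq unfolding squeeze_consts_def by blast+
  define q where "q = q0 / r"
  have q: "q > 0" "r * q \<le> q0" using K by (simp_all add: q_def)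
  have "0 < q / 2" using q by simp
  from order_tendstoD(2)[OF lim_\<phi> this]
  obtain N where N: "\<And>z. z \<le> N \<Longrightarrow> \<phi> z * exp (- lam * z) < q / 2" unfolding eventually_at_bot_linorder by blast
  define Y where "Y = min N 0"
  have Y: "\<phi> z \<le> q * e z" if "z \<le> Y" for z
  proof -
    have z: "z \<le> N" "z \<le> 0" using that by (simp_all add: Y_def)
    have "\<phi> z = (\<phi> z * exp (- lam * z)) * exp (lam * z)" by (simp add: mult.assoc flip: exp_add)
    also have "\<dots> \<le> q / 2 * exp (lam * z)" using N[OF z(1)] by (intro mult_right_mono) auto
    also have "\<dots> \<le> q / 2 * (2 * e z)" using exp_le_2e[OF z(2)] q by (intro mult_left_mono) auto
    finally show ?thesis by simp
  qed
  have "\<kappa> - q * e Y < \<kappa>" using q e_pos[of Y] by simp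
  from invasion[OF m B this] obtain T B' where T: "T \<ge> h"
    "\<And>s z. T - h \<le> s \<Longrightarrow> s \<le> T \<Longrightarrow> z \<ge> B' \<Longrightarrow> w s z \<ge> \<kappa> - q * e Y" by blast
  have "(B' - Y) + K * (r * q) * exp (\<gamma> * h) \<in> dominating_shifts (-1)"
  proof (rule dominating_shift_of_initial_bound[OF sq _ _ q, where ?t0.0=T])
    show "T \<ge> 0" using T h by simp
    fix s z assume s: "T - h \<le> s" "s \<le> T"
    define y where "y = z - (B' - Y)"
    have "\<phi> y \<le> w s z + q * e y"
    proof (cases "y \<le> Y")
      case True
      have "0 \<le> w s z" using s T h by (intro w_range) simp
      then show ?thesis using Y[OF True] by simp
    next
      case False
      then have "w s z \<ge> \<kappa> - q * e Y" by (intro T(2) s) (simp add: y_def)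
      moreover have "q * e Y \<le> q * e y" using False e_mono[of Y y] q by (intro mult_left_mono) auto
      ultimately show ?thesis using \<phi>_less[of y] by simp
    qed
    then show "- 1 * w s z \<le> - 1 * \<phi> (z + - 1 * (B' - Y)) + q * e (z + - 1 * (B' - Y))"
      by (simp add: y_def algebra_simps)
  qed simp
  then show ?thesis by blast
qed

end

section \<open>Conclusion in the weighted norm\<close>

lemma eta_pos: "eta lam z > 0"
  by (simp add: eta_def)

theorem theorem4:
  fixes g :: "real \<Rightarrow> real" and h \<kappa> c A B \<sigma> \<mu> lam :: real
    and \<phi> :: "real \<Rightarrow> real" and w0 w :: "real \<Rightarrow> real \<Rightarrow> real"
  assumes mono: "mono g"
    and H: "hypH g \<kappa>"
    and h: "h \<ge> 0"
    and c: "c = c_star g h \<kappa>"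
    and pushed: "c > c_sharp g h"
    and front: "wavefront g h \<kappa> c \<phi>"
    and w0reg: "admissible_init h w0"
    and AB: "A > 0" "B > 0"
    and \<sigma>: "0 < \<sigma>" "\<sigma> < \<kappa>"
    and \<mu>: "\<mu> > lambda1 g h c"
    and ic: "IC h \<kappa> A B \<sigma> \<mu> w0"
    and lam: "lambda1 g h c < lam" "lam < lambda2 g h c" "lam < \<mu>"
    and sol: "classical_solution g h c w0 w"
  shows "\<exists>z0. ((\<lambda>t. wnorm lam (\<lambda>z. w t z - \<phi> (z + z0))) \<longlongrightarrow> 0) at_top"
proof -
  interpret monostable g \<kappa> h by unfold_locales (use mono H h in auto)
  note roots = chi_roots[OF pushed]
  have c0: "c > 0" by (rule front_speed_pos[OF front])
  obtain \<phi>1 \<phi>2 where f: "\<And>z. (\<phi> has_real_derivative \<phi>1 z) (at z)" "\<And>z. (\<phi>1 has_real_derivative \<phi>2 z) (at z)"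
    "\<And>z. \<phi>2 z - c * \<phi>1 z - \<phi> z = - g (\<phi> (z - c * h))" "\<And>z. \<phi>1 z > 0"
    "((\<lambda>z. \<phi> z * exp (- lam * z)) \<longlongrightarrow> 0) at_bot"
    "((\<lambda>z. \<phi>1 z * exp (- lam * z)) \<longlongrightarrow> 0) at_bot" "(\<phi>1 \<longlongrightarrow> 0) at_top"
    using pushed_front_properties[OF front c pushed lam(1,2)] by blast
  have lam0: "lam > 0" using roots(1) lam(1) by simp
  have Xl: "chi g h lam c < 0" by (rule roots(4)[OF lam(1,2)])
  interpret stable_front g \<kappa> h c lam \<phi> \<phi>1 \<phi>2
    by unfold_locales (fact front f lam0 Xl)+
  have ws: "w s z = w0 s (z - c * s)" if "-h \<le> s" "s \<le> 0" for s z
    using sol that unfolding classical_solution_def by simp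
  have ic1: "0 \<le> w0 s x" "w0 s x \<le> \<kappa>" and ic2: "w0 s x \<le> A * exp (\<mu> * x)"
    and ic3: "x \<ge> B \<Longrightarrow> w0 s x > \<kappa> - \<sigma>" if "-h \<le> s" "s \<le> 0" for s x
    using ic that unfolding IC_def by auto
  obtain wt wz wzz where p: "\<forall>t>0. \<forall>z.
        ((\<lambda>\<tau>. w \<tau> z) has_real_derivative wt t z) (at t) \<and>
        ((\<lambda>y. w t y) has_real_derivative wz t z) (at z) \<and>
        ((\<lambda>y. wz t y) has_real_derivative wzz t z) (at z) \<and>
        wt t z = wzz t z - c * wz t z - w t z + g (w (t - h) (z - c * h))"
    using sol unfolding classical_solution_def by blast
  interpret evolution g \<kappa> h c lam \<phi> \<phi>1 \<phi>2 w wt wz wzz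
  proof unfold_locales
    show "continuous_on ({- h..} \<times> UNIV) (\<lambda>(t, z). w t z)" "bounded ((\<lambda>(t, z). w t z) ` ({- h..T} \<times> UNIV))" for T
      using sol unfolding classical_solution_def by blast+
    show "0 \<le> w s z \<and> w s z \<le> \<kappa>" if "-h \<le> s" "s \<le> 0" for s z
      using ic1[OF that] ws[OF that] by simp
  qed (use p in blast)+
  \<comment> \<open>In the moving frame the data are read at z - c s, at most c h to the right of z:
    this costs the factor exp (\<mu> c h) in the upper bound and nothing in the lower one.\<close>
  have cs: "0 \<le> c * - s" "c * - s \<le> c * h" if "-h \<le> s" "s \<le> 0" for s
    using that c0 by (intro mult_nonneg_nonneg mult_left_mono; simp)+
  have up: "w s z \<le> A * exp (\<mu> * (c * h)) * exp (\<mu> * z)" if s: "-h \<le> s" "s \<le> 0" for s z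
  proof -
    have "w s z \<le> A * exp (\<mu> * (z - c * s))" using ws[OF s] ic2[OF s] by simp
    also have "\<dots> \<le> A * exp (\<mu> * (z + c * h))"
      using cs[OF s] AB lam lam0 by (intro mult_left_mono iffD2[OF exp_le_cancel_iff]) auto
    also have "\<dots> = A * exp (\<mu> * (c * h)) * exp (\<mu> * z)" by (simp add: distrib_left exp_add)
    finally show ?thesis .
  qed
  have "A * exp (\<mu> * (c * h)) > 0" "\<mu> \<ge> lam" using AB lam by simp_all
  then have ne1: "dominating_shifts 1 \<noteq> {}" by (rule upper_barrier[OF _ _ up])
  have ne2: "dominating_shifts (-1) \<noteq> {}"
  proof (rule lower_barrier[of "(\<kappa> - \<sigma>) / 2" B])
    fix s z assume s: "-h \<le> s" "s \<le> 0" and z: "z \<ge> B"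
    have "z - c * s \<ge> B" using cs[OF s] z by simp
    then show "2 * ((\<kappa> - \<sigma>) / 2) \<le> w s z" using ic3[OF s, of "z - c * s"] ws[OF s, of z] by simp
  qed (use \<sigma> in auto)
  obtain z0 where z0: "\<And>\<epsilon>. \<epsilon> > 0 \<Longrightarrow> \<exists>T. \<forall>t\<ge>T. \<forall>z. \<bar>w t z - \<phi> (z + z0)\<bar> \<le> \<epsilon> * e z"
    using convergence_from_barriers[OF ne1 ne2] by blast
  have nn: "0 \<le> wnorm lam y" for y
  proof -
    have "0 \<le> ereal (\<bar>y 0\<bar> / eta lam 0)" using eta_pos[of lam 0] by simp
    also have "\<dots> \<le> wnorm lam y" unfolding wnorm_def by (rule SUP_upper) simp
    finally show ?thesis .
  qed
  have ev: "\<forall>\<^sub>F t in at_top. wnorm lam (\<lambda>z. w t z - \<phi> (z + z0)) \<le> ereal \<epsilon>" if \<epsilon>: "\<epsilon> > 0" for \<epsilon>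
  proof -
    obtain T where T: "\<And>t z. t \<ge> T \<Longrightarrow> \<bar>w t z - \<phi> (z + z0)\<bar> \<le> \<epsilon> * e z" using z0[OF \<epsilon>] by blast
    have "wnorm lam (\<lambda>z. w t z - \<phi> (z + z0)) \<le> ereal \<epsilon>" if "t \<ge> T" for t
      unfolding wnorm_def
    proof (rule SUP_least)
      fix z
      have "\<epsilon> * e z \<le> \<epsilon> * eta lam z" using e_le_eta[of z] \<epsilon> by (intro mult_left_mono) auto
      then have "\<bar>w t z - \<phi> (z + z0)\<bar> \<le> \<epsilon> * eta lam z" using T[OF that, of z] by simp
      then show "ereal (\<bar>w t z - \<phi> (z + z0)\<bar> / eta lam z) \<le> ereal \<epsilon>"
        using eta_pos[of lam z] by (simp add: pos_divide_le_eq)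
    qed
    then show ?thesis by (auto simp: eventually_at_top_linorder)
  qed
  have "((\<lambda>t. wnorm lam (\<lambda>z. w t z - \<phi> (z + z0))) \<longlongrightarrow> 0) at_top"
  proof (rule order_tendstoI)
    fix a :: ereal assume "a < 0"
    then show "\<forall>\<^sub>F t in at_top. a < wnorm lam (\<lambda>z. w t z - \<phi> (z + z0))"
      using nn by (auto intro!: always_eventually intro: less_le_trans)
  next
    fix a :: ereal assume "0 < a"
    then obtain r where r: "0 < ereal r" "ereal r < a" using ereal_dense2 by blast
    then have "r > 0" by simp
    from ev[OF this] show "\<forall>\<^sub>F t in at_top. wnorm lam (\<lambda>z. w t z - \<phi> (z + z0)) < a"
      by eventually_elim (use r in \<open>auto intro: le_less_trans\<close>)
  qed
  then show ?thesis by blast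
qed

end
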